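(* Let $\omega\in\mathbb{R}\setminus\{0\}$, let $g:\mathbb{R}\to\mathbb{R}$ be real analytic, and let $f:\mathbb{R}\to\mathbb{R}$ be real analytic and $2\pi$-periodic, with Fourier expansion $f(\psi)=\sum_{\nu\in\mathbb{Z}}e^{i\nu\psi}f_\nu$. Assume that there is $c_0\in\mathbb{R}$ such that $g(c_0)=f_0$ and $g'(c_0)\neq 0$. For $\varepsilon>0$ consider the ordinary differential equation $$\varepsilon\ddot x+\dot x+\varepsilon g(x)=\varepsilon f(\omega t).$$ Then there exists $\varepsilon_0>0$ such that for $0<\varepsilon<\varepsilon_0$ the equation has a periodic solution $x(t;\varepsilon)$ which has the same frequency $\omega$ as the forcing term and which is Borel summable in $\varepsilon$ at the origin. If moreover $g'(c_0)>0$, then this solution is a local attractor.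
   Context: Frequency: a solution has the same frequency $\omega$ as the forcing if $x(t;\varepsilon)=X(\omega t;\varepsilon)$ with $X(\cdot;\varepsilon)$ a $2\pi$-periodic function. Formal series: the equation has a formal power series solution $x_0(t;\varepsilon)=\sum_{k=0}^{\infty}\varepsilon^k x^{(k)}(t)$, with $x^{(0)}(t)\equiv c_0$ and coefficients of the form $x^{(k)}(t)=\sum_{\nu\in\mathbb{Z}}e^{i\nu\omega t}x^{(k)}_\nu$, which solves the equation order by order in $\varepsilon$. Borel summability: a formal power series $F(\varepsilon)=\sum_{n\ge 1}a_n\varepsilon^n$ is Borel summable if (1) $B(p):=\sum_{n\ge1}a_n p^{n-1}/(n-1)!$ converges in some disc $|p|<\delta$; (2) $B(p)$ has an analytic continuation to a neighbourhood of the positive real axis; (3) $G(\varepsilon)=\int_0^\infty e^{-p/\varepsilon}B(p)\,dp$ converges for some $\varepsilon>0$. The function $G$ is the Borel sum of $F$. A function admitting the formal expansion $F$ is called Borel summable if $F$ is Borel summable; in that case the function equals the Borel sum $G$. A constant term ($n=0$) is simply added to the Borel sum. For the solution $x(t;\varepsilon)$, Borel summability at the origin means that for every $t\in\mathbb{R}$ the series $\sum_{k\ge1}\varepsilon^k x^{(k)}(t)$ is Borel summable and $x(t;\varepsilon)-c_0$ equals its Borel sum for $0<\varepsilon<\varepsilon_0$. Local attractor: all solutions $\tilde x(t)$ of the equation with initial data $(\tilde x(0),\dot{\tilde x}(0))$ sufficiently close to $(x(0;\varepsilon),\dot x(0;\varepsilon))$ exist for all $t\ge0$ and satisfy $|\tilde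 x(t)-x(t;\varepsilon)|+|\dot{\tilde x}(t)-\dot x(t;\varepsilon)|\to0$ as $t\to+\infty$. *)

theory Defs
  imports
    "HOL-Analysis.Analysis"
    "HOL-Computational_Algebra.Formal_Power_Series"
begin

definition real_analytic :: "(real \<Rightarrow> real) \<Rightarrow> bool" where
  "real_analytic h \<longleftrightarrow>
     (\<forall>x. \<exists>r>0. \<exists>a :: nat \<Rightarrow> real. \<forall>y\<in>ball x r. (\<lambda>n. a n * (y - x) ^ n) sums h y)"

definition periodic_2pi :: "(real \<Rightarrow> real) \<Rightarrow> bool" where
  "periodic_2pi h \<longleftrightarrow> (\<forall>\<psi>. h (\<psi> + 2 * pi) = h \<psi>)"

(* h(t) = sum over all integers nu of exp(i nu omega t) c_nu; the sum is unordered,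
   i.e. absolutely convergent, which is automatic for analytic periodic h. *)
definition has_fourier_expansion ::
  "real \<Rightarrow> (real \<Rightarrow> real) \<Rightarrow> (int \<Rightarrow> complex) \<Rightarrow> bool" where
  "has_fourier_expansion \<omega> h c \<longleftrightarrow>
     (\<forall>t. ((\<lambda>\<nu>. exp (\<i> * of_int \<nu> * of_real \<omega> * of_real t) * c \<nu>)
             has_sum complex_of_real (h t)) UNIV)"

definition has_frequency :: "real \<Rightarrow> (real \<Rightarrow> real) \<Rightarrow> bool" where
  "has_frequency \<omega> x \<longleftrightarrow> (\<exists>X. periodic_2pi X \<and> (\<forall>t. x t = X (\<omega> * t)))"

(* x solves  eps x'' + x' + eps g(x) = eps f(omega t)  on the set I, with velocity v = x'.
   Derivatives are one-sided at endpoints of I that belong to I. *)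
definition ode_solution ::
  "real \<Rightarrow> (real \<Rightarrow> real) \<Rightarrow> (real \<Rightarrow> real) \<Rightarrow> real \<Rightarrow> real set \<Rightarrow> (real \<Rightarrow> real) \<Rightarrow> (real \<Rightarrow> real) \<Rightarrow> bool" where
  "ode_solution \<omega> g f \<epsilon> I x v \<longleftrightarrow>
     (\<exists>a. \<forall>t\<in>I. (x has_real_derivative v t) (at t within I) \<and>
               (v has_real_derivative a t) (at t within I) \<and>
               \<epsilon> * a t + v t + \<epsilon> * g (x t) = \<epsilon> * f (\<omega> * t))"

(* xs k is the coefficient function x^(k).  For each t the equation is an identity between
   formal power series in eps = fps_X, where g(x) is the Taylor series of g at c0 composed
   with x - c0 (which has no constant term). *)
definition formal_solution ::
  "real \<Rightarrow> (real \<Rightarrow> real) \<Rightarrow> (real \<Rightarrow> real) \<Rightarrow> real \<Rightarrow> (nat \<Rightarrow> real \<Rightarrow> real) \<Rightarrow> bool" where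
  "formal_solution \<omega> g f c0 xs \<longleftrightarrow>
     (\<forall>t. xs 0 t = c0) \<and>
     (\<forall>k. \<exists>c. has_fourier_expansion \<omega> (xs k) c) \<and>
     (\<forall>k. xs k differentiable_on UNIV \<and> deriv (xs k) differentiable_on UNIV) \<and>
     (\<forall>t. fps_X * Abs_fps (\<lambda>k. deriv (deriv (xs k)) t)
          + Abs_fps (\<lambda>k. deriv (xs k) t)
          + fps_X * fps_compose (Abs_fps (\<lambda>n. (deriv ^^ n) g c0 / fact n))
                                (Abs_fps (\<lambda>k. xs k t) - fps_const c0)
          = fps_X * fps_const (f (\<omega> * t)))"

(* B is an analytic continuation, to a neighbourhood of the half-line p >= 0, of
     sum over n >= 1 of a_n p^(n-1) / (n-1)!.
   The value a 0 plays no role.  B is determined by a on the half-line since S is connected. *)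
definition borel_transform_continuation :: "(nat \<Rightarrow> real) \<Rightarrow> (complex \<Rightarrow> complex) \<Rightarrow> bool" where
  "borel_transform_continuation a B \<longleftrightarrow>
     (\<exists>\<delta>>0. \<exists>S. open S \<and> connected S \<and> ball 0 \<delta> \<subseteq> S \<and> complex_of_real ` {0..} \<subseteq> S \<and>
        B holomorphic_on S \<and>
        (\<forall>p\<in>ball 0 \<delta>. (\<lambda>n. of_real (a (Suc n)) * p ^ n / fact n) sums B p))"

(* The Henstock-Kurzweil integral over {0..} of a function continuous on {0..} exists iff
   the improper integral from 0 to infinity converges, and then they agree. *)
definition has_borel_sum :: "(nat \<Rightarrow> real) \<Rightarrow> real \<Rightarrow> real \<Rightarrow> bool" where
  "has_borel_sum a \<epsilon> G \<longleftrightarrow>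
     (\<exists>B. borel_transform_continuation a B \<and>
          ((\<lambda>p. exp (- of_real (p / \<epsilon>)) * B (of_real p)) has_integral complex_of_real G) {0..})"

definition borel_summable :: "(nat \<Rightarrow> real) \<Rightarrow> bool" where
  "borel_summable a \<longleftrightarrow> (\<exists>\<epsilon>>0. \<exists>G. has_borel_sum a \<epsilon> G)"

(* x eps t is the value at time t of the solution with parameter eps. *)
definition borel_summable_at_origin ::
  "real \<Rightarrow> (nat \<Rightarrow> real \<Rightarrow> real) \<Rightarrow> real \<Rightarrow> (real \<Rightarrow> real \<Rightarrow> real) \<Rightarrow> bool" where
  "borel_summable_at_origin c0 xs \<epsilon>0 x \<longleftrightarrow>
     (\<forall>t. borel_summable (\<lambda>k. xs k t) \<and>
          (\<forall>\<epsilon>. 0 < \<epsilon> \<and> \<epsilon> < \<epsilon>0 \<longrightarrow> has_borel_sum (\<lambda>k. xs k t) \<epsilon> (x \<epsilon> t - c0)))"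

(* For initial data close to (x 0, x' 0): a solution on [0,oo) exists, every solution on some
   [0,T) extends to [0,oo), and every solution on [0,oo) is attracted to x. *)
definition local_attractor ::
  "real \<Rightarrow> (real \<Rightarrow> real) \<Rightarrow> (real \<Rightarrow> real) \<Rightarrow> real \<Rightarrow> (real \<Rightarrow> real) \<Rightarrow> bool" where
  "local_attractor \<omega> g f \<epsilon> x \<longleftrightarrow>
     (\<exists>\<delta>>0. \<forall>y0 w0. \<bar>y0 - x 0\<bar> + \<bar>w0 - deriv x 0\<bar> < \<delta> \<longrightarrow>
        (\<exists>y w. ode_solution \<omega> g f \<epsilon> {0..} y w \<and> y 0 = y0 \<and> w 0 = w0) \<and>
        (\<forall>T>0. \<forall>y w. ode_solution \<omega> g f \<epsilon> {0..<T} y w \<and> y 0 = y0 \<and> w 0 = w0 \<longrightarrow>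
           (\<exists>Y W. ode_solution \<omega> g f \<epsilon> {0..} Y W \<and> (\<forall>t\<in>{0..<T}. Y t = y t \<and> W t = w t))) \<and>
        (\<forall>y w. ode_solution \<omega> g f \<epsilon> {0..} y w \<and> y 0 = y0 \<and> w 0 = w0 \<longrightarrow>
           ((\<lambda>t. \<bar>y t - x t\<bar> + \<bar>w t - deriv x t\<bar>) \<longlongrightarrow> 0) at_top))"

end

theory Submission
  imports Defs "HOL-Complex_Analysis.Complex_Analysis"
begin

unbundle no vec_syntax

text \<open>
  Put \<open>x = c0 + u\<close>, \<open>v = u'\<close> and \<open>h = f (\<omega> t) - g (c0 + u)\<close>. For a periodic solution,
  \<open>v(t) = \<integral> e^(-s/\<epsilon>) h(t - s) ds\<close> over \<open>s \<ge> 0\<close>, so \<open>h\<close> has mean zero; \<open>v\<close> determines \<open>u\<close> up to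
  its mean, and the mean of \<open>u\<close> follows from that of \<open>h\<close> because \<open>g' (c0) \<noteq> 0\<close>. For Laplace
  integrals \<open>u(t) = \<integral> e^(-p/\<epsilon>) w(t, p) dp\<close> these relations become an equation for \<open>w\<close> in which the
  delay acts by \<open>t - (p - q)\<close>; as \<open>f\<close> extends to a strip, it can be solved on
  \<open>\<bar>Im t\<bar> + \<bar>Im p\<bar> < \<kappa>\<close>. The solution is a sum of terms \<open>w\<^sub>n\<close> graded by the order in \<open>\<epsilon>\<close>, and induction on
  \<open>n\<close> gives \<open>\<bar>w\<^sub>n\<bar> \<le> B z^(-n) n^(-2) \<bar>p\<bar>^(n-1) / (n-1)!\<close>. Hence \<open>w\<close> has exponential type, its Laplace integral
  converges for \<open>\<epsilon> < z\<close>, and the sum of the Laplace integrals of the \<open>w\<^sub>n\<close> solves the differential equation.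

  By Watson's lemma \<open>u\<close> has an asymptotic expansion, uniformly in \<open>t\<close>. Comparing coefficients in the
  twice integrated differential equation, where no derivative of \<open>u\<close> except one initial velocity
  occurs, shows that its coefficients are twice differentiable and solve the equation order by order.

  Attraction follows from the decay of \<open>\<zeta>\<^sup>2 + \<theta>\<^sup>2\<close>, where \<open>\<zeta>\<close> and \<open>\<theta>\<close> are the differences of
  \<open>x + \<epsilon> x'\<close> and of \<open>\<epsilon> x'\<close> between two solutions, after \<open>g\<close> has been made
  globally increasing by linear continuation outside a neighbourhood of \<open>c0\<close>.
\<close>

section \<open>Periodic real-analytic functions\<close>

text \<open>The terms \<open>w\<^sub>n\<close> are not multiples of \<open>p^(n-1)\<close>: already
  the first one depends on \<open>t - p\<close>. Their index only records that the Laplace integral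
  is O(\<epsilon>^n), so the coefficients of the formal series are read off from the Taylor
  expansion of the whole sum at \<open>p = 0\<close>, not from the recursion. The grading replaces a
  fixed-point argument, since each term is an explicit expression in earlier ones. A direct power
  series recursion in \<epsilon> differentiates in \<open>t\<close> at every order and so diverges
  factorially; here every operation is an average over real shifts or over a segment, nothing is
  differentiated, and the domain never shrinks. The factorials are reproduced exactly by Euler's
  beta integral, and the weight \<open>n^(-2)\<close> is reproduced by discrete convolution up to a
  factor 8; without such a weight the number of products of given total order would spoil the
  induction. Two smallness parameters close it: \<open>B\<close> makes the nonlinear part of
  \<open>g\<close>, divided by \<open>g' (c0)\<close>, cost at most half of the bound, and
  \<open>z\<close>, chosen after \<open>B\<close>, pays for the forcing and the delay.\<close>

lemma periodic_2pi_of_int: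
  assumes "periodic_2pi h"
  shows "h (x + 2 * pi * of_int k) = h x"
proof -
  have nat: "h (x + 2 * pi * of_nat n) = h x" for x n
  proof (induction n)
    case (Suc n)
    have "h (x + 2 * pi * of_nat (Suc n)) = h ((x + 2 * pi * of_nat n) + 2 * pi)"
      by (simp add: algebra_simps)
    with Suc assms show ?case unfolding periodic_2pi_def by metis
  qed auto
  show ?thesis
  proof (cases "k \<ge> 0")
    case True
    then show ?thesis using nat[of x "nat k"] by simp
  next
    case False
    then show ?thesis using nat[of "x + 2 * pi * of_int k" "nat (-k)"] by simp
  qed
qed

lemma real_power_series_complex:
  fixes a :: "nat \<Rightarrow> real"
  assumes "r > 0" and sums: "\<And>y. y \<in> ball x r \<Longrightarrow> (\<lambda>n. a n * (y - x) ^ n) sums h y"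
  obtains \<phi> where "\<phi> holomorphic_on ball (complex_of_real x) r"
    and "\<And>y. y \<in> ball x r \<Longrightarrow> \<phi> (complex_of_real y) = complex_of_real (h y)"
proof -
  define \<phi> where "\<phi> z = (\<Sum>n. complex_of_real (a n) * (z - of_real x) ^ n)" for z
  have smm: "summable (\<lambda>n. complex_of_real (a n) * (z - of_real x) ^ n)"
    if z: "z \<in> ball (of_real x) r" for z
  proof -
    obtain s where s: "norm (z - of_real x) < s" "s < r"
      using z dense[of "norm (z - of_real x)" r] by (auto simp: dist_norm norm_minus_commute)
    then have "s > 0" using norm_ge_zero[of "z - of_real x"] by linarith
    then have "x + s \<in> ball x r" using s by (simp add: dist_norm)
    then have "summable (\<lambda>n. a n * s ^ n)" using sums[of "x + s"] by (auto simp: sums_iff)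
    then have "summable (\<lambda>n. complex_of_real (a n * s ^ n))" by (rule summable_of_real)
    then have "summable (\<lambda>n. complex_of_real (a n) * complex_of_real s ^ n)" by simp
    then show ?thesis by (rule powser_inside) (use s \<open>s > 0\<close> in auto)
  qed
  have "\<phi> holomorphic_on ball (of_real x) r"
    by (rule power_series_holomorphic[where a = "\<lambda>n. of_real (a n)"])
       (use smm in \<open>auto simp: \<phi>_def intro: summable_sums\<close>)
  moreover have "\<phi> (of_real y) = of_real (h y)" if "y \<in> ball x r" for y
  proof -
    have "(\<lambda>n. complex_of_real (a n * (y - x) ^ n)) sums of_real (h y)"
      using sums[OF that] by (rule sums_of_real)
    then show ?thesis unfolding \<phi>_def by (simp add: sums_iff)
  qed
  ultimately show ?thesis using that by blast
qed

lemma islimpt_of_real_range: "complex_of_real x islimpt {z. Im z = 0 \<and> dist z (of_real x) < e}" if "e > 0"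
proof (unfold islimpt_approachable, intro allI impI)
  fix d :: real assume "d > 0"
  define s where "s = min d e / 2"
  have s: "s > 0" "s < d" "s < e" using that \<open>d > 0\<close> by (auto simp: s_def)
  have "dist (of_real (x + s)) (complex_of_real x) = s"
    using s by (simp add: dist_norm)
  then show "\<exists>x'\<in>{z. Im z = 0 \<and> dist z (complex_of_real x) < e}. x' \<noteq> complex_of_real x \<and> dist x' (complex_of_real x) < d"
    using s by (intro bexI[of _ "of_real (x + s)"]) auto
qed

text \<open>The real points of \<open>S\<close> accumulate at \<open>x\<close>, so the identity
  theorem applies.\<close>

lemma holomorphic_eq_on_real_imp_eq:
  assumes "f holomorphic_on S" "g holomorphic_on S" "open S" "connected S"
    and x: "complex_of_real x \<in> S" and "w \<in> S"
    and eq: "\<And>y. complex_of_real y \<in> S \<Longrightarrow> f (of_real y) = g (of_real y)"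
  shows "f w = g w"
proof -
  obtain e where e: "e > 0" "ball (of_real x) e \<subseteq> S" using assms by (meson open_contains_ball)
  let ?U = "{z. Im z = 0 \<and> dist z (complex_of_real x) < e}"
  have "?U \<subseteq> S" using e by (auto simp: dist_commute)
  have "f w - g w = 0"
  proof (rule analytic_continuation[of "\<lambda>z. f z - g z" S ?U "of_real x"])
    show "f z - g z = 0" if "z \<in> ?U" for z
    proof -
      have "z = of_real (Re z)" using that by (simp add: complex_eq_iff)
      then show ?thesis using eq[of "Re z"] that \<open>?U \<subseteq> S\<close> by auto
    qed
  qed (use assms islimpt_of_real_range[OF e(1)] \<open>?U \<subseteq> S\<close> in \<open>auto intro!: holomorphic_intros\<close>)
  then show ?thesis by simp
qed

lemma open_horizontal_strip: "open {z. \<bar>Im z\<bar> < \<kappa>}"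
  by (intro open_Collect_less continuous_intros)

lemma convex_horizontal_strip: "convex {z. \<bar>Im z\<bar> < \<kappa>}"
proof -
  have "{z. \<bar>Im z\<bar> < \<kappa>} = {z. Im z < \<kappa>} \<inter> {z. Im z > - \<kappa>}" by auto
  then show ?thesis by (simp add: convex_Int convex_halfspace_Im_lt convex_halfspace_Im_gt)
qed

text \<open>A Lebesgue number of the cover of one compact period by discs of convergence gives a
  single radius \<open>e\<close>, which periodicity carries to all real centres. The local
  extensions agree on overlaps by the identity theorem and glue to a function on the strip.
  Boundedness is taken from a compact rectangle of half the height, whence the final strip has width
  \<open>e / 2\<close>.\<close>

lemma real_analytic_periodic_extension:
  assumes "real_analytic h" and per: "periodic_2pi h"
  obtains \<kappa> H M where "\<kappa> > 0" "H holomorphic_on {z. \<bar>Im z\<bar> < \<kappa>}"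
    "\<And>x. H (complex_of_real x) = complex_of_real (h x)"
    "\<And>z. \<bar>Im z\<bar> < \<kappa> \<Longrightarrow> H (z + 2 * pi) = H z"
    "\<And>z. \<bar>Im z\<bar> < \<kappa> \<Longrightarrow> norm (H z) \<le> M"
proof -
  define ext where "ext x r \<phi> \<longleftrightarrow> \<phi> holomorphic_on ball (complex_of_real x) r \<and>
     (\<forall>y\<in>ball x r. \<phi> (complex_of_real y) = complex_of_real (h y))" for x r \<phi>
  have "\<exists>r>0. \<exists>\<phi>. ext x r \<phi>" for x
  proof -
    obtain r a where "r > 0" "\<And>y. y \<in> ball x r \<Longrightarrow> (\<lambda>n. a n * (y - x) ^ n) sums h y"
      using assms(1) unfolding real_analytic_def by blast
    with real_power_series_complex[OF this] show ?thesis unfolding ext_def by metis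
  qed
  then obtain R where R: "\<And>x. R x > 0" "\<And>x. \<exists>\<phi>. ext x (R x) \<phi>" by metis
  let ?S = "complex_of_real ` {0..2*pi}"
  have "compact ?S" by (intro compact_continuous_image continuous_intros) auto
  moreover have "?S \<subseteq> \<Union> (range (\<lambda>x. ball (complex_of_real x) (R x)))"
  proof
    fix z assume "z \<in> ?S"
    then obtain x where "z = of_real x" by blast
    then have "z \<in> ball (of_real x) (R x)" using R(1) by simp
    then show "z \<in> \<Union> (range (\<lambda>x. ball (complex_of_real x) (R x)))" by blast
  qed
  ultimately obtain e where e: "e > 0"
     "\<And>x. x \<in> ?S \<Longrightarrow> \<exists>G \<in> range (\<lambda>x. ball (complex_of_real x) (R x)). ball x e \<subseteq> G"
    using Heine_Borel_lemma[of ?S "range (\<lambda>x. ball (complex_of_real x) (R x))"] by blast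
  have "\<exists>\<phi>. ext x e \<phi>" for x
  proof -
    define k where "k = \<lfloor>x / (2 * pi)\<rfloor>"
    define x0 where "x0 = x - 2 * pi * of_int k"
    have "of_int k \<le> x / (2*pi)" "x / (2*pi) < of_int k + 1" unfolding k_def by linarith+
    then have "x0 \<in> {0..2*pi}" by (auto simp: x0_def field_simps)
    then obtain y where y: "ball (complex_of_real x0) e \<subseteq> ball (of_real y) (R y)"
      using e(2)[of "of_real x0"] by auto
    obtain \<phi> where \<phi>: "ext y (R y) \<phi>" using R by blast
    have img: "z - of_real (2 * pi * of_int k) \<in> ball (of_real y) (R y)"
      if "z \<in> ball (complex_of_real x) e" for z
    proof -
      have "z - of_real (2 * pi * of_int k) \<in> ball (of_real x0) e"
        using that by (simp add: x0_def dist_norm)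
      with y show ?thesis by blast
    qed
    have "ext x e (\<lambda>z. \<phi> (z - of_real (2 * pi * of_int k)))"
      unfolding ext_def
    proof safe
      have "(\<phi> \<circ> (\<lambda>z. z - of_real (2 * pi * of_int k))) holomorphic_on ball (of_real x) e"
      proof (rule holomorphic_on_compose_gen)
        show "\<phi> holomorphic_on ball (of_real y) (R y)" using \<phi> by (simp add: ext_def)
        show "(\<lambda>z. z - of_real (2 * pi * of_int k)) ` ball (complex_of_real x) e \<subseteq> ball (of_real y) (R y)"
          using img by blast
      qed (intro holomorphic_intros)
      then show "(\<lambda>z. \<phi> (z - of_real (2 * pi * of_int k))) holomorphic_on ball (of_real x) e"
        by (simp add: o_def)
    next
      fix s assume "s \<in> ball x e"
      then have "complex_of_real (s - 2 * pi * of_int k) \<in> ball (of_real x0) e"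
        unfolding x0_def mem_ball dist_of_real by (simp add: dist_norm)
      with y have "complex_of_real (s - 2 * pi * of_int k) \<in> ball (of_real y) (R y)" by blast
      then have "s - 2 * pi * of_int k \<in> ball y (R y)" unfolding mem_ball dist_of_real .
      then have "\<phi> (of_real (s - 2 * pi * of_int k)) = of_real (h (s - 2 * pi * of_int k))"
        using \<phi> unfolding ext_def by blast
      also have "h (s - 2 * pi * of_int k) = h s"
        using periodic_2pi_of_int[OF per, of s "-k"] by simp
      finally show "\<phi> (of_real s - of_real (2 * pi * of_int k)) = of_real (h s)" by simp
    qed
    then show ?thesis by blast
  qed
  then obtain \<Phi> where \<Phi>: "\<And>x. ext x e (\<Phi> x)" by metis
  \<comment> \<open>The extension around the real part of \<open>z\<close> is used. Its value does
    not depend on the centre, because two discs that contain \<open>z\<close> and have real centres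
    share the midpoint of these centres, a real point from which the identity theorem can
    start.\<close>
  define H where "H z = \<Phi> (Re z) z" for z
  have H_eq: "H z = \<Phi> x z" if z: "z \<in> ball (of_real x) e" for x z
  proof -
    have "norm (z - of_real x) < e" using z by (simp add: dist_norm norm_minus_commute)
    then have le: "\<bar>Im z\<bar> < e" "\<bar>Re z - x\<bar> < e"
      using abs_Im_le_cmod[of "z - of_real x"] abs_Re_le_cmod[of "z - of_real x"] by auto
    let ?B = "ball (complex_of_real (Re z)) e \<inter> ball (complex_of_real x) e"
    have "\<Phi> (Re z) z = \<Phi> x z"
    proof (rule holomorphic_eq_on_real_imp_eq[where S = ?B and f = "\<Phi> (Re z)" and g = "\<Phi> x" and w = z and x = "(Re z + x) / 2"])
      show "\<Phi> (Re z) holomorphic_on ?B" "\<Phi> x holomorphic_on ?B"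
        using \<Phi> unfolding ext_def by (meson holomorphic_on_subset inf_le1 inf_le2)+
      show "complex_of_real ((Re z + x) / 2) \<in> ?B"
        using le unfolding mem_ball Int_iff dist_of_real dist_real_def by (auto simp: abs_if field_simps split: if_splits)
      have "z - of_real (Re z) = \<i> * of_real (Im z)" by (simp add: complex_eq_iff)
      then have "norm (z - of_real (Re z)) < e" using le by (simp add: norm_mult)
      then show "z \<in> ?B" using z by (simp add: dist_norm norm_minus_commute)
      show "\<Phi> (Re z) (of_real y) = \<Phi> x (of_real y)" if "of_real y \<in> ?B" for y
      proof -
        have "y \<in> ball (Re z) e" "y \<in> ball x e" using that unfolding mem_ball Int_iff dist_of_real by auto
        then show ?thesis using \<Phi> unfolding ext_def by metis
      qed
    qed (auto intro!: convex_connected convex_Int)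
    then show ?thesis by (simp add: H_def)
  qed
  let ?T = "{z. \<bar>Im z\<bar> < e}"
  have T_eq: "?T = (\<Union>x. ball (complex_of_real x) e)"
  proof (intro set_eqI iffI)
    fix z assume "z \<in> ?T"
    have "z - of_real (Re z) = \<i> * of_real (Im z)" by (simp add: complex_eq_iff)
    then have "norm (z - of_real (Re z)) < e" using \<open>z \<in> ?T\<close> by (simp add: norm_mult)
    then show "z \<in> (\<Union>x. ball (complex_of_real x) e)" by (auto simp: dist_norm norm_minus_commute)
  next
    fix z assume "z \<in> (\<Union>x. ball (complex_of_real x) e)"
    then obtain x where "norm (z - of_real x) < e" by (auto simp: dist_norm norm_minus_commute)
    then show "z \<in> ?T" using abs_Im_le_cmod[of "z - of_real x"] by auto
  qed
  have holo: "H holomorphic_on ?T"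
    unfolding T_eq
  proof (rule holomorphic_on_UN_open)
    show "H holomorphic_on ball (of_real x) e" for x
      by (rule holomorphic_transform[of "\<Phi> x"]) (use \<Phi>[of x] H_eq[of _ x] in \<open>auto simp: ext_def\<close>)
  qed auto
  have real: "H (of_real x) = of_real (h x)" for x
    using \<Phi>[of x] e(1) unfolding ext_def H_def by simp
  have shift: "H (z + 2 * pi) = H z" if "\<bar>Im z\<bar> < e" for z
  proof (rule holomorphic_eq_on_real_imp_eq[where S = ?T and x = 0 and f = "\<lambda>z. H (z + 2 * pi)" and g = H and w = z])
    have "(H \<circ> (\<lambda>z. z + 2 * pi)) holomorphic_on ?T"
      by (rule holomorphic_on_compose_gen[OF _ holo]) (auto intro!: holomorphic_intros)
    then show "(\<lambda>z. H (z + 2 * pi)) holomorphic_on ?T" by (simp add: o_def)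
    show "H (complex_of_real y + complex_of_real (2 * pi)) = H (complex_of_real y)" for y
      using real[of "y + 2 * pi"] real[of y] per unfolding periodic_2pi_def by (simp del: of_real_mult)
  qed (use that e holo in \<open>auto simp: open_horizontal_strip intro: convex_connected convex_horizontal_strip\<close>)
  let ?K = "cbox (Complex 0 (-e/2)) (Complex (2*pi) (e/2))"
  have "?K \<subseteq> ?T" using e(1) by (auto simp: in_cbox_complex_iff)
  then have "continuous_on ?K H"
    using holo holomorphic_on_imp_continuous_on continuous_on_subset by blast
  then have "bounded (H ` ?K)" by (intro compact_imp_bounded compact_continuous_image) auto
  then obtain M where M: "\<And>z. z \<in> ?K \<Longrightarrow> norm (H z) \<le> M" by (auto simp: bounded_iff)
  have shift_int: "H (z + 2 * pi * of_int k) = H z" if "\<bar>Im z\<bar> < e" for z k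
  proof -
    \<comment> \<open>On a horizontal line the real and the imaginary part are real periodic
      functions, so integer multiples of the period are handled by
      \<open>periodic_2pi_of_int\<close>.\<close>
    define q where "q = (\<lambda>x. Re (H (of_real x + \<i> * Im z)))"
    define q' where "q' = (\<lambda>x. Im (H (of_real x + \<i> * Im z)))"
    have "H (of_real (x + 2 * pi) + \<i> * Im z) = H (of_real x + \<i> * Im z)" for x
      using shift[of "of_real x + \<i> * Im z"] that by (simp add: add_ac)
    then have "periodic_2pi q" "periodic_2pi q'" unfolding periodic_2pi_def q_def q'_def by metis+
    then have "q (Re z + 2 * pi * of_int k) = q (Re z)" "q' (Re z + 2 * pi * of_int k) = q' (Re z)"
      by (auto intro: periodic_2pi_of_int)
    then have "H (of_real (Re z + 2 * pi * of_int k) + \<i> * Im z) = H (of_real (Re z) + \<i> * Im z)"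
      unfolding q_def q'_def complex_eq_iff by blast
    moreover have "of_real (Re z + 2 * pi * of_int k) + \<i> * Im z = z + 2 * pi * of_int k"
      "of_real (Re z) + \<i> * Im z = z" by (auto simp: complex_eq_iff)
    ultimately show ?thesis by metis
  qed
  have "norm (H z) \<le> M" if z: "\<bar>Im z\<bar> < e / 2" for z
  proof -
    define k where "k = \<lfloor>Re z / (2 * pi)\<rfloor>"
    have "of_int k \<le> Re z / (2*pi)" "Re z / (2*pi) < of_int k + 1" unfolding k_def by linarith+
    then have "z - 2 * pi * of_int k \<in> ?K"
      using z by (auto simp: in_cbox_complex_iff field_simps)
    from M[OF this] show ?thesis using shift_int[of z "-k"] z by simp
  qed
  moreover have "H holomorphic_on {z. \<bar>Im z\<bar> < e / 2}"
    by (rule holomorphic_on_subset[OF holo]) (use e(1) in auto)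
  moreover have "H (z + 2 * pi) = H z" if "\<bar>Im z\<bar> < e / 2" for z
    using shift[of z] that e(1) by simp
  ultimately show ?thesis using that[of "e/2" H M] e(1) real by simp
qed

lemma power_series_deriv_sums:
  fixes a :: "nat \<Rightarrow> real"
  assumes sums: "\<And>y. y \<in> ball x r \<Longrightarrow> (\<lambda>n. a n * (y - x) ^ n) sums h y" and y: "y \<in> ball x r"
  shows "(h has_real_derivative deriv h y) (at y)"
    and "(\<lambda>n. diffs a n * (y - x) ^ n) sums deriv h y"
proof -
  have s: "(\<lambda>n. a n * z ^ n) sums h (x + z)" if "norm z < r" for z
    using sums[of "x + z"] that by (simp add: dist_norm)
  have y': "norm (y - x) < r" using y by (simp add: dist_norm norm_minus_commute)
  have "((\<lambda>z. \<Sum>n. a n * z ^ n) has_field_derivative (\<Sum>n. diffs a n * (y - x) ^ n)) (at (y - x))"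
    by (rule termdiffs_strong'[OF _ y']) (use s in \<open>auto simp: sums_iff\<close>)
  moreover have "eventually (\<lambda>z. z \<in> ball 0 r) (nhds (y - x))"
    using y' by (intro eventually_nhds_in_open) (auto simp: dist_norm)
  then have "eventually (\<lambda>z. (\<Sum>n. a n * z ^ n) = h (x + z)) (nhds (y - x))"
    by eventually_elim (use s in \<open>auto simp: sums_iff\<close>)
  ultimately have d: "((\<lambda>z. h (x + z)) has_field_derivative (\<Sum>n. diffs a n * (y - x) ^ n)) (at (y - x))"
    by (simp add: DERIV_cong_ev)
  then have "(h has_field_derivative (\<Sum>n. diffs a n * (y - x) ^ n)) (at y)"
    using DERIV_at_within_shift[of "\<lambda>z. h z" _ x "y - x" UNIV] by simp
  moreover from this have "deriv h y = (\<Sum>n. diffs a n * (y - x) ^ n)" by (rule DERIV_imp_deriv)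
  moreover have "(\<lambda>n. diffs a n * (y - x) ^ n) sums (\<Sum>n. diffs a n * (y - x) ^ n)"
    by (rule termdiffs_sums_strong[OF s d y'])
  ultimately show "(h has_real_derivative deriv h y) (at y)" "(\<lambda>n. diffs a n * (y - x) ^ n) sums deriv h y"
    by simp_all
qed

lemma real_analytic_has_derivative:
  assumes "real_analytic h"
  shows "(h has_real_derivative deriv h x) (at x)"
proof -
  obtain r a where "r > 0" and *: "\<And>y. y \<in> ball x r \<Longrightarrow> (\<lambda>n. a n * (y - x) ^ n) sums h y"
    using assms unfolding real_analytic_def by meson
  then show ?thesis by (intro power_series_deriv_sums(1)[OF *]) auto
qed

lemma real_analytic_deriv:
  assumes "real_analytic h"
  shows "real_analytic (deriv h)"
  unfolding real_analytic_def
proof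
  fix x
  obtain r a where "r > 0" and *: "\<And>y. y \<in> ball x r \<Longrightarrow> (\<lambda>n. a n * (y - x) ^ n) sums h y"
    using assms unfolding real_analytic_def by meson
  with power_series_deriv_sums(2)[OF *]
  show "\<exists>r>0. \<exists>a. \<forall>y\<in>ball x r. (\<lambda>n. a n * (y - x) ^ n) sums deriv h y" by blast
qed

lemma real_analytic_continuous: "real_analytic h \<Longrightarrow> continuous_on A h"
  by (rule DERIV_continuous_on[OF has_field_derivative_at_within[OF real_analytic_has_derivative]])

text \<open>Iterated termwise differentiation, evaluated at the centre, leaves only the constant
  term \<open>fact n * a n\<close>.\<close>

lemma power_series_coeff_eq_deriv:
  fixes a :: "nat \<Rightarrow> real"
  assumes "r > 0" and sums: "\<And>y. y \<in> ball x r \<Longrightarrow> (\<lambda>n. a n * (y - x) ^ n) sums h y"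
  shows "(deriv ^^ n) h x / fact n = a n"
proof -
  have *: "y \<in> ball x r \<Longrightarrow> (\<lambda>n. (diffs ^^ k) a n * (y - x) ^ n) sums (deriv ^^ k) h y" for k y
  proof (induction k arbitrary: y)
    case 0
    then show ?case using sums by simp
  next
    case (Suc k)
    from power_series_deriv_sums(2)[OF Suc.IH Suc.prems] show ?case by simp
  qed
  have d: "(diffs ^^ k) a m = fact (m + k) / fact m * a (m + k)" for k m
  proof (induction k arbitrary: m)
    case (Suc k)
    have "(diffs ^^ Suc k) a m = of_nat (Suc m) * (diffs ^^ k) a (Suc m)" by (simp add: diffs_def)
    also have "\<dots> = fact (m + Suc k) / fact m * a (m + Suc k)"
      by (simp add: Suc fact_Suc[of m] del: of_nat_Suc)
    finally show ?case .
  qed auto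
  have "(\<lambda>m. (diffs ^^ n) a m * (x - x) ^ m) sums (deriv ^^ n) h x"
    using *[of x n] assms(1) by simp
  then have "(deriv ^^ n) h x = (diffs ^^ n) a 0"
    by (simp add: powser_sums_zero_iff)
  then show ?thesis by (simp add: d)
qed

section \<open>Fourier expansion of periodic functions\<close>

text \<open>The derivative of the left-hand side in \<open>a\<close> is
  \<open>h (a + P) - h a\<close>, which is zero.\<close>

lemma integral_periodic_shift:
  fixes h :: "real \<Rightarrow> 'a::banach"
  assumes "continuous_on UNIV h" and per: "\<And>x. h (x + P) = h x" and "P > 0"
  shows "integral {a..a+P} h = integral {0..P} h"
proof -
  have int: "h integrable_on {u..v}" for u v
    by (rule integrable_continuous_real) (rule continuous_on_subset[OF assms(1)], simp)
  have "((\<lambda>a. integral {a..a+P} h) has_vector_derivative 0) (at a within UNIV)" for a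
  proof -
    \<comment> \<open>The base point \<open>a - 1\<close> lies strictly to the left of both ends of
      the moving interval, so two-sided derivatives of the primitives are available at
      \<open>a\<close>.\<close>
    have eq: "integral {b..b+P} h = integral {a-1..b+P} h - integral {a-1..b} h" if "b \<in> {a-1<..}" for b
      using Henstock_Kurzweil_Integration.integral_combine[of "a-1" b "b+P" h] int that \<open>P > 0\<close> by (simp add: algebra_simps)
    have d: "((\<lambda>u. integral {a-1..u} h) has_vector_derivative h x) (at x)" if "x > a - 1" for x
    proof -
      have "((\<lambda>u. integral {a-1..u} h) has_vector_derivative h x) (at x within {a-1..x+1})"
        using that by (intro integral_has_vector_derivative continuous_on_subset[OF assms(1)]) auto
      moreover have "at x within {a-1..x+1} = at x"
        by (rule at_within_interior) (use that in auto)
      ultimately show ?thesis by simp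
    qed
    have d2: "((\<lambda>b. integral {a-1..b+P} h) has_vector_derivative h (a+P)) (at a)"
    proof -
      have "((\<lambda>b. b + P) has_real_derivative 1) (at a)" by (auto intro!: derivative_eq_intros)
      then have "((\<lambda>u. integral {a-1..u} h) \<circ> (\<lambda>b. b + P) has_vector_derivative 1 *\<^sub>R h (a+P)) (at a)"
        by (intro vector_diff_chain_at d) (use \<open>P > 0\<close> in \<open>auto simp: has_real_derivative_iff_has_vector_derivative\<close>)
      then show ?thesis by (simp add: o_def)
    qed
    have "((\<lambda>b. integral {a-1..b+P} h - integral {a-1..b} h) has_vector_derivative h (a+P) - h a) (at a)"
      by (intro has_vector_derivative_diff d2 d) auto
    then have "((\<lambda>b. integral {b..b+P} h) has_vector_derivative h (a+P) - h a) (at a)"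
      by (rule has_vector_derivative_transform_within_open[of _ _ _ "{a-1<..}"]) (use eq in auto)
    then show ?thesis by (simp add: per)
  qed
  then obtain c where c: "\<And>a. a \<in> UNIV \<Longrightarrow> integral {a..a+P} h = c"
    by (rule has_vector_derivative_zero_constant[OF convex_UNIV]) blast
  show ?thesis using c[of a] c[of 0] by simp
qed

text \<open>The base point \<open>a\<close> of the period is kept free. In the convergence proof the
  period is centred at the evaluation point \<open>t\<close>, so that the denominator
  \<open>exp (i (s - t)) - 1\<close> vanishes only at \<open>s = t\<close>.\<close>

definition fourier_coeff :: "(real \<Rightarrow> complex) \<Rightarrow> real \<Rightarrow> int \<Rightarrow> complex" where
  "fourier_coeff h a \<nu> = integral {a..a + 2 * pi} (\<lambda>s. exp (- \<i> * of_int \<nu> * of_real s) * h s) / (2 * pi)"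

lemma integral_exp_int:
  "integral {a..a + 2 * pi} (\<lambda>s. exp (\<i> * of_int \<nu> * of_real s)) = (if \<nu> = 0 then 2 * pi else 0)"
proof (cases "\<nu> = 0")
  case False
  have "((\<lambda>s. exp (\<i> * of_int \<nu> * of_real s)) has_integral
      exp (\<i> * of_int \<nu> * of_real (a + 2 * pi)) / (\<i> * of_int \<nu>) - exp (\<i> * of_int \<nu> * of_real a) / (\<i> * of_int \<nu>))
      {a..a + 2 * pi}"
  proof (rule fundamental_theorem_of_calculus)
    fix x :: real
    show "((\<lambda>s. exp (\<i> * of_int \<nu> * of_real s) / (\<i> * of_int \<nu>)) has_vector_derivative exp (\<i> * of_int \<nu> * of_real x))
        (at x within {a..a + 2 * pi})"
      using False by (auto intro!: derivative_eq_intros has_vector_derivative_real_field)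
  qed auto
  moreover have "exp (\<i> * of_int \<nu> * of_real (a + 2 * pi)) = exp (\<i> * of_int \<nu> * of_real a)"
  proof -
    have "exp (\<i> * of_int \<nu> * of_real (a + 2 * pi)) = exp (\<i> * of_int \<nu> * of_real a) * exp (2 * of_int \<nu> * of_real pi * \<i>)"
      by (simp add: exp_add[symmetric] algebra_simps)
    moreover have "exp (2 * of_int \<nu> * of_real pi * \<i>) = 1" by (auto simp: exp_eq_1)
    ultimately show ?thesis by simp
  qed
  ultimately show ?thesis using False by (simp add: integral_unique)
qed (simp add: scaleR_conv_of_real)

text \<open>Expand the integral of \<open>|q - S|^2 \<ge> 0\<close>, where \<open>S\<close> is the
  partial sum over \<open>A\<close>: by orthogonality the mixed integral and the integral of
  \<open>|S|^2\<close> both equal \<open>2 pi\<close> times the sum of the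
  \<open>|c \<nu>|^2\<close>.\<close>

lemma bessel_inequality:
  fixes q :: "real \<Rightarrow> complex"
  assumes q: "continuous_on {a..a + 2 * pi} q" and "finite A"
  shows "(\<Sum>\<nu>\<in>A. (norm (fourier_coeff q a \<nu>))\<^sup>2) \<le> integral {a..a + 2 * pi} (\<lambda>s. (norm (q s))\<^sup>2) / (2 * pi)"
proof -
  define e where "e \<nu> s = exp (\<i> * of_int \<nu> * of_real s)" for \<nu> :: int and s :: real
  define c where "c = fourier_coeff q a"
  define S where "S s = (\<Sum>\<nu>\<in>A. c \<nu> * e \<nu> s)" for s
  let ?J = "{a..a + 2 * pi}"
  have ce: "continuous_on ?J (e \<nu>)" for \<nu> unfolding e_def by (intro continuous_intros)
  have cS: "continuous_on ?J S" unfolding S_def by (intro continuous_intros ce)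
  have ecnj: "cnj (e \<nu> s) = exp (- \<i> * of_int \<nu> * of_real s)" for \<nu> s
    unfolding e_def by (simp add: exp_cnj)
  have int: "h integrable_on ?J" if "continuous_on ?J h" for h :: "real \<Rightarrow> complex"
    using that by (rule integrable_continuous_real)
  have qe: "integral ?J (\<lambda>s. q s * cnj (e \<nu> s)) = 2 * pi * c \<nu>" for \<nu>
    unfolding c_def fourier_coeff_def ecnj by (simp add: mult.commute)
  have qS: "integral ?J (\<lambda>s. q s * cnj (S s)) = 2 * pi * (\<Sum>\<nu>\<in>A. complex_of_real ((norm (c \<nu>))\<^sup>2))"
  proof -
    have "integral ?J (\<lambda>s. q s * cnj (S s)) = integral ?J (\<lambda>s. \<Sum>\<nu>\<in>A. cnj (c \<nu>) * (q s * cnj (e \<nu> s)))"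
      by (simp add: S_def sum_distrib_left mult_ac)
    also have "\<dots> = (\<Sum>\<nu>\<in>A. integral ?J (\<lambda>s. cnj (c \<nu>) * (q s * cnj (e \<nu> s))))"
      by (intro integral_sum \<open>finite A\<close> int continuous_intros q ce)
    also have "\<dots> = (\<Sum>\<nu>\<in>A. cnj (c \<nu>) * (2 * pi * c \<nu>))" by (simp add: qe)
    also have "\<dots> = 2 * pi * (\<Sum>\<nu>\<in>A. complex_of_real ((norm (c \<nu>))\<^sup>2))"
      unfolding sum_distrib_left by (intro sum.cong refl) (simp only: complex_norm_square mult_ac)
    finally show ?thesis .
  qed
  have Se: "integral ?J (\<lambda>s. S s * cnj (e \<nu> s)) = 2 * pi * c \<nu>" if "\<nu> \<in> A" for \<nu>
  proof -
    have "e \<mu> s * cnj (e \<nu> s) = exp (\<i> * of_int (\<mu> - \<nu>) * of_real s)" for \<mu> s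
      unfolding ecnj by (simp add: e_def exp_add[symmetric] algebra_simps)
    then have ee: "integral ?J (\<lambda>s. e \<mu> s * cnj (e \<nu> s)) = (if \<mu> = \<nu> then 2 * pi else 0)" for \<mu>
      using integral_exp_int[of a "\<mu> - \<nu>"] by simp
    have "integral ?J (\<lambda>s. S s * cnj (e \<nu> s)) = integral ?J (\<lambda>s. \<Sum>\<mu>\<in>A. c \<mu> * (e \<mu> s * cnj (e \<nu> s)))"
      unfolding S_def sum_distrib_right mult.assoc ..
    also have "\<dots> = (\<Sum>\<mu>\<in>A. integral ?J (\<lambda>s. c \<mu> * (e \<mu> s * cnj (e \<nu> s))))"
      by (intro integral_sum \<open>finite A\<close> int continuous_intros ce)
    also have "\<dots> = (\<Sum>\<mu>\<in>A. if \<mu> = \<nu> then c \<mu> * (2 * pi) else 0)" by (intro sum.cong) (auto simp: ee)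
    also have "\<dots> = 2 * pi * c \<nu>" using that \<open>finite A\<close> by simp
    finally show ?thesis .
  qed
  have SS: "integral ?J (\<lambda>s. S s * cnj (S s)) = 2 * pi * (\<Sum>\<nu>\<in>A. complex_of_real ((norm (c \<nu>))\<^sup>2))"
  proof -
    have "integral ?J (\<lambda>s. S s * cnj (S s)) = integral ?J (\<lambda>s. \<Sum>\<nu>\<in>A. cnj (c \<nu>) * (S s * cnj (e \<nu> s)))"
      by (subst (2) S_def) (simp add: sum_distrib_left mult_ac)
    also have "\<dots> = (\<Sum>\<nu>\<in>A. integral ?J (\<lambda>s. cnj (c \<nu>) * (S s * cnj (e \<nu> s))))"
      by (intro integral_sum \<open>finite A\<close> int continuous_intros cS ce)
    also have "\<dots> = (\<Sum>\<nu>\<in>A. cnj (c \<nu>) * (2 * pi * c \<nu>))" by (simp add: Se)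
    also have "\<dots> = 2 * pi * (\<Sum>\<nu>\<in>A. complex_of_real ((norm (c \<nu>))\<^sup>2))"
      unfolding sum_distrib_left by (intro sum.cong refl) (simp only: complex_norm_square mult_ac)
    finally show ?thesis .
  qed
  define N where "N = (\<Sum>\<nu>\<in>A. (norm (c \<nu>))\<^sup>2)"
  have re: "integral ?J (\<lambda>s. Re (h s)) = Re (integral ?J h)" if "continuous_on ?J h" for h
    using integral_linear[OF int[OF that] bounded_linear_Re] by (simp add: o_def)
  have "0 \<le> integral ?J (\<lambda>s. (norm (q s - S s))\<^sup>2)"
    by (intro integral_nonneg integrable_continuous_real continuous_intros q cS) auto
  also have "\<dots> = integral ?J (\<lambda>s. ((norm (q s))\<^sup>2 - Re (q s * cnj (S s)) * 2) + Re (S s * cnj (S s)))"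
    by (intro integral_cong, simp only: cmod_power2) (simp add: power2_eq_square algebra_simps)
  also have "\<dots> = integral ?J (\<lambda>s. (norm (q s))\<^sup>2) - Re (integral ?J (\<lambda>s. q s * cnj (S s))) * 2
      + Re (integral ?J (\<lambda>s. S s * cnj (S s)))"
    by (simp add: integral_add integral_diff re[symmetric] integrable_continuous_real continuous_intros q cS)
  also have "\<dots> = integral ?J (\<lambda>s. (norm (q s))\<^sup>2) - 2 * pi * N"
    unfolding qS SS N_def by (simp add: of_real_sum[symmetric] del: of_real_sum)
  finally show ?thesis by (simp add: N_def c_def field_simps)
qed

text \<open>The Riemann-Lebesgue lemma for continuous functions. Injectivity of \<open>N\<close>
  keeps the frequencies distinct, so Bessel's inequality bounds the partial sums of the squares,
  which are therefore summable.\<close>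

lemma fourier_coeff_tendsto_0:
  fixes q :: "real \<Rightarrow> complex" and N :: "nat \<Rightarrow> int"
  assumes q: "continuous_on {a..a + 2 * pi} q" and "inj N"
  shows "(\<lambda>n. fourier_coeff q a (N n)) \<longlonglongrightarrow> 0"
proof -
  have "(\<Sum>i<n. (norm (fourier_coeff q a (N i)))\<^sup>2) \<le> integral {a..a + 2 * pi} (\<lambda>s. (norm (q s))\<^sup>2) / (2 * pi)" for n
    using bessel_inequality[OF q, of "N ` {..<n}"] \<open>inj N\<close>
    by (simp add: sum.reindex inj_on_subset[OF \<open>inj N\<close>] o_def)
  then have "summable (\<lambda>i. (norm (fourier_coeff q a (N i)))\<^sup>2)"
    by (intro bounded_imp_summable[where B = "integral {a..a + 2 * pi} (\<lambda>s. (norm (q s))\<^sup>2) / (2 * pi)"])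
       (auto simp: lessThan_Suc_atMost[symmetric] simp del: sum.lessThan_Suc)
  then have "(\<lambda>i. (norm (fourier_coeff q a (N i)))\<^sup>2) \<longlonglongrightarrow> 0" by (rule summable_LIMSEQ_zero)
  then have "(\<lambda>i. sqrt ((norm (fourier_coeff q a (N i)))\<^sup>2)) \<longlonglongrightarrow> sqrt 0" by (rule tendsto_real_sqrt)
  then show ?thesis by (simp add: tendsto_norm_zero_iff)
qed

lemma fourier_coeff_deriv:
  assumes H: "\<And>s. (H has_vector_derivative H' s) (at s)" and "continuous_on UNIV H'"
    and per: "\<And>s. H (s + 2 * pi) = H s"
  shows "fourier_coeff H' a \<nu> = \<i> * of_int \<nu> * fourier_coeff H a \<nu>"
proof -
  let ?e = "\<lambda>s::real. exp (- \<i> * of_int \<nu> * of_real s)" and ?J = "{a..a + 2 * pi}"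
  have cH: "continuous_on UNIV H"
    using H by (meson continuous_at_imp_continuous_on has_vector_derivative_continuous)
  have e: "(?e has_vector_derivative (- \<i> * of_int \<nu>) * ?e s) (at s within ?J)" for s
    by (auto intro!: derivative_eq_intros has_vector_derivative_real_field)
  have "((\<lambda>s. ?e s * H' s + (- \<i> * of_int \<nu>) * ?e s * H s) has_integral
     ?e (a + 2 * pi) * H (a + 2 * pi) - ?e a * H a) ?J"
  proof (rule fundamental_theorem_of_calculus)
    show "((\<lambda>s. ?e s * H s) has_vector_derivative ?e s * H' s + (- \<i> * of_int \<nu>) * ?e s * H s) (at s within ?J)" for s
      by (rule has_vector_derivative_mult[OF e has_vector_derivative_at_within[OF H]])
  qed simp
  moreover have "?e (a + 2 * pi) = ?e a"
  proof -
    have "?e (a + 2 * pi) = ?e a * exp (- (2 * of_int \<nu> * of_real pi * \<i>))"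
      by (simp add: exp_add[symmetric] algebra_simps)
    moreover have "exp (2 * of_int \<nu> * of_real pi * \<i>) = 1" by (auto simp: exp_eq_1)
    ultimately show ?thesis by (simp add: exp_minus)
  qed
  ultimately have "integral ?J (\<lambda>s. ?e s * H' s + (- \<i> * of_int \<nu>) * (?e s * H s)) = 0"
    using per by (simp add: integral_unique mult_ac)
  moreover have "integral ?J (\<lambda>s. ?e s * H' s + (- \<i> * of_int \<nu>) * (?e s * H s))
    = integral ?J (\<lambda>s. ?e s * H' s) + (- \<i> * of_int \<nu>) * integral ?J (\<lambda>s. ?e s * H s)"
    by (subst integral_add)
       (auto intro!: integrable_continuous_real continuous_intros
          continuous_on_subset[OF cH] continuous_on_subset[OF assms(2)])
  ultimately show ?thesis by (simp add: fourier_coeff_def field_simps)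
qed

lemma norm_fourier_coeff_le:
  assumes "continuous_on {a..a + 2 * pi} q" "\<And>s. s \<in> {a..a + 2 * pi} \<Longrightarrow> norm (q s) \<le> M"
  shows "norm (fourier_coeff q a \<nu>) \<le> M"
proof -
  have "norm (integral {a..a + 2 * pi} (\<lambda>s. exp (- \<i> * of_int \<nu> * of_real s) * q s)) \<le> M * (a + 2 * pi - a)"
    by (rule integral_bound) (use assms in \<open>auto intro!: continuous_intros simp: norm_mult\<close>)
  then show ?thesis by (simp add: fourier_coeff_def norm_divide field_simps)
qed

text \<open>The integers are split into the nonnegative and the negative ones; the term at 0 is
  harmless because \<open>1 / 0 = 0\<close>.\<close>

lemma summable_on_int_inverse_square: "(\<lambda>\<nu>::int. 1 / (of_int \<nu>)\<^sup>2 :: real) summable_on UNIV"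
proof -
  have nat: "(\<lambda>n::nat. 1 / (of_nat n)\<^sup>2 :: real) summable_on UNIV"
    by (rule norm_summable_imp_summable_on)
       (use inverse_power_summable[of 2, where ?'a = real] in \<open>simp add: divide_inverse\<close>)
  have nat': "(\<lambda>n::nat. 1 / (of_nat (Suc n))\<^sup>2 :: real) summable_on UNIV"
    by (rule norm_summable_imp_summable_on)
       (use inverse_power_summable[of 2, where ?'a = real, THEN summable_Suc_iff[THEN iffD2]] in \<open>simp add: divide_inverse\<close>)
  have "(\<lambda>\<nu>::int. 1 / (of_int \<nu>)\<^sup>2 :: real) summable_on (range int)"
    using nat by (subst summable_on_reindex) (auto simp: o_def)
  moreover have "(\<lambda>\<nu>::int. 1 / (of_int \<nu>)\<^sup>2 :: real) summable_on (range (\<lambda>n. - int (Suc n)))"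
  proof (subst summable_on_reindex)
    have "(1 + real n)\<^sup>2 = (- 1 - real n)\<^sup>2" for n by (simp add: power2_eq_square algebra_simps)
    with nat' show "((\<lambda>\<nu>::int. 1 / (of_int \<nu>)\<^sup>2 :: real) \<circ> (\<lambda>n. - int (Suc n))) summable_on UNIV"
      by (simp add: o_def)
  qed (auto simp: inj_on_def)
  moreover have "range int \<inter> range (\<lambda>n. - int (Suc n)) = {}" by auto
  moreover have "range int \<union> range (\<lambda>n. - int (Suc n)) = UNIV"
  proof (intro set_eqI iffI UNIV_I)
    fix x :: int
    show "x \<in> range int \<union> range (\<lambda>n. - int (Suc n))"
      by (cases x rule: int_cases) auto
  qed
  ultimately show ?thesis using summable_on_Un_disjoint by metis
qed

lemma has_vector_derivative_imp_quotient_tendsto: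
  fixes H :: "real \<Rightarrow> complex"
  assumes "(H has_vector_derivative D) (at t)"
  shows "((\<lambda>s. (H s - H t) / of_real (s - t)) \<longlongrightarrow> D) (at t)"
proof -
  have "((\<lambda>s. norm (H s - H t - (s - t) *\<^sub>R D) / norm (s - t)) \<longlongrightarrow> 0) (at t)"
    using assms by (simp add: has_vector_derivative_def has_derivative_iff_norm)
  then have "((\<lambda>s. norm ((H s - H t) / of_real (s - t) - D)) \<longlongrightarrow> 0) (at t)"
  proof (rule Lim_transform_within[OF _ zero_less_one])
    fix s assume "0 < dist s t"
    then have "s \<noteq> t" by simp
    then have "(H s - H t) / of_real (s - t) - D = (H s - H t - (s - t) *\<^sub>R D) / of_real (s - t)"
      by (simp add: scaleR_conv_of_real field_simps)
    then show "norm (H s - H t - (s - t) *\<^sub>R D) / norm (s - t) = norm ((H s - H t) / of_real (s - t) - D)"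
      by (simp add: norm_divide del: of_real_diff)
  qed
  then show ?thesis by (simp add: tendsto_norm_zero_iff LIM_zero_iff)
qed

text \<open>Summation by parts against \<open>(h s - h t) / (exp (i (s - t)) - 1)\<close>: the Fourier series at \<open>t\<close>
  telescopes, and the remainder tends to zero by Bessel's inequality.\<close>
lemma fourier_series_C2:
  fixes H :: "real \<Rightarrow> complex"
  assumes H: "\<And>s. (H has_vector_derivative H' s) (at s)" and H': "\<And>s. (H' has_vector_derivative H'' s) (at s)"
    and cont: "continuous_on UNIV H''" and per: "\<And>s. H (s + 2 * pi) = H s"
  shows "((\<lambda>\<nu>. exp (\<i> * of_int \<nu> * of_real t) * fourier_coeff H 0 \<nu>) has_sum H t) UNIV"
proof -
  define c where "c = fourier_coeff H 0"
  have cH: "continuous_on UNIV H" and cH': "continuous_on UNIV H'"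
    using H H' by (meson continuous_at_imp_continuous_on has_vector_derivative_continuous)+
  have per': "H' (s + 2 * pi) = H' s" for s
  proof -
    have "((\<lambda>s. s + 2 * pi) has_real_derivative 1) (at s)" by (auto intro!: derivative_eq_intros)
    then have "(H \<circ> (\<lambda>s. s + 2 * pi) has_vector_derivative 1 *\<^sub>R H' (s + 2 * pi)) (at s)"
      by (intro vector_diff_chain_at H) (auto simp: has_real_derivative_iff_has_vector_derivative)
    then have "(H has_vector_derivative H' (s + 2 * pi)) (at s)" by (simp add: o_def per)
    then show ?thesis using H vector_derivative_unique_at by blast
  qed
  obtain M where M: "M \<ge> 0" "\<And>s. s \<in> {0..0 + 2*pi} \<Longrightarrow> norm (H'' s) \<le> M"
    using continuous_on_compact_bound[OF compact_Icc continuous_on_subset[OF cont subset_UNIV]] by blast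
  \<comment> \<open>Two integrations by parts give the decay \<open>\<nu>^(-2)\<close>, hence
    absolute convergence. What remains is to identify the sum.\<close>
  have c_le: "norm (c \<nu>) \<le> M * (1 / (of_int \<nu>)\<^sup>2)" if "\<nu> \<noteq> 0" for \<nu>
  proof -
    have "fourier_coeff H'' 0 \<nu> = \<i> * of_int \<nu> * (\<i> * of_int \<nu> * c \<nu>)"
      unfolding c_def by (simp only: fourier_coeff_deriv[OF H' cont per'] fourier_coeff_deriv[OF H cH' per])
    moreover have "norm (fourier_coeff H'' 0 \<nu>) \<le> M"
      by (rule norm_fourier_coeff_le) (use M in \<open>auto intro: continuous_on_subset[OF cont]\<close>)
    ultimately have "(of_int \<nu>)\<^sup>2 * norm (c \<nu>) \<le> M"
      by (simp add: norm_mult power2_eq_square mult_ac)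
    then show ?thesis using that by (simp add: field_simps)
  qed
  let ?F = "\<lambda>\<nu>. exp (\<i> * of_int \<nu> * of_real t) * c \<nu>"
  have "(\<lambda>\<nu>. norm (?F \<nu>)) summable_on (UNIV - {0})"
  proof (rule summable_on_comparison_test)
    show "(\<lambda>\<nu>::int. M * (1 / (of_int \<nu>)\<^sup>2)) summable_on (UNIV - {0})"
      using summable_on_int_inverse_square by (intro summable_on_cmult_right) (rule summable_on_subset_banach, auto)
    show "norm (?F \<nu>) \<le> M * (1 / (of_int \<nu>)\<^sup>2)" if "\<nu> \<in> UNIV - {0}" for \<nu>
      using c_le[of \<nu>] that by (simp add: norm_mult)
  qed auto
  then have "(\<lambda>\<nu>. norm (?F \<nu>)) summable_on (insert 0 (UNIV - {0}))" by (simp only: summable_on_insert_iff)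
  moreover have "insert 0 (UNIV - {0}) = (UNIV :: int set)" by auto
  ultimately have "(\<lambda>\<nu>. norm (?F \<nu>)) summable_on UNIV" by (simp only:)
  then have "?F summable_on UNIV" by (rule abs_summable_summable)
  then obtain S where S: "(?F has_sum S) UNIV" by (auto simp: summable_on_def)
  \<comment> \<open>Symmetric intervals are cofinal among the finite sets of integers, so the
    unordered sum is the limit of the symmetric partial sums.\<close>
  have "filterlim (\<lambda>n::nat. {-int n..int n}) (finite_subsets_at_top UNIV) sequentially"
    unfolding filterlim_finite_subsets_at_top
  proof (intro allI impI; elim conjE)
    fix X :: "int set" assume "finite X"
    then have "bdd_above (abs ` X)" by (intro bdd_above_finite finite_imageI)
    then obtain m where m: "\<And>x. x \<in> X \<Longrightarrow> \<bar>x\<bar> \<le> m" by (auto simp: bdd_above_def)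
    show "\<forall>\<^sub>F n in sequentially. finite {-int n..int n} \<and> X \<subseteq> {-int n..int n} \<and> {-int n..int n} \<subseteq> UNIV"
      using eventually_ge_at_top[of "nat m"]
    proof eventually_elim
      case (elim n)
      have "x \<in> {-int n..int n}" if "x \<in> X" for x using m[OF that] elim by auto
      then show ?case by auto
    qed
  qed
  with S have lim: "(\<lambda>n::nat. sum ?F {-int n..int n}) \<longlonglongrightarrow> S"
    unfolding has_sum_def by (rule filterlim_compose)
  \<comment> \<open>The value at \<open>s = t\<close> is the limit of the quotient, as the
    denominator has derivative \<open>i\<close> there. Thus \<open>q\<close> is continuous and its
    Fourier coefficients tend to zero.\<close>
  define q where "q s = (if s = t then H' t / \<i> else (H s - H t) / (exp (\<i> * of_real (s - t)) - 1))" for s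
  let ?a = "t - pi"
  let ?J = "{?a..?a + 2 * pi}"
  have nz: "exp (\<i> * complex_of_real (s - t)) \<noteq> 1" if "s \<in> ?J" "s \<noteq> t" for s
  proof
    assume "exp (\<i> * complex_of_real (s - t)) = 1"
    then obtain k :: int where k: "s - t = of_int (2 * k) * pi" unfolding exp_eq_1 by auto
    have "\<bar>s - t\<bar> \<le> pi" using that by auto
    then have "\<bar>of_int (2 * k)\<bar> * pi \<le> 1 * pi" using k by (simp add: abs_mult)
    then have "\<bar>of_int (2 * k) :: real\<bar> \<le> 1" by (rule mult_right_le_imp_le) auto
    then have "k = 0" by linarith
    with k that show False by simp
  qed
  have q_eq: "H s = H t + exp (\<i> * of_real (s - t)) * q s - q s" if "s \<in> ?J" for s
  proof (cases "s = t")
    case False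
    then have "(exp (\<i> * of_real (s - t)) - 1) * q s = H s - H t"
      using nz[OF that] by (simp add: q_def del: of_real_diff)
    then show ?thesis by (simp add: algebra_simps del: of_real_diff)
  qed simp
  have "continuous_on ?J q"
    unfolding continuous_on_eq_continuous_within
  proof
    fix s assume s: "s \<in> ?J"
    show "continuous (at s within ?J) q"
    proof (cases "s = t")
      case True
      have "((\<lambda>s. exp (\<i> * complex_of_real (s - t))) has_vector_derivative \<i>) (at t)"
        by (auto intro!: derivative_eq_intros has_vector_derivative_real_field)
      from has_vector_derivative_imp_quotient_tendsto[OF this] have "((\<lambda>s. (exp (\<i> * complex_of_real (s - t)) - 1) / of_real (s - t)) \<longlongrightarrow> \<i>) (at t)"
        by simp
      moreover have "((\<lambda>s. (H s - H t) / of_real (s - t)) \<longlongrightarrow> H' t) (at t)"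
        by (rule has_vector_derivative_imp_quotient_tendsto[OF H])
      ultimately have "((\<lambda>s. ((H s - H t) / of_real (s - t)) / ((exp (\<i> * complex_of_real (s - t)) - 1) / of_real (s - t))) \<longlongrightarrow> H' t / \<i>) (at t)"
        by (intro tendsto_divide) auto
      then have "((\<lambda>s. ((H s - H t) / of_real (s - t)) / ((exp (\<i> * complex_of_real (s - t)) - 1) / of_real (s - t))) \<longlongrightarrow> q t) (at t within ?J)"
        by (auto simp: q_def intro: tendsto_within_subset)
      then have "(q \<longlongrightarrow> q t) (at t within ?J)"
        by (rule Lim_transform_within[OF _ zero_less_one]) (auto simp: q_def)
      then show ?thesis using True by (simp add: continuous_within)
    next
      case False
      have "continuous (at s) H" using cH by (simp add: continuous_on_eq_continuous_at)
      then have "continuous (at s within ?J) (\<lambda>s. (H s - H t) / (exp (\<i> * of_real (s - t)) - 1))"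
        using nz[OF s False] by (intro continuous_intros continuous_within_subset[OF \<open>continuous (at s) H\<close>]) auto
      then show ?thesis
        by (rule continuous_transform_within[where \<delta> = "\<bar>s - t\<bar>"]) (use False s in \<open>auto simp: q_def dist_real_def\<close>)
    qed
  qed
  note cq = this
  define d where "d \<nu> = exp (\<i> * of_int \<nu> * of_real t) * fourier_coeff q ?a \<nu>" for \<nu>
  \<comment> \<open>Multiplication by \<open>exp (i (s - t))\<close> lowers the index of a Fourier
    coefficient by one. Inserting \<open>q_eq\<close> therefore turns each term of the series into a
    difference of consecutive values of \<open>d\<close>, plus \<open>H t\<close> at index
    0.\<close>
  have tele: "?F \<nu> = (if \<nu> = 0 then H t else 0) + (d (\<nu> - 1) - d \<nu>)" for \<nu>
  proof -
    let ?e = "\<lambda>s::real. exp (- \<i> * of_int \<nu> * of_real s)"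
    let ?e1 = "\<lambda>s::real. exp (- \<i> * of_int (\<nu> - 1) * of_real s)"
    have "c \<nu> = fourier_coeff H ?a \<nu>"
    proof -
      have "?e (s + 2 * pi) = ?e s" for s
      proof -
        have "?e (s + 2 * pi) = ?e s * exp (- (2 * of_int \<nu> * of_real pi * \<i>))"
          by (simp add: exp_add[symmetric] algebra_simps)
        moreover have "exp (2 * of_int \<nu> * of_real pi * \<i>) = 1" by (auto simp: exp_eq_1)
        ultimately show ?thesis by (simp add: exp_minus)
      qed
      then show ?thesis unfolding c_def fourier_coeff_def
        by (subst integral_periodic_shift[where P = "2 * pi" and a = ?a])
           (auto intro!: continuous_intros cH simp: per)
    qed
    moreover have "integral ?J (\<lambda>s. ?e s * H s)
      = integral ?J (\<lambda>s. H t * ?e s + exp (- \<i> * of_real t) * (?e1 s * q s) - ?e s * q s)"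
    proof (rule integral_cong)
      fix s assume s: "s \<in> ?J"
      have e1: "?e s * exp (\<i> * of_real (s - t)) = exp (- \<i> * of_real t) * ?e1 s"
        by (simp add: exp_add[symmetric] algebra_simps)
      have "?e s * H s = H t * ?e s + (?e s * exp (\<i> * of_real (s - t))) * q s - ?e s * q s"
        by (subst q_eq[OF s]) (simp add: algebra_simps)
      then show "?e s * H s = H t * ?e s + exp (- \<i> * of_real t) * (?e1 s * q s) - ?e s * q s"
        unfolding e1 by (simp only: mult.assoc)
    qed
    moreover have "\<dots> = H t * integral ?J ?e + exp (- \<i> * of_real t) * integral ?J (\<lambda>s. ?e1 s * q s) - integral ?J (\<lambda>s. ?e s * q s)"
      by (subst integral_diff integral_add integral_mult_right; 
          (intro integrable_continuous_real continuous_intros cq)?)+ simp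
    moreover have "integral ?J ?e = (if \<nu> = 0 then 2 * pi else 0)"
      using integral_exp_int[of ?a "-\<nu>"] by simp
    ultimately have "c \<nu> = (H t * (if \<nu> = 0 then 2 * pi else 0) + exp (- \<i> * of_real t) * integral ?J (\<lambda>s. ?e1 s * q s)
        - integral ?J (\<lambda>s. ?e s * q s)) / (2 * pi)"
      by (simp only: fourier_coeff_def)
    then have "c \<nu> = (if \<nu> = 0 then H t else 0) + exp (- \<i> * of_real t) * fourier_coeff q ?a (\<nu> - 1) - fourier_coeff q ?a \<nu>"
      unfolding fourier_coeff_def by (simp only: add_divide_distrib diff_divide_distrib times_divide_eq_right) simp
    then have "?F \<nu> = exp (\<i> * of_int \<nu> * of_real t) * (if \<nu> = 0 then H t else 0)
        + (exp (\<i> * of_int \<nu> * of_real t) * exp (- \<i> * of_real t)) * fourier_coeff q ?a (\<nu> - 1)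
        - exp (\<i> * of_int \<nu> * of_real t) * fourier_coeff q ?a \<nu>"
      by (simp only: right_diff_distrib distrib_left mult.assoc)
    moreover have "exp (\<i> * of_int \<nu> * of_real t) * exp (- \<i> * of_real t) = exp (\<i> * of_int (\<nu> - 1) * of_real t)"
      by (simp add: exp_add[symmetric] algebra_simps)
    ultimately have "?F \<nu> = exp (\<i> * of_int \<nu> * of_real t) * (if \<nu> = 0 then H t else 0) + d (\<nu> - 1) - d \<nu>"
      unfolding d_def by (simp only:)
    then show ?thesis by simp
  qed
  have part: "sum ?F {-int n..int n} = H t + d (- int (Suc n)) - d (int n)" for n
  proof (induction n)
    case 0
    then show ?case using tele[of 0] by simp
  next
    case (Suc n)
    have "{-int (Suc n)..int (Suc n)} = insert (int (Suc n)) (insert (- int (Suc n)) {-int n..int n})" by auto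
    then have "sum ?F {-int (Suc n)..int (Suc n)} = ?F (int (Suc n)) + (?F (- int (Suc n)) + sum ?F {-int n..int n})"
      by simp
    moreover have "- int (Suc n) - 1 = - int (Suc (Suc n))" "int (Suc n) - 1 = int n" by simp_all
    ultimately show ?case unfolding Suc tele[of "int (Suc n)"] tele[of "- int (Suc n)"]
      by (simp del: of_nat_Suc)
  qed
  have d0: "(\<lambda>n. d (N n)) \<longlonglongrightarrow> 0" if "inj N" for N :: "nat \<Rightarrow> int"
  proof -
    have "norm (d \<nu>) = norm (fourier_coeff q ?a \<nu>)" for \<nu> by (simp add: d_def norm_mult)
    then have "(\<lambda>n. norm (d (N n))) \<longlonglongrightarrow> 0"
      using tendsto_norm_zero[OF fourier_coeff_tendsto_0[OF cq that]] by (simp only:)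
    then show ?thesis by (rule tendsto_norm_zero_cancel)
  qed
  have "(\<lambda>n. H t + d (- int (Suc n)) - d (int n)) \<longlonglongrightarrow> H t + 0 - 0"
    by (intro tendsto_intros d0) (auto simp: inj_def)
  with lim have "S = H t" unfolding part by (simp add: LIMSEQ_unique)
  with S show ?thesis by (simp add: c_def)
qed

text \<open>Rescaling time by \<omega> reduces the claim to period \<open>2 * pi\<close>; a negative
  \<omega> needs no separate treatment.\<close>

lemma has_fourier_expansion_C2:
  fixes h :: "real \<Rightarrow> real"
  assumes "\<omega> \<noteq> 0" and h: "\<And>s. (h has_real_derivative h' s) (at s)" and h': "\<And>s. (h' has_real_derivative h'' s) (at s)"
    and cont: "continuous_on UNIV h''" and per: "\<And>s. h (s + 2 * pi / \<omega>) = h s"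
  shows "\<exists>c. has_fourier_expansion \<omega> h c"
proof -
  let ?H = "\<lambda>s. complex_of_real (h (s / \<omega>))" and ?H' = "\<lambda>s. complex_of_real (h' (s / \<omega>) / \<omega>)"
    and ?H'' = "\<lambda>s. complex_of_real (h'' (s / \<omega>) / \<omega>\<^sup>2)"
  have "((\<lambda>s. h (s / \<omega>)) has_real_derivative h' (s / \<omega>) / \<omega>) (at s)" for s
    using DERIV_chain2[OF h DERIV_cdivide[OF DERIV_ident]] by simp
  then have 1: "(?H has_vector_derivative ?H' s) (at s)" for s
    by (intro has_vector_derivative_of_real) (simp only: has_real_derivative_iff_has_vector_derivative)
  have "((\<lambda>s. h' (s / \<omega>) / \<omega>) has_real_derivative h'' (s / \<omega>) / \<omega> / \<omega>) (at s)" for s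
    using DERIV_cdivide[OF DERIV_chain2[OF h' DERIV_cdivide[OF DERIV_ident]]] by simp
  then have 2: "(?H' has_vector_derivative ?H'' s) (at s)" for s
    by (intro has_vector_derivative_of_real)
       (simp add: has_real_derivative_iff_has_vector_derivative power2_eq_square)
  have 3: "continuous_on UNIV ?H''"
    using \<open>\<omega> \<noteq> 0\<close> by (intro continuous_intros continuous_on_compose2[OF cont]) auto
  have "((\<lambda>\<nu>. exp (\<i> * of_int \<nu> * of_real (\<omega> * t)) * fourier_coeff ?H 0 \<nu>) has_sum ?H (\<omega> * t)) UNIV" for t
    by (rule fourier_series_C2[OF 1 2 3]) (use per in \<open>simp add: add_divide_distrib\<close>)
  then show ?thesis
    unfolding has_fourier_expansion_def using \<open>\<omega> \<noteq> 0\<close>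
    by (intro exI[of _ "fourier_coeff ?H 0"]) (simp add: mult.assoc)
qed

text \<open>At \<open>t = 0\<close> all exponentials are 1, so the assumed unordered convergence
  gives absolute summability of \<open>c\<close>. The expansion then converges uniformly by the
  M-test and may be integrated term by term over a period.\<close>

lemma fourier_expansion_mean:
  assumes f: "has_fourier_expansion 1 f c" and cont: "continuous_on UNIV f"
  shows "c 0 = complex_of_real (integral {0..2 * pi} f / (2 * pi))"
proof -
  let ?F = "\<lambda>\<nu> t. exp (\<i> * of_int \<nu> * of_real t) * c \<nu>"
  have hs: "((\<lambda>\<nu>. ?F \<nu> t) has_sum of_real (f t)) UNIV" for t
    using f by (simp add: has_fourier_expansion_def)
  have "(\<lambda>\<nu>. ?F \<nu> 0) summable_on UNIV" using hs[of 0] by (auto simp: summable_on_def)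
  then have "(\<lambda>\<nu>. norm (c \<nu>)) summable_on UNIV"
    by (simp add: summable_on_iff_abs_summable_on_complex)
  then have "uniform_limit UNIV (\<lambda>X t. \<Sum>\<nu>\<in>X. ?F \<nu> t) (\<lambda>t. \<Sum>\<^sub>\<infinity>\<nu>. ?F \<nu> t) (finite_subsets_at_top UNIV)"
    by (intro Weierstrass_m_test_general[where M = "\<lambda>\<nu>. norm (c \<nu>)"]) (auto simp: norm_mult)
  moreover have "(\<Sum>\<^sub>\<infinity>\<nu>. ?F \<nu> t) = of_real (f t)" for t using hs by (rule infsumI)
  ultimately have "uniform_limit {0..2*pi} (\<lambda>X t. \<Sum>\<nu>\<in>X. ?F \<nu> t) (\<lambda>t. complex_of_real (f t)) (finite_subsets_at_top UNIV)"
    by (simp only:) (rule uniform_limit_on_subset, auto)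
  then obtain I J where I: "\<And>X. ((\<lambda>t. \<Sum>\<nu>\<in>X. ?F \<nu> t) has_integral I X) {0..2*pi}"
    and J: "((\<lambda>t. complex_of_real (f t)) has_integral J) {0..2*pi}" "(I \<longlongrightarrow> J) (finite_subsets_at_top UNIV)"
    by (rule uniform_limit_integral) (auto intro!: continuous_intros)
  have "I X = 2 * pi * c 0" if "finite X" "0 \<in> X" for X
  proof -
    have "I X = integral {0..2*pi} (\<lambda>t. \<Sum>\<nu>\<in>X. ?F \<nu> t)" by (rule integral_unique[OF I, symmetric])
    also have "\<dots> = (\<Sum>\<nu>\<in>X. integral {0..2*pi} (?F \<nu>))"
      by (intro integral_sum integrable_continuous_real continuous_intros that)
    also have "\<dots> = (\<Sum>\<nu>\<in>X. if \<nu> = 0 then 2 * pi * c \<nu> else 0)"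
      using integral_exp_int[of 0] by (intro sum.cong) auto
    finally show ?thesis using that by simp
  qed
  then have "\<forall>\<^sub>F X in finite_subsets_at_top UNIV. I X = 2 * pi * c 0"
    unfolding eventually_finite_subsets_at_top by (intro exI[of _ "{0}"]) auto
  then have "(I \<longlongrightarrow> 2 * pi * c 0) (finite_subsets_at_top UNIV)" by (rule tendsto_eventually)
  then have "J = 2 * pi * c 0"
    by (rule tendsto_unique[OF finite_subsets_at_top_neq_bot J(2)])
  moreover have "f integrable_on {0..2*pi}"
    by (rule integrable_continuous_real[OF continuous_on_subset[OF cont]]) simp
  then have "((\<lambda>t. complex_of_real (f t)) has_integral of_real (integral {0..2*pi} f)) {0..2*pi}"
    by (intro has_integral_of_real) (rule integrable_integral)
  then have "J = of_real (integral {0..2*pi} f)" by (rule has_integral_unique[OF J(1)])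
  ultimately show ?thesis by (simp add: field_simps)
qed

section \<open>Attraction\<close>

lemma integral_has_vector_derivative_halfline:
  fixes h :: "real \<Rightarrow> 'a::banach"
  assumes "continuous_on {0..} h" "t \<ge> 0"
  shows "((\<lambda>t. integral {0..t} h) has_vector_derivative h t) (at t within {0..})"
proof -
  have "((\<lambda>t. integral {0..t} h) has_vector_derivative h t) (at t within {0..t+1})"
    using assms by (intro integral_has_vector_derivative continuous_on_subset[OF assms(1)]) auto
  moreover have "at t within {0..t+1} = at t within {0..}"
    by (rule at_within_nhd[of _ "{..<t+1}"]) (use assms in auto)
  ultimately show ?thesis by simp
qed

text \<open>On a fixed interval \<open>[0, T]\<close> consecutive Picard iterates differ by at most
  \<open>K (L t)^n / n!\<close>, which is summable whatever \<open>T\<close> is; a global Lipschitz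
  constant thus gives a global solution. Continuity of \<open>F\<close> is asked along continuous
  curves, the form in which the integrals use it.\<close>

lemma picard_global_existence:
  fixes F :: "real \<Rightarrow> 'a::banach \<Rightarrow> 'a"
  assumes cont: "\<And>y. continuous_on {0..} y \<Longrightarrow> continuous_on {0..} (\<lambda>t. F t (y t))"
    and lip: "\<And>t x y. t \<ge> 0 \<Longrightarrow> norm (F t x - F t y) \<le> L * norm (x - y)" and "L \<ge> 0"
  obtains y where "y 0 = y0"
    "\<And>t. t \<ge> 0 \<Longrightarrow> (y has_vector_derivative F t (y t)) (at t within {0..})"
proof -
  define Y where "Y = rec_nat (\<lambda>t. y0) (\<lambda>_ y t. y0 + integral {0..t} (\<lambda>s. F s (y s)))"
  have Y0: "Y 0 = (\<lambda>t. y0)" and YS: "Y (Suc n) = (\<lambda>t. y0 + integral {0..t} (\<lambda>s. F s (Y n s)))" for n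
    by (simp_all add: Y_def)
  have contY: "continuous_on {0..} (Y n)" for n
  proof (induction n)
    case (Suc n)
    have "(Y (Suc n) has_vector_derivative F t (Y n t)) (at t within {0..})" if "t \<ge> 0" for t
      unfolding YS using integral_has_vector_derivative_halfline[OF cont[OF Suc] that]
      by (auto intro!: derivative_eq_intros)
    then show ?case
      unfolding continuous_on_eq_continuous_within
      by (metis atLeast_iff has_vector_derivative_continuous)
  qed (simp add: Y0)
  have int: "(\<lambda>s. F s (y s)) integrable_on {0..t}" if "continuous_on {0..} y" for y t
    by (rule integrable_continuous_real) (use cont[OF that] in \<open>auto intro: continuous_on_subset\<close>)
  have ex: "\<exists>l. uniform_limit {0..T} Y l sequentially" if "T \<ge> 0" for T
  proof -
    have "continuous_on {0..T} (\<lambda>t. Y 1 t - Y 0 t)"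
      by (intro continuous_on_diff continuous_on_subset[OF contY]) auto
    then obtain K where "K \<ge> 0" and K: "\<And>t. t \<in> {0..T} \<Longrightarrow> norm (Y 1 t - Y 0 t) \<le> K"
      by (rule continuous_on_compact_bound[OF compact_Icc]) blast
    have diff: "norm (Y (Suc n) t - Y n t) \<le> K * (L * t) ^ n / fact n" if "t \<in> {0..T}" for n t
      using that
    proof (induction n arbitrary: t)
      case 0
      then show ?case using K[of t] by simp
    next
      case (Suc n)
      have "Y (Suc (Suc n)) t - Y (Suc n) t
          = integral {0..t} (\<lambda>s. F s (Y (Suc n) s) - F s (Y n s))"
        unfolding YS[of "Suc n"] YS[of n, THEN fun_cong, of t]
        by (simp add: integral_diff[OF int[OF contY] int[OF contY]])
      also have "norm \<dots> \<le> integral {0..t} (\<lambda>s. L * (K * (L * s) ^ n / fact n))"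
      proof (rule integral_norm_bound_integral)
        show "norm (F s (Y (Suc n) s) - F s (Y n s)) \<le> L * (K * (L * s) ^ n / fact n)"
          if "s \<in> {0..t}" for s
        proof -
          have "L * norm (Y (Suc n) s - Y n s) \<le> L * (K * (L * s) ^ n / fact n)"
            using Suc.IH[of s] Suc.prems that \<open>L \<ge> 0\<close> by (intro mult_left_mono) auto
          with lip[of s "Y (Suc n) s" "Y n s"] that show ?thesis by simp
        qed
        show "(\<lambda>s. F s (Y (Suc n) s) - F s (Y n s)) integrable_on {0..t}"
          by (intro integrable_diff int contY)
        show "(\<lambda>s. L * (K * (L * s) ^ n / fact n)) integrable_on {0..t}"
          by (intro integrable_continuous_real continuous_intros) auto
      qed
      also have "\<dots> = K * (L * t) ^ Suc n / fact (Suc n)"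
      proof (rule integral_unique)
        have "((\<lambda>s. K * (L * s) ^ Suc n / fact (Suc n)) has_real_derivative
            L * (K * (L * s) ^ n / fact n)) (at s within {0..t})" for s
        proof -
          have "((\<lambda>s. L * s) has_real_derivative L) (at s within {0..t})"
            by (auto intro!: derivative_eq_intros)
          from DERIV_cdivide[OF DERIV_cmult[OF DERIV_power_Suc[OF this, of n], of K], of "fact (Suc n)"]
          moreover have "fact (Suc n) = (1 + real n) * fact n" "1 + real n \<noteq> 0"
            by (simp_all add: algebra_simps)
          ultimately show ?thesis by (elim DERIV_cong) (simp add: mult_ac del: fact_Suc)
        qed
        from fundamental_theorem_of_calculus[OF _ this[unfolded has_real_derivative_iff_has_vector_derivative]]
        show "((\<lambda>s. L * (K * (L * s) ^ n / fact n)) has_integral K * (L * t) ^ Suc n / fact (Suc n)) {0..t}"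
          using Suc.prems by auto
      qed
      finally show ?case .
    qed
    have "uniform_limit {0..T} (\<lambda>n t. \<Sum>i<n. Y (Suc i) t - Y i t) (\<lambda>t. \<Sum>i. Y (Suc i) t - Y i t) sequentially"
    proof (rule Weierstrass_m_test)
      show "norm (Y (Suc n) t - Y n t) \<le> K * ((L * T) ^ n / fact n)" if "t \<in> {0..T}" for n t
      proof -
        have "norm (Y (Suc n) t - Y n t) \<le> K * ((L * t) ^ n / fact n)" using diff[OF that, of n] by simp
        also have "\<dots> \<le> K * ((L * T) ^ n / fact n)"
          using that \<open>K \<ge> 0\<close> \<open>L \<ge> 0\<close>
          by (intro mult_left_mono divide_right_mono power_mono) auto
        finally show ?thesis .
      qed
      show "summable (\<lambda>n. K * ((L * T) ^ n / fact n))"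
        using summable_exp_generic[of "L * T"] by (intro summable_mult) (simp add: divide_inverse mult.commute)
    qed
    then have "uniform_limit {0..T} (\<lambda>n t. y0 + (\<Sum>i<n. Y (Suc i) t - Y i t)) (\<lambda>t. y0 + (\<Sum>i. Y (Suc i) t - Y i t)) sequentially"
      by (intro uniform_limit_intros)
    moreover have "y0 + (\<Sum>i<n. Y (Suc i) t - Y i t) = Y n t" for n t
      by (subst sum_lessThan_telescope) (simp add: Y0)
    ultimately show ?thesis by auto
  qed
  define y where "y t = lim (\<lambda>n. Y n t)" for t
  have ulim: "uniform_limit {0..T} Y y sequentially" if T: "T \<ge> 0" for T
  proof -
    obtain l where l: "uniform_limit {0..T} Y l sequentially" using ex[OF T] by blast
    have "y t = l t" if "t \<in> {0..T}" for t
      unfolding y_def using tendsto_uniform_limitI[OF l that] by (rule limI)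
    with l show ?thesis by (metis (no_types, lifting) uniform_limit_cong')
  qed
  have conty: "continuous_on {0..T} y" if "T \<ge> 0" for T
    by (rule uniform_limit_theorem[OF _ ulim[OF that]])
       (auto intro!: always_eventually continuous_on_subset[OF contY])
  have conty': "continuous_on {0..} y"
  proof (unfold continuous_on_eq_continuous_within, intro ballI)
    fix t :: real assume t: "t \<in> {0..}"
    have "continuous (at t within {0..t+1}) y"
      using conty[of "t+1"] t by (auto simp: continuous_on_eq_continuous_within)
    moreover have "at t within {0..t+1} = at t within {0..}"
      by (rule at_within_nhd[of _ "{..<t+1}"]) (use t in auto)
    ultimately show "continuous (at t within {0..}) y" by simp
  qed
  have eq: "y t = y0 + integral {0..t} (\<lambda>s. F s (y s))" if t: "t \<ge> 0" for t
  proof -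
    have "uniform_limit {0..t} (\<lambda>n s. F s (Y n s)) (\<lambda>s. F s (y s)) sequentially"
    proof (rule uniform_limitI)
      fix e :: real assume "e > 0"
      then have "e / (L + 1) > 0" using \<open>L \<ge> 0\<close> by simp
      then have "\<forall>\<^sub>F n in sequentially. \<forall>s\<in>{0..t}. dist (Y n s) (y s) < e / (L + 1)"
        using ulim[OF t] by (auto simp: uniform_limit_iff)
      then show "\<forall>\<^sub>F n in sequentially. \<forall>s\<in>{0..t}. dist (F s (Y n s)) (F s (y s)) < e"
      proof eventually_elim
        case (elim n)
        show ?case
        proof
          fix s assume s: "s \<in> {0..t}"
          have "norm (F s (Y n s) - F s (y s)) \<le> L * norm (Y n s - y s)" using s by (intro lip) auto
          also have "\<dots> \<le> (L + 1) * norm (Y n s - y s)" by (intro mult_right_mono) auto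
          also have "\<dots> < e" using elim s \<open>L \<ge> 0\<close> by (auto simp: dist_norm field_simps)
          finally show "dist (F s (Y n s)) (F s (y s)) < e" by (simp add: dist_norm)
        qed
      qed
    qed
    then obtain I J where IJ: "\<And>n. ((\<lambda>s. F s (Y n s)) has_integral I n) {0..t}"
        "((\<lambda>s. F s (y s)) has_integral J) {0..t}" "I \<longlonglongrightarrow> J"
      by (rule uniform_limit_integral) (auto intro!: continuous_on_subset[OF cont[OF contY]])
    have "Y (Suc n) t = y0 + I n" for n using IJ(1)[of n] unfolding YS by (simp add: integral_unique)
    moreover have "(\<lambda>n. Y (Suc n) t) \<longlonglongrightarrow> y t"
      using tendsto_uniform_limitI[OF ulim[OF t], of t] t by (intro LIMSEQ_Suc) auto
    ultimately have "(\<lambda>n. y0 + I n) \<longlonglongrightarrow> y t" by simp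
    moreover have "(\<lambda>n. y0 + I n) \<longlonglongrightarrow> y0 + J" by (intro tendsto_intros IJ)
    ultimately have "y t = y0 + J" by (rule LIMSEQ_unique)
    with IJ(2) show ?thesis by (simp add: integral_unique)
  qed
  show ?thesis
  proof
    show "y 0 = y0" using eq[of 0] by simp
    show "(y has_vector_derivative F t (y t)) (at t within {0..})" if t: "t \<ge> 0" for t
    proof (rule has_vector_derivative_transform)
      show "((\<lambda>t. y0 + integral {0..t} (\<lambda>s. F s (y s))) has_vector_derivative F t (y t)) (at t within {0..})"
        using integral_has_vector_derivative_halfline[OF cont[OF conty'] t]
        by (auto intro!: derivative_eq_intros)
    qed (use t eq in auto)
  qed
qed

text \<open>Gronwall's argument: \<open>E t * exp (- k * t)\<close> has nonpositive derivative in
  the interior. The rate \<open>k\<close> may have either sign; uniqueness uses a positive one,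
  attraction a negative one.\<close>

lemma differential_inequality_exp:
  fixes E :: "real \<Rightarrow> real"
  assumes I: "convex I" "0 \<in> I" "I \<subseteq> {0..}"
    and E: "\<And>t. t \<in> I \<Longrightarrow> (E has_real_derivative E' t) (at t within I)"
    and le: "\<And>t. t \<in> I \<Longrightarrow> E' t \<le> k * E t" and t: "t \<in> I"
  shows "E t \<le> E 0 * exp (k * t)"
proof (cases "t = 0")
  case False
  with I t have "t > 0" by auto
  have sub: "{0..t} \<subseteq> I"
    using I t by (metis closed_segment_eq_real_ivl1 convex_contains_segment atLeast_iff subset_iff)
  have cont: "continuous_on {0..t} E"
    using E sub continuous_on_subset[of I E "{0..t}"] by (metis DERIV_continuous_on)
  let ?F = "\<lambda>s. E s * exp (- k * s)"
  have "?F t \<le> ?F 0"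
  proof (rule DERIV_nonpos_imp_decreasing_open[where f = ?F and a = 0 and b = t])
    fix s assume s: "0 < s" "s < t"
    have "{0<..<t} \<subseteq> I" using sub by auto
    then have "s \<in> interior I" using s by (meson greaterThanLessThan_iff interior_maximal open_greaterThanLessThan subsetD)
    then have "(E has_real_derivative E' s) (at s)"
      using E[of s] interior_subset[of I] by (metis at_within_interior subsetD)
    then have "(?F has_real_derivative (E' s - k * E s) * exp (- k * s)) (at s)"
      by (auto intro!: derivative_eq_intros simp: algebra_simps)
    moreover have "(E' s - k * E s) * exp (- k * s) \<le> 0"
      using le[of s] \<open>s \<in> interior I\<close> interior_subset[of I] by (intro mult_nonpos_nonneg) auto
    ultimately show "\<exists>y. (?F has_real_derivative y) (at s) \<and> y \<le> 0" by blast
  qed (use \<open>t > 0\<close> cont in \<open>auto intro!: continuous_intros\<close>)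
  then show ?thesis by (simp add: exp_minus field_simps)
qed auto

lemma ode_solution_subset:
  assumes "ode_solution \<omega> g f \<epsilon> I x v" "J \<subseteq> I"
  shows "ode_solution \<omega> g f \<epsilon> J x v"
  using assms unfolding ode_solution_def by (meson DERIV_subset subsetD)

lemma ode_solution_cong:
  assumes "ode_solution \<omega> g f \<epsilon> I x v" "\<And>t. t \<in> I \<Longrightarrow> h (x t) = g (x t)"
  shows "ode_solution \<omega> h f \<epsilon> I x v"
  using assms unfolding ode_solution_def by metis

lemma ode_solution_continuous_on:
  assumes "ode_solution \<omega> g f \<epsilon> I x v"
  shows "continuous_on I x"
  using assms unfolding ode_solution_def by (metis DERIV_continuous_on)

text \<open>The squared distance in the phase plane satisfies \<open>E' \<le> (1 + L) * E\<close>
  and starts at 0. The damping contributes the square of the velocity difference times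
  \<open>- 2 / \<epsilon>\<close>, which has the favourable sign, and \<open>L\<close> is a
  Lipschitz constant of \<open>g\<close> on the bounded range of the two solutions over
  \<open>[0, t]\<close>.\<close>

lemma ode_solution_unique:
  assumes y: "ode_solution \<omega> g f \<epsilon> I y w" and Y: "ode_solution \<omega> g f \<epsilon> I Y W"
    and I: "convex I" "0 \<in> I" "I \<subseteq> {0..}" and "\<epsilon> > 0"
    and eq0: "y 0 = Y 0" "w 0 = W 0"
    and lip: "\<And>R. \<exists>L\<ge>0. \<forall>a b. \<bar>a\<bar> \<le> R \<longrightarrow> \<bar>b\<bar> \<le> R \<longrightarrow> \<bar>g a - g b\<bar> \<le> L * \<bar>a - b\<bar>"
    and t: "t \<in> I"
  shows "y t = Y t \<and> w t = W t"
proof -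
  have sub: "{0..t} \<subseteq> I" and "t \<ge> 0"
    using I t by (metis closed_segment_eq_real_ivl1 convex_contains_segment atLeast_iff subset_iff) (use I t in auto)
  let ?J = "{0..t}"
  have yJ: "ode_solution \<omega> g f \<epsilon> ?J y w" and YJ: "ode_solution \<omega> g f \<epsilon> ?J Y W"
    using y Y sub by (auto intro: ode_solution_subset)
  obtain R1 where R1: "\<And>s. s \<in> ?J \<Longrightarrow> norm (y s) \<le> R1"
    using continuous_on_compact_bound[OF compact_Icc ode_solution_continuous_on[OF yJ]] by metis
  obtain R2 where R2: "\<And>s. s \<in> ?J \<Longrightarrow> norm (Y s) \<le> R2"
    using continuous_on_compact_bound[OF compact_Icc ode_solution_continuous_on[OF YJ]] by metis
  define R where "R = max R1 R2"
  have R: "\<bar>y s\<bar> \<le> R \<and> \<bar>Y s\<bar> \<le> R" if "s \<in> ?J" for s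
    using R1[OF that] R2[OF that] by (auto simp: R_def)
  obtain L where L: "L \<ge> 0" "\<And>a b. \<bar>a\<bar> \<le> R \<Longrightarrow> \<bar>b\<bar> \<le> R \<Longrightarrow> \<bar>g a - g b\<bar> \<le> L * \<bar>a - b\<bar>"
    using lip[of R] by blast
  obtain a A where
    a: "\<And>s. s \<in> ?J \<Longrightarrow> (y has_real_derivative w s) (at s within ?J) \<and> (w has_real_derivative a s) (at s within ?J)
          \<and> \<epsilon> * a s + w s + \<epsilon> * g (y s) = \<epsilon> * f (\<omega> * s)" and
    A: "\<And>s. s \<in> ?J \<Longrightarrow> (Y has_real_derivative W s) (at s within ?J) \<and> (W has_real_derivative A s) (at s within ?J)
          \<and> \<epsilon> * A s + W s + \<epsilon> * g (Y s) = \<epsilon> * f (\<omega> * s)"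
    using yJ YJ unfolding ode_solution_def by metis
  define E where "E s = (y s - Y s)\<^sup>2 + (w s - W s)\<^sup>2" for s
  define E' where "E' s = 2 * (y s - Y s) * (w s - W s) + 2 * (w s - W s) * (a s - A s)" for s
  have "E t \<le> E 0 * exp ((1 + L) * t)"
  proof (rule differential_inequality_exp)
    fix s assume s: "s \<in> ?J"
    show "(E has_real_derivative E' s) (at s within ?J)"
    proof -
      have 1: "((\<lambda>s. y s - Y s) has_real_derivative w s - W s) (at s within ?J)"
        and 2: "((\<lambda>s. w s - W s) has_real_derivative a s - A s) (at s within ?J)"
        using a[OF s] A[OF s] by (auto intro: DERIV_diff)
      show ?thesis
        unfolding E_def E'_def
        by (rule DERIV_cong[OF DERIV_add[OF DERIV_power[OF 1, of 2] DERIV_power[OF 2, of 2]]]) (simp add: algebra_simps)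
    qed
    define p q d where "p = y s - Y s" and "q = w s - W s" and "d = g (y s) - g (Y s)"
    have "\<epsilon> * (a s - A s) = - q - \<epsilon> * d"
      using a[OF s] A[OF s] by (simp add: q_def d_def algebra_simps)
    then have "a s - A s = - q / \<epsilon> - d" using \<open>\<epsilon> > 0\<close> by (simp add: field_simps)
    moreover have "E' s = 2 * (p * q) + 2 * (q * (a s - A s))" unfolding E'_def p_def q_def by (simp only: mult.assoc)
    ultimately have "E' s = 2 * (p * q) + 2 * (q * (- q / \<epsilon> - d))" by (simp only:)
    also have "q * (- q / \<epsilon> - d) = - (q\<^sup>2 / \<epsilon>) - q * d"
      by (simp only: right_diff_distrib times_divide_eq_right mult_minus_right power2_eq_square minus_divide_left)
    also have "2 * (p * q) + 2 * (- (q\<^sup>2 / \<epsilon>) - q * d) \<le> 2 * (\<bar>p\<bar> * \<bar>q\<bar>) + 2 * (\<bar>q\<bar> * \<bar>d\<bar>)"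
    proof -
      have "0 \<le> q\<^sup>2 / \<epsilon>" using \<open>\<epsilon> > 0\<close> by simp
      moreover have "p * q \<le> \<bar>p\<bar> * \<bar>q\<bar>" using abs_ge_self[of "p * q"] by (simp add: abs_mult)
      moreover have "- (q * d) \<le> \<bar>q\<bar> * \<bar>d\<bar>" using abs_ge_minus_self[of "q * d"] by (simp add: abs_mult)
      moreover have "2 * x + 2 * (- r - y) \<le> 2 * X + 2 * Y" if "0 \<le> r" "x \<le> X" "- y \<le> Y" for r x X y Y :: real
        using that by (simp add: algebra_simps)
      ultimately show ?thesis by blast
    qed
    also have "\<bar>q\<bar> * \<bar>d\<bar> \<le> \<bar>q\<bar> * (L * \<bar>p\<bar>)"
      using L(2)[of "y s" "Y s"] R[OF s] by (intro mult_left_mono) (auto simp: d_def p_def)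
    also have "2 * (\<bar>p\<bar> * \<bar>q\<bar>) + 2 * (\<bar>q\<bar> * (L * \<bar>p\<bar>)) = (1 + L) * (2 * \<bar>p\<bar> * \<bar>q\<bar>)"
      by (simp add: algebra_simps)
    also have "\<dots> \<le> (1 + L) * (p\<^sup>2 + q\<^sup>2)"
      using L(1) sum_squares_bound[of "\<bar>p\<bar>" "\<bar>q\<bar>"] by (intro mult_left_mono) auto
    finally show "E' s \<le> (1 + L) * E s" by (simp add: E_def p_def q_def)
  qed (use \<open>t \<ge> 0\<close> in auto)
  moreover have "E 0 = 0" using eq0 by (simp add: E_def)
  ultimately have "E t \<le> 0" by simp
  moreover have "0 \<le> E t" by (simp add: E_def)
  ultimately have "E t = 0" by linarith
  then show ?thesis by (simp add: E_def sum_power2_eq_zero_iff)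
qed

text \<open>With \<open>\<zeta> = y - x + \<epsilon> (w - v)\<close> and \<open>\<theta> = \<epsilon> (w - v)\<close> the mixed terms in the derivative
  of \<open>\<zeta>\<^sup>2 + \<theta>\<^sup>2\<close> cancel, so no smallness of \<open>y - x\<close> is needed.\<close>
lemma ode_solution_contraction:
  fixes g :: "real \<Rightarrow> real"
  assumes y: "ode_solution \<omega> g f \<epsilon> I y w" and x: "ode_solution \<omega> g f \<epsilon> I x v"
    and I: "convex I" "0 \<in> I" "I \<subseteq> {0..}" and \<epsilon>: "\<epsilon> > 0" "2 * \<epsilon>\<^sup>2 * M \<le> 1" and m: "0 < m" "m \<le> M"
    and slope: "\<And>a b. a < b \<Longrightarrow> m * (b - a) \<le> g b - g a \<and> g b - g a \<le> M * (b - a)"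
    and t: "t \<in> I"
  shows "(y t - x t + \<epsilon> * (w t - v t))\<^sup>2 + (\<epsilon> * (w t - v t))\<^sup>2
    \<le> ((y 0 - x 0 + \<epsilon> * (w 0 - v 0))\<^sup>2 + (\<epsilon> * (w 0 - v 0))\<^sup>2) * exp (- min (2 * \<epsilon> * m) (1 / \<epsilon>) * t)"
    (is "_ \<le> _ * exp (- ?k * t)")
proof -
  obtain a A where
    a: "\<And>s. s \<in> I \<Longrightarrow> (y has_real_derivative w s) (at s within I) \<and> (w has_real_derivative a s) (at s within I)
          \<and> \<epsilon> * a s + w s + \<epsilon> * g (y s) = \<epsilon> * f (\<omega> * s)" and
    A: "\<And>s. s \<in> I \<Longrightarrow> (x has_real_derivative v s) (at s within I) \<and> (v has_real_derivative A s) (at s within I)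
          \<and> \<epsilon> * A s + v s + \<epsilon> * g (x s) = \<epsilon> * f (\<omega> * s)"
    using y x unfolding ode_solution_def by metis
  define \<zeta> \<theta> where "\<zeta> s = y s - x s + \<epsilon> * (w s - v s)" and "\<theta> s = \<epsilon> * (w s - v s)" for s
  define E where "E s = (\<zeta> s)\<^sup>2 + (\<theta> s)\<^sup>2" for s
  define E' where "E' s = 2 * \<zeta> s * (w s - v s + \<epsilon> * (a s - A s)) + 2 * \<theta> s * (\<epsilon> * (a s - A s))" for s
  have "E t \<le> E 0 * exp (- ?k * t)"
  proof (rule differential_inequality_exp[OF I _ _ t])
    fix s assume s: "s \<in> I"
    have "(\<zeta> has_real_derivative w s - v s + \<epsilon> * (a s - A s)) (at s within I)"
      "(\<theta> has_real_derivative \<epsilon> * (a s - A s)) (at s within I)"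
      unfolding \<zeta>_def \<theta>_def using a[OF s] A[OF s] by (auto intro!: derivative_eq_intros)
    then show "(E has_real_derivative E' s) (at s within I)"
      unfolding E_def E'_def by (auto intro!: derivative_eq_intros)
    \<comment> \<open>\<open>G\<close> is the mean slope of \<open>g\<close> between the two
      solutions. The value \<open>m\<close> where they meet keeps \<open>G\<close> between
      \<open>m\<close> and \<open>M\<close> and is compatible with \<open>Gmul\<close>, whose two
      sides are then 0.\<close>
    define G where "G = (if y s = x s then m else (g (y s) - g (x s)) / (y s - x s))"
    have G: "m \<le> G" "G \<le> M" and Gmul: "g (y s) - g (x s) = G * (\<zeta> s - \<theta> s)"
    proof -
      have "m \<le> G \<and> G \<le> M"
        using slope[of "y s" "x s"] slope[of "x s" "y s"] m
        by (cases "y s" "x s" rule: linorder_cases) (auto simp: G_def field_simps)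
      then show "m \<le> G" "G \<le> M" by auto
      show "g (y s) - g (x s) = G * (\<zeta> s - \<theta> s)" by (simp add: G_def \<zeta>_def \<theta>_def)
    qed
    have 1: "\<epsilon> * (a s - A s) = - (w s - v s) - \<epsilon> * (G * (\<zeta> s - \<theta> s))"
    proof -
      have "\<epsilon> * (a s - A s) = - (w s - v s) - \<epsilon> * (g (y s) - g (x s))"
        using a[OF s] A[OF s] by (simp add: algebra_simps)
      then show ?thesis by (simp only: Gmul)
    qed
    have 2: "w s - v s = \<theta> s / \<epsilon>" using \<epsilon> by (simp add: \<theta>_def)
    have "E' s = - (2 * \<epsilon> * G) * (\<zeta> s)\<^sup>2 - (2 / \<epsilon> - 2 * \<epsilon> * G) * (\<theta> s)\<^sup>2"
      unfolding E'_def 1 2 by (simp add: algebra_simps power2_eq_square)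
    moreover have "?k * (\<zeta> s)\<^sup>2 \<le> (2 * \<epsilon> * G) * (\<zeta> s)\<^sup>2"
      using G \<epsilon> by (intro mult_right_mono) (auto intro: min.coboundedI1)
    \<comment> \<open>Half of the damping coefficient \<open>2 / \<epsilon>\<close> is given up to
      absorb \<open>2 * \<epsilon> * G\<close>, which is exactly what
      \<open>2 * \<epsilon>\<^sup>2 * M \<le> 1\<close> permits.\<close>
    moreover have "?k * (\<theta> s)\<^sup>2 \<le> (2 / \<epsilon> - 2 * \<epsilon> * G) * (\<theta> s)\<^sup>2"
    proof (intro mult_right_mono)
      have "2 * \<epsilon>\<^sup>2 * G \<le> 2 * \<epsilon>\<^sup>2 * M" using G by (intro mult_left_mono) auto
      then have "2 * \<epsilon>\<^sup>2 * G \<le> 1" using \<epsilon> by linarith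
      then have "1 / \<epsilon> \<le> 2 / \<epsilon> - 2 * \<epsilon> * G" using \<epsilon>(1) by (simp add: field_simps power2_eq_square)
      then show "?k \<le> 2 / \<epsilon> - 2 * \<epsilon> * G" by linarith
    qed auto
    ultimately show "E' s \<le> - ?k * E s" by (simp add: E_def algebra_simps)
  qed
  then show ?thesis by (simp add: E_def \<zeta>_def \<theta>_def)
qed

text \<open>The equation becomes a first-order system for the pair of position and velocity; a
  global Lipschitz constant of \<open>g\<close> gives one for the system.\<close>

lemma ode_solution_exists:
  fixes g :: "real \<Rightarrow> real"
  assumes "\<epsilon> > 0" "M \<ge> 0" and lip: "\<And>a b. \<bar>g a - g b\<bar> \<le> M * \<bar>a - b\<bar>" and "continuous_on UNIV f"
  obtains y w where "ode_solution \<omega> g f \<epsilon> {0..} y w" "y 0 = y0" "w 0 = w0"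
proof -
  define F where "F t z = (snd z, f (\<omega> * t) - g (fst z) - snd z / \<epsilon>)" for t :: real and z :: "real \<times> real"
  have contg: "continuous_on UNIV g"
    by (rule lipschitz_on_continuous_on[of M]) (auto intro!: lipschitz_onI simp: dist_real_def lip assms)
  obtain z where z: "z 0 = (y0, w0)" "\<And>t. t \<ge> 0 \<Longrightarrow> (z has_vector_derivative F t (z t)) (at t within {0..})"
  proof (rule picard_global_existence[of F "1 + M + 1 / \<epsilon>" "(y0, w0)"])
    fix y :: "real \<Rightarrow> real \<times> real" assume "continuous_on {0..} y"
    then show "continuous_on {0..} (\<lambda>t. F t (y t))"
      unfolding F_def using \<open>\<epsilon> > 0\<close>
      by (auto intro!: continuous_intros continuous_on_compose2[OF contg] continuous_on_compose2[OF assms(4)])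
  next
    fix t :: real and p q :: "real \<times> real"
    have p: "\<bar>fst p - fst q\<bar> \<le> norm (p - q)" "\<bar>snd p - snd q\<bar> \<le> norm (p - q)"
      using norm_fst_le[of "fst (p - q)" "snd (p - q)"] norm_snd_le[of "snd (p - q)" "fst (p - q)"]
      unfolding prod.collapse by auto
    have "norm (F t p - F t q) \<le> \<bar>snd p - snd q\<bar> + \<bar>(g (fst q) - g (fst p)) + (snd q - snd p) / \<epsilon>\<bar>"
      using norm_Pair_le[of "snd p - snd q" "(g (fst q) - g (fst p)) + (snd q - snd p) / \<epsilon>"]
      by (simp add: F_def diff_divide_distrib algebra_simps)
    also have "\<bar>(g (fst q) - g (fst p)) + (snd q - snd p) / \<epsilon>\<bar> \<le> M * \<bar>fst p - fst q\<bar> + \<bar>snd p - snd q\<bar> / \<epsilon>"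
      using lip[of "fst q" "fst p"] \<open>\<epsilon> > 0\<close> abs_triangle_ineq[of "g (fst q) - g (fst p)" "(snd q - snd p) / \<epsilon>"]
      by (simp add: abs_minus_commute)
    also have "\<bar>snd p - snd q\<bar> + (M * \<bar>fst p - fst q\<bar> + \<bar>snd p - snd q\<bar> / \<epsilon>)
       \<le> norm (p - q) + (M * norm (p - q) + norm (p - q) / \<epsilon>)"
      using p assms by (intro add_mono mult_left_mono divide_right_mono) auto
    also have "\<dots> = (1 + M + 1 / \<epsilon>) * norm (p - q)" by (simp add: algebra_simps)
    finally show "norm (F t p - F t q) \<le> (1 + M + 1 / \<epsilon>) * norm (p - q)" by simp
  qed (use assms in auto)
  show ?thesis
  proof
    have d: "((\<lambda>t. fst (z t)) has_real_derivative snd (z t)) (at t within {0..}) \<and>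
        ((\<lambda>t. snd (z t)) has_real_derivative f (\<omega> * t) - g (fst (z t)) - snd (z t) / \<epsilon>) (at t within {0..})"
      if "t \<ge> 0" for t
      using bounded_linear.has_vector_derivative[OF bounded_linear_fst z(2)[OF that]]
        bounded_linear.has_vector_derivative[OF bounded_linear_snd z(2)[OF that]]
      by (simp add: F_def has_real_derivative_iff_has_vector_derivative)
    show "ode_solution \<omega> g f \<epsilon> {0..} (\<lambda>t. fst (z t)) (\<lambda>t. snd (z t))"
      unfolding ode_solution_def
      by (rule exI[of _ "\<lambda>t. f (\<omega> * t) - g (fst (z t)) - snd (z t) / \<epsilon>"])
         (use d \<open>\<epsilon> > 0\<close> in \<open>auto simp: algebra_simps\<close>)
  qed (use z(1) in auto)
qed

text \<open>With the modified nonlinearity \<open>h\<close> solutions exist globally and contract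
  towards \<open>x\<close>. For small initial distance the contraction bound keeps them within
  \<rho> of \<open>c0\<close>, where \<open>h = g\<close>, so they solve the original equation as
  well; uniqueness for \<open>g\<close> then transfers the conclusion to every solution with the
  same initial data.\<close>

lemma local_attractor_of_increasing:
  fixes g g' :: "real \<Rightarrow> real"
  assumes x: "ode_solution \<omega> g f \<epsilon> UNIV x (deriv x)" and near: "\<And>t. \<bar>x t - c0\<bar> \<le> \<rho> / 2"
    and "\<rho> > 0" and \<epsilon>: "\<epsilon> > 0" "2 * \<epsilon>\<^sup>2 * M \<le> 1"
    and g': "\<And>u. (g has_real_derivative g' u) (at u)" "continuous_on UNIV g'"
    and bound: "\<And>u. \<bar>u - c0\<bar> \<le> \<rho> \<Longrightarrow> m \<le> g' u \<and> g' u \<le> M" and m: "0 < m"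
    and f: "continuous_on UNIV f"
  shows "local_attractor \<omega> g f \<epsilon> x"
proof -
  \<comment> \<open>\<open>cl\<close> projects onto the interval of radius \<rho> about
    \<open>c0\<close>. Outside it \<open>h\<close> continues with slope \<open>m\<close>, so all
    difference quotients of \<open>h\<close> lie between \<open>m\<close> and
    \<open>M\<close>.\<close>
  define cl where "cl u = max (c0 - \<rho>) (min (c0 + \<rho>) u)" for u
  define h where "h u = g (cl u) + m * (u - cl u)" for u
  have "m \<le> M" using bound[of c0] \<open>\<rho> > 0\<close> by auto
  have MVT: "m * (b - a) \<le> g b - g a \<and> g b - g a \<le> M * (b - a)"
    if ab: "a < b" "\<bar>a - c0\<bar> \<le> \<rho>" "\<bar>b - c0\<bar> \<le> \<rho>" for a b
  proof -
    obtain z where z: "a < z" "z < b" "g b - g a = (b - a) * g' z"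
      using MVT2[OF ab(1), of g g'] g'(1) by metis
    then have "\<bar>z - c0\<bar> \<le> \<rho>" using ab by auto
    from bound[OF this] show ?thesis using z that by (auto simp: mult.commute intro!: mult_right_mono)
  qed
  have slope: "m * (b - a) \<le> h b - h a \<and> h b - h a \<le> M * (b - a)" if "a < b" for a b
  proof -
    have c: "\<bar>cl a - c0\<bar> \<le> \<rho>" "\<bar>cl b - c0\<bar> \<le> \<rho>" "cl a \<le> cl b" "cl b - cl a \<le> b - a"
      using that \<open>\<rho> > 0\<close> by (auto simp: cl_def)
    have 1: "m * (cl b - cl a) \<le> g (cl b) - g (cl a) \<and> g (cl b) - g (cl a) \<le> M * (cl b - cl a)"
      using MVT[of "cl a" "cl b"] c by (cases "cl a = cl b") auto
    have "m * (b - a - (cl b - cl a)) \<le> M * (b - a - (cl b - cl a))"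
      using \<open>m \<le> M\<close> c by (intro mult_right_mono) auto
    with 1 show ?thesis by (simp add: h_def algebra_simps)
  qed
  have h_eq: "h u = g u" if "\<bar>u - c0\<bar> \<le> \<rho>" for u
  proof -
    have "cl u = u" using that by (auto simp: cl_def)
    then show ?thesis by (simp add: h_def)
  qed
  have h_lip: "\<bar>h a - h b\<bar> \<le> M * \<bar>a - b\<bar>" for a b
  proof (cases a b rule: linorder_cases)
    case less
    have "0 \<le> m * (b - a)" using m less by simp
    with slope[OF less] less show ?thesis by (simp add: abs_if)
  next
    case greater
    have "0 \<le> m * (a - b)" using m greater by simp
    with slope[OF greater] greater show ?thesis by (simp add: abs_if)
  qed auto
  have g_lip: "\<exists>L\<ge>0. \<forall>a b. \<bar>a\<bar> \<le> R \<longrightarrow> \<bar>b\<bar> \<le> R \<longrightarrow> \<bar>g a - g b\<bar> \<le> L * \<bar>a - b\<bar>" for R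
  proof -
    obtain L where L: "\<And>u. u \<in> {-R..R} \<Longrightarrow> \<bar>g' u\<bar> \<le> L"
      using continuous_on_compact_bound[OF compact_Icc continuous_on_subset[OF g'(2)], of "-R" R]
      by (metis real_norm_def subset_UNIV)
    have "\<bar>g a - g b\<bar> \<le> max L 0 * \<bar>a - b\<bar>" if "\<bar>a\<bar> \<le> R" "\<bar>b\<bar> \<le> R" for a b
    proof -
      have "norm (g a - g b) \<le> max L 0 * norm (a - b)"
      proof (rule field_differentiable_bound[of "{-R..R}" g g'])
        show "(g has_field_derivative g' z) (at z within {-R..R})" for z
          using g'(1) by (rule has_field_derivative_at_within)
        show "norm (g' z) \<le> max L 0" if "z \<in> {-R..R}" for z using L[OF that] by simp
      qed (use that in auto)
      then show ?thesis by simp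
    qed
    then show ?thesis by (intro exI[of _ "max L 0"]) auto
  qed
  \<comment> \<open>With this choice \<open>\<zeta> 0\<close> and \<open>\<theta> 0\<close> are at
    most \<open>\<rho> / 6\<close> in absolute value. Hence
    \<open>E0 \<le> \<rho>^2 / 18 \<le> (\<rho> / 4)^2\<close> and \<open>Y\<close> stays within
    \<open>2 * sqrt E0 \<le> \<rho> / 2\<close> of \<open>x\<close>; the other half of \<rho> is the
    allowed distance of \<open>x\<close> from \<open>c0\<close>.\<close>
  define \<delta> where "\<delta> = \<rho> / 6 / (1 + \<epsilon>)"
  have "\<delta> > 0" using \<open>\<rho> > 0\<close> \<epsilon> by (simp add: \<delta>_def)
  have xh: "ode_solution \<omega> h f \<epsilon> UNIV x (deriv x)"
    by (rule ode_solution_cong[OF x]) (use near \<open>\<rho> > 0\<close> in \<open>auto intro!: h_eq order_trans[OF near]\<close>)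
  have main: "\<exists>Y W. ode_solution \<omega> g f \<epsilon> {0..} Y W \<and> Y 0 = y0 \<and> W 0 = w0 \<and>
      ((\<lambda>t. \<bar>Y t - x t\<bar> + \<bar>W t - deriv x t\<bar>) \<longlongrightarrow> 0) at_top"
    if small: "\<bar>y0 - x 0\<bar> + \<bar>w0 - deriv x 0\<bar> < \<delta>" for y0 w0
  proof -
    obtain Y W where YW: "ode_solution \<omega> h f \<epsilon> {0..} Y W" "Y 0 = y0" "W 0 = w0"
      using ode_solution_exists[OF \<epsilon>(1) _ h_lip f, of \<omega> y0 w0] m \<open>m \<le> M\<close> by auto
    define \<theta> \<zeta> where "\<theta> t = \<epsilon> * (W t - deriv x t)" and "\<zeta> t = Y t - x t + \<epsilon> * (W t - deriv x t)" for t
    define k where "k = min (2 * \<epsilon> * m) (1 / \<epsilon>)"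
    have "k > 0" using \<epsilon> m by (simp add: k_def)
    define E0 where "E0 = (\<zeta> 0)\<^sup>2 + (\<theta> 0)\<^sup>2"
    have E: "(\<zeta> t)\<^sup>2 + (\<theta> t)\<^sup>2 \<le> E0 * exp (- k * t)" if "t \<ge> 0" for t
      unfolding E0_def \<zeta>_def \<theta>_def k_def
      using ode_solution_contraction[OF YW(1) ode_solution_subset[OF xh subset_UNIV] _ _ _ \<epsilon> m \<open>m \<le> M\<close> slope, of t] that
      by auto
    have "\<bar>\<theta> 0\<bar> = \<epsilon> * \<bar>w0 - deriv x 0\<bar>" using \<epsilon> YW by (simp add: \<theta>_def abs_mult)
    also have "\<dots> \<le> \<epsilon> * \<delta>" using small \<epsilon> by (intro mult_left_mono) auto
    finally have \<theta>0: "\<bar>\<theta> 0\<bar> \<le> \<epsilon> * \<delta>" .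
    have "\<bar>\<zeta> 0\<bar> \<le> \<bar>y0 - x 0\<bar> + \<bar>\<theta> 0\<bar>" using YW by (simp add: \<zeta>_def \<theta>_def)
    then have \<zeta>0: "\<bar>\<zeta> 0\<bar> \<le> (1 + \<epsilon>) * \<delta>" using \<theta>0 small by (simp add: algebra_simps)
    have "\<bar>\<theta> 0\<bar> \<le> (1 + \<epsilon>) * \<delta>" using \<theta>0 \<open>\<delta> > 0\<close> by (simp add: algebra_simps)
    then have "(\<theta> 0)\<^sup>2 \<le> ((1 + \<epsilon>) * \<delta>)\<^sup>2" by (metis abs_ge_zero power2_abs power_mono)
    moreover have "(\<zeta> 0)\<^sup>2 \<le> ((1 + \<epsilon>) * \<delta>)\<^sup>2" using \<zeta>0 by (metis abs_ge_zero power2_abs power_mono)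
    moreover have "(1 + \<epsilon>) * \<delta> = \<rho> / 6" unfolding \<delta>_def
      by (subst times_divide_eq_right, rule nonzero_mult_div_cancel_left) (use \<epsilon>(1) in auto)
    ultimately have E0: "E0 \<le> 2 * (\<rho> / 6)\<^sup>2" by (simp add: E0_def)
    have "E0 \<ge> 0" by (simp add: E0_def)
    have dist: "\<bar>Y t - x t\<bar> + \<bar>W t - deriv x t\<bar> \<le> (2 + 1 / \<epsilon>) * sqrt (E0 * exp (- k * t))"
      and dist': "\<bar>Y t - x t\<bar> \<le> 2 * sqrt (E0 * exp (- k * t))" if "t \<ge> 0" for t
    proof -
      have "\<bar>\<zeta> t\<bar> \<le> sqrt (E0 * exp (- k * t))"
        by (rule real_le_rsqrt) (use E[OF that] zero_le_power2[of "\<theta> t"] in \<open>simp; linarith\<close>)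
      moreover have th: "\<bar>\<theta> t\<bar> \<le> sqrt (E0 * exp (- k * t))"
        by (rule real_le_rsqrt) (use E[OF that] zero_le_power2[of "\<zeta> t"] in \<open>simp; linarith\<close>)
      moreover have "Y t - x t = \<zeta> t - \<theta> t" by (simp add: \<zeta>_def \<theta>_def)
      ultimately show 1: "\<bar>Y t - x t\<bar> \<le> 2 * sqrt (E0 * exp (- k * t))" by linarith
      have "\<bar>W t - deriv x t\<bar> = \<bar>\<theta> t\<bar> / \<epsilon>" using \<epsilon> by (simp add: \<theta>_def abs_mult)
      also have "\<dots> \<le> sqrt (E0 * exp (- k * t)) / \<epsilon>" using th \<epsilon> by (intro divide_right_mono) auto
      finally show "\<bar>Y t - x t\<bar> + \<bar>W t - deriv x t\<bar> \<le> (2 + 1 / \<epsilon>) * sqrt (E0 * exp (- k * t))"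
        using 1 by (simp add: algebra_simps)
    qed
    have "\<bar>Y t - c0\<bar> \<le> \<rho>" if "t \<ge> 0" for t
    proof -
      have "E0 * exp (- k * t) \<le> E0 * 1" using \<open>k > 0\<close> that \<open>E0 \<ge> 0\<close> by (intro mult_left_mono) auto
      also have "\<dots> \<le> (\<rho> / 4)\<^sup>2"
        using E0 by (simp add: power2_eq_square field_simps) (smt (verit) zero_le_square)
      finally have "sqrt (E0 * exp (- k * t)) \<le> \<rho> / 4" using \<open>\<rho> > 0\<close> by (intro real_le_lsqrt) auto
      then have "\<bar>Y t - x t\<bar> \<le> \<rho> / 2" using dist'[OF that] by linarith
      then show ?thesis using near[of t] by linarith
    qed
    then have "ode_solution \<omega> g f \<epsilon> {0..} Y W"
      by (intro ode_solution_cong[OF YW(1)]) (use h_eq in auto)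
    moreover have "((\<lambda>t. \<bar>Y t - x t\<bar> + \<bar>W t - deriv x t\<bar>) \<longlongrightarrow> 0) at_top"
    proof (rule tendsto_sandwich[OF _ _ tendsto_const])
      show "\<forall>\<^sub>F t in at_top. \<bar>Y t - x t\<bar> + \<bar>W t - deriv x t\<bar> \<le> (2 + 1 / \<epsilon>) * sqrt (E0 * exp (- k * t))"
        using eventually_ge_at_top[of 0] by eventually_elim (rule dist)
      have "LIM t at_top. - k * t :> at_bot"
        using \<open>k > 0\<close> filterlim_tendsto_neg_mult_at_bot[OF tendsto_const _ filterlim_ident, of "-k"] by auto
      then have "((\<lambda>t. exp (- k * t)) \<longlongrightarrow> 0) at_top" by (rule filterlim_compose[OF exp_at_bot])
      then have "((\<lambda>t. (2 + 1 / \<epsilon>) * sqrt (E0 * exp (- k * t))) \<longlongrightarrow> (2 + 1 / \<epsilon>) * sqrt (E0 * 0)) at_top"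
        by (intro tendsto_intros)
      then show "((\<lambda>t. (2 + 1 / \<epsilon>) * sqrt (E0 * exp (- k * t))) \<longlongrightarrow> 0) at_top" by simp
    qed auto
    ultimately show ?thesis using YW by blast
  qed
  show ?thesis
    unfolding local_attractor_def
  proof (intro exI[of _ \<delta>] conjI allI impI \<open>\<delta> > 0\<close>; (elim conjE)?)
    fix y0 w0 assume small: "\<bar>y0 - x 0\<bar> + \<bar>w0 - deriv x 0\<bar> < \<delta>"
    obtain Y W where YW: "ode_solution \<omega> g f \<epsilon> {0..} Y W" "Y 0 = y0" "W 0 = w0"
      "((\<lambda>t. \<bar>Y t - x t\<bar> + \<bar>W t - deriv x t\<bar>) \<longlongrightarrow> 0) at_top"
      using main[OF small] by blast
    show "\<exists>y w. ode_solution \<omega> g f \<epsilon> {0..} y w \<and> y 0 = y0 \<and> w 0 = w0" using YW by blast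
    \<comment> \<open>The interval is left general because solutions given only on
      \<open>{0..<T}\<close> must be identified too.\<close>
    have uniq: "y t = Y t \<and> w t = W t"
      if "ode_solution \<omega> g f \<epsilon> I y w" "y 0 = y0" "w 0 = w0" "convex I" "0 \<in> I" "I \<subseteq> {0..}" "t \<in> I" for I y w t
      using ode_solution_unique[OF that(1) ode_solution_subset[OF YW(1) that(6)] that(4-6) \<epsilon>(1) _ _ g_lip that(7)]
        that YW by simp
    show "\<exists>Y W. ode_solution \<omega> g f \<epsilon> {0..} Y W \<and> (\<forall>t\<in>{0..<T}. Y t = y t \<and> W t = w t)"
      if "T > 0" "ode_solution \<omega> g f \<epsilon> {0..<T} y w" "y 0 = y0" "w 0 = w0" for T y w
    proof -
      have "y t = Y t \<and> w t = W t" if "t \<in> {0..<T}" for t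
        by (rule uniq[OF \<open>ode_solution \<omega> g f \<epsilon> {0..<T} y w\<close>])
           (use \<open>T > 0\<close> \<open>y 0 = y0\<close> \<open>w 0 = w0\<close> that in auto)
      with YW(1) show ?thesis by (metis (no_types, lifting))
    qed
    show "((\<lambda>t. \<bar>y t - x t\<bar> + \<bar>w t - deriv x t\<bar>) \<longlongrightarrow> 0) at_top"
      if "ode_solution \<omega> g f \<epsilon> {0..} y w" "y 0 = y0" "w 0 = w0" for y w
    proof (rule Lim_transform_eventually[OF YW(4)])
      show "\<forall>\<^sub>F t in at_top. \<bar>Y t - x t\<bar> + \<bar>W t - deriv x t\<bar> = \<bar>y t - x t\<bar> + \<bar>w t - deriv x t\<bar>"
        using eventually_ge_at_top[of 0] by eventually_elim (use uniq[OF that] in auto)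
    qed
  qed
qed

section \<open>The recursion in the Borel plane\<close>

definition strip2 :: "real \<Rightarrow> (complex \<times> complex) set" where
  "strip2 \<kappa> = {(t, p). \<bar>Im t\<bar> + \<bar>Im p\<bar> < \<kappa>}"

lemma mem_strip2: "(t, p) \<in> strip2 \<kappa> \<longleftrightarrow> \<bar>Im t\<bar> + \<bar>Im p\<bar> < \<kappa>"
  by (simp add: strip2_def)

text \<open>Holomorphy in two variables is tested on all complex lines, together with joint
  continuity. In this form it passes through affine substitutions, products and parameter integrals
  by one-variable theory alone.\<close>

definition bihol :: "real \<Rightarrow> (complex \<Rightarrow> complex \<Rightarrow> complex) \<Rightarrow> bool" where
  "bihol \<kappa> h \<longleftrightarrow> continuous_on (strip2 \<kappa>) (\<lambda>(t, p). h t p) \<and>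
     (\<forall>a b c d. (\<lambda>z. h (a + b * z) (c + d * z)) holomorphic_on {z. (a + b * z, c + d * z) \<in> strip2 \<kappa>})"

lemma open_line_strip2: "open {z. (a + b * z, c + d * z) \<in> strip2 \<kappa>}"
  unfolding mem_strip2 by (intro open_Collect_less continuous_intros)

text \<open>Morera's theorem: by continuity the contour integral over a triangle may be exchanged
  with the integral over \<open>s\<close>, and for each \<open>s\<close> it vanishes by Cauchy's
  theorem.\<close>

lemma holomorphic_on_integral_param:
  fixes F :: "real \<Rightarrow> complex \<Rightarrow> complex"
  assumes "open S" and cont: "continuous_on ({0..1} \<times> S) (\<lambda>(s, z). F s z)"
    and holo: "\<And>s. s \<in> {0..1} \<Longrightarrow> F s holomorphic_on S"
  shows "(\<lambda>z. integral {0..1} (\<lambda>s. F s z)) holomorphic_on S"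
proof -
  let ?G = "\<lambda>z. integral {0..1} (\<lambda>s. F s z)"
  have cont': "continuous_on (S \<times> {0..1}) (\<lambda>(z, s). F s z)"
  proof -
    have "continuous_on (S \<times> {0..1}) (\<lambda>x. (\<lambda>(s, z). F s z) (snd x, fst x))"
      by (rule continuous_on_compose2[OF cont]) (auto intro!: continuous_intros)
    then show ?thesis by (simp add: case_prod_unfold)
  qed
  have "continuous_on S ?G"
    using integral_continuous_on_param[of S 0 1 "\<lambda>z s. F s z"] cont' by (simp add: cbox_interval)
  moreover have lin: "contour_integral (linepath a b) ?G = integral {0..1} (\<lambda>s. contour_integral (linepath a b) (F s))"
    if "closed_segment a b \<subseteq> S" for a b
  proof -
    have "continuous_on (cbox (0, 0) (1, 1)) (\<lambda>(x, s). F s (linepath a b x) * (b - a))"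
    proof -
      have "continuous_on (cbox (0, 0) (1, 1)) (\<lambda>y. case (snd y, linepath a b (fst y)) of (s, z) \<Rightarrow> F s z)"
      proof (rule continuous_on_compose2[OF cont])
        show "(\<lambda>y. (snd y, linepath a b (fst y))) ` cbox (0, 0) (1, 1) \<subseteq> {0..1::real} \<times> S"
          using that linepath_in_path[of _ a b] by (force simp: cbox_Pair_eq cbox_interval)
      qed (auto intro!: continuous_intros simp: linepath_def)
      then show ?thesis by (auto simp: case_prod_unfold intro!: continuous_intros)
    qed
    from integral_swap_continuous[OF this]
    have "integral {0..1} (\<lambda>x. integral {0..1} (\<lambda>s. F s (linepath a b x) * (b - a)))
        = integral {0..1} (\<lambda>s. integral {0..1} (\<lambda>x. F s (linepath a b x) * (b - a)))"
      by (simp add: cbox_interval)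
    then show ?thesis by (simp add: contour_integral_integral)
  qed
  have "?G analytic_on S"
  proof (rule Morera_triangle)
    fix a b c :: complex
    show "convex hull {a, b, c} \<subseteq> S \<longrightarrow>
      contour_integral (linepath a b) ?G + contour_integral (linepath b c) ?G + contour_integral (linepath c a) ?G = 0"
    proof
      assume hull: "convex hull {a, b, c} \<subseteq> S"
      have seg: "closed_segment a b \<subseteq> S" "closed_segment b c \<subseteq> S" "closed_segment c a \<subseteq> S"
        by (rule subset_trans[OF _ hull], simp add: segments_subset_convex_hull)+
      have int: "(\<lambda>s. contour_integral (linepath u v) (F s)) integrable_on {0..1}"
        if uv: "closed_segment u v \<subseteq> S" for u v
      proof (rule integrable_continuous_real)
        have "continuous_on ({0..1} \<times> {0..1}) (\<lambda>y. case (fst y, linepath u v (snd y)) of (s, z) \<Rightarrow> F s z)"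
        proof (rule continuous_on_compose2[OF cont])
          show "(\<lambda>y. (fst y, linepath u v (snd y))) ` ({0..1} \<times> {0..1}) \<subseteq> {0..1::real} \<times> S"
            using uv linepath_in_path[of _ u v] by force
        qed (auto intro!: continuous_intros simp: linepath_def)
        then have "continuous_on ({0..1} \<times> cbox 0 1) (\<lambda>(s, x). F s (linepath u v x) * (v - u))"
          by (auto simp: case_prod_unfold cbox_interval intro!: continuous_intros)
        from integral_continuous_on_param[OF this]
        show "continuous_on {0..1} (\<lambda>s. contour_integral (linepath u v) (F s))"
          by (simp add: contour_integral_integral cbox_interval)
      qed
      have "contour_integral (linepath a b) (F s) + contour_integral (linepath b c) (F s)
          + contour_integral (linepath c a) (F s) = 0" if "s \<in> {0..1}" for s
      proof -
        have "F s holomorphic_on convex hull {a, b, c}" using holo[OF that] hull by (rule holomorphic_on_subset)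
        from Cauchy_theorem_triangle[OF this]
        have *: "(F s has_contour_integral 0) (linepath a b +++ linepath b c +++ linepath c a)" .
        have "F s contour_integrable_on linepath u v" if "closed_segment u v \<subseteq> S" for u v
          using that \<open>s \<in> {0..1}\<close> holo by (intro contour_integrable_continuous_linepath
              holomorphic_on_imp_continuous_on) (auto intro: holomorphic_on_subset)
        with seg have "contour_integral (linepath a b +++ linepath b c +++ linepath c a) (F s)
          = contour_integral (linepath a b) (F s) + (contour_integral (linepath b c) (F s)
          + contour_integral (linepath c a) (F s))"
          by (simp add: contour_integral_join contour_integrable_join)
        with * show ?thesis by (metis contour_integral_unique add.assoc)
      qed
      then have "0 = integral {0..1} (\<lambda>s. contour_integral (linepath a b) (F s)
          + contour_integral (linepath b c) (F s) + contour_integral (linepath c a) (F s))"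
        by (subst integral_cong[where g = "\<lambda>_. 0"]) auto
      also have "\<dots> = integral {0..1} (\<lambda>s. contour_integral (linepath a b) (F s))
          + integral {0..1} (\<lambda>s. contour_integral (linepath b c) (F s))
          + integral {0..1} (\<lambda>s. contour_integral (linepath c a) (F s))"
        by (subst integral_add, intro integrable_add int seg, intro int seg, subst integral_add, intro int seg, intro int seg, simp)
      finally show "contour_integral (linepath a b) ?G + contour_integral (linepath b c) ?G
          + contour_integral (linepath c a) ?G = 0"
        using seg by (simp add: lin)
    qed
  qed (use \<open>open S\<close> \<open>continuous_on S ?G\<close> in auto)
  then show ?thesis by (rule analytic_imp_holomorphic)
qed

lemma bihol_add: "bihol \<kappa> a \<Longrightarrow> bihol \<kappa> b \<Longrightarrow> bihol \<kappa> (\<lambda>t p. a t p + b t p)"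
  unfolding bihol_def by (auto intro!: continuous_intros holomorphic_intros simp: case_prod_unfold)

lemma bihol_diff: "bihol \<kappa> a \<Longrightarrow> bihol \<kappa> b \<Longrightarrow> bihol \<kappa> (\<lambda>t p. a t p - b t p)"
  unfolding bihol_def by (auto intro!: continuous_intros holomorphic_intros simp: case_prod_unfold)

lemma bihol_uminus: "bihol \<kappa> a \<Longrightarrow> bihol \<kappa> (\<lambda>t p. - a t p)"
  unfolding bihol_def by (auto intro!: continuous_intros holomorphic_intros simp: case_prod_unfold)

lemma bihol_mult: "bihol \<kappa> a \<Longrightarrow> bihol \<kappa> b \<Longrightarrow> bihol \<kappa> (\<lambda>t p. a t p * b t p)"
  unfolding bihol_def by (auto intro!: continuous_intros holomorphic_intros simp: case_prod_unfold)

lemma bihol_const: "bihol \<kappa> (\<lambda>t p. c)"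
  unfolding bihol_def by (auto intro!: continuous_intros holomorphic_intros)

lemma bihol_snd: "bihol \<kappa> (\<lambda>t p. p)"
  unfolding bihol_def by (auto intro!: continuous_intros holomorphic_intros simp: case_prod_unfold)

lemma bihol_sum: "(\<And>i. i \<in> A \<Longrightarrow> bihol \<kappa> (a i)) \<Longrightarrow> bihol \<kappa> (\<lambda>t p. \<Sum>i\<in>A. a i t p)"
  by (induction A rule: infinite_finite_induct) (auto intro!: bihol_const bihol_add)

lemma bihol_diff_arg:
  assumes "F holomorphic_on {z. \<bar>Im z\<bar> < \<kappa>}"
  shows "bihol \<kappa> (\<lambda>t p. F (t - p))"
  unfolding bihol_def
proof (intro conjI allI)
  have sub: "\<bar>Im (t - p)\<bar> < \<kappa>" if "(t, p) \<in> strip2 \<kappa>" for t p using that by (auto simp: mem_strip2)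
  have "continuous_on (strip2 \<kappa>) (\<lambda>x. F (fst x - snd x))"
    by (rule continuous_on_compose2[OF holomorphic_on_imp_continuous_on[OF assms]])
       (use sub in \<open>auto intro!: continuous_intros\<close>)
  then show "continuous_on (strip2 \<kappa>) (\<lambda>(t, p). F (t - p))" by (simp add: case_prod_unfold)
  fix a b c d
  have "(F \<circ> (\<lambda>z. (a + b * z) - (c + d * z))) holomorphic_on {z. (a + b * z, c + d * z) \<in> strip2 \<kappa>}"
  proof (rule holomorphic_on_compose_gen[OF _ assms])
    show "(\<lambda>z. (a + b * z) - (c + d * z)) ` {z. (a + b * z, c + d * z) \<in> strip2 \<kappa>} \<subseteq> {z. \<bar>Im z\<bar> < \<kappa>}"
      using sub by blast
  qed (intro holomorphic_intros)
  then show "(\<lambda>z. F ((a + b * z) - (c + d * z))) holomorphic_on {z. (a + b * z, c + d * z) \<in> strip2 \<kappa>}"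
    by (simp add: o_def)
qed

text \<open>Continuity is required jointly in all three variables, as both the exchange of integrals
  and the continuity of the integral over \<open>s\<close> rely on it.\<close>

definition bihol_family :: "real \<Rightarrow> (real \<Rightarrow> complex \<Rightarrow> complex \<Rightarrow> complex) \<Rightarrow> bool" where
  "bihol_family \<kappa> \<Phi> \<longleftrightarrow> (\<forall>s\<in>{0..1}. bihol \<kappa> (\<Phi> s)) \<and>
     continuous_on ({0..1} \<times> strip2 \<kappa>) (\<lambda>(s, t, p). \<Phi> s t p)"

lemma bihol_family_mult:
  "bihol_family \<kappa> a \<Longrightarrow> bihol_family \<kappa> b \<Longrightarrow> bihol_family \<kappa> (\<lambda>s t p. a s t p * b s t p)"
  unfolding bihol_family_def by (auto intro!: continuous_intros bihol_mult simp: case_prod_unfold)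

lemma bihol_family_weight:
  "continuous_on {0..1} w \<Longrightarrow> bihol_family \<kappa> (\<lambda>s t p. w s)"
  unfolding bihol_family_def
  by (auto intro!: continuous_intros bihol_const simp: case_prod_unfold intro: continuous_on_compose2)

text \<open>Real shifts leave imaginary parts unchanged, and the real coefficients mix them with
  total weight at most 1. The delay takes \<open>(t, p)\<close> to
  \<open>(t - (1 - s) p, s p)\<close>, that is \<open>r = s - 1\<close> and \<open>w = s\<close>,
  with \<open>\<bar>r\<bar> + \<bar>w\<bar> = 1\<close>: this is why the domain is measured by the
  sum of the two imaginary parts.\<close>

lemma strip2_affine:
  assumes "(t, p) \<in> strip2 \<kappa>" "\<bar>x\<bar> \<le> 1" "\<bar>r\<bar> + \<bar>w\<bar> \<le> 1"
  shows "(of_real x * t + of_real r * p + of_real y, of_real w * p) \<in> strip2 \<kappa>"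
proof -
  have "\<bar>x * Im t + r * Im p\<bar> + \<bar>w * Im p\<bar> \<le> \<bar>x\<bar> * \<bar>Im t\<bar> + (\<bar>r\<bar> + \<bar>w\<bar>) * \<bar>Im p\<bar>"
    using abs_triangle_ineq[of "x * Im t" "r * Im p"] by (simp add: abs_mult algebra_simps)
  also have "\<dots> \<le> 1 * \<bar>Im t\<bar> + 1 * \<bar>Im p\<bar>" using assms by (intro add_mono mult_right_mono) auto
  finally show ?thesis using assms by (simp add: mem_strip2)
qed

lemma bihol_family_affine:
  assumes h: "bihol \<kappa> h" and cont: "continuous_on {0..1} x" "continuous_on {0..1} r" "continuous_on {0..1} y" "continuous_on {0..1} w"
    and bd: "\<And>s. s \<in> {0..1} \<Longrightarrow> \<bar>x s\<bar> \<le> 1 \<and> \<bar>r s\<bar> + \<bar>w s\<bar> \<le> 1"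
  shows "bihol_family \<kappa> (\<lambda>s t p. h (of_real (x s) * t + of_real (r s) * p + of_real (y s)) (of_real (w s) * p))"
  unfolding bihol_family_def
proof (intro conjI ballI)
  have c: "continuous_on (strip2 \<kappa>) (\<lambda>(t, p). h t p)" using h by (simp add: bihol_def)
  have cs: "continuous_on ({0..1} \<times> strip2 \<kappa>) (\<lambda>z. v (fst z))" if "continuous_on {0..1} v" for v :: "real \<Rightarrow> real"
    by (rule continuous_on_compose2[OF that]) (auto intro!: continuous_intros)
  have "continuous_on ({0..1} \<times> strip2 \<kappa>)
     (\<lambda>z. (\<lambda>(t, p). h t p) (of_real (x (fst z)) * fst (snd z) + of_real (r (fst z)) * snd (snd z) + of_real (y (fst z)),
          of_real (w (fst z)) * snd (snd z)))"
    by (rule continuous_on_compose2[OF c])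
       (use bd in \<open>auto intro!: continuous_intros cs cont strip2_affine\<close>)
  then show "continuous_on ({0..1} \<times> strip2 \<kappa>) (\<lambda>(s, t, p). h (of_real (x s) * t + of_real (r s) * p + of_real (y s)) (of_real (w s) * p))"
    by (simp add: case_prod_unfold)
next
  fix s :: real assume s: "s \<in> {0..1}"
  let ?X = "complex_of_real (x s)" and ?R = "complex_of_real (r s)" and ?Y = "complex_of_real (y s)" and ?W = "complex_of_real (w s)"
  have sub: "(?X * t + ?R * p + ?Y, ?W * p) \<in> strip2 \<kappa>" if "(t, p) \<in> strip2 \<kappa>" for t p
    using strip2_affine[OF that] bd[OF s] by blast
  show "bihol \<kappa> (\<lambda>t p. h (?X * t + ?R * p + ?Y) (?W * p))"
    unfolding bihol_def
  proof (intro conjI allI)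
    have c: "continuous_on (strip2 \<kappa>) (\<lambda>(t, p). h t p)" using h by (simp add: bihol_def)
    have "continuous_on (strip2 \<kappa>) (\<lambda>z. (\<lambda>(t, p). h t p) (?X * fst z + ?R * snd z + ?Y, ?W * snd z))"
      by (rule continuous_on_compose2[OF c]) (use sub in \<open>auto intro!: continuous_intros\<close>)
    then show "continuous_on (strip2 \<kappa>) (\<lambda>(t, p). h (?X * t + ?R * p + ?Y) (?W * p))"
      by (simp add: case_prod_unfold)
    fix a b c d :: complex
    have "(\<lambda>z. h ((?X * a + ?R * c + ?Y) + (?X * b + ?R * d) * z) (?W * c + ?W * d * z))
       holomorphic_on {z. ((?X * a + ?R * c + ?Y) + (?X * b + ?R * d) * z, ?W * c + ?W * d * z) \<in> strip2 \<kappa>}"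
      using h by (simp add: bihol_def)
    moreover have "(?X * a + ?R * c + ?Y) + (?X * b + ?R * d) * z = ?X * (a + b * z) + ?R * (c + d * z) + ?Y"
      "?W * c + ?W * d * z = ?W * (c + d * z)" for z by (simp_all add: algebra_simps)
    ultimately show "(\<lambda>z. h (?X * (a + b * z) + ?R * (c + d * z) + ?Y) (?W * (c + d * z)))
       holomorphic_on {z. (a + b * z, c + d * z) \<in> strip2 \<kappa>}"
      using sub by (auto elim!: holomorphic_on_subset)
  qed
qed

lemma bihol_integral:
  assumes "bihol_family \<kappa> \<Phi>"
  shows "bihol \<kappa> (\<lambda>t p. integral {0..1} (\<lambda>s. \<Phi> s t p))"
  unfolding bihol_def
proof (intro conjI allI)
  have c: "continuous_on ({0..1} \<times> strip2 \<kappa>) (\<lambda>(s, t, p). \<Phi> s t p)"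
    using assms by (simp add: bihol_family_def)
  have "continuous_on (strip2 \<kappa> \<times> cbox 0 1) (\<lambda>z. (\<lambda>(s, t, p). \<Phi> s t p) (snd z, fst z))"
    by (rule continuous_on_compose2[OF c]) (auto intro!: continuous_intros)
  then have "continuous_on (strip2 \<kappa> \<times> cbox 0 1) (\<lambda>(z, s). \<Phi> s (fst z) (snd z))"
    by (simp add: case_prod_unfold)
  from integral_continuous_on_param[OF this]
  show "continuous_on (strip2 \<kappa>) (\<lambda>(t, p). integral {0..1} (\<lambda>s. \<Phi> s t p))"
    by (simp add: case_prod_unfold)
  fix a b c' d
  show "(\<lambda>z. integral {0..1} (\<lambda>s. \<Phi> s (a + b * z) (c' + d * z))) holomorphic_on
      {z. (a + b * z, c' + d * z) \<in> strip2 \<kappa>}"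
  proof (rule holomorphic_on_integral_param[OF open_line_strip2])
    have "continuous_on ({0..1} \<times> {z. (a + b * z, c' + d * z) \<in> strip2 \<kappa>})
       (\<lambda>y. (\<lambda>(s, t, p). \<Phi> s t p) (fst y, a + b * snd y, c' + d * snd y))"
      by (rule continuous_on_compose2[OF c]) (auto intro!: continuous_intros)
    then show "continuous_on ({0..1} \<times> {z. (a + b * z, c' + d * z) \<in> strip2 \<kappa>}) (\<lambda>(s, z). \<Phi> s (a + b * z) (c' + d * z))"
      by (simp add: case_prod_unfold)
    show "(\<lambda>z. \<Phi> s (a + b * z) (c' + d * z)) holomorphic_on {z. (a + b * z, c' + d * z) \<in> strip2 \<kappa>}"
      if "s \<in> {0..1}" for s
      using assms that by (simp add: bihol_family_def bihol_def)
  qed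
qed

text \<open>Operations on Borel transforms; the substitution \<open>q = s p\<close> makes their paths of integration straight
  segments. \<open>bconv\<close> corresponds to the product, \<open>btrans\<close> to \<open>h \<mapsto> y\<close> with \<open>\<epsilon> y' + y = \<epsilon> h\<close>, and \<open>bprim\<close> to
  the primitive of mean zero of a \<open>P\<close>-periodic function of mean zero.\<close>
definition bconv :: "('a::{real_normed_field,banach} \<Rightarrow> 'a \<Rightarrow> 'a) \<Rightarrow> ('a \<Rightarrow> 'a \<Rightarrow> 'a) \<Rightarrow> 'a \<Rightarrow> 'a \<Rightarrow> 'a" where
  "bconv a b t p = p * integral {0..1} (\<lambda>s. a t (of_real s * p) * b t (of_real (1 - s) * p))"

definition btrans :: "('a::{real_normed_field,banach} \<Rightarrow> 'a \<Rightarrow> 'a) \<Rightarrow> 'a \<Rightarrow> 'a \<Rightarrow> 'a" where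
  "btrans h t p = p * integral {0..1} (\<lambda>s. h (t - of_real (1 - s) * p) (of_real s * p))"

definition bprim :: "real \<Rightarrow> ('a::{real_normed_field,banach} \<Rightarrow> 'a \<Rightarrow> 'a) \<Rightarrow> 'a \<Rightarrow> 'a \<Rightarrow> 'a" where
  "bprim P h t p = of_real P * integral {0..1} (\<lambda>s. of_real (1/2 - s) * h (t - of_real (P * s)) p)"

definition bmean :: "real \<Rightarrow> ('a::{real_normed_field,banach} \<Rightarrow> 'a \<Rightarrow> 'a) \<Rightarrow> 'a \<Rightarrow> 'a \<Rightarrow> 'a" where
  "bmean P h t p = integral {0..1} (\<lambda>s. h (of_real (P * s)) p)"

text \<open>\<open>bpow u k\<close> is the convolution power with \<open>k + 1\<close> factors; a
  power with no factor would be a unit of convolution, which is not a function. The argument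
  \<open>n\<close> collects the products of total order \<open>n\<close>.\<close>

primrec bpow :: "(nat \<Rightarrow> 'a::{real_normed_field,banach} \<Rightarrow> 'a \<Rightarrow> 'a) \<Rightarrow> nat \<Rightarrow> nat \<Rightarrow> 'a \<Rightarrow> 'a \<Rightarrow> 'a" where
  "bpow u 0 = u"
| "bpow u (Suc k) = (\<lambda>n t p. \<Sum>i\<le>n. bconv (u i) (bpow u k (n - i)) t p)"

text \<open>The part of order \<open>n\<close> of the sum of \<open>c (k + 1) u^(k + 1)\<close> over
  \<open>k\<close> in \<open>A\<close>. As all terms of \<open>u\<close> have positive order,
  \<open>A = {..<n}\<close> gives everything that \<open>g (c0 + u) - g c0\<close> has in order
  \<open>n\<close>, and \<open>A = {1..<n}\<close> its nonlinear part.\<close>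

definition bseries :: "(nat \<Rightarrow> real) \<Rightarrow> nat set \<Rightarrow> (nat \<Rightarrow> 'a::{real_normed_field,banach} \<Rightarrow> 'a \<Rightarrow> 'a) \<Rightarrow> nat \<Rightarrow> 'a \<Rightarrow> 'a \<Rightarrow> 'a" where
  "bseries c A u n t p = (\<Sum>k\<in>A. of_real (c (Suc k)) * bpow u k n t p)"

text \<open>Order \<open>n\<close> of the Borel transform of the velocity \<open>u'\<close>, from
  \<open>\<epsilon> u'' + u' = \<epsilon> h\<close>. The external forcing enters in order 1, where
  it is merely delayed to \<open>F (t - p)\<close>. The terms of \<open>g\<close> enter one order
  higher than they have themselves, because of the factor \<epsilon>.\<close>

definition bforce :: "(nat \<Rightarrow> real) \<Rightarrow> ('a::{real_normed_field,banach} \<Rightarrow> 'a) \<Rightarrow> (nat \<Rightarrow> 'a \<Rightarrow> 'a \<Rightarrow> 'a) \<Rightarrow> nat \<Rightarrow> 'a \<Rightarrow> 'a \<Rightarrow> 'a" where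
  "bforce c F u n t p = (if n = 1 then F (t - p) else - btrans (bseries c {..<n-1} u (n-1)) t p)"

text \<open>The mean of \<open>u\<^sub>n\<close> is chosen so that the terms of order \<open>n\<close> in \<open>g (c0 + u) - g c0\<close>
  have mean zero.\<close>
definition bstep :: "real \<Rightarrow> (nat \<Rightarrow> real) \<Rightarrow> ('a::{real_normed_field,banach} \<Rightarrow> 'a) \<Rightarrow> (nat \<Rightarrow> 'a \<Rightarrow> 'a \<Rightarrow> 'a) \<Rightarrow> nat \<Rightarrow> 'a \<Rightarrow> 'a \<Rightarrow> 'a" where
  "bstep P c F u n t p = bprim P (bforce c F u n) t p
     - bmean P (\<lambda>t p. bprim P (bforce c F u n) t p + of_real (1 / c 1) * bseries c {1..<n} u n t p) t p"

definition trunc :: "nat \<Rightarrow> (nat \<Rightarrow> 'a::zero \<Rightarrow> 'a \<Rightarrow> 'a) \<Rightarrow> nat \<Rightarrow> 'a \<Rightarrow> 'a \<Rightarrow> 'a" where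
  "trunc n u j = (if j < n then u j else (\<lambda>t p. 0))"

text \<open>Course-of-values recursion: cutting the sequence off at \<open>n\<close> makes the
  decrease of the index visible for termination. That the cut changes nothing is
  \<open>bsol_eq\<close>.\<close>

fun bsol :: "real \<Rightarrow> (nat \<Rightarrow> real) \<Rightarrow> ('a::{real_normed_field,banach} \<Rightarrow> 'a) \<Rightarrow> nat \<Rightarrow> 'a \<Rightarrow> 'a \<Rightarrow> 'a" where
  "bsol P c F n = (if n = 0 then (\<lambda>t p. 0)
     else bstep P c F (\<lambda>j. if j < n then bsol P c F j else (\<lambda>t p. 0)) n)"

declare bsol.simps [simp del]

lemma bsol_0 [simp]: "bsol P c F 0 = (\<lambda>t p. 0)"
  by (simp add: bsol.simps)

lemma bsol_trunc: "n > 0 \<Longrightarrow> bsol P c F n = bstep P c F (trunc n (bsol P c F)) n"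
  by (subst bsol.simps) (simp add: trunc_def[abs_def])

lemma bconv_zero [simp]: "bconv (\<lambda>t p. 0) b = (\<lambda>t p. 0)" "bconv a (\<lambda>t p. 0) = (\<lambda>t p. 0)"
  by (auto simp: bconv_def fun_eq_iff)

lemma bpow_cong:
  assumes "\<And>j. j \<le> n \<Longrightarrow> u j = v j"
  shows "bpow u k n = bpow v k n"
  using assms
proof (induction k arbitrary: n)
  case (Suc k)
  have "bconv (u i) (bpow u k (n - i)) = bconv (v i) (bpow v k (n - i))" if "i \<le> n" for i
    using Suc.prems[of i] Suc.IH[of "n - i"] Suc.prems that by simp
  then show ?case by (auto simp: fun_eq_iff intro!: sum.cong)
qed auto

lemma bpow_0 [simp]: "u 0 = (\<lambda>t p. 0) \<Longrightarrow> bpow u k 0 = (\<lambda>t p. 0)"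
  by (induction k) auto

text \<open>For \<open>k > 0\<close> there are at least two factors, and as the term of order 0
  vanishes, none of them can carry the full order \<open>n\<close>.\<close>

lemma bpow_cong_strict:
  assumes "\<And>j. j < n \<Longrightarrow> u j = v j" "u 0 = (\<lambda>t p. 0)" "v 0 = (\<lambda>t p. 0)" "k > 0"
  shows "bpow u k n = bpow v k n"
proof -
  obtain k' where k: "k = Suc k'" using \<open>k > 0\<close> by (cases k) auto
  have "bconv (u i) (bpow u k' (n - i)) = bconv (v i) (bpow v k' (n - i))" if "i \<le> n" for i
  proof (cases "i = 0 \<or> i = n")
    case True
    then show ?thesis using assms by auto
  next
    case False
    then have "bpow u k' (n - i) = bpow v k' (n - i)" by (intro bpow_cong assms(1)) (use that in auto)
    with False that show ?thesis using assms(1)[of i] by simp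
  qed
  then show ?thesis by (auto simp: k fun_eq_iff intro!: sum.cong)
qed

text \<open>The forcing looks only at orders below \<open>n\<close>, and the sum in the mean starts
  with the quadratic term, so \<open>bpow_cong_strict\<close> applies to it.\<close>

lemma bsol_eq: 
  assumes "n > 0"
  shows "bsol P c F n = bstep P c F (bsol P c F) n"
proof -
  let ?u = "bsol P c F"
  have "bseries c {..<n-1} (trunc n ?u) (n-1) = bseries c {..<n-1} ?u (n-1)"
    unfolding bseries_def by (subst bpow_cong[of "n-1" "trunc n ?u" ?u]) (use assms in \<open>auto simp: trunc_def\<close>)
  then have 1: "bforce c F (trunc n ?u) n = bforce c F ?u n"     by (intro ext) (simp only: bforce_def)
  have 2: "bseries c {1..<n} (trunc n ?u) n = bseries c {1..<n} ?u n"
    unfolding bseries_def fun_eq_iff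
    by (intro allI sum.cong refl, subst bpow_cong_strict[of n "trunc n ?u" ?u]) (auto simp: trunc_def)
  show ?thesis unfolding bsol_trunc[OF assms] bstep_def 1 2 ..
qed

section \<open>Holomorphy of the terms\<close>

lemma bihol_bconv:
  assumes Ha: "bihol \<kappa> a" and Hb: "bihol \<kappa> b"
  shows "bihol \<kappa> (bconv a b)"
proof -
  have 1: "bihol_family \<kappa> (\<lambda>s t p. a t (of_real s * p))"
  proof -
    have "bihol_family \<kappa> (\<lambda>s t p. a (of_real (1) * t + of_real (0) * p + of_real (0)) (of_real (s) * p))"
      by (rule bihol_family_affine[OF Ha, where x = "\<lambda>s. 1" and r = "\<lambda>s. 0" and y = "\<lambda>s. 0" and w = "\<lambda>s. s"])
         (auto intro!: continuous_intros)
    then show ?thesis by simp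
  qed
  have 2: "bihol_family \<kappa> (\<lambda>s t p. b t (of_real (1 - s) * p))"
  proof -
    have "bihol_family \<kappa> (\<lambda>s t p. b (of_real (1) * t + of_real (0) * p + of_real (0)) (of_real (1 - s) * p))"
      by (rule bihol_family_affine[OF Hb, where x = "\<lambda>s. 1" and r = "\<lambda>s. 0" and y = "\<lambda>s. 0" and w = "\<lambda>s. 1 - s"])
         (auto intro!: continuous_intros)
    then show ?thesis by simp
  qed
  show ?thesis
    unfolding bconv_def[abs_def]
    by (intro bihol_mult[OF bihol_snd] bihol_integral bihol_family_mult 1 2)
qed

lemma bihol_btrans:
  assumes Hh: "bihol \<kappa> h"
  shows "bihol \<kappa> (btrans h)"
proof -
  have 1: "bihol_family \<kappa> (\<lambda>s t p. h (t - of_real (1 - s) * p) (of_real s * p))"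
  proof -
    have "bihol_family \<kappa> (\<lambda>s t p. h (of_real (1) * t + of_real (s - 1) * p + of_real (0)) (of_real (s) * p))"
      by (rule bihol_family_affine[OF Hh, where x = "\<lambda>s. 1" and r = "\<lambda>s. s - 1" and y = "\<lambda>s. 0" and w = "\<lambda>s. s"])
         (auto intro!: continuous_intros)
    moreover have "of_real 1 * t + of_real (s - 1) * p + of_real 0 = t - of_real (1 - s) * p" for s and t p :: complex
      by (simp add: algebra_simps)
    ultimately show ?thesis by (simp only:)
  qed
  show ?thesis
    unfolding btrans_def[abs_def] by (intro bihol_mult[OF bihol_snd] bihol_integral 1)
qed

lemma bihol_bprim:
  assumes Hh: "bihol \<kappa> h"
  shows "bihol \<kappa> (bprim P h)"
proof -
  have 1: "bihol_family \<kappa> (\<lambda>s t p. h (t - of_real (P * s)) p)"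
  proof -
    have "bihol_family \<kappa> (\<lambda>s t p. h (of_real (1) * t + of_real (0) * p + of_real (- (P * s))) (of_real (1) * p))"
      by (rule bihol_family_affine[OF Hh, where x = "\<lambda>s. 1" and r = "\<lambda>s. 0" and y = "\<lambda>s. - (P * s)" and w = "\<lambda>s. 1"])
         (auto intro!: continuous_intros)
    then show ?thesis by simp
  qed
  have 2: "bihol_family \<kappa> (\<lambda>s t p. of_real (1/2 - s))"
    by (rule bihol_family_weight) (auto intro!: continuous_intros)
  show ?thesis
    unfolding bprim_def[abs_def]
    by (intro bihol_mult[OF bihol_const] bihol_integral bihol_family_mult[OF 2 1])
qed

lemma bihol_bmean:
  assumes Hh: "bihol \<kappa> h"
  shows "bihol \<kappa> (bmean P h)"
proof -
  have 1: "bihol_family \<kappa> (\<lambda>s t p. h (of_real (P * s)) p)"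
  proof -
    have "bihol_family \<kappa> (\<lambda>s t p. h (of_real (0) * t + of_real (0) * p + of_real (P * s)) (of_real (1) * p))"
      by (rule bihol_family_affine[OF Hh, where x = "\<lambda>s. 0" and r = "\<lambda>s. 0" and y = "\<lambda>s. P * s" and w = "\<lambda>s. 1"])
         (auto intro!: continuous_intros)
    then show ?thesis by simp
  qed
  show ?thesis
    unfolding bmean_def[abs_def] by (intro bihol_integral 1)
qed

lemma bihol_bpow: "(\<And>j. j \<le> n \<Longrightarrow> bihol \<kappa> (u j)) \<Longrightarrow> bihol \<kappa> (bpow u k n)"
proof (induction k arbitrary: n)
  case (Suc k)
  then show ?case by (auto intro!: bihol_sum bihol_bconv)
qed auto

lemma bihol_bseries: "(\<And>j. j \<le> n \<Longrightarrow> bihol \<kappa> (u j)) \<Longrightarrow> bihol \<kappa> (bseries c A u n)"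
  unfolding bseries_def[abs_def] by (intro bihol_sum bihol_mult bihol_const bihol_bpow)

lemma bihol_bforce:
  assumes "F holomorphic_on {z. \<bar>Im z\<bar> < \<kappa>}" "\<And>j. j \<le> n \<Longrightarrow> bihol \<kappa> (u j)"
  shows "bihol \<kappa> (bforce c F u n)"
  unfolding bforce_def[abs_def]
  by (cases "n = 1") (auto intro!: bihol_diff_arg assms bihol_uminus bihol_btrans bihol_bseries)

lemma bihol_bsol:
  assumes F: "F holomorphic_on {z. \<bar>Im z\<bar> < \<kappa>}"
  shows "bihol \<kappa> (bsol P c F n)"
proof (induction n rule: less_induct)
  case (less n)
  have tr: "bihol \<kappa> (trunc n (bsol P c F) j)" for j
    using less by (auto simp: trunc_def bihol_const)
  show ?case
  proof (cases "n = 0")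
    case False
    then show ?thesis
      unfolding bsol_trunc[OF False[unfolded neq0_conv]] bstep_def[abs_def]
      by (intro bihol_diff bihol_bprim bihol_bmean bihol_add bihol_mult bihol_const bihol_bforce bihol_bseries F tr)
  qed (simp add: bihol_const)
qed

section \<open>Majorant estimates for the recursion\<close>

lemma norm_integral_le_has_integral:
  fixes f :: "real \<Rightarrow> 'a::banach"
  assumes g: "(g has_integral G) {a..b}" and le: "\<And>x. x \<in> {a..b} \<Longrightarrow> norm (f x) \<le> g x"
  shows "norm (integral {a..b} f) \<le> G"
proof (cases "f integrable_on {a..b}")
  case True
  then show ?thesis
    using integral_norm_bound_integral[OF True has_integral_integrable[OF g] le] g by (simp add: integral_unique)
next
  case False
  \<comment> \<open>A function without integral has integral 0 by convention, so only the sign of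
    \<open>G\<close> is left to check.\<close>
  have "0 \<le> G" by (rule has_integral_nonneg[OF g]) (use le in \<open>meson norm_ge_zero order_trans\<close>)
  with False show ?thesis by (simp add: not_integrable_integral)
qed

lemma norm_integral_01_le:
  fixes f :: "real \<Rightarrow> 'a::banach"
  assumes "\<And>x. x \<in> {0..1} \<Longrightarrow> norm (f x) \<le> K"
  shows "norm (integral {0..1} f) \<le> K"
  using norm_integral_le_has_integral[of "\<lambda>_. K" K 0 1 f] has_integral_const_real[of K 0 1] assms by simp

text \<open>Euler's beta integral at integer arguments, by integration by parts. It makes the
  convolution of \<open>p^m / m!\<close> and \<open>p^n / n!\<close> equal to
  \<open>p^(m+n+1) / (m+n+1)!\<close>, so the factorials in the estimates cost no constant.\<close>

lemma has_integral_beta_nat: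
  "((\<lambda>s::real. s ^ m * (1 - s) ^ n) has_integral (fact m * fact n / fact (m + n + 1))) {0..1}"
proof (induction m arbitrary: n)
  case 0
  have "((\<lambda>s::real. - ((1 - s) ^ Suc n) / of_nat (Suc n)) has_real_derivative (1 - s) ^ n) (at s within {0..1})" for s
  proof -
    have "((\<lambda>s::real. 1 - s) has_real_derivative - 1) (at s within {0..1})" by (auto intro!: derivative_eq_intros)
    from DERIV_cdivide[OF DERIV_minus[OF DERIV_power_Suc[OF this, of n]], of "real (Suc n)"]
    show ?thesis by (rule DERIV_cong) (simp add: field_simps)
  qed
  then have "((\<lambda>s::real. (1 - s) ^ n) has_integral
      (- ((1 - 1) ^ Suc n) / of_nat (Suc n) - (- ((1 - 0) ^ Suc n) / of_nat (Suc n)))) {0..1}"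
    by (intro fundamental_theorem_of_calculus) (auto simp: has_real_derivative_iff_has_vector_derivative)
  moreover have "fact (0 + n + 1) = (1 + real n) * fact n" "1 + real n \<noteq> 0"
    by (simp_all add: algebra_simps)
  ultimately show ?case by (simp del: fact_Suc)
next
  case (Suc m)
  have "((\<lambda>s::real. s ^ Suc m * (1 - s) ^ Suc n) has_real_derivative
      (1 + real m) * (s ^ m * (1 - s) ^ Suc n) - (1 + real n) * (s ^ Suc m * (1 - s) ^ n)) (at s within {0..1})" for s
  proof -
    have 1: "((\<lambda>s::real. 1 - s) has_real_derivative - 1) (at s within {0..1})" by (auto intro!: derivative_eq_intros)
    from DERIV_mult[OF DERIV_power_Suc[OF DERIV_ident, of m] DERIV_power_Suc[OF 1, of n]]
    show ?thesis by (rule DERIV_cong) (simp add: algebra_simps)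
  qed
  then have "((\<lambda>s::real. (1 + real m) * (s ^ m * (1 - s) ^ Suc n) - (1 + real n) * (s ^ Suc m * (1 - s) ^ n)) has_integral
      (1 ^ Suc m * (1 - 1) ^ Suc n - 0 ^ Suc m * (1 - 0) ^ Suc n)) {0..1}"
    by (intro fundamental_theorem_of_calculus) (auto simp: has_real_derivative_iff_has_vector_derivative)
  from has_integral_diff[OF has_integral_mult_right[OF Suc.IH[of "Suc n"], of "1 + real m"] this]
  have "((\<lambda>s::real. (1 + real n) * (s ^ Suc m * (1 - s) ^ n)) has_integral
      (1 + real m) * (fact m * fact (Suc n) / fact (m + Suc n + 1))) {0..1}" by simp
  from has_integral_mult_right[OF this, of "1 / (1 + real n)"]
  have "((\<lambda>s::real. s ^ Suc m * (1 - s) ^ n) has_integral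
      1 / (1 + real n) * ((1 + real m) * (fact m * fact (Suc n) / fact (m + Suc n + 1)))) {0..1}"
    by (simp add: add_nonneg_eq_0_iff)
  moreover have "1 / (1 + real n) * ((1 + real m) * (fact m * fact (Suc n) / fact (m + Suc n + 1)))
      = fact (Suc m) * fact n / fact (Suc m + n + 1)"
  proof -
    have "fact (Suc n) = (1 + real n) * fact n" "fact (Suc m) = (1 + real m) * fact m" "1 + real n \<noteq> 0"
      by (simp_all add: algebra_simps)
    then show ?thesis by (simp add: mult_ac del: fact_Suc)
  qed
  ultimately show ?case by (simp only:)
qed

text \<open>\<open>p^(n-1) / (n-1)!\<close> is the Borel transform of \<open>\<epsilon>^n\<close>.
  For \<open>n = 0\<close> natural subtraction turns the bound into
  \<open>norm (h t p) \<le> C\<close>; it then occurs with multiples of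
  \<open>bcoef B z 0 = 0\<close> as constant, which forces \<open>h\<close> to vanish on the
  strip.\<close>

definition bnd :: "real \<Rightarrow> nat \<Rightarrow> real \<Rightarrow> (complex \<Rightarrow> complex \<Rightarrow> complex) \<Rightarrow> bool" where
  "bnd \<kappa> n C h \<longleftrightarrow> (\<forall>t p. (t, p) \<in> strip2 \<kappa> \<longrightarrow> norm (h t p) \<le> C * norm p ^ (n - 1) / fact (n - 1))"

lemma bndD: "bnd \<kappa> n C h \<Longrightarrow> (t, p) \<in> strip2 \<kappa> \<Longrightarrow> norm (h t p) \<le> C * norm p ^ (n - 1) / fact (n - 1)"
  by (simp add: bnd_def)

lemma bnd_mono: "bnd \<kappa> n C h \<Longrightarrow> C \<le> D \<Longrightarrow> bnd \<kappa> n D h"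
  unfolding bnd_def by (meson divide_right_mono fact_ge_zero mult_right_mono norm_ge_zero order_trans zero_le_power)

lemma bnd_const_zero: "C \<ge> 0 \<Longrightarrow> bnd \<kappa> n C (\<lambda>t p. 0)"
  by (simp add: bnd_def)

lemma bnd_uminus: "bnd \<kappa> n C h \<Longrightarrow> bnd \<kappa> n C (\<lambda>t p. - h t p)"
  by (simp add: bnd_def)

lemma bnd_add: "bnd \<kappa> n C g \<Longrightarrow> bnd \<kappa> n D h \<Longrightarrow> bnd \<kappa> n (C + D) (\<lambda>t p. g t p + h t p)"
  unfolding bnd_def by (auto simp: distrib_right add_divide_distrib intro!: norm_triangle_le add_mono)

lemma bnd_diff: "bnd \<kappa> n C g \<Longrightarrow> bnd \<kappa> n D h \<Longrightarrow> bnd \<kappa> n (C + D) (\<lambda>t p. g t p - h t p)"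
  using bnd_add[OF _ bnd_uminus] by fastforce

lemma bnd_cmult: "bnd \<kappa> n C h \<Longrightarrow> bnd \<kappa> n (norm c * C) (\<lambda>t p. c * h t p)"
  unfolding bnd_def norm_mult by (metis (no_types, lifting) mult.assoc mult_left_mono norm_ge_zero times_divide_eq_right)

lemma bnd_sum:
  assumes "finite A" "\<And>i. i \<in> A \<Longrightarrow> bnd \<kappa> n (C i) (h i)"
  shows "bnd \<kappa> n (\<Sum>i\<in>A. C i) (\<lambda>t p. \<Sum>i\<in>A. h i t p)"
  using assms by (induction rule: finite_induct) (auto intro!: bnd_add simp: bnd_const_zero)

lemma strip2_scale:
  assumes "(t, p) \<in> strip2 \<kappa>" "s \<in> {0..1}"
  shows "(t, of_real s * p) \<in> strip2 \<kappa>" "(t, of_real (1 - s) * p) \<in> strip2 \<kappa>"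
    "(t - of_real (1 - s) * p, of_real s * p) \<in> strip2 \<kappa>"
  using strip2_affine[OF assms(1), of 1 0 s 0] strip2_affine[OF assms(1), of 1 0 "1 - s" 0]
    strip2_affine[OF assms(1), of 1 "s - 1" s 0] assms(2) by (auto simp: algebra_simps)

lemma bnd_bconv:
  assumes a: "bnd \<kappa> m C a" and b: "bnd \<kappa> n D b" and "m > 0" "n > 0"
  shows "bnd \<kappa> (m + n) (C * D) (bconv a b)"
  unfolding bnd_def
proof (intro allI impI)
  fix t p assume tp: "(t, p) \<in> strip2 \<kappa>"
  obtain m' n' where mn: "m = Suc m'" "n = Suc n'" using \<open>m > 0\<close> \<open>n > 0\<close> by (metis gr0_implies_Suc)
  let ?K = "C * norm p ^ m' / fact m' * (D * norm p ^ n' / fact n')"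
  have "norm (integral {0..1} (\<lambda>s. a t (of_real s * p) * b t (of_real (1 - s) * p)))
     \<le> ?K * (fact m' * fact n' / fact (m' + n' + 1))"
  proof (rule norm_integral_le_has_integral[OF has_integral_mult_right[OF has_integral_beta_nat]])
    fix s :: real assume s: "s \<in> {0..1}"
    have "norm (a t (of_real s * p)) \<le> C * norm (of_real s * p) ^ m' / fact m'"
      using bndD[OF a strip2_scale(1)[OF tp s]] by (simp add: mn)
    moreover have "norm (b t (of_real (1 - s) * p)) \<le> D * norm (of_real (1 - s) * p) ^ n' / fact n'"
      using bndD[OF b strip2_scale(2)[OF tp s]] by (simp only: mn diff_Suc_1)
    ultimately have "norm (a t (of_real s * p)) * norm (b t (of_real (1 - s) * p))
       \<le> (C * norm (of_real s * p) ^ m' / fact m') * (D * norm (of_real (1 - s) * p) ^ n' / fact n')"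
      by (intro mult_mono) (auto intro: order_trans[OF norm_ge_zero])
    also have "\<dots> = (C * (s * norm p) ^ m' / fact m') * (D * ((1 - s) * norm p) ^ n' / fact n')"
      using s by (simp add: norm_mult del: of_real_diff)
    also have "\<dots> = ?K * (s ^ m' * (1 - s) ^ n')"
      by (simp add: power_mult_distrib mult_ac)
    finally show "norm (a t (of_real s * p) * b t (of_real (1 - s) * p)) \<le> ?K * (s ^ m' * (1 - s) ^ n')"
      by (simp add: norm_mult)
  qed
  then have "norm (bconv a b t p) \<le> norm p * (?K * (fact m' * fact n' / fact (m' + n' + 1)))"
    unfolding bconv_def norm_mult by (intro mult_left_mono) auto
  also have "\<dots> = C * D * norm p ^ (m + n - 1) / fact (m + n - 1)"
    by (simp add: mn power_add mult_ac)
  finally show "norm (bconv a b t p) \<le> C * D * norm p ^ (m + n - 1) / fact (m + n - 1)" .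
qed

lemma bconv_eq_0_left: "(\<And>t p. (t, p) \<in> strip2 \<kappa> \<Longrightarrow> a t p = 0) \<Longrightarrow> (t, p) \<in> strip2 \<kappa> \<Longrightarrow> bconv a b t p = 0"
  unfolding bconv_def by (subst integral_cong[where g = "\<lambda>_. 0"]) (auto simp: strip2_scale)

lemma bconv_eq_0_right: "(\<And>t p. (t, p) \<in> strip2 \<kappa> \<Longrightarrow> b t p = 0) \<Longrightarrow> (t, p) \<in> strip2 \<kappa> \<Longrightarrow> bconv a b t p = 0"
  unfolding bconv_def
  by (subst integral_cong[where g = "\<lambda>_. 0"]) (auto simp: strip2_scale(2) simp del: of_real_diff)

text \<open>Along the segment \<open>s^(n-1)\<close> integrates to \<open>1 / n\<close>, and the
  outer factor \<open>p\<close> completes the next order: the delay gains an order at no cost in the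
  constant.\<close>

lemma bnd_btrans:
  assumes h: "bnd \<kappa> n C h" and "n > 0"
  shows "bnd \<kappa> (Suc n) C (btrans h)"
  unfolding bnd_def
proof (intro allI impI)
  fix t p assume tp: "(t, p) \<in> strip2 \<kappa>"
  obtain n' where n: "n = Suc n'" using \<open>n > 0\<close> by (metis gr0_implies_Suc)
  let ?K = "C * norm p ^ n' / fact n'"
  have "norm (integral {0..1} (\<lambda>s. h (t - of_real (1 - s) * p) (of_real s * p))) \<le> ?K * (fact n' * fact 0 / fact (n' + 0 + 1))"
  proof (rule norm_integral_le_has_integral[OF has_integral_mult_right[OF has_integral_beta_nat]])
    fix s :: real assume s: "s \<in> {0..1}"
    have "norm (h (t - of_real (1 - s) * p) (of_real s * p)) \<le> C * norm (of_real s * p) ^ n' / fact n'"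
      using bndD[OF h strip2_scale(3)[OF tp s]] by (simp only: n diff_Suc_1)
    also have "norm (of_real s * p) = s * norm p" using s by (simp add: norm_mult)
    finally show "norm (h (t - of_real (1 - s) * p) (of_real s * p)) \<le> ?K * (s ^ n' * (1 - s) ^ 0)"
      by (simp add: power_mult_distrib mult_ac)
  qed
  then have "norm (btrans h t p) \<le> norm p * (?K * (fact n' * fact 0 / fact (n' + 0 + 1)))"
    unfolding btrans_def norm_mult by (intro mult_left_mono) auto
  also have "\<dots> = C * norm p ^ (Suc n - 1) / fact (Suc n - 1)"
    by (simp add: n mult_ac)
  finally show "norm (btrans h t p) \<le> C * norm p ^ (Suc n - 1) / fact (Suc n - 1)" .
qed

lemma bnd_bprim:
  assumes h: "bnd \<kappa> n C h" and "P \<ge> 0"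
  shows "bnd \<kappa> n (P / 2 * C) (bprim P h)"
  unfolding bnd_def
proof (intro allI impI)
  fix t p assume tp: "(t, p) \<in> strip2 \<kappa>"
  let ?K = "C * norm p ^ (n - 1) / fact (n - 1)"
  have "norm (integral {0..1} (\<lambda>s. of_real (1/2 - s) * h (t - of_real (P * s)) p)) \<le> 1/2 * ?K"
  proof (rule norm_integral_01_le)
    show "norm (of_real (1/2 - s) * h (t - of_real (P * s)) p) \<le> 1/2 * ?K" if "s \<in> {0..1}" for s
      unfolding norm_mult
    proof (intro mult_mono)
      show "norm (h (t - of_real (P * s)) p) \<le> ?K"
        by (rule bndD[OF h]) (use tp in \<open>simp add: mem_strip2\<close>)
      show "norm (complex_of_real (1/2 - s)) \<le> 1/2" using that unfolding norm_of_real by (auto simp: abs_if)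
    qed auto
  qed
  then have "norm (bprim P h t p) \<le> P * (1/2 * ?K)"
    unfolding bprim_def norm_mult norm_of_real abs_of_nonneg[OF \<open>P \<ge> 0\<close>]
    using \<open>P \<ge> 0\<close> by (rule mult_left_mono)
  then show "norm (bprim P h t p) \<le> P / 2 * C * norm p ^ (n - 1) / fact (n - 1)" by simp
qed

lemma bnd_bmean:
  assumes h: "bnd \<kappa> n C h"
  shows "bnd \<kappa> n C (bmean P h)"
  unfolding bnd_def
proof (intro allI impI)
  fix t p assume tp: "(t, p) \<in> strip2 \<kappa>"
  let ?K = "C * norm p ^ (n - 1) / fact (n - 1)"
  have "norm (integral {0..1} (\<lambda>s. h (of_real (P * s)) p)) \<le> ?K"
  proof (rule norm_integral_01_le)
    show "norm (h (of_real (P * s)) p) \<le> ?K" for s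
      by (rule bndD[OF h]) (use tp in \<open>auto simp: mem_strip2\<close>)
  qed
  then show "norm (bmean P h t p) \<le> C * norm p ^ (n - 1) / fact (n - 1)" by (simp add: bmean_def)
qed

text \<open>\<open>z^(-n)\<close> is multiplicative over the orders and \<open>n^(-2)\<close>
  reproduces itself under discrete convolution up to a constant factor, so all powers of
  \<open>u\<close> keep the same majorant. Division by zero makes the value at \<open>n = 0\<close>
  equal to 0, in agreement with the vanishing term of order 0.\<close>

definition bcoef :: "real \<Rightarrow> real \<Rightarrow> nat \<Rightarrow> real" where
  "bcoef B z n = B / z ^ n * (1 / (real n)\<^sup>2)"

lemma bcoef_0 [simp]: "bcoef B z 0 = 0"
  by (simp add: bcoef_def)

text \<open>The estimate \<open>1 / (n + 1)^2 \<le> 1 / n - 1 / (n + 1)\<close> telescopes; the term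
  at \<open>i = 0\<close> is 0 by convention.\<close>

lemma sum_inverse_squares_le: "n > 0 \<Longrightarrow> (\<Sum>i\<le>n. 1 / (real i)\<^sup>2) \<le> 2 - 1 / real n"
proof (induction n rule: nat_induct_non_zero)
  case (Suc n)
  have "1 / (real (Suc n))\<^sup>2 \<le> 1 / (real n * real (Suc n))"
    using Suc.hyps by (intro divide_left_mono) (auto simp: power2_eq_square)
  also have "\<dots> = 1 / real n - 1 / real (Suc n)" using Suc.hyps by (simp add: field_simps)
  finally show ?case using Suc.IH by simp
qed simp

text \<open>From \<open>1 / (x y) = (1 / x + 1 / y) / (x + y)\<close> with \<open>x + y = n\<close>,
  and \<open>(a + b)^2 \<le> 2 (a^2 + b^2)\<close>, each term is at most \<open>2 / n^2\<close>
  times a sum of two inverse squares. Both resulting sums are at most 2, which gives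
  \<open>2 * (2 + 2) = 8\<close>. The end terms vanish since \<open>1 / 0 = 0\<close>.\<close>

lemma sum_inverse_squares_conv:
  "(\<Sum>i\<le>n. 1 / (real i)\<^sup>2 * (1 / (real (n - i))\<^sup>2)) \<le> 8 * (1 / (real n)\<^sup>2)"
proof (cases "n = 0")
  case False
  have "1 / (real i)\<^sup>2 * (1 / (real (n - i))\<^sup>2) \<le> 2 / (real n)\<^sup>2 * (1 / (real i)\<^sup>2 + 1 / (real (n - i))\<^sup>2)"
    if "i \<le> n" for i
  proof (cases "i = 0 \<or> i = n")
    case False
    define x y where "x = real i" and "y = real (n - i)"
    have pos: "x > 0" "y > 0" and n: "real n = x + y" using False that by (auto simp: x_def y_def)
    have "1 / x\<^sup>2 * (1 / y\<^sup>2) = (1 / (x + y))\<^sup>2 * (1 / x + 1 / y)\<^sup>2"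
    proof -
      have "1 / x + 1 / y = (x + y) / (x * y)" "x + y \<noteq> 0" using pos by (auto simp: field_simps)
      then show ?thesis by (simp add: power_divide power_mult_distrib)
    qed
    also have "\<dots> \<le> (1 / (x + y))\<^sup>2 * (2 * (1 / x\<^sup>2 + 1 / y\<^sup>2))"
    proof (intro mult_left_mono)
      have "0 \<le> (1 / x - 1 / y)\<^sup>2" by simp
      then show "(1 / x + 1 / y)\<^sup>2 \<le> 2 * (1 / x\<^sup>2 + 1 / y\<^sup>2)"
        by (simp add: power2_sum power2_diff power_divide)
    qed auto
    finally show ?thesis by (simp add: n x_def[symmetric] y_def[symmetric] power_divide)
  qed auto
  then have "(\<Sum>i\<le>n. 1 / (real i)\<^sup>2 * (1 / (real (n - i))\<^sup>2))
      \<le> (\<Sum>i\<le>n. 2 / (real n)\<^sup>2 * (1 / (real i)\<^sup>2 + 1 / (real (n - i))\<^sup>2))"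
    by (intro sum_mono) auto
  also have "\<dots> = 2 / (real n)\<^sup>2 * ((\<Sum>i\<le>n. 1 / (real i)\<^sup>2) + (\<Sum>i\<le>n. 1 / (real (n - i))\<^sup>2))"
    by (simp only: sum.distrib sum_distrib_left[symmetric])
  also have "(\<Sum>i\<le>n. 1 / (real (n - i))\<^sup>2) = (\<Sum>i\<le>n. 1 / (real i)\<^sup>2)"
    by (rule sum.reindex_bij_witness[of _ "\<lambda>i. n - i" "\<lambda>i. n - i"]) auto
  also have "2 / (real n)\<^sup>2 * ((\<Sum>i\<le>n. 1 / (real i)\<^sup>2) + (\<Sum>i\<le>n. 1 / (real i)\<^sup>2)) \<le> 2 / (real n)\<^sup>2 * (2 + 2)"
  proof (intro mult_left_mono)
    have "(\<Sum>i\<le>n. 1 / (real i)\<^sup>2) \<le> 2"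
      using sum_inverse_squares_le[of n] False by (smt (verit) divide_nonneg_nonneg of_nat_0_le_iff neq0_conv)
    then show "(\<Sum>i\<le>n. 1 / (real i)\<^sup>2) + (\<Sum>i\<le>n. 1 / (real i)\<^sup>2) \<le> 2 + 2" by linarith
  qed auto
  finally show ?thesis by simp
qed simp

lemma sum_bcoef_conv:
  assumes "z > 0"
  shows "(\<Sum>i\<le>n. bcoef B z i * bcoef B z (n - i)) \<le> 8 * B * bcoef B z n"
proof -
  have "(\<Sum>i\<le>n. bcoef B z i * bcoef B z (n - i))
      = B\<^sup>2 / z ^ n * (\<Sum>i\<le>n. 1 / (real i)\<^sup>2 * (1 / (real (n - i))\<^sup>2))"
    unfolding sum_distrib_left
  proof (intro sum.cong refl)
    fix i assume "i \<in> {..n}"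
    then have "z ^ n = z ^ i * z ^ (n - i)" by (simp flip: power_add)
    then show "bcoef B z i * bcoef B z (n - i) = B\<^sup>2 / z ^ n * (1 / (real i)\<^sup>2 * (1 / (real (n - i))\<^sup>2))"
      by (simp add: bcoef_def power2_eq_square mult_ac)
  qed
  also have "\<dots> \<le> B\<^sup>2 / z ^ n * (8 * (1 / (real n)\<^sup>2))"
    using assms by (intro mult_left_mono sum_inverse_squares_conv) auto
  also have "\<dots> = 8 * B * bcoef B z n" by (simp add: bcoef_def power2_eq_square)
  finally show ?thesis .
qed

text \<open>Each further factor costs \<open>8 * B\<close> by \<open>sum_bcoef_conv\<close>, while
  the dependence on \<open>n\<close> stays the same.\<close>

lemma bnd_bpow:
  assumes "B \<ge> 0" "z > 0" "\<And>j. j \<le> n \<Longrightarrow> bnd \<kappa> j (bcoef B z j) (u j)"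
  shows "bnd \<kappa> n ((8 * B) ^ k * bcoef B z n) (bpow u k n)"
  using assms(3)
proof (induction k arbitrary: n)
  case (Suc k)
  have "bnd \<kappa> n (bcoef B z i * ((8 * B) ^ k * bcoef B z (n - i))) (bconv (u i) (bpow u k (n - i)))"
    if "i \<le> n" for i
  proof -
    have u: "bnd \<kappa> i (bcoef B z i) (u i)" and p: "bnd \<kappa> (n - i) ((8 * B) ^ k * bcoef B z (n - i)) (bpow u k (n - i))"
      using Suc.prems Suc.IH that by auto
    \<comment> \<open>\<open>bnd_bconv\<close> needs positive orders. In order 0 the factor has
      bound 0, so the convolution vanishes.\<close>
    consider "i = 0" | "n - i = 0" | "i > 0" "n - i > 0" by linarith
    then show ?thesis
    proof cases
      case 1
      then have "u i t p = 0" if "(t, p) \<in> strip2 \<kappa>" for t p using bndD[OF u that] by simp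
      then have "bconv (u i) (bpow u k (n - i)) t p = 0" if "(t, p) \<in> strip2 \<kappa>" for t p
        using bconv_eq_0_left[OF _ that, of "u i"] by blast
      then show ?thesis using 1 by (simp add: bnd_def)
    next
      case 2
      then have "bpow u k (n - i) t p = 0" if "(t, p) \<in> strip2 \<kappa>" for t p using bndD[OF p that] by simp
      then have "bconv (u i) (bpow u k (n - i)) t p = 0" if "(t, p) \<in> strip2 \<kappa>" for t p
        using bconv_eq_0_right[OF _ that, of "bpow u k (n - i)"] by blast
      moreover have "bcoef B z (n - i) = 0" using 2 by simp
      ultimately show ?thesis by (simp add: bnd_def)
    next
      case 3
      with bnd_bconv[OF u p] that show ?thesis by simp
    qed
  qed
  then have "bnd \<kappa> n (\<Sum>i\<le>n. bcoef B z i * ((8 * B) ^ k * bcoef B z (n - i))) (bpow u (Suc k) n)"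
    by (simp, intro bnd_sum) auto
  moreover have "(\<Sum>i\<le>n. bcoef B z i * ((8 * B) ^ k * bcoef B z (n - i))) \<le> (8 * B) ^ Suc k * bcoef B z n"
  proof -
    have "(\<Sum>i\<le>n. bcoef B z i * ((8 * B) ^ k * bcoef B z (n - i))) = (8 * B) ^ k * (\<Sum>i\<le>n. bcoef B z i * bcoef B z (n - i))"
      by (simp add: sum_distrib_left mult_ac)
    also have "\<dots> \<le> (8 * B) ^ k * (8 * B * bcoef B z n)"
      using assms by (intro mult_left_mono sum_bcoef_conv) auto
    finally show ?thesis by (simp add: mult_ac)
  qed
  ultimately show ?case by (rule bnd_mono)
qed auto

lemma bnd_bseries:
  assumes "B \<ge> 0" "z > 0" "\<And>j. j \<le> n \<Longrightarrow> bnd \<kappa> j (bcoef B z j) (u j)" "finite A"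
  shows "bnd \<kappa> n ((\<Sum>k\<in>A. \<bar>c (Suc k)\<bar> * (8 * B) ^ k) * bcoef B z n) (bseries c A u n)"
proof -
  have "bnd \<kappa> n (\<Sum>k\<in>A. norm (complex_of_real (c (Suc k))) * ((8 * B) ^ k * bcoef B z n)) (bseries c A u n)"
    unfolding bseries_def[abs_def] using assms by (intro bnd_sum bnd_cmult bnd_bpow) auto
  then show ?thesis by (simp add: sum_distrib_right sum_distrib_left mult_ac)
qed

lemma bnd_bforce:
  assumes F: "\<And>x. \<bar>Im x\<bar> < \<kappa> \<Longrightarrow> norm (F x) \<le> CF" and n: "n > 0"
    and u: "\<And>j. j \<le> n \<Longrightarrow> bnd \<kappa> j (bcoef B z j) (u j)" and "B \<ge> 0" "z > 0"
    and \<Gamma>: "\<And>N. (\<Sum>k<N. \<bar>c (Suc k)\<bar> * (8 * B) ^ k) \<le> \<Gamma>"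
  shows "bnd \<kappa> n (if n = 1 then CF else \<Gamma> * bcoef B z (n - 1)) (bforce c F u n)"
proof (cases "n = 1")
  case True
  have "norm (F (t - p)) \<le> CF" if "(t, p) \<in> strip2 \<kappa>" for t p
    by (rule F) (use that in \<open>auto simp: mem_strip2\<close>)
  then show ?thesis using True by (simp add: bnd_def bforce_def)
next
  case False
  have "bcoef B z (n - 1) \<ge> 0" using \<open>B \<ge> 0\<close> \<open>z > 0\<close> by (simp add: bcoef_def)
  have "bnd \<kappa> (n-1) ((\<Sum>k<n-1. \<bar>c (Suc k)\<bar> * (8 * B) ^ k) * bcoef B z (n-1)) (bseries c {..<n-1} u (n-1))"
    using assms by (intro bnd_bseries) auto
  then have "bnd \<kappa> (n-1) (\<Gamma> * bcoef B z (n-1)) (bseries c {..<n-1} u (n-1))"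
    by (rule bnd_mono) (intro mult_right_mono \<Gamma> \<open>bcoef B z (n - 1) \<ge> 0\<close>)
  then have "bnd \<kappa> (Suc (n-1)) (\<Gamma> * bcoef B z (n-1)) (btrans (bseries c {..<n-1} u (n-1)))"
    by (rule bnd_btrans) (use False n in auto)
  then show ?thesis using False n bnd_uminus by (auto simp: bforce_def[abs_def])
qed

text \<open>\<open>(n / (n - 1))^2 \<le> 4\<close> for \<open>n \<ge> 2\<close>. The factor
  \<open>z\<close> that appears when the order is lowered by one is what makes the delayed terms
  small.\<close>

lemma bcoef_pred_le:
  assumes "n \<ge> 2" "B \<ge> 0" "z > 0"
  shows "bcoef B z (n - 1) \<le> 4 * z * bcoef B z n"
proof -
  obtain m where n: "n = Suc m" and m: "m \<ge> 1" using assms(1) by (cases n) auto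
  have "(real (Suc m))\<^sup>2 \<le> (2 * real m)\<^sup>2" using m by (intro power_mono) auto
  then have "1 / (real m)\<^sup>2 \<le> 4 * (1 / (real (Suc m))\<^sup>2)" using m by (simp add: field_simps del: of_nat_Suc)
  then have "B / z ^ m * (1 / (real m)\<^sup>2) \<le> B / z ^ m * (4 * (1 / (real (Suc m))\<^sup>2))"
    using assms by (intro mult_left_mono) auto
  also have "\<dots> = 4 * z * bcoef B z n" using assms by (simp add: bcoef_def n)
  finally show ?thesis by (simp add: bcoef_def n)
qed

text \<open>The bound of order \<open>n\<close> is shared in halves. Small \<open>B\<close> keeps
  the nonlinear part of \<open>g\<close>, divided by \<open>c 1\<close>, below one half; small
  \<open>z\<close> keeps the primitive of the forcing and its mean below the other, by
  \<open>bcoef_pred_le\<close>. In order 1 there is no nonlinear part and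
  \<open>z * P * CF \<le> B\<close> suffices.\<close>

lemma bnd_bsol:
  assumes F: "\<And>x. \<bar>Im x\<bar> < \<kappa> \<Longrightarrow> norm (F x) \<le> CF" and "B \<ge> 0" "z > 0" "P \<ge> 0" "\<rho> > 0"
    and \<Gamma>: "\<And>N. (\<Sum>k<N. \<bar>c (Suc k)\<bar> * \<rho> ^ k) \<le> \<Gamma>" and B: "8 * B \<le> \<rho>" "8 * B * \<Gamma> \<le> \<rho> * \<bar>c 1\<bar> / 2" "c 1 \<noteq> 0"
    and z: "z * P * CF \<le> B" "4 * P * \<Gamma> * z \<le> 1 / 2"
  shows "bnd \<kappa> n (bcoef B z n) (bsol P c F n)"
proof (induction n rule: less_induct)
  case (less n)
  let ?u = "trunc n (bsol P c F)"
  have bpos: "bcoef B z j \<ge> 0" for j using \<open>B \<ge> 0\<close> \<open>z > 0\<close> by (simp add: bcoef_def)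
  have u: "bnd \<kappa> j (bcoef B z j) (?u j)" for j
    using less bpos by (auto simp: trunc_def bnd_const_zero)
  have \<Gamma>': "(\<Sum>k<N. \<bar>c (Suc k)\<bar> * (8 * B) ^ k) \<le> \<Gamma>" for N
    by (rule order_trans[OF sum_mono \<Gamma>]) (use B \<open>B \<ge> 0\<close> in \<open>intro mult_left_mono power_mono, auto\<close>)
  \<comment> \<open>For \<open>k \<ge> 1\<close> at least one factor \<open>8 * B / \<rho>\<close>
    can be split off, so the sum is at most \<open>8 * B / \<rho>\<close> times \<Gamma>.\<close>
  have W2: "(\<Sum>k\<in>{1..<n}. \<bar>c (Suc k)\<bar> * (8 * B) ^ k) \<le> \<bar>c 1\<bar> / 2"
  proof -
    have "\<bar>c (Suc k)\<bar> * (8 * B) ^ k \<le> 8 * B / \<rho> * (\<bar>c (Suc k)\<bar> * \<rho> ^ k)" if "k \<in> {1..<n}" for k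
    proof -
      have "((8 * B) / \<rho>) ^ k \<le> ((8 * B) / \<rho>) ^ 1"
        using B \<open>B \<ge> 0\<close> \<open>\<rho> > 0\<close> that by (intro power_decreasing) auto
      then have "((8 * B) / \<rho>) ^ k * \<rho> ^ k \<le> 8 * B / \<rho> * \<rho> ^ k"
        using \<open>\<rho> > 0\<close> by (intro mult_right_mono) auto
      then have "(8 * B) ^ k \<le> 8 * B / \<rho> * \<rho> ^ k" using \<open>\<rho> > 0\<close> by (simp add: power_divide)
      then have "\<bar>c (Suc k)\<bar> * (8 * B) ^ k \<le> \<bar>c (Suc k)\<bar> * (8 * B / \<rho> * \<rho> ^ k)" by (intro mult_left_mono) auto
      then show ?thesis by (simp add: mult_ac)
    qed
    then have "(\<Sum>k\<in>{1..<n}. \<bar>c (Suc k)\<bar> * (8 * B) ^ k) \<le> (\<Sum>k\<in>{1..<n}. 8 * B / \<rho> * (\<bar>c (Suc k)\<bar> * \<rho> ^ k))"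
      by (rule sum_mono)
    also have "\<dots> \<le> (\<Sum>k<n. 8 * B / \<rho> * (\<bar>c (Suc k)\<bar> * \<rho> ^ k))"
      using \<open>B \<ge> 0\<close> \<open>\<rho> > 0\<close> by (intro sum_mono2) auto
    also have "\<dots> = 8 * B / \<rho> * (\<Sum>k<n. \<bar>c (Suc k)\<bar> * \<rho> ^ k)" by (simp only: sum_distrib_left)
    also have "\<dots> \<le> 8 * B / \<rho> * \<Gamma>" using \<open>B \<ge> 0\<close> \<open>\<rho> > 0\<close> by (intro mult_left_mono \<Gamma>) auto
    also have "\<dots> \<le> \<bar>c 1\<bar> / 2" using B \<open>\<rho> > 0\<close> by (simp add: field_simps)
    finally show ?thesis .
  qed
  show ?case
  proof (cases "n = 0")
    case False
    define Y where "Y = (if n = 1 then CF else \<Gamma> * bcoef B z (n - 1))"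
    define W where "W = \<bar>1 / c 1\<bar> * ((\<Sum>k\<in>{1..<n}. \<bar>c (Suc k)\<bar> * (8 * B) ^ k) * bcoef B z n)"
    have bY: "bnd \<kappa> n Y (bforce c F ?u n)"
      unfolding Y_def using False by (intro bnd_bforce F u \<open>B \<ge> 0\<close> \<open>z > 0\<close> \<Gamma>') auto
    have bW: "bnd \<kappa> n W (\<lambda>t p. of_real (1 / c 1) * bseries c {1..<n} ?u n t p)"
    proof -
      have "W = norm (complex_of_real (1 / c 1)) * ((\<Sum>k\<in>{1..<n}. \<bar>c (Suc k)\<bar> * (8 * B) ^ k) * bcoef B z n)"
        by (simp only: W_def norm_of_real)
      then show ?thesis
        by (simp only:) (rule bnd_cmult, rule bnd_bseries[OF \<open>B \<ge> 0\<close> \<open>z > 0\<close> u], simp)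
    qed
    \<comment> \<open>The primitive of the forcing occurs twice, once inside the mean that is
      subtracted, so its total share is \<open>P * Y\<close>.\<close>
    have "bnd \<kappa> n (P / 2 * Y + (P / 2 * Y + W)) (bsol P c F n)"
      unfolding bsol_trunc[OF False[unfolded neq0_conv]] bstep_def[abs_def]
      by (intro bnd_diff bnd_bprim bnd_bmean bnd_add bY bW \<open>P \<ge> 0\<close>)
    moreover have "P / 2 * Y + (P / 2 * Y + W) \<le> bcoef B z n"
    proof (cases "n = 1")
      case True
      then show ?thesis using z \<open>z > 0\<close> by (simp add: Y_def W_def bcoef_def field_simps)
    next
      case n1: False
      have "\<Gamma> \<ge> 0" using \<Gamma>[of 0] by simp
      have "P * Y \<le> P * (\<Gamma> * (4 * z * bcoef B z n))"
      proof -
        have "bcoef B z (n - 1) \<le> 4 * z * bcoef B z n"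
          by (rule bcoef_pred_le) (use n1 False \<open>B \<ge> 0\<close> \<open>z > 0\<close> in auto)
        then show ?thesis
          unfolding Y_def using n1 \<open>P \<ge> 0\<close> \<open>\<Gamma> \<ge> 0\<close> by (auto intro!: mult_left_mono)
      qed
      also have "\<dots> = (4 * P * \<Gamma> * z) * bcoef B z n" by simp
      also have "\<dots> \<le> 1/2 * bcoef B z n" using z bpos by (intro mult_right_mono)
      finally have 1: "P * Y \<le> 1/2 * bcoef B z n" .
      have "W \<le> \<bar>1 / c 1\<bar> * (\<bar>c 1\<bar> / 2 * bcoef B z n)"
        unfolding W_def by (intro mult_left_mono mult_right_mono W2 bpos) auto
      also have "\<dots> = 1/2 * bcoef B z n" using \<open>c 1 \<noteq> 0\<close> by simp
      finally show ?thesis using 1 by linarith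
    qed
    ultimately show ?thesis by (rule bnd_mono)
  qed (simp add: bnd_const_zero)
qed

section \<open>Laplace integrals\<close>

text \<open>The exponential kernel is extended by zero to negative \<open>p\<close>, so that Laplace
  integrals become Lebesgue integrals over the whole line, where translations and Fubini's theorem
  are at hand. The rate \<open>l\<close> stands for \<open>1 / \<epsilon>\<close>.\<close>

definition expker :: "real \<Rightarrow> real \<Rightarrow> real" where
  "expker l p = (if 0 \<le> p then exp (- l * p) else 0)"

lemma expker_nonneg [simp]: "0 \<le> expker l p"
  by (simp add: expker_def)

lemma expker_measurable [measurable]: "expker l \<in> borel_measurable borel"
  unfolding expker_def by measurable

lemma expker_integral:
  assumes "l > 0"
  shows "integrable lborel (expker l)" "(LINT p|lborel. expker l p) = 1 / l"
proof -
  have "(\<integral>\<^sup>+ p. ennreal (exp (- l * p)) * indicator {0..} p \<partial>lborel) = ennreal (0 - (- exp (- l * 0) / l))"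
  proof (rule nn_integral_FTC_atLeast)
    show "((\<lambda>p. - exp (- l * p) / l) has_real_derivative exp (- l * p)) (at p)" if "0 \<le> p" for p
      using assms by (auto intro!: derivative_eq_intros)
    have "filterlim (\<lambda>p. - l * p) at_bot at_top"
      using assms filterlim_tendsto_neg_mult_at_bot[OF tendsto_const _ filterlim_ident, of "-l"] by auto
    then have "((\<lambda>p. exp (- l * p)) \<longlongrightarrow> 0) at_top" by (rule filterlim_compose[OF exp_at_bot])
    then have "((\<lambda>p. - exp (- l * p) / l) \<longlongrightarrow> - 0 / l) at_top" by (intro tendsto_intros) (use assms in auto)
    then show "((\<lambda>p. - exp (- l * p) / l) \<longlongrightarrow> 0) at_top" by simp
  qed auto
  moreover have "ennreal (exp (- l * p)) * indicator {0..} p = ennreal (expker l p)" for p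
    by (auto simp: expker_def indicator_def)
  ultimately have eq: "(\<integral>\<^sup>+ p. ennreal (expker l p) \<partial>lborel) = ennreal (1 / l)" by simp
  show int: "integrable lborel (expker l)"
    by (rule integrableI_nonneg) (use eq in auto)
  show "(LINT p|lborel. expker l p) = 1 / l"
    by (rule integral_eq_nn_integral[THEN trans]) (use eq assms in auto)
qed

lemma expker_mult: "expker l p * exp (c * p) = expker (l - c) p"
  by (auto simp: expker_def exp_add[symmetric] algebra_simps)

definition laplace :: "real \<Rightarrow> (real \<Rightarrow> real) \<Rightarrow> real" where
  "laplace l \<phi> = (LINT p|lborel. expker l p * \<phi> p)"

lemma laplace_integrable:
  assumes [measurable]: "\<phi> \<in> borel_measurable borel" and bd: "\<And>p. p \<ge> 0 \<Longrightarrow> \<bar>\<phi> p\<bar> \<le> M * exp (c * p)" and "c < l"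
  shows "integrable lborel (\<lambda>p. expker l p * \<phi> p)"
proof (rule Bochner_Integration.integrable_bound)
  show "integrable lborel (\<lambda>p. M * expker (l - c) p)"
    using expker_integral(1)[of "l - c"] \<open>c < l\<close> by (intro integrable_mult_right) auto
  have "\<bar>expker l p * \<phi> p\<bar> \<le> \<bar>M * expker (l - c) p\<bar>" for p
  proof (cases "p \<ge> 0")
    case True
    have "\<bar>expker l p * \<phi> p\<bar> = expker l p * \<bar>\<phi> p\<bar>" by (simp add: abs_mult)
    also have "\<dots> \<le> expker l p * (M * exp (c * p))" by (intro mult_left_mono bd True) simp
    also have "\<dots> = M * expker (l - c) p" by (simp add: expker_mult[symmetric] mult_ac)
    finally show ?thesis by linarith
  qed (simp add: expker_def)
  then show "AE p in lborel. norm (expker l p * \<phi> p) \<le> norm (M * expker (l - c) p)" by simp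
qed measurable

lemma laplace_mono:
  assumes "integrable lborel (\<lambda>p. expker l p * \<phi> p)" "integrable lborel (\<lambda>p. expker l p * \<psi> p)"
    and "\<And>p. p \<ge> 0 \<Longrightarrow> \<bar>\<phi> p\<bar> \<le> \<psi> p"
  shows "\<bar>laplace l \<phi>\<bar> \<le> laplace l \<psi>"
  unfolding laplace_def
proof (rule integral_abs_bound[THEN order_trans], rule integral_mono)
  show "\<bar>expker l p * \<phi> p\<bar> \<le> expker l p * \<psi> p" for p
    using assms(3)[of p] by (cases "p \<ge> 0") (auto simp: abs_mult expker_def intro!: mult_left_mono)
qed (use assms in auto)

lemma laplace_add:
  "integrable lborel (\<lambda>p. expker l p * \<phi> p) \<Longrightarrow> integrable lborel (\<lambda>p. expker l p * \<psi> p) \<Longrightarrow>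
   laplace l (\<lambda>p. \<phi> p + \<psi> p) = laplace l \<phi> + laplace l \<psi>"
  by (simp add: laplace_def distrib_left)

lemma laplace_diff:
  "integrable lborel (\<lambda>p. expker l p * \<phi> p) \<Longrightarrow> integrable lborel (\<lambda>p. expker l p * \<psi> p) \<Longrightarrow>
   laplace l (\<lambda>p. \<phi> p - \<psi> p) = laplace l \<phi> - laplace l \<psi>"
  by (simp add: laplace_def right_diff_distrib)

lemma laplace_cmult: "laplace l (\<lambda>p. c * \<phi> p) = c * laplace l \<phi>"
  by (simp add: laplace_def mult.left_commute)

lemma laplace_uminus: "laplace l (\<lambda>p. - \<phi> p) = - laplace l \<phi>"
  by (simp add: laplace_def)

lemma laplace_sum:
  "(\<And>i. i \<in> A \<Longrightarrow> integrable lborel (\<lambda>p. expker l p * \<phi> i p)) \<Longrightarrow>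
   laplace l (\<lambda>p. \<Sum>i\<in>A. \<phi> i p) = (\<Sum>i\<in>A. laplace l (\<phi> i))"
  by (simp add: laplace_def sum_distrib_left)

lemma integrable_pair_mult:
  fixes a b :: "real \<Rightarrow> real"
  assumes a: "integrable lborel a" and b: "integrable lborel b"
  shows "integrable (lborel \<Otimes>\<^sub>M lborel) (\<lambda>(x, y). a x * b y)"
proof (rule lborel_pair.Fubini_integrable)
  have [measurable]: "a \<in> borel_measurable borel" "b \<in> borel_measurable borel" using a b by auto
  show "(\<lambda>(x, y). a x * b y) \<in> borel_measurable (lborel \<Otimes>\<^sub>M lborel)" by measurable
  show "integrable lborel (\<lambda>x. LINT y|lborel. norm (case (x, y) of (x, y) \<Rightarrow> a x * b y))"
    using a by (simp add: abs_mult)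
  show "AE x in lborel. integrable lborel (\<lambda>y. case (x, y) of (x, y) \<Rightarrow> a x * b y)"
    using b by simp
qed

text \<open>Fubini's theorem with the integrable majorant \<open>M * expker (l - c) p\<close>. It
  serves the averages over a period.\<close>

lemma laplace_integral_swap:
  fixes \<phi> :: "real \<Rightarrow> real \<Rightarrow> real"
  assumes cont: "continuous_on UNIV (\<lambda>(s, p). \<phi> s p)"
    and bd: "\<And>s p. s \<in> {0..1} \<Longrightarrow> p \<ge> 0 \<Longrightarrow> \<bar>\<phi> s p\<bar> \<le> M * exp (c * p)" and "c < l"
  shows "laplace l (\<lambda>p. integral {0..1} (\<lambda>s. \<phi> s p)) = integral {0..1} (\<lambda>s. laplace l (\<phi> s))"
    and "(\<lambda>s. laplace l (\<phi> s)) integrable_on {0..1}"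
proof -
  have [measurable]: "(\<lambda>(s, p). \<phi> s p) \<in> borel_measurable borel"
    using cont by (rule borel_measurable_continuous_onI)
  have meas [measurable]: "(\<lambda>(s, p). \<phi> s p) \<in> borel_measurable (borel \<Otimes>\<^sub>M borel)"
    unfolding borel_prod by measurable
  have ms: "\<phi> s \<in> borel_measurable borel" for s
    using measurable_compose[OF measurable_Pair1'[of s borel borel] meas] by simp
  let ?G = "\<lambda>s p. indicator {0..1} s * (expker l p * \<phi> s p)"
  have "integrable (lborel \<Otimes>\<^sub>M lborel) (\<lambda>(s::real, p). indicator {0..1} s * (M * expker (l - c) p))"
    using expker_integral(1)[of "l - c"] \<open>c < l\<close>
    by (intro integrable_pair_mult integrable_mult_right) (auto simp: integrable_indicator_iff)
  then have int: "integrable (lborel \<Otimes>\<^sub>M lborel) (\<lambda>(s, p). ?G s p)"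
  proof (rule Bochner_Integration.integrable_bound)
    show "(\<lambda>(s, p). ?G s p) \<in> borel_measurable (lborel \<Otimes>\<^sub>M lborel)" by measurable
    have "\<bar>?G s p\<bar> \<le> \<bar>indicator {0..1} s * (M * expker (l - c) p)\<bar>" for s p :: real
    proof (cases "s \<in> {0..1} \<and> p \<ge> 0")
      case True
      have "\<bar>expker l p * \<phi> s p\<bar> = expker l p * \<bar>\<phi> s p\<bar>" by (simp add: abs_mult)
      also have "\<dots> \<le> expker l p * (M * exp (c * p))" using True by (intro mult_left_mono bd) auto
      also have "\<dots> = M * expker (l - c) p" by (simp add: expker_mult[symmetric] mult_ac)
      finally show ?thesis using True by simp
    qed (auto simp: expker_def indicator_def)
    then show "AE x in lborel \<Otimes>\<^sub>M lborel. norm (case x of (s, p) \<Rightarrow> ?G s p)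
        \<le> norm (case x of (s, p) \<Rightarrow> indicator {0..1} s * (M * expker (l - c) p))"
      by (simp add: case_prod_unfold)
  qed
  have swap: "(LINT p|lborel. LINT s|lborel. ?G s p) = (LINT s|lborel. LINT p|lborel. ?G s p)"
    by (rule lborel_pair.Fubini_integral[OF int])
  have inner: "(LINT s|lborel. ?G s p) = expker l p * integral {0..1} (\<lambda>s. \<phi> s p)" for p
  proof -
    have "continuous_on {0..1} (\<lambda>s. \<phi> s p)"
    proof -
      have "continuous_on {0..1} (\<lambda>s. (\<lambda>(s, p). \<phi> s p) (s, p))"
        by (rule continuous_on_compose2[OF cont]) (auto intro!: continuous_intros)
      then show ?thesis by simp
    qed
    then have "set_integrable lborel {0..1} (\<lambda>s. \<phi> s p)" by (rule borel_integrable_atLeastAtMost')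
    then have "(LINT s:{0..1}|lborel. \<phi> s p) = integral {0..1} (\<lambda>s. \<phi> s p)"
      by (rule set_borel_integral_eq_integral)
    then show ?thesis by (simp add: set_lebesgue_integral_def mult.left_commute)
  qed
  have "integrable lborel (\<lambda>s. LINT p|lborel. ?G s p)"
    using lborel_pair.integrable_fst'[OF int] by simp
  then have "set_integrable lborel {0..1} (\<lambda>s. laplace l (\<phi> s))"
    by (simp add: set_integrable_def laplace_def)
  note * = set_borel_integral_eq_integral[OF this]
  show "(\<lambda>s. laplace l (\<phi> s)) integrable_on {0..1}" by (rule *)
  show "laplace l (\<lambda>p. integral {0..1} (\<lambda>s. \<phi> s p)) = integral {0..1} (\<lambda>s. laplace l (\<phi> s))"
    using swap *(2) unfolding inner by (simp add: laplace_def set_lebesgue_integral_def)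
qed

text \<open>Substitute \<open>p = q + s\<close> in the double Laplace integral: the two kernels
  multiply to \<open>expker l p\<close>, and what is left is an integral over the segment from 0 to
  \<open>p\<close>, rescaled to \<open>[0, 1]\<close>. Products, delays and powers of
  \<open>p\<close> are all instances, with different \<Psi>.\<close>

lemma laplace_triangle:
  fixes \<Psi> :: "real \<Rightarrow> real \<Rightarrow> real"
  assumes cont: "continuous_on UNIV (\<lambda>(q, s). \<Psi> q s)"
    and bd: "\<And>q s. q \<ge> 0 \<Longrightarrow> s \<ge> 0 \<Longrightarrow> \<bar>\<Psi> q s\<bar> \<le> M * exp (c * (q + s))" and "c < l"
  shows "laplace l (\<lambda>p. p * integral {0..1} (\<lambda>s. \<Psi> ((1 - s) * p) (s * p))) = laplace l (\<lambda>q. laplace l (\<Psi> q))"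
    and "integrable lborel (\<lambda>q. expker l q * laplace l (\<Psi> q))"
proof -
  have [measurable]: "(\<lambda>(s, p). \<Psi> s p) \<in> borel_measurable borel"
    using cont by (rule borel_measurable_continuous_onI)
  have [measurable]: "(\<lambda>(s, p). \<Psi> s p) \<in> borel_measurable (borel \<Otimes>\<^sub>M borel)"
    unfolding borel_prod by measurable
  have [measurable]: "(\<lambda>(p, s). \<Psi> (p - s) s) \<in> borel_measurable (borel \<Otimes>\<^sub>M borel)"
  proof -
    have "continuous_on UNIV (\<lambda>(p, s). \<Psi> (p - s) s)"
    proof -
      have "continuous_on UNIV (\<lambda>z::real \<times> real. (\<lambda>(q, s). \<Psi> q s) (fst z - snd z, snd z))"
        by (rule continuous_on_compose2[OF cont]) (auto intro!: continuous_intros)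
      then show ?thesis by (simp add: case_prod_unfold)
    qed
    then show ?thesis unfolding borel_prod by (rule borel_measurable_continuous_onI)
  qed
  define F where "F q s = expker l q * (expker l s * \<Psi> q s)" for q s
  define G where "G p s = F (p - s) s" for p s
  \<comment> \<open>On the sheared domain \<open>0 \<le> s \<le> p\<close>, so half of the surplus
    decay \<open>l - c\<close> in \<open>p\<close> can be moved to \<open>s\<close>. This gives a
    product majorant for \<open>G\<close>.\<close>
  let ?d = "(l - c) / 2"
  have "?d > 0" using \<open>c < l\<close> by simp
  have intF: "integrable (lborel \<Otimes>\<^sub>M lborel) (\<lambda>(q, s). F q s)"
  proof (rule Bochner_Integration.integrable_bound)
    show "integrable (lborel \<Otimes>\<^sub>M lborel) (\<lambda>(q, s). M * expker (l - c) q * expker (l - c) s)"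
      using expker_integral(1)[of "l - c"] \<open>c < l\<close> by (intro integrable_pair_mult integrable_mult_right) auto
    show "(\<lambda>(q, s). F q s) \<in> borel_measurable (lborel \<Otimes>\<^sub>M lborel)" unfolding F_def by measurable
    have "\<bar>F q s\<bar> \<le> \<bar>M * expker (l - c) q * expker (l - c) s\<bar>" for q s
    proof (cases "q \<ge> 0 \<and> s \<ge> 0")
      case True
      have "\<bar>F q s\<bar> = expker l q * (expker l s * \<bar>\<Psi> q s\<bar>)" by (simp add: F_def abs_mult)
      also have "\<dots> \<le> expker l q * (expker l s * (M * exp (c * (q + s))))"
        using True by (intro mult_left_mono bd) auto
      also have "\<dots> = M * (expker l q * exp (c * q)) * (expker l s * exp (c * s))"
        by (simp add: distrib_left exp_add mult_ac)
      finally show ?thesis unfolding expker_mult by linarith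
    qed (auto simp: expker_def F_def)
    then show "AE x in lborel \<Otimes>\<^sub>M lborel. norm (case x of (q, s) \<Rightarrow> F q s)
        \<le> norm (case x of (q, s) \<Rightarrow> M * expker (l - c) q * expker (l - c) s)"
      by (simp add: case_prod_unfold)
  qed
  have intG: "integrable (lborel \<Otimes>\<^sub>M lborel) (\<lambda>(p, s). G p s)"
  proof (rule Bochner_Integration.integrable_bound)
    show "integrable (lborel \<Otimes>\<^sub>M lborel) (\<lambda>(p, s). M * expker ?d p * expker ?d s)"
      using expker_integral(1)[OF \<open>?d > 0\<close>] by (intro integrable_pair_mult integrable_mult_right) auto
    show "(\<lambda>(p, s). G p s) \<in> borel_measurable (lborel \<Otimes>\<^sub>M lborel)" unfolding F_def G_def by measurable
    have "\<bar>G p s\<bar> \<le> \<bar>M * expker ?d p * expker ?d s\<bar>" for p s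
    proof (cases "s \<ge> 0 \<and> p - s \<ge> 0")
      case True
      have "M * exp (c * 0) \<ge> 0" using bd[of 0 0] by (auto intro: order_trans[OF abs_ge_zero])
      then have "M \<ge> 0" by simp
      have "\<bar>G p s\<bar> = expker l (p - s) * (expker l s * \<bar>\<Psi> (p - s) s\<bar>)" by (simp add: G_def F_def abs_mult)
      also have "\<dots> \<le> expker l (p - s) * (expker l s * (M * exp (c * ((p - s) + s))))"
        using True by (intro mult_left_mono bd) auto
      also have "\<dots> = M * exp (- (l - c) * p)"
        using True by (simp add: expker_def exp_add[symmetric] algebra_simps)
      also have "\<dots> \<le> M * exp (- ?d * p + - ?d * s)"
      proof -
        have "(l - c) * s \<le> (l - c) * p" using True \<open>c < l\<close> by (intro mult_left_mono) auto
        then have "- (l - c) * p \<le> - ?d * p + - ?d * s" by (simp add: field_simps)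
        then show ?thesis using \<open>M \<ge> 0\<close> by (intro mult_left_mono) auto
      qed
      also have "\<dots> = M * expker ?d p * expker ?d s" unfolding exp_add using True by (simp add: expker_def)
      finally show ?thesis by linarith
    qed (auto simp: expker_def F_def G_def)
    then show "AE x in lborel \<Otimes>\<^sub>M lborel. norm (case x of (p, s) \<Rightarrow> G p s)
        \<le> norm (case x of (p, s) \<Rightarrow> M * expker ?d p * expker ?d s)"
      by (simp add: case_prod_unfold)
  qed
  have innerF: "(LINT s|lborel. F q s) = expker l q * laplace l (\<Psi> q)" for q
    by (simp add: F_def laplace_def)
  have "(LINT q|lborel. LINT s|lborel. F q s) = (LINT s|lborel. LINT q|lborel. F q s)"
    using lborel_pair.Fubini_integral[OF intF] by simp
  also have "\<dots> = (LINT s|lborel. LINT p|lborel. G p s)"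
  proof -
    have "(LINT q|lborel. F q s) = (LINT p|lborel. F (- s + 1 * p) s)" for s
      using lborel_integral_real_affine[of 1 "\<lambda>q. F q s" "- s"] by simp
    then show ?thesis by (simp add: G_def)
  qed
  also have "\<dots> = (LINT p|lborel. LINT s|lborel. G p s)"
    using lborel_pair.Fubini_integral[OF intG] by simp
  also have "\<dots> = (LINT p|lborel. expker l p * (p * integral {0..1} (\<lambda>s. \<Psi> ((1 - s) * p) (s * p))))"
  proof (intro Bochner_Integration.integral_cong refl)
    fix p :: real
    show "(LINT s|lborel. G p s) = expker l p * (p * integral {0..1} (\<lambda>s. \<Psi> ((1 - s) * p) (s * p)))"
    proof (cases "p > 0")
      case True
      have "(LINT s|lborel. G p s) = p * (LINT s|lborel. G p (p * s))"
        using lborel_integral_real_affine[of p "G p" 0] True by simp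
      also have "(LINT s|lborel. G p (p * s)) = (LINT s|lborel. expker l p * (indicator {0..1} s * \<Psi> ((1 - s) * p) (s * p)))"
      proof (intro Bochner_Integration.integral_cong refl)
        fix s :: real
        show "G p (p * s) = expker l p * (indicator {0..1} s * \<Psi> ((1 - s) * p) (s * p))"
        proof (cases "s \<in> {0..1}")
          case s: True
          have e: "p - p * s = (1 - s) * p" "p * s = s * p" by (simp_all add: algebra_simps)
          have "(1 - s) * p \<ge> 0" "s * p \<ge> 0" using s True by auto
          then have "expker l ((1 - s) * p) * expker l (s * p) = expker l p"
            using True by (simp add: expker_def exp_add[symmetric] algebra_simps)
          then show ?thesis using s unfolding G_def F_def e(1) unfolding e(2)
            by (simp add: mult.assoc[symmetric] del: right_diff_distrib left_diff_distrib)
        next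
          case s: False
          then have "p * s < 0 \<or> p - p * s < 0"
            using True by (auto simp: not_le mult_pos_neg)
          then show ?thesis using s by (auto simp: G_def F_def expker_def)
        qed
      qed
      also have "\<dots> = expker l p * (LINT s:{0..1}|lborel. \<Psi> ((1 - s) * p) (s * p))"
        by (simp add: set_lebesgue_integral_def)
      also have "(LINT s:{0..1}|lborel. \<Psi> ((1 - s) * p) (s * p)) = integral {0..1} (\<lambda>s. \<Psi> ((1 - s) * p) (s * p))"
      proof (rule set_borel_integral_eq_integral, rule borel_integrable_atLeastAtMost')
        show "continuous_on {0..1} (\<lambda>s. \<Psi> ((1 - s) * p) (s * p))"
        proof -
          have "continuous_on {0..1} (\<lambda>s. (\<lambda>(q, s). \<Psi> q s) ((1 - s) * p, s * p))"
            by (rule continuous_on_compose2[OF cont]) (auto intro!: continuous_intros)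
          then show ?thesis by simp
        qed
      qed
      finally show ?thesis by simp
    next
      \<comment> \<open>For \<open>p \<le> 0\<close> only the single point \<open>s = 0\<close> can
        contribute, a null set.\<close>
      case False
      have "G p s = 0" if "s \<noteq> 0" for s
        using False that by (auto simp: G_def F_def expker_def)
      then have "AE s in lborel. G p s = 0"
        using AE_lborel_singleton[of "0::real"] by (auto elim: eventually_mono)
      then have "(LINT s|lborel. G p s) = 0" by (rule integral_eq_zero_AE)
      then show ?thesis using False by (auto simp: expker_def)
    qed
  qed
  finally show "laplace l (\<lambda>p. p * integral {0..1} (\<lambda>s. \<Psi> ((1 - s) * p) (s * p))) = laplace l (\<lambda>q. laplace l (\<Psi> q))"
    unfolding innerF by (simp add: laplace_def)
  have "integrable lborel (\<lambda>q. LINT s|lborel. F q s)"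
    using lborel_pair.integrable_fst'[OF intF] by simp
  then show "integrable lborel (\<lambda>q. expker l q * laplace l (\<Psi> q))" unfolding innerF .
qed

section \<open>Comparison of the complex and the real recursion\<close>

lemma integral_complex_of_real: "integral S (\<lambda>x. complex_of_real (f x)) = of_real (integral S f)"
proof (cases "f integrable_on S")
  case True
  then have "((\<lambda>x. complex_of_real (f x)) has_integral of_real (integral S f)) S"
    by (intro has_integral_of_real integrable_integral)
  then show ?thesis by (rule integral_unique)
next
  case False
  have "\<not> (\<lambda>x. complex_of_real (f x)) integrable_on S"
  proof
    assume "(\<lambda>x. complex_of_real (f x)) integrable_on S"
    from integrable_linear[OF this bounded_linear_Re] have "f integrable_on S" by (simp add: o_def)
    with False show False ..
  qed
  with False show ?thesis by (simp add: not_integrable_integral)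
qed

text \<open>The operations are polymorphic, so the same recursion runs over both fields. Holomorphy
  and bounds are proved over the complex numbers, while the Laplace integrals are those of the real
  terms; this relation transports the bounds.\<close>

definition real_restr :: "(complex \<Rightarrow> complex \<Rightarrow> complex) \<Rightarrow> (real \<Rightarrow> real \<Rightarrow> real) \<Rightarrow> bool" where
  "real_restr h r \<longleftrightarrow> (\<forall>t p. h (of_real t) (of_real p) = of_real (r t p))"

lemma real_restr_bconv: "real_restr a a' \<Longrightarrow> real_restr b b' \<Longrightarrow> real_restr (bconv a b) (bconv a' b')"
  unfolding real_restr_def bconv_def
  by (simp add: integral_complex_of_real del: of_real_diff of_real_mult flip: of_real_mult)

lemma real_restr_btrans: "real_restr h r \<Longrightarrow> real_restr (btrans h) (btrans r)"
  unfolding real_restr_def btrans_def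
  by (simp add: integral_complex_of_real del: of_real_diff of_real_mult flip: of_real_mult of_real_diff)

lemma real_restr_bprim: "real_restr h r \<Longrightarrow> real_restr (bprim P h) (bprim P r)"
  unfolding real_restr_def bprim_def
  by (simp add: integral_complex_of_real del: of_real_diff of_real_mult flip: of_real_mult of_real_diff)

lemma real_restr_bmean: "real_restr h r \<Longrightarrow> real_restr (bmean P h) (bmean P r)"
  unfolding real_restr_def bmean_def
  by (simp add: integral_complex_of_real del: of_real_mult flip: of_real_mult)

lemma real_restr_bpow: "(\<And>j. j \<le> n \<Longrightarrow> real_restr (u j) (v j)) \<Longrightarrow> real_restr (bpow u k n) (bpow v k n)"
proof (induction k arbitrary: n)
  case (Suc k)
  have "real_restr (bconv (u i) (bpow u k (n - i))) (bconv (v i) (bpow v k (n - i)))" if "i \<le> n" for i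
    using Suc that by (intro real_restr_bconv) auto
  then show ?case by (simp add: real_restr_def)
qed auto

lemma real_restr_bseries:
  "(\<And>j. j \<le> n \<Longrightarrow> real_restr (u j) (v j)) \<Longrightarrow> real_restr (bseries c A u n) (bseries c A v n)"
  using real_restr_bpow[of n u v] by (simp add: real_restr_def bseries_def)

lemma real_restr_bforce:
  assumes "\<And>x. F (of_real x) = of_real (Fr x)" "\<And>j. j \<le> n \<Longrightarrow> real_restr (u j) (v j)"
  shows "real_restr (bforce c F u n) (bforce c Fr v n)"
proof (cases "n = 1")
  case True
  then show ?thesis using assms(1) by (simp add: real_restr_def bforce_def flip: of_real_diff)
next
  case False
  have "real_restr (btrans (bseries c {..<n-1} u (n-1))) (btrans (bseries c {..<n-1} v (n-1)))"
    using assms(2) by (intro real_restr_btrans real_restr_bseries) auto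
  then show ?thesis using False by (simp add: real_restr_def bforce_def)
qed

lemma real_restr_bsol:
  assumes F: "\<And>x. F (of_real x) = of_real (Fr x)"
  shows "real_restr (bsol P c F n) (bsol P c Fr n)"
proof (induction n rule: less_induct)
  case (less n)
  have u: "real_restr (trunc n (bsol P c F) j) (trunc n (bsol P c Fr) j)" for j
    using less by (auto simp: trunc_def real_restr_def)
  show ?case
  proof (cases "n = 0")
    case False
    let ?u = "trunc n (bsol P c F)" and ?v = "trunc n (bsol P c Fr)"
    have 1: "real_restr (bprim P (bforce c F ?u n)) (bprim P (bforce c Fr ?v n))"
      by (intro real_restr_bprim real_restr_bforce F u)
    have 2: "real_restr (bseries c {1..<n} ?u n) (bseries c {1..<n} ?v n)" by (intro real_restr_bseries u)
    have "real_restr (bmean P (\<lambda>t p. bprim P (bforce c F ?u n) t p + of_real (1 / c 1) * bseries c {1..<n} ?u n t p))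
       (bmean P (\<lambda>t p. bprim P (bforce c Fr ?v n) t p + of_real (1 / c 1) * bseries c {1..<n} ?v n t p))"
      by (rule real_restr_bmean) (use 1 2 in \<open>simp add: real_restr_def\<close>)
    with 1 show ?thesis
      using False by (simp add: real_restr_def bsol_trunc bstep_def)
  qed (simp add: real_restr_def)
qed

text \<open>The real trace of \<open>bihol\<close> and \<open>bnd\<close>: the continuity and the
  growth bound that the Laplace integrals require.\<close>

definition rreg :: "nat \<Rightarrow> real \<Rightarrow> (real \<Rightarrow> real \<Rightarrow> real) \<Rightarrow> bool" where
  "rreg n C r \<longleftrightarrow> continuous_on UNIV (\<lambda>(t, p). r t p) \<and> (\<forall>t p. \<bar>r t p\<bar> \<le> C * \<bar>p\<bar> ^ (n - 1) / fact (n - 1))"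

lemma rreg_of_restr:
  assumes "bihol \<kappa> h" "bnd \<kappa> n C h" "real_restr h r" "\<kappa> > 0"
  shows "rreg n C r"
  unfolding rreg_def
proof (intro conjI allI)
  have mem: "(complex_of_real t, complex_of_real p) \<in> strip2 \<kappa>" for t p using \<open>\<kappa> > 0\<close> by (simp add: mem_strip2)
  have r: "h (of_real t) (of_real p) = of_real (r t p)" for t p using assms by (simp add: real_restr_def)
  have c: "continuous_on (strip2 \<kappa>) (\<lambda>(t, p). h t p)" using assms by (simp add: bihol_def)
  have "continuous_on UNIV (\<lambda>z. (\<lambda>(t, p). h t p) (complex_of_real (fst z), complex_of_real (snd z)))"
    by (rule continuous_on_compose2[OF c]) (auto intro!: continuous_intros mem)
  then have "continuous_on UNIV (\<lambda>z. complex_of_real (r (fst z) (snd z)))"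
    unfolding case_prod_conv r .
  from continuous_on_Re[OF this] show "continuous_on UNIV (\<lambda>(t, p). r t p)" by (simp add: case_prod_unfold)
  show "\<bar>r t p\<bar> \<le> C * \<bar>p\<bar> ^ (n - 1) / fact (n - 1)" for t p
    using bndD[OF assms(2) mem[of t p]] by (simp add: r)
qed

lemma power_over_fact_le_exp:
  assumes "c > 0"
  shows "\<bar>p\<bar> ^ m / fact m \<le> (1 / c ^ m) * exp (c * \<bar>p\<bar> :: real)"
proof -
  have "(c * \<bar>p\<bar>) ^ m / fact m \<le> exp (c * \<bar>p\<bar>)"
    using sum_le_suminf[OF sums_summable[OF exp_converges[of "c * \<bar>p\<bar>"]], of "{m}"] assms
    by (simp add: exp_def divide_inverse mult.commute)
  then show ?thesis using assms by (simp add: power_mult_distrib field_simps)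
qed

lemma rreg_nonneg: "rreg n C r \<Longrightarrow> 0 \<le> C"
proof -
  assume "rreg n C r"
  then have "\<bar>r 0 1\<bar> \<le> C * \<bar>1\<bar> ^ (n - 1) / fact (n - 1)" unfolding rreg_def by blast
  then have "0 \<le> C / fact (n - 1)" by simp
  from mult_nonneg_nonneg[OF this fact_ge_zero[of "n - 1"]] show "0 \<le> C" by simp
qed

lemma rreg_continuous2: "rreg n C r \<Longrightarrow> continuous_on UNIV f \<Longrightarrow> continuous_on UNIV g \<Longrightarrow>
  continuous_on UNIV (\<lambda>x::'a::topological_space. r (f x) (g x))"
proof -
  assume r: "rreg n C r" and c: "continuous_on UNIV f" "continuous_on UNIV g"
  have "continuous_on UNIV (\<lambda>x. (\<lambda>(t, p). r t p) (f x, g x))"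
    by (rule continuous_on_compose2[of UNIV "\<lambda>(t, p). r t p"])
       (use r c in \<open>auto simp: rreg_def intro!: continuous_intros\<close>)
  then show ?thesis by simp
qed

lemma rreg_measurable: "rreg n C r \<Longrightarrow> r t \<in> borel_measurable borel"
  using rreg_continuous2[of n C r "\<lambda>_. t" "\<lambda>p. p"]
  by (intro borel_measurable_continuous_onI) (auto intro!: continuous_intros)

lemma rreg_exp_bound:
  assumes r: "rreg n C r" and "c > 0" "p \<ge> 0"
  shows "\<bar>r t p\<bar> \<le> C / c ^ (n - 1) * exp (c * p)"
proof -
  have "\<bar>r t p\<bar> \<le> C * (\<bar>p\<bar> ^ (n - 1) / fact (n - 1))" using r by (simp add: rreg_def)
  also have "\<dots> \<le> C * (1 / c ^ (n - 1) * exp (c * \<bar>p\<bar>))"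
    by (intro mult_left_mono power_over_fact_le_exp \<open>c > 0\<close> rreg_nonneg[OF r])
  finally show ?thesis using \<open>p \<ge> 0\<close> by simp
qed

lemma rreg_laplace_integrable:
  assumes "rreg n C r" "l > 0"
  shows "integrable lborel (\<lambda>p. expker l p * r t p)"
  by (rule laplace_integrable[OF rreg_measurable[OF assms(1)] rreg_exp_bound[OF assms(1), of "l/2"]])
     (use assms in auto)

text \<open>Induction by \<open>laplace_triangle\<close> with
  \<open>\<Psi> q s = s ^ m / fact m\<close>: convolution with the constant 1 raises the power and
  multiplies the transform by \<open>1 / l\<close>.\<close>

lemma laplace_power_over_fact:
  assumes "l > 0"
  shows "laplace l (\<lambda>p. p ^ m / fact m) = (1 / l) ^ Suc m"
    and "integrable lborel (\<lambda>p. expker l p * (p ^ m / fact m))"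
proof -
  have bd: "\<bar>p ^ m / fact m\<bar> \<le> 1 / (l/2) ^ m * exp (l/2 * p)" if "p \<ge> 0" for p m
    using power_over_fact_le_exp[of "l/2" p m] assms that by (simp add: abs_mult power_abs)
  show "integrable lborel (\<lambda>p. expker l p * (p ^ m / fact m))" for m
    by (rule laplace_integrable[OF _ bd]) (use assms in auto)
  show "laplace l (\<lambda>p. p ^ m / fact m) = (1 / l) ^ Suc m"
  proof (induction m)
    case 0
    then show ?case using expker_integral(2)[OF assms] by (simp add: laplace_def)
  next
    case (Suc m)
    have "laplace l (\<lambda>p. p * integral {0..1} (\<lambda>s. (\<lambda>q s. s ^ m / fact m) ((1 - s) * p) (s * p)))
        = laplace l (\<lambda>q. laplace l ((\<lambda>q s. s ^ m / fact m) q))"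
    proof (rule laplace_triangle(1))
      show "\<bar>s ^ m / fact m\<bar> \<le> 1 / (l/2) ^ m * exp (l/2 * (q + s))" if "q \<ge> 0" "s \<ge> 0" for q s
      proof (rule order_trans[OF bd[OF that(2), of m]], rule mult_left_mono)
        show "exp (l/2 * s) \<le> exp (l/2 * (q + s))" using that assms by simp
      qed (use assms in auto)
    qed (use assms in \<open>auto intro!: continuous_intros simp: case_prod_unfold\<close>)
    moreover have "p * integral {0..1} (\<lambda>s. (s * p) ^ m / fact m) = p ^ Suc m / fact (Suc m)" for p :: real
    proof -
      have "((\<lambda>s. p ^ m / fact m * (s ^ m * (1 - s) ^ 0)) has_integral p ^ m / fact m * (fact m * fact 0 / fact (m + 0 + 1))) {0..1}"
        by (intro has_integral_mult_right has_integral_beta_nat)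
      then have "integral {0..1} (\<lambda>s. (s * p) ^ m / fact m) = p ^ m / fact m * (fact m * fact 0 / fact (m + 0 + 1))"
        by (intro integral_unique) (simp add: power_mult_distrib mult_ac)
      then show ?thesis by simp
    qed
    ultimately have "laplace l (\<lambda>p. p ^ Suc m / fact (Suc m)) = laplace l (\<lambda>q. (1 / l) ^ Suc m)"
      using Suc.IH by simp
    also have "\<dots> = (1 / l) ^ Suc (Suc m)"
      using expker_integral(2)[OF assms] by (simp add: laplace_def)
    finally show ?case .
  qed
qed

text \<open>The majorant integrates exactly, so a term of order \<open>n\<close> in the Borel plane
  becomes one of size \<open>\<epsilon>^n\<close>.\<close>

lemma rreg_laplace_bound:
  assumes r: "rreg n C r" and "l > 0" "n > 0"
  shows "\<bar>laplace l (r t)\<bar> \<le> C * (1 / l) ^ n"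
proof -
  have "\<bar>laplace l (r t)\<bar> \<le> laplace l (\<lambda>p. C * (p ^ (n - 1) / fact (n - 1)))"
  proof (rule laplace_mono[OF rreg_laplace_integrable[OF r \<open>l > 0\<close>]])
    show "integrable lborel (\<lambda>p. expker l p * (C * (p ^ (n - 1) / fact (n - 1))))"
      using integrable_mult_right[OF laplace_power_over_fact(2)[OF \<open>l > 0\<close>, of "n - 1"], of C]
      by (simp add: mult_ac)
    show "\<bar>r t p\<bar> \<le> C * (p ^ (n - 1) / fact (n - 1))" if "p \<ge> 0" for p
      using r that unfolding rreg_def by (metis abs_of_nonneg times_divide_eq_right)
  qed
  also have "\<dots> = C * (1 / l) ^ Suc (n - 1)"
    by (simp only: laplace_cmult laplace_power_over_fact(1)[OF \<open>l > 0\<close>])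
  finally show ?thesis using \<open>n > 0\<close> by simp
qed

lemma laplace_continuous:
  fixes \<phi> :: "real \<Rightarrow> real \<Rightarrow> real"
  assumes cont: "continuous_on UNIV (\<lambda>(t, p). \<phi> t p)"
    and bd: "\<And>t p. p \<ge> 0 \<Longrightarrow> \<bar>\<phi> t p\<bar> \<le> M * exp (c * p)" and "c < l"
  shows "continuous_on UNIV (\<lambda>t. laplace l (\<phi> t))"
proof (intro continuous_at_imp_continuous_on ballI, subst continuous_at_sequentially, intro allI impI)
  fix t :: real and x :: "nat \<Rightarrow> real" assume x: "x \<longlonglongrightarrow> t"
  have c2: "continuous_on UNIV (\<lambda>p. \<phi> t p)" for t
  proof -
    have "continuous_on UNIV (\<lambda>p. (\<lambda>(t, p). \<phi> t p) (t, p))"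
      by (rule continuous_on_compose2[OF cont]) (auto intro!: continuous_intros)
    then show ?thesis by simp
  qed
  then have [measurable]: "\<phi> t \<in> borel_measurable borel" for t by (rule borel_measurable_continuous_onI)
  have "(\<lambda>i. LINT p|lborel. expker l p * \<phi> (x i) p) \<longlonglongrightarrow> (LINT p|lborel. expker l p * \<phi> t p)"
  proof (rule integral_dominated_convergence)
    show "integrable lborel (\<lambda>p. M * expker (l - c) p)"
      using expker_integral(1)[of "l - c"] \<open>c < l\<close> by (intro integrable_mult_right) auto
    show "AE p in lborel. (\<lambda>i. expker l p * \<phi> (x i) p) \<longlonglongrightarrow> expker l p * \<phi> t p"
    proof (intro AE_I2 tendsto_mult_left)
      fix p
      have "continuous_on UNIV (\<lambda>t. (\<lambda>(t, p). \<phi> t p) (t, p))"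
        by (rule continuous_on_compose2[OF cont]) (auto intro!: continuous_intros)
      then have "isCont (\<lambda>t. \<phi> t p) t" by (simp add: continuous_on_eq_continuous_at)
      then show "(\<lambda>i. \<phi> (x i) p) \<longlonglongrightarrow> \<phi> t p" using x by (rule isCont_tendsto_compose)
    qed
    have "\<bar>expker l p * \<phi> t p\<bar> \<le> M * expker (l - c) p" for t p
    proof (cases "p \<ge> 0")
      case True
      have "\<bar>expker l p * \<phi> t p\<bar> = expker l p * \<bar>\<phi> t p\<bar>" by (simp add: abs_mult)
      also have "\<dots> \<le> expker l p * (M * exp (c * p))" by (intro mult_left_mono bd True) simp
      also have "\<dots> = M * expker (l - c) p" by (simp add: expker_mult[symmetric] mult_ac)
      finally show ?thesis .
    qed (simp add: expker_def)
    then show "AE p in lborel. norm (expker l p * \<phi> (x i) p) \<le> M * expker (l - c) p" for i by simp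
  qed measurable
  then show "((\<lambda>t. laplace l (\<phi> t)) \<circ> x) \<longlonglongrightarrow> laplace l (\<phi> t)" by (simp add: laplace_def o_def)
qed

lemma rreg_laplace_continuous:
  assumes r: "rreg n C r" and "l > 0"
  shows "continuous_on UNIV (\<lambda>t. laplace l (r t))"
  by (rule laplace_continuous[OF _ rreg_exp_bound[OF r, of "l/2"]]) (use assms in \<open>auto simp: rreg_def\<close>)

text \<open>The instance of \<open>laplace_triangle\<close> in which the double integral
  factorizes.\<close>

lemma laplace_bconv:
  assumes a: "rreg m C a" and b: "rreg n D b" and "l > 0"
  shows "laplace l (bconv a b t) = laplace l (a t) * laplace l (b t)"
proof -
  let ?M = "C / (l/2) ^ (m - 1)" and ?N = "D / (l/2) ^ (n - 1)"
  have "laplace l (\<lambda>p. p * integral {0..1} (\<lambda>s. (\<lambda>q s. a t s * b t q) ((1 - s) * p) (s * p)))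
      = laplace l (\<lambda>q. laplace l ((\<lambda>q s. a t s * b t q) q))"
  proof (rule laplace_triangle(1))
    show "continuous_on UNIV (\<lambda>(q, s). a t s * b t q)"
      unfolding case_prod_unfold
      by (intro continuous_intros rreg_continuous2[OF a] rreg_continuous2[OF b])
    show "\<bar>a t s * b t q\<bar> \<le> (?M * ?N) * exp (l/2 * (q + s))" if "q \<ge> 0" "s \<ge> 0" for q s
    proof -
      have "\<bar>a t s * b t q\<bar> \<le> (?M * exp (l/2 * s)) * (?N * exp (l/2 * q))"
        unfolding abs_mult using rreg_exp_bound[OF a, of "l/2" s t] rreg_exp_bound[OF b, of "l/2" q t] that \<open>l > 0\<close>
        by (intro mult_mono) auto
      also have "\<dots> = (?M * ?N) * (exp (l/2 * q) * exp (l/2 * s))" by simp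
      also have "exp (l/2 * q) * exp (l/2 * s) = exp (l/2 * (q + s))"
        by (simp only: exp_add[symmetric] distrib_left)
      finally show ?thesis .
    qed
  qed (use \<open>l > 0\<close> in auto)
  moreover have "laplace l (\<lambda>s. a t s * b t q) = b t q * laplace l (a t)" for q
    using laplace_cmult[of l "b t q" "a t"] by (simp add: mult.commute)
  moreover have "laplace l (\<lambda>q. b t q * laplace l (a t)) = laplace l (a t) * laplace l (b t)"
    using laplace_cmult[of l "laplace l (a t)" "b t"] by (simp add: mult.commute)
  ultimately show ?thesis by (simp add: bconv_def[abs_def])
qed

lemma laplace_btrans:
  assumes h: "rreg n C h" and "l > 0"
  shows "laplace l (btrans h t) = laplace l (\<lambda>q. laplace l (h (t - q)))"
proof -
  let ?M = "C / (l/2) ^ (n - 1)"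
  have "laplace l (\<lambda>p. p * integral {0..1} (\<lambda>s. (\<lambda>q. h (t - q)) ((1 - s) * p) (s * p)))
      = laplace l (\<lambda>q. laplace l ((\<lambda>q. h (t - q)) q))"
  proof (rule laplace_triangle(1))
    show "continuous_on UNIV (\<lambda>(q, s). h (t - q) s)"
      unfolding case_prod_unfold by (intro rreg_continuous2[OF h] continuous_intros)
    show "\<bar>h (t - q) s\<bar> \<le> ?M * exp (l/2 * (q + s))" if "q \<ge> 0" "s \<ge> 0" for q s
    proof (rule order_trans[OF rreg_exp_bound[OF h, of "l/2" s]], use \<open>l > 0\<close> that in simp_all)
      show "C * exp (l * s / 2) / (l/2) ^ (n - Suc 0) \<le> C * exp (l * (q + s) / 2) / (l/2) ^ (n - Suc 0)"
        using that \<open>l > 0\<close> rreg_nonneg[OF h] by (intro divide_right_mono mult_left_mono) auto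
    qed
  qed (use \<open>l > 0\<close> in auto)
  then show ?thesis by (simp add: btrans_def[abs_def])
qed

lemma laplace_bprim:
  assumes h: "rreg n C h" and "l > 0"
  shows "laplace l (bprim P h t) = P * integral {0..1} (\<lambda>s. (1/2 - s) * laplace l (h (t - P * s)))"
proof -
  let ?M = "C / (l/2) ^ (n - 1)"
  have "laplace l (\<lambda>p. integral {0..1} (\<lambda>s. (1/2 - s) * h (t - P * s) p))
     = integral {0..1} (\<lambda>s. laplace l (\<lambda>p. (1/2 - s) * h (t - P * s) p))"
  proof (rule laplace_integral_swap(1))
    show "continuous_on UNIV (\<lambda>(s, p). (1/2 - s) * h (t - P * s) p)"
      unfolding case_prod_unfold by (intro continuous_intros rreg_continuous2[OF h])
    show "\<bar>(1/2 - s) * h (t - P * s) p\<bar> \<le> ?M * exp (l/2 * p)" if "s \<in> {0..1}" "p \<ge> 0" for s p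
    proof -
      have "\<bar>1/2 - s\<bar> * \<bar>h (t - P * s) p\<bar> \<le> 1 * \<bar>h (t - P * s) p\<bar>"
        using that by (intro mult_right_mono) (auto simp: abs_if)
      then show ?thesis
        using rreg_exp_bound[OF h, of "l/2" p "t - P * s"] that \<open>l > 0\<close> unfolding abs_mult by linarith
    qed
  qed (use \<open>l > 0\<close> in auto)
  then have "laplace l (\<lambda>p. P * integral {0..1} (\<lambda>s. (1/2 - s) * h (t - P * s) p))
     = P * integral {0..1} (\<lambda>s. (1/2 - s) * laplace l (h (t - P * s)))"
    unfolding laplace_cmult by simp
  then show ?thesis by (simp add: bprim_def[abs_def])
qed

lemma laplace_bmean:
  assumes h: "rreg n C h" and "l > 0"
  shows "laplace l (bmean P h t) = integral {0..1} (\<lambda>s. laplace l (h (P * s)))"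
proof -
  let ?M = "C / (l/2) ^ (n - 1)"
  have "laplace l (\<lambda>p. integral {0..1} (\<lambda>s. h (P * s) p)) = integral {0..1} (\<lambda>s. laplace l (\<lambda>p. h (P * s) p))"
  proof (rule laplace_integral_swap(1))
    show "continuous_on UNIV (\<lambda>(s, p). h (P * s) p)"
      unfolding case_prod_unfold by (intro continuous_intros rreg_continuous2[OF h])
    show "\<bar>h (P * s) p\<bar> \<le> ?M * exp (l/2 * p)" if "p \<ge> 0" for s p
      using rreg_exp_bound[OF h, of "l/2" p "P * s"] that \<open>l > 0\<close> by simp
  qed (use \<open>l > 0\<close> in auto)
  then show ?thesis by (simp add: bmean_def[abs_def])
qed

section \<open>Derivatives and means of sawtooth averages and delays\<close>

lemma real_antiderivative:
  fixes Y :: "real \<Rightarrow> real"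
  assumes "continuous_on UNIV Y"
  obtains G where "\<And>t. (G has_real_derivative Y t) (at t)"
proof -
  have "\<exists>F. \<forall>x::real. -\<infinity> < ereal x \<longrightarrow> ereal x < \<infinity> \<longrightarrow> (F has_vector_derivative Y x) (at x)"
    by (rule einterval_antiderivative) (use assms in \<open>auto simp: continuous_on_eq_continuous_at\<close>)
  then show ?thesis using that by (auto simp: has_real_derivative_iff_has_vector_derivative)
qed

lemma DERIV_real_continuous_on: "(\<And>t. (G has_real_derivative Y t) (at t)) \<Longrightarrow> continuous_on A G"
  by (meson DERIV_isCont continuous_at_imp_continuous_on)

text \<open>\<open>1/2 - s\<close> is the sawtooth Green's function of differentiation on periodic
  functions of mean zero. Integrating by parts against two successive primitives \<open>G\<close>
  and \<open>G2\<close> writes the average without an integral, so it can be differentiated although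
  \<open>Y\<close> is only continuous.\<close>

lemma sawtooth_average_derivative:
  fixes Y :: "real \<Rightarrow> real"
  assumes cont: "continuous_on UNIV Y" and per: "\<And>t. Y (t + P) = Y t" and "P > 0"
  shows "((\<lambda>t. P * integral {0..1} (\<lambda>s. (1/2 - s) * Y (t - P * s))) has_real_derivative
     Y t - integral {0..1} (\<lambda>s. Y (P * s))) (at t)"
proof -
  obtain G where G: "\<And>t. (G has_real_derivative Y t) (at t)" using real_antiderivative[OF cont] by blast
  obtain G2 where G2: "\<And>t. (G2 has_real_derivative G t) (at t)"
    using real_antiderivative[OF DERIV_real_continuous_on[OF G]] by blast
  have lin: "((\<lambda>s. t - P * s) has_real_derivative - P) (at s within S)" for t s S
    by (auto intro!: derivative_eq_intros)
  have shift: "((\<lambda>t. t - P) has_real_derivative 1) (at t)" for t by (auto intro!: derivative_eq_intros)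
  have eq: "P * integral {0..1} (\<lambda>s. (1/2 - s) * Y (t - P * s)) = (G (t - P) + G t) / 2 + (G2 (t - P) - G2 t) / P" for t
  proof -
    let ?K = "\<lambda>s. - (1/2 - s) * G (t - P * s) + G2 (t - P * s) / P"
    have d1: "((\<lambda>s. - (1/2 - s)) has_real_derivative 1) (at s within {0..1})" for s
      by (auto intro!: derivative_eq_intros)
    have d2: "((\<lambda>s. G (t - P * s)) has_real_derivative Y (t - P * s) * - P) (at s within {0..1})" for s
      by (rule DERIV_chain2[OF G lin])
    have d3: "((\<lambda>s. G2 (t - P * s)) has_real_derivative G (t - P * s) * - P) (at s within {0..1})" for s
      by (rule DERIV_chain2[OF G2 lin])
    have "(?K has_real_derivative P * ((1/2 - s) * Y (t - P * s))) (at s within {0..1})" for s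
      using DERIV_add[OF DERIV_mult[OF d1 d2] DERIV_cdivide[OF d3, of P]]
      by (rule DERIV_cong) (use \<open>P > 0\<close> in \<open>simp add: algebra_simps\<close>)
    then have "((\<lambda>s. P * ((1/2 - s) * Y (t - P * s))) has_integral (?K 1 - ?K 0)) {0..1}"
      by (intro fundamental_theorem_of_calculus) (auto simp: has_real_derivative_iff_has_vector_derivative)
    then have "integral {0..1} (\<lambda>s. P * ((1/2 - s) * Y (t - P * s))) = ?K 1 - ?K 0" by (rule integral_unique)
    then show ?thesis by (simp add: add_divide_distrib diff_divide_distrib)
  qed
  \<comment> \<open>The increment of a primitive over one period is \<open>P\<close> times the mean
    of \<open>Y\<close>, wherever the period starts.\<close>
  have const: "G t - G (t - P) = P * integral {0..1} (\<lambda>s. Y (P * s))" for t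
  proof -
    have per': "Y (s - P) = Y s" for s using per[of "s - P"] by simp
    have "((\<lambda>t. G t - G (t - P)) has_real_derivative 0) (at s)" for s
      using DERIV_diff[OF G DERIV_chain2[OF G shift]] by (rule DERIV_cong) (simp add: per')
    then have "G t - G (t - P) = G P - G (P - P)"
      using DERIV_isconst_all[of "\<lambda>t. G t - G (t - P)" t P] by blast
    moreover have "((\<lambda>s. P * Y (P * s)) has_integral (G (P * 1) - G (P * 0))) {0..1}"
    proof (intro fundamental_theorem_of_calculus)
      fix s :: real
      have l: "((\<lambda>s. P * s) has_real_derivative P) (at s within {0..1})" by (auto intro!: derivative_eq_intros)
      from DERIV_chain2[OF G this] show "((\<lambda>s. G (P * s)) has_vector_derivative P * Y (P * s)) (at s within {0..1})"
        by (simp add: has_real_derivative_iff_has_vector_derivative mult.commute)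
    qed auto
    then have "integral {0..1} (\<lambda>s. P * Y (P * s)) = G (P * 1) - G (P * 0)" by (rule integral_unique)
    ultimately show ?thesis by simp
  qed
  have "((\<lambda>t. (G (t - P) + G t) / 2 + (G2 (t - P) - G2 t) / P) has_real_derivative
     (Y (t - P) * 1 + Y t) / 2 + (G (t - P) * 1 - G t) / P) (at t)"
    by (intro DERIV_add DERIV_diff DERIV_cdivide DERIV_chain2[OF G shift] DERIV_chain2[OF G2 shift] G G2)
  moreover have "(Y (t - P) * 1 + Y t) / 2 + (G (t - P) * 1 - G t) / P = Y t - integral {0..1} (\<lambda>s. Y (P * s))"
  proof -
    have "(G (t - P) * 1 - G t) / P = - integral {0..1} (\<lambda>s. Y (P * s))"
      using const[of t] \<open>P > 0\<close> by (simp add: field_simps)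
    moreover have "Y (t - P) = Y t" using per[of "t - P"] by simp
    ultimately show ?thesis by simp
  qed
  ultimately show ?thesis unfolding eq by simp
qed

text \<open>Multiplied by \<open>exp (l * t)\<close> the function becomes the integral of
  \<open>exp (l * s) * H s\<close> over \<open>s \<le> t\<close>, whose increments are those of a
  primitive \<open>G\<close> of the integrand.\<close>

lemma laplace_shift_derivative:
  fixes H :: "real \<Rightarrow> real"
  assumes cont: "continuous_on UNIV H" and bd: "\<And>t. \<bar>H t\<bar> \<le> M" and "l > 0"
  shows "((\<lambda>t. laplace l (\<lambda>q. H (t - q))) has_real_derivative H t - l * laplace l (\<lambda>q. H (t - q))) (at t)"
proof -
  let ?Y = "\<lambda>t. laplace l (\<lambda>q. H (t - q))" and ?h = "\<lambda>s. exp (l * s) * H s"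
  have contH: "continuous_on UNIV (\<lambda>q. H (t - q))" for t
    by (rule continuous_on_compose2[OF cont]) (auto intro!: continuous_intros)
  then have [measurable]: "(\<lambda>q. H (t - q)) \<in> borel_measurable borel" for t
    by (rule borel_measurable_continuous_onI)
  have conth: "continuous_on A ?h" for A
    by (intro continuous_intros continuous_on_subset[OF cont]) auto
  obtain G where G: "\<And>t. (G has_real_derivative ?h t) (at t)" using real_antiderivative[OF conth] by blast
  have int: "integrable lborel (\<lambda>q. expker l q * H (t - q))" for t
    by (rule laplace_integrable[where M = M and c = 0]) (use bd \<open>l > 0\<close> in auto)
  have e: "exp (l * t) * (expker l (t - s) * H s) = indicator {..t} s * ?h s" for t s
    by (auto simp: expker_def indicator_def exp_add[symmetric] algebra_simps)
  have Yint: "integrable lborel (\<lambda>s. indicator {..t} s * ?h s)" for t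
    using lborel_integrable_real_affine[OF integrable_mult_right[OF int[of t], of "exp (l * t)"], of "-1" t]
    by (simp add: e)
  have Y: "exp (l * t) * ?Y t = (LINT s|lborel. indicator {..t} s * ?h s)" for t
    using lborel_integral_real_affine[of "-1" "\<lambda>q. exp (l * t) * (expker l q * H (t - q))" t]
    by (simp add: laplace_def e)
  have diff: "exp (l * b) * ?Y b - exp (l * a) * ?Y a = G b - G a" if "a < b" for a b
  proof -
    have "exp (l * b) * ?Y b - exp (l * a) * ?Y a = (LINT s|lborel. indicator {..b} s * ?h s - indicator {..a} s * ?h s)"
      unfolding Y by (rule Bochner_Integration.integral_diff[symmetric]) (rule Yint)+
    also have "\<dots> = (LINT s|lborel. indicator {a<..b} s * ?h s)"
      using that by (intro Bochner_Integration.integral_cong) (auto simp: indicator_def)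
    also have "\<dots> = (LINT s|lborel. indicator {a..b} s * ?h s)"
    proof (rule integral_cong_AE)
      have "?h \<in> borel_measurable borel" using conth by (rule borel_measurable_continuous_onI)
      then show "(\<lambda>s. indicator {a<..b} s * ?h s) \<in> borel_measurable lborel"
        "(\<lambda>s. indicator {a..b} s * ?h s) \<in> borel_measurable lborel" by simp_all
      show "AE s in lborel. indicator {a<..b} s * ?h s = indicator {a..b} s * ?h s"
        using AE_lborel_singleton[of a] by eventually_elim (auto simp: indicator_def)
    qed
    also have "\<dots> = (LINT s:{a..b}|lborel. ?h s)" by (simp add: set_lebesgue_integral_def)
    also have "\<dots> = integral {a..b} ?h"
      by (intro set_borel_integral_eq_integral borel_integrable_atLeastAtMost' conth)
    also have "\<dots> = G b - G a"
      by (intro integral_unique fundamental_theorem_of_calculus)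
         (use that G in \<open>auto simp: has_real_derivative_iff_has_vector_derivative intro: has_vector_derivative_at_within\<close>)
    finally show ?thesis .
  qed
  have "exp (l * s) * ?Y s = G s + (exp (l * 0) * ?Y 0 - G 0)" for s
    using diff[of s 0] diff[of 0 s] by (cases s "0::real" rule: linorder_cases) auto
  then have "?Y s = exp (- l * s) * (G s + (?Y 0 - G 0))" for s
    by (metis (no_types, lifting) add.commute exp_minus_inverse exp_zero mult.assoc mult.commute mult_1 mult_minus_left mult_zero_right)
  then have eq: "?Y = (\<lambda>s. exp (- l * s) * (G s + (?Y 0 - G 0)))" by (rule ext)
  have de: "((\<lambda>s. exp (- l * s)) has_real_derivative - l * exp (- l * t)) (at t)"
    by (auto intro!: derivative_eq_intros)
  have dg: "((\<lambda>s. G s + (?Y 0 - G 0)) has_real_derivative ?h t + 0) (at t)"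
    by (intro DERIV_add G DERIV_const)
  from DERIV_mult[OF de dg] have "(?Y has_real_derivative
     - l * exp (- l * t) * (G t + (?Y 0 - G 0)) + (?h t + 0) * exp (- l * t)) (at t)"
    unfolding eq[symmetric] .
  moreover have "- l * exp (- l * t) * (G t + (?Y 0 - G 0)) + (?h t + 0) * exp (- l * t) = H t - l * ?Y t"
  proof -
    have "?Y t = exp (- l * t) * (G t + (?Y 0 - G 0))" using eq by (rule fun_cong)
    moreover have "exp (l * t) * exp (- l * t) = 1" by (simp add: exp_minus)
    ultimately show ?thesis by (simp add: mult.assoc mult.left_commute[of _ "H t"])
  qed
  ultimately show ?thesis by simp
qed

text \<open>Integrate \<open>Y' = H - l Y\<close> over one period: the left side contributes nothing
  by periodicity, so the means of \<open>H\<close> and of \<open>l Y\<close> agree.\<close>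

lemma laplace_shift_mean_zero:
  fixes H :: "real \<Rightarrow> real"
  assumes cont: "continuous_on UNIV H" and per: "\<And>t. H (t + P) = H t" and bd: "\<And>t. \<bar>H t\<bar> \<le> M"
    and "l > 0" "P > 0" and mean: "integral {0..1} (\<lambda>s. H (P * s)) = 0"
  shows "integral {0..1} (\<lambda>s. laplace l (\<lambda>q. H (P * s - q))) = 0"
proof -
  let ?Y = "\<lambda>t. laplace l (\<lambda>q. H (t - q))"
  note d = laplace_shift_derivative[OF cont bd \<open>l > 0\<close>]
  have cY: "continuous_on UNIV ?Y" by (rule DERIV_real_continuous_on[OF d])
  have "?Y P = ?Y 0"
  proof -
    have "H (P - q) = H (0 - q)" for q using per[of "- q"] by (simp add: add.commute)
    then show ?thesis by simp
  qed
  have "((\<lambda>s. P * H (P * s) - l * P * ?Y (P * s)) has_integral (?Y (P * 1) - ?Y (P * 0))) {0..1}"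
  proof (intro fundamental_theorem_of_calculus)
    fix s :: real
    have lin: "((\<lambda>s. P * s) has_real_derivative P) (at s within {0..1})" by (auto intro!: derivative_eq_intros)
    from DERIV_chain2[OF d this]
    have "((\<lambda>s. ?Y (P * s)) has_real_derivative (H (P * s) - l * ?Y (P * s)) * P) (at s within {0..1})" .
    then show "((\<lambda>s. ?Y (P * s)) has_vector_derivative P * H (P * s) - l * P * ?Y (P * s)) (at s within {0..1})"
      unfolding has_real_derivative_iff_has_vector_derivative[symmetric]
      by (rule DERIV_cong) (simp add: algebra_simps)
  qed auto
  then have "integral {0..1} (\<lambda>s. P * H (P * s) - l * P * ?Y (P * s)) = 0"
    using \<open>?Y P = ?Y 0\<close> by (simp add: integral_unique)
  moreover have "integral {0..1} (\<lambda>s. P * H (P * s) - l * P * ?Y (P * s))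
     = P * integral {0..1} (\<lambda>s. H (P * s)) - l * P * integral {0..1} (\<lambda>s. ?Y (P * s))"
    by (subst integral_diff)
       (auto intro!: integrable_continuous_real continuous_intros continuous_on_compose2[OF cont] continuous_on_compose2[OF cY])
  ultimately show ?thesis using mean \<open>l > 0\<close> \<open>P > 0\<close> by simp
qed

section \<open>Periodicity of the terms and resummation of power series\<close>

definition per :: "real \<Rightarrow> (real \<Rightarrow> real \<Rightarrow> real) \<Rightarrow> bool" where
  "per P r \<longleftrightarrow> (\<forall>t p. r (t + P) p = r t p)"

lemma perD: "per P r \<Longrightarrow> r (t + P) p = r t p"
  by (simp add: per_def)

lemma per_fun: "per P r \<Longrightarrow> r (t + P) = r t"
  by (auto simp: per_def)

lemma perD': "per P r \<Longrightarrow> r (t + P - x) p = r (t - x) p"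
  using perD[of P r "t - x" p] by (simp add: algebra_simps)

lemma per_bpow: "(\<And>j. j \<le> n \<Longrightarrow> per P (u j)) \<Longrightarrow> per P (bpow u k n)"
proof (induction k arbitrary: n)
  case (Suc k)
  have "bconv (u i) (bpow u k (n - i)) (t + P) p = bconv (u i) (bpow u k (n - i)) t p" if "i \<le> n" for i t p
  proof -
    have "per P (u i)" "per P (bpow u k (n - i))" using Suc that by auto
    then show ?thesis by (simp add: bconv_def perD)
  qed
  then show ?case by (simp add: per_def)
qed auto

lemma per_bseries: "(\<And>j. j \<le> n \<Longrightarrow> per P (u j)) \<Longrightarrow> per P (bseries c A u n)"
  using per_bpow[of n P u] by (simp add: per_def bseries_def)

lemma per_bforce:
  assumes "\<And>x. F (x + P) = F x" "\<And>j. j \<le> n \<Longrightarrow> per P (u j)"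
  shows "per P (bforce c F u n)"
proof (cases "n = 1")
  case True
  have "F (t + P - p) = F (t - p)" for t p using assms(1)[of "t - p"] by (simp add: algebra_simps)
  then show ?thesis using True by (simp add: per_def bforce_def)
next
  case False
  have "per P (bseries c {..<n-1} u (n-1))" using assms by (intro per_bseries) auto
  then show ?thesis using False by (simp add: per_def bforce_def btrans_def perD')
qed

lemma per_bsol:
  assumes F: "\<And>x. F (x + P) = F x"
  shows "per P (bsol P c F n)"
proof (induction n rule: less_induct)
  case (less n)
  have u: "per P (trunc n (bsol P c F) j)" for j using less by (auto simp: trunc_def per_def)
  have "per P (bforce c F (trunc n (bsol P c F)) n)" by (intro per_bforce F u)
  then show ?case
    by (cases "n = 0") (simp_all add: per_def bsol_trunc bstep_def bprim_def bmean_def perD')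
qed

text \<open>Cauchy products of absolutely convergent series, repeated; the majorant \<beta> supplies
  absolute convergence for every power.\<close>

lemma Cauchy_power_sums:
  fixes \<phi> :: "real fps"
  assumes bd: "\<And>k n. \<bar>(\<phi> ^ Suc k) $ n\<bar> \<le> R ^ k * \<beta> n" and "summable \<beta>"
  shows "(\<lambda>n. (\<phi> ^ Suc k) $ n) sums (\<Sum>n. \<phi> $ n) ^ Suc k"
proof (induction k)
  case 0
  have "summable (\<lambda>n. \<phi> $ n)"
    by (rule summable_comparison_test'[OF \<open>summable \<beta>\<close>, of 0]) (use bd[of 0] in auto)
  then show ?case by (simp add: summable_sums)
next
  case (Suc k)
  have sm: "summable (\<lambda>n. norm ((\<phi> ^ Suc j) $ n))" for j
    by (rule summable_comparison_test'[OF summable_mult[OF \<open>summable \<beta>\<close>, of "R ^ j"], of 0]) (use bd in auto)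
  have "(\<lambda>n. \<Sum>i\<le>n. \<phi> $ i * (\<phi> ^ Suc k) $ (n - i)) sums ((\<Sum>n. \<phi> $ n) * (\<Sum>n. (\<phi> ^ Suc k) $ n))"
    by (rule Cauchy_product_sums) (use sm[of 0] sm[of k] in auto)
  then show ?case using Suc by (simp add: fps_mult_nth sums_iff atLeast0AtMost)
qed

text \<open>The two orders of summation are compared at the square cut-off \<open>k, n < N\<close>.
  Truncating a power costs \<open>R ^ k\<close> times the tail of \<beta>, and summed against
  \<open>c\<close> this is at most \<Gamma> times that tail. The inner range \<open>k < n\<close> is
  complete because \<open>(\<phi> ^ Suc k) $ n = 0\<close> for \<open>k \<ge> n\<close>.\<close>

lemma fps_composition_sums:
  fixes \<phi> :: "real fps" and c :: "nat \<Rightarrow> real"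
  assumes \<phi>0: "\<phi> $ 0 = 0" and bd: "\<And>k n. \<bar>(\<phi> ^ Suc k) $ n\<bar> \<le> R ^ k * \<beta> n" and \<beta>: "summable \<beta>"
    and "R \<ge> 0" and \<Gamma>: "\<And>N. (\<Sum>k<N. \<bar>c (Suc k)\<bar> * R ^ k) \<le> \<Gamma>"
    and S: "(\<lambda>k. c (Suc k) * (\<Sum>n. \<phi> $ n) ^ Suc k) sums S"
  shows "(\<lambda>n. \<Sum>k<n. c (Suc k) * (\<phi> ^ Suc k) $ n) sums S"
proof -
  define x where "x = (\<Sum>n. \<phi> $ n)"
  define tail where "tail N = (\<Sum>n. \<beta> (n + N))" for N
  have pw: "(\<lambda>n. (\<phi> ^ Suc k) $ n) sums x ^ Suc k" for k
    unfolding x_def by (rule Cauchy_power_sums[OF bd \<beta>])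
  have tail_bd: "\<bar>x ^ Suc k - (\<Sum>n<N. (\<phi> ^ Suc k) $ n)\<bar> \<le> R ^ k * tail N" for k N
  proof -
    have "(\<lambda>n. (\<phi> ^ Suc k) $ (n + N)) sums (x ^ Suc k - (\<Sum>n<N. (\<phi> ^ Suc k) $ n))"
      using pw[of k] by (simp add: sums_iff_shift)
    moreover have sb: "summable (\<lambda>n. R ^ k * \<beta> (n + N))" using \<beta> by (intro summable_mult) (simp add: summable_iff_shift)
    moreover have sa: "summable (\<lambda>n. \<bar>(\<phi> ^ Suc k) $ (n + N)\<bar>)"
      by (rule summable_comparison_test'[OF sb, of 0]) (use bd in auto)
    ultimately have "\<bar>x ^ Suc k - (\<Sum>n<N. (\<phi> ^ Suc k) $ n)\<bar> \<le> (\<Sum>n. \<bar>(\<phi> ^ Suc k) $ (n + N)\<bar>)"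
      using summable_rabs[OF sa] by (simp only: sums_iff)
    also have "\<dots> \<le> (\<Sum>n. R ^ k * \<beta> (n + N))" by (rule suminf_le[OF bd sa sb])
    also have "\<dots> = R ^ k * tail N" unfolding tail_def
      by (rule suminf_mult) (use \<beta> in \<open>simp add: summable_iff_shift\<close>)
    finally show ?thesis .
  qed
  have part: "(\<Sum>n<N. \<Sum>k<n. c (Suc k) * (\<phi> ^ Suc k) $ n) = (\<Sum>k<N. c (Suc k) * (\<Sum>n<N. (\<phi> ^ Suc k) $ n))" for N
  proof -
    have "(\<Sum>k<n. c (Suc k) * (\<phi> ^ Suc k) $ n) = (\<Sum>k<N. c (Suc k) * (\<phi> ^ Suc k) $ n)" if "n < N" for n
    proof (rule sum.mono_neutral_left)
      show "\<forall>i\<in>{..<N} - {..<n}. c (Suc i) * (\<phi> ^ Suc i) $ n = 0"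
        using startsby_zero_power_prefix[OF \<phi>0] by (auto simp del: power_Suc)
    qed (use that in auto)
    then have "(\<Sum>n<N. \<Sum>k<n. c (Suc k) * (\<phi> ^ Suc k) $ n) = (\<Sum>n<N. \<Sum>k<N. c (Suc k) * (\<phi> ^ Suc k) $ n)"
      by (rule sum.cong[OF refl]) (simp only: lessThan_iff)
    also have "\<dots> = (\<Sum>k<N. \<Sum>n<N. c (Suc k) * (\<phi> ^ Suc k) $ n)" by (rule sum.swap)
    finally show ?thesis by (simp only: sum_distrib_left)
  qed
  have tail0: "tail \<longlonglongrightarrow> 0"
    unfolding tail_def[abs_def] using suminf_exist_split2[OF \<beta>] .
  have "(\<lambda>N. (\<Sum>k<N. c (Suc k) * (\<Sum>n<N. (\<phi> ^ Suc k) $ n)) - (\<Sum>k<N. c (Suc k) * x ^ Suc k)) \<longlonglongrightarrow> 0"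
  proof (rule Lim_null_comparison[OF always_eventually])
    show "\<forall>N. norm ((\<Sum>k<N. c (Suc k) * (\<Sum>n<N. (\<phi> ^ Suc k) $ n)) - (\<Sum>k<N. c (Suc k) * x ^ Suc k)) \<le> \<Gamma> * \<bar>tail N\<bar>"
    proof
      fix N
      have "norm ((\<Sum>k<N. c (Suc k) * (\<Sum>n<N. (\<phi> ^ Suc k) $ n)) - (\<Sum>k<N. c (Suc k) * x ^ Suc k))
          = norm (\<Sum>k<N. c (Suc k) * ((\<Sum>n<N. (\<phi> ^ Suc k) $ n) - x ^ Suc k))"
        by (simp only: sum_subtractf[symmetric] right_diff_distrib)
      also have "\<dots> \<le> (\<Sum>k<N. \<bar>c (Suc k)\<bar> * (R ^ k * \<bar>tail N\<bar>))"
      proof (rule sum_norm_le)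
        fix k
        have "\<bar>(\<Sum>n<N. (\<phi> ^ Suc k) $ n) - x ^ Suc k\<bar> \<le> R ^ k * tail N"
          using tail_bd[of k N] by (simp only: abs_minus_commute)
        also have "\<dots> \<le> R ^ k * \<bar>tail N\<bar>" using \<open>R \<ge> 0\<close> by (intro mult_left_mono) auto
        finally show "norm (c (Suc k) * ((\<Sum>n<N. (\<phi> ^ Suc k) $ n) - x ^ Suc k)) \<le> \<bar>c (Suc k)\<bar> * (R ^ k * \<bar>tail N\<bar>)"
          by (simp add: abs_mult mult_left_mono del: power_Suc)
      qed
      also have "\<dots> = (\<Sum>k<N. \<bar>c (Suc k)\<bar> * R ^ k) * \<bar>tail N\<bar>" by (simp only: sum_distrib_right mult.assoc)
      also have "\<dots> \<le> \<Gamma> * \<bar>tail N\<bar>" by (intro mult_right_mono \<Gamma>) auto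
      finally show "norm ((\<Sum>k<N. c (Suc k) * (\<Sum>n<N. (\<phi> ^ Suc k) $ n)) - (\<Sum>k<N. c (Suc k) * x ^ Suc k)) \<le> \<Gamma> * \<bar>tail N\<bar>" .
    qed
    have "(\<lambda>N. \<Gamma> * \<bar>tail N\<bar>) \<longlonglongrightarrow> \<Gamma> * \<bar>0\<bar>" by (intro tendsto_intros tail0)
    then show "(\<lambda>N. \<Gamma> * \<bar>tail N\<bar>) \<longlonglongrightarrow> 0" by simp
  qed
  moreover have "(\<lambda>N. \<Sum>k<N. c (Suc k) * x ^ Suc k) \<longlonglongrightarrow> S" using S by (simp add: sums_def x_def)
  ultimately have "(\<lambda>N. (\<Sum>k<N. c (Suc k) * (\<Sum>n<N. (\<phi> ^ Suc k) $ n))) \<longlonglongrightarrow> 0 + S"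
    using tendsto_add by fastforce
  then show ?thesis unfolding sums_def part by simp
qed

lemma summable_inverse_squares: "summable (\<lambda>n. B * (1 / (real n)\<^sup>2))"
  using inverse_power_summable[of 2, where ?'a = real] by (intro summable_mult) (simp add: divide_inverse)

lemma suminf_inverse_squares_le: "(\<Sum>n. 1 / (real n)\<^sup>2) \<le> 2"
proof (rule suminf_le_const)
  show "summable (\<lambda>n. 1 / (real n)\<^sup>2)" using summable_inverse_squares[of 1] by simp
  fix N
  show "(\<Sum>n<N. 1 / (real n)\<^sup>2) \<le> 2"
  proof -
    have "(\<Sum>n<N. 1 / (real n)\<^sup>2) \<le> (\<Sum>n\<le>Suc N. 1 / (real n)\<^sup>2)" by (intro sum_mono2) auto
    also have "\<dots> \<le> 2 - 1 / real (Suc N)" by (rule sum_inverse_squares_le) simp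
    also have "\<dots> \<le> 2" by simp
    finally show ?thesis .
  qed
qed

section \<open>The periodic solution\<close>

text \<open>\<open>c\<close> will hold the Taylor coefficients of \<open>g\<close> at
  \<open>c0\<close>, and \<open>Fr t\<close> will be \<open>f (\<omega> * t) - g c0\<close>, whose
  mean over the period \<open>P\<close> is zero by \<open>g c0 = f_0\<close>. The inequalities in
  the last lines are the smallness conditions of \<open>bnd_bsol\<close>; \<open>z\<close> becomes
  the upper limit for \<epsilon>.\<close>

locale borel_recursion =
  fixes \<kappa> P CF B z \<rho> \<Gamma> :: real and c :: "nat \<Rightarrow> real" and F :: "complex \<Rightarrow> complex" and Fr :: "real \<Rightarrow> real"
  assumes pos: "\<kappa> > 0" "P > 0" "B > 0" "z > 0" "\<rho> > 0"
    and F_hol: "F holomorphic_on {x. \<bar>Im x\<bar> < \<kappa>}" and F_bd: "\<And>x. \<bar>Im x\<bar> < \<kappa> \<Longrightarrow> norm (F x) \<le> CF"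
    and F_real: "\<And>x. F (of_real x) = of_real (Fr x)" and Fr_per: "\<And>x. Fr (x + P) = Fr x"
    and Fr_mean: "integral {0..1} (\<lambda>s. Fr (P * s)) = 0"
    and \<Gamma>: "\<And>N. (\<Sum>k<N. \<bar>c (Suc k)\<bar> * \<rho> ^ k) \<le> \<Gamma>" and B: "8 * B \<le> \<rho>" "8 * B * \<Gamma> \<le> \<rho> * \<bar>c 1\<bar> / 2"
    and c1: "c 1 \<noteq> 0" and z: "z * P * CF \<le> B" "4 * P * \<Gamma> * z \<le> 1 / 2"
begin

abbreviation uc :: "nat \<Rightarrow> complex \<Rightarrow> complex \<Rightarrow> complex" where "uc \<equiv> bsol P c F"
abbreviation u :: "nat \<Rightarrow> real \<Rightarrow> real \<Rightarrow> real" where "u \<equiv> bsol P c Fr"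

lemma bihol_uc: "bihol \<kappa> (uc n)" by (rule bihol_bsol[OF F_hol])

lemma bnd_uc: "bnd \<kappa> n (bcoef B z n) (uc n)"
  by (rule bnd_bsol[OF F_bd _ pos(4) _ pos(5) \<Gamma> B c1 z]) (use pos in auto)

lemma restr_u: "real_restr (uc n) (u n)" by (rule real_restr_bsol) (rule F_real)

lemma per_u: "per P (u n)" by (rule per_bsol) (rule Fr_per)

lemma \<Gamma>': "(\<Sum>k<N. \<bar>c (Suc k)\<bar> * (8 * B) ^ k) \<le> \<Gamma>"
  by (rule order_trans[OF sum_mono \<Gamma>]) (use B pos in \<open>intro mult_left_mono power_mono, auto\<close>)

lemma reg_u: "rreg n (bcoef B z n) (u n)"
  by (rule rreg_of_restr[OF bihol_uc bnd_uc restr_u pos(1)])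

lemma reg_pow: "rreg n ((8 * B) ^ k * bcoef B z n) (bpow u k n)"
  by (rule rreg_of_restr[OF bihol_bpow[OF bihol_uc] bnd_bpow[OF _ _ bnd_uc] real_restr_bpow[OF restr_u] pos(1)])
     (use pos in auto)

lemma reg_series: "finite A \<Longrightarrow> rreg n ((\<Sum>k\<in>A. \<bar>c (Suc k)\<bar> * (8 * B) ^ k) * bcoef B z n) (bseries c A u n)"
  by (rule rreg_of_restr[OF bihol_bseries[OF bihol_uc] bnd_bseries[OF _ _ bnd_uc] real_restr_bseries[OF restr_u] pos(1)])
     (use pos in auto)

lemma bihol_force: "bihol \<kappa> (bforce c F uc n)" by (rule bihol_bforce[OF F_hol bihol_uc])

lemma bnd_force: "n > 0 \<Longrightarrow> bnd \<kappa> n (if n = 1 then CF else \<Gamma> * bcoef B z (n - 1)) (bforce c F uc n)"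
  by (rule bnd_bforce[OF F_bd _ bnd_uc _ _ \<Gamma>']) (use pos in auto)

lemma restr_force: "real_restr (bforce c F uc n) (bforce c Fr u n)"
  by (rule real_restr_bforce) (rule F_real, rule restr_u)

lemma reg_force: "n > 0 \<Longrightarrow> rreg n (if n = 1 then CF else \<Gamma> * bcoef B z (n - 1)) (bforce c Fr u n)"
  by (rule rreg_of_restr[OF bihol_force bnd_force restr_force pos(1)])

lemma reg_prim: "n > 0 \<Longrightarrow> rreg n (P / 2 * (if n = 1 then CF else \<Gamma> * bcoef B z (n - 1))) (bprim P (bforce c Fr u n))"
  by (rule rreg_of_restr[OF bihol_bprim[OF bihol_force] bnd_bprim[OF bnd_force] real_restr_bprim[OF restr_force] pos(1)])
     (use pos in auto)

lemma rreg_add: "rreg n C a \<Longrightarrow> rreg n D b \<Longrightarrow> rreg n (C + D) (\<lambda>t p. a t p + b t p)"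
  unfolding rreg_def
  by (auto simp: case_prod_unfold distrib_right add_divide_distrib intro!: continuous_intros order_trans[OF abs_triangle_ineq] add_mono)

lemma rreg_cmult: "rreg n C a \<Longrightarrow> rreg n (\<bar>x\<bar> * C) (\<lambda>t p. x * a t p)"
  unfolding rreg_def abs_mult
  by (auto simp: case_prod_unfold mult.assoc intro!: continuous_intros)
     (metis (no_types, lifting) abs_ge_zero mult_left_mono times_divide_eq_right)

text \<open>Time-domain counterparts for \<open>l = 1 / \<epsilon>\<close>: the orders of the
  solution, of its velocity, of the expansion of \<open>g\<close> and of the total force. The index
  of \<open>H\<close> is one lower than that of the \<open>Y\<close> it drives, because the force
  carries a factor \<epsilon>. The formal variable of \<phi> counts the order; it is not
  \<epsilon>.\<close>

definition U :: "real \<Rightarrow> nat \<Rightarrow> real \<Rightarrow> real" where "U l n t = laplace l (u n t)"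
definition Y :: "real \<Rightarrow> nat \<Rightarrow> real \<Rightarrow> real" where "Y l n t = laplace l (bforce c Fr u n t)"
definition W :: "real \<Rightarrow> nat set \<Rightarrow> nat \<Rightarrow> real \<Rightarrow> real" where "W l A n t = laplace l (bseries c A u n t)"
definition H :: "real \<Rightarrow> nat \<Rightarrow> real \<Rightarrow> real" where "H l m t = (if m = 0 then Fr t else - W l {..<m} m t)"
definition \<phi> :: "real \<Rightarrow> real \<Rightarrow> real fps" where "\<phi> l t = Abs_fps (\<lambda>n. U l n t)"

lemma U_0 [simp]: "U l 0 t = 0"
  by (simp add: U_def laplace_def)

lemma U_rec:
  assumes "n > 0" "l > 0"
  shows "U l n t = P * integral {0..1} (\<lambda>s. (1/2 - s) * Y l n (t - P * s))
     - integral {0..1} (\<lambda>x. P * integral {0..1} (\<lambda>s. (1/2 - s) * Y l n (P * x - P * s)) + 1 / c 1 * W l {1..<n} n (P * x))"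
proof -
  let ?h = "\<lambda>t p. bprim P (bforce c Fr u n) t p + 1 / c 1 * bseries c {1..<n} u n t p"
  have h: "rreg n (P / 2 * (if n = 1 then CF else \<Gamma> * bcoef B z (n - 1)) + \<bar>1 / c 1\<bar> * ((\<Sum>k\<in>{1..<n}. \<bar>c (Suc k)\<bar> * (8 * B) ^ k) * bcoef B z n)) ?h"
    by (intro rreg_add rreg_cmult reg_prim reg_series assms) auto
  have prim: "laplace l (bprim P (bforce c Fr u n) t) = P * integral {0..1} (\<lambda>s. (1/2 - s) * Y l n (t - P * s))" for t
    unfolding Y_def by (rule laplace_bprim[OF reg_force[OF assms(1)] assms(2)])
  have lh: "laplace l (?h t) = P * integral {0..1} (\<lambda>s. (1/2 - s) * Y l n (t - P * s)) + 1 / c 1 * W l {1..<n} n t" for t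
  proof -
    have i2: "integrable lborel (\<lambda>p. expker l p * (1 / c 1 * bseries c {1..<n} u n t p))"
      by (rule rreg_laplace_integrable[OF rreg_cmult[OF reg_series] assms(2)]) simp
    show ?thesis
      using laplace_add[OF rreg_laplace_integrable[OF reg_prim[OF assms(1)] assms(2)] i2] laplace_cmult[of l "1 / c 1"]
      by (simp add: prim W_def)
  qed
  have mean: "laplace l (bmean P ?h t) = integral {0..1} (\<lambda>x. laplace l (?h (P * x)))"
    by (rule laplace_bmean[OF h assms(2)])
  have "bmean P ?h t p = bmean P ?h 0 0 + (bmean P ?h t p - bmean P ?h 0 0)" for p by simp
  have im: "integrable lborel (\<lambda>p. expker l p * bmean P ?h t p)"
  proof -
    have "bmean P ?h t = bmean P ?h 0" by (simp add: bmean_def[abs_def])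
    let ?hc = "\<lambda>t p. bprim P (bforce c F uc n) t p + of_real (1 / c 1) * bseries c {1..<n} uc n t p"
    have 1: "bihol \<kappa> (bmean P ?hc)"
      by (intro bihol_bmean bihol_add bihol_mult bihol_const bihol_bprim bihol_force bihol_bseries bihol_uc)
    have 2: "bnd \<kappa> n (P / 2 * (if n = 1 then CF else \<Gamma> * bcoef B z (n - 1)) + norm (complex_of_real (1 / c 1)) * ((\<Sum>k\<in>{1..<n}. \<bar>c (Suc k)\<bar> * (8 * B) ^ k) * bcoef B z n)) (bmean P ?hc)"
      by (intro bnd_bmean bnd_add bnd_cmult bnd_bprim bnd_force bnd_bseries bnd_uc assms) (use pos in auto)
    have 3: "real_restr (bmean P ?hc) (bmean P ?h)"
      by (rule real_restr_bmean)
         (use real_restr_bprim[OF restr_force, of P] real_restr_bseries[OF restr_u, where n = n and c = c and A = "{1..<n}"] in \<open>simp add: real_restr_def\<close>)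
    show ?thesis by (rule rreg_laplace_integrable[OF rreg_of_restr[OF 1 2 3 pos(1)] assms(2)])
  qed
  have "u n t = (\<lambda>p. bprim P (bforce c Fr u n) t p - bmean P ?h t p)"
    by (subst bsol_eq[OF assms(1)]) (simp add: bstep_def[abs_def])
  then have "U l n t = laplace l (bprim P (bforce c Fr u n) t) - laplace l (bmean P ?h t)"
    unfolding U_def by (simp only:) (rule laplace_diff[OF rreg_laplace_integrable[OF reg_prim[OF assms(1)] assms(2)] im])
  then show ?thesis unfolding prim mean lh .
qed

text \<open>Laplace integrals turn convolutions into products, so a graded convolution power becomes
  a coefficient of an ordinary power of the generating series.\<close>

lemma laplace_bpow:
  assumes "l > 0"
  shows "laplace l (bpow u k n t) = (\<phi> l t ^ Suc k) $ n"
proof (induction k arbitrary: n)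
  case 0
  then show ?case by (simp add: \<phi>_def U_def)
next
  case (Suc k)
  have "laplace l (bpow u (Suc k) n t) = laplace l (\<lambda>p. \<Sum>i\<le>n. bconv (u i) (bpow u k (n - i)) t p)" by simp
  also have "\<dots> = (\<Sum>i\<le>n. laplace l (bconv (u i) (bpow u k (n - i)) t))"
  proof (rule laplace_sum)
    fix i assume "i \<in> {..n}"
    show "integrable lborel (\<lambda>p. expker l p * bconv (u i) (bpow u k (n - i)) t p)"
    \<comment> \<open>The estimate for convolutions needs positive orders; in the excluded cases a
      factor is identically 0.\<close>
    proof (cases "i = 0 \<or> n - i = 0")
      case True
      then have "bconv (u i) (bpow u k (n - i)) = (\<lambda>t p. 0)" by auto
      then show ?thesis by simp
    next
      case False
      have "rreg (i + (n - i)) (bcoef B z i * ((8 * B) ^ k * bcoef B z (n - i))) (bconv (u i) (bpow u k (n - i)))"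
        by (rule rreg_of_restr[OF bihol_bconv[OF bihol_uc bihol_bpow[OF bihol_uc]] bnd_bconv[OF bnd_uc bnd_bpow[OF _ _ bnd_uc]]
               real_restr_bconv[OF restr_u real_restr_bpow[OF restr_u]] pos(1)])
           (use False pos in auto)
      then show ?thesis using assms by (rule rreg_laplace_integrable)
    qed
  qed
  also have "\<dots> = (\<Sum>i\<le>n. U l i t * (\<phi> l t ^ Suc k) $ (n - i))"
    by (simp add: laplace_bconv[OF reg_u reg_pow assms] Suc U_def del: power_Suc)
  also have "\<dots> = (\<phi> l t ^ Suc (Suc k)) $ n"
    by (subst (2) power_Suc) (simp add: fps_mult_nth atLeast0AtMost \<phi>_def del: power_Suc)
  finally show ?case .
qed

lemma W_eq:
  assumes "l > 0" "finite A"
  shows "W l A n t = (\<Sum>k\<in>A. c (Suc k) * (\<phi> l t ^ Suc k) $ n)"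
proof -
  have "W l A n t = laplace l (\<lambda>p. \<Sum>k\<in>A. c (Suc k) * bpow u k n t p)"
    by (simp add: W_def bseries_def[abs_def])
  also have "\<dots> = (\<Sum>k\<in>A. laplace l (\<lambda>p. c (Suc k) * bpow u k n t p))"
    by (rule laplace_sum) (rule rreg_laplace_integrable[OF rreg_cmult[OF reg_pow] assms(1)])
  finally show ?thesis by (simp add: laplace_cmult laplace_bpow[OF assms(1)] del: power_Suc)
qed

lemma Y_Suc:
  assumes "l > 0"
  shows "Y l (Suc m) t = laplace l (\<lambda>q. H l m (t - q))"
proof (cases "m = 0")
  case True
  then show ?thesis by (simp add: Y_def H_def bforce_def[abs_def])
next
  case False
  have "Y l (Suc m) t = laplace l (\<lambda>p. - btrans (bseries c {..<m} u m) t p)"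
    using False by (simp add: Y_def bforce_def[abs_def])
  also have "\<dots> = - laplace l (\<lambda>q. W l {..<m} m (t - q))"
    unfolding laplace_uminus W_def by (subst laplace_btrans[OF reg_series assms]) auto
  finally show ?thesis using False by (simp add: H_def laplace_uminus[symmetric])
qed

text \<open>Majorant of the terms in the time domain: for \<open>1 \<le> l * z\<close> the power
  \<open>(1 / l) ^ n\<close> absorbs the \<open>z^(-n)\<close> of \<open>bcoef\<close> and leaves a
  summable bound that is uniform in \<open>l\<close>.\<close>

definition \<beta> :: "nat \<Rightarrow> real" where "\<beta> n = B * (1 / (real n)\<^sup>2)"

lemma \<beta>_nonneg: "0 \<le> \<beta> n" using pos by (simp add: \<beta>_def)

lemma summable_\<beta>: "summable \<beta>"
  unfolding \<beta>_def[abs_def] by (rule summable_inverse_squares)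

lemma suminf_\<beta>_le: "(\<Sum>n. \<beta> n) \<le> 2 * B"
proof -
  have "(\<Sum>n. \<beta> n) = B * (\<Sum>n. 1 / (real n)\<^sup>2)"
    unfolding \<beta>_def[abs_def] by (rule suminf_mult) (use summable_inverse_squares[of 1] in simp)
  also have "\<dots> \<le> B * 2" using pos by (intro mult_left_mono suminf_inverse_squares_le) auto
  finally show ?thesis by simp
qed

lemma bcoef_scaled: "1 \<le> l * z \<Longrightarrow> bcoef B z n * (1 / l) ^ n = \<beta> n * (1 / (l * z)) ^ n"
  by (simp add: bcoef_def \<beta>_def power_divide power_mult_distrib mult_ac)

lemma bcoef_scaled_le: "1 \<le> l * z \<Longrightarrow> bcoef B z n * (1 / l) ^ n \<le> \<beta> n"
proof -
  assume l: "1 \<le> l * z"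
  have "(1 / (l * z)) ^ n \<le> 1" using l by (intro power_le_one) auto
  then have "\<beta> n * (1 / (l * z)) ^ n \<le> \<beta> n * 1" by (intro mult_left_mono \<beta>_nonneg)
  then show ?thesis using bcoef_scaled[OF l, of n] by simp
qed

lemma l_pos: "1 \<le> l * z \<Longrightarrow> l > 0"
  using pos by (metis less_le_trans mult_neg_pos not_less_iff_gr_or_eq zero_less_one mult_zero_left)

lemma Fr_bound: "\<bar>Fr t\<bar> \<le> CF"
  using F_bd[of "of_real t"] pos by (simp add: F_real)

lemma Fr_continuous: "continuous_on UNIV Fr"
proof -
  have "continuous_on UNIV (\<lambda>t::real. F (of_real t))"
    by (rule continuous_on_compose2[OF holomorphic_on_imp_continuous_on[OF F_hol]])
       (use pos in \<open>auto intro!: continuous_intros\<close>)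
  from continuous_on_Re[OF this] show ?thesis by (simp add: F_real)
qed

definition hb :: "nat \<Rightarrow> real" where "hb m = (if m = 0 then CF else \<Gamma> * \<beta> m)"

lemma summable_hb: "summable hb"
proof -
  have "summable (\<lambda>m. \<Gamma> * \<beta> (Suc m))"
    using summable_\<beta> by (intro summable_mult) (simp add: summable_Suc_iff)
  then show ?thesis by (subst summable_Suc_iff[symmetric]) (simp add: hb_def)
qed

lemma \<Gamma>_nonneg: "0 \<le> \<Gamma>" using \<Gamma>[of 0] by simp

lemma H_bound:
  assumes "1 \<le> l * z"
  shows "\<bar>H l m t\<bar> \<le> hb m"
proof (cases "m = 0")
  case False
  have "\<bar>W l {..<m} m t\<bar> \<le> ((\<Sum>k<m. \<bar>c (Suc k)\<bar> * (8 * B) ^ k) * bcoef B z m) * (1 / l) ^ m"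
    unfolding W_def by (rule rreg_laplace_bound[OF reg_series l_pos[OF assms]]) (use False in auto)
  also have "\<dots> = (\<Sum>k<m. \<bar>c (Suc k)\<bar> * (8 * B) ^ k) * (bcoef B z m * (1 / l) ^ m)" by simp
  also have "\<dots> \<le> \<Gamma> * \<beta> m"
    using \<Gamma>' bcoef_scaled_le[OF assms] pos l_pos[OF assms]
    by (intro mult_mono \<Gamma>_nonneg) (auto simp: bcoef_def)
  finally show ?thesis using False by (simp add: H_def hb_def)
qed (simp add: H_def hb_def Fr_bound)

lemma H_continuous: "l > 0 \<Longrightarrow> continuous_on UNIV (H l m)"
proof (cases "m = 0")
  case True
  then show ?thesis using Fr_continuous by (simp add: H_def[abs_def])
next
  case False
  assume "l > 0"
  then have "continuous_on UNIV (\<lambda>t. - W l {..<m} m t)"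
    unfolding W_def by (intro continuous_intros rreg_laplace_continuous[OF reg_series]) auto
  then show ?thesis using False by (simp add: H_def[abs_def])
qed

lemma H_per: "H l m (t + P) = H l m t"
  using Fr_per per_fun[OF per_bseries[of m P u c "{..<m}", OF per_u]] by (simp add: H_def W_def)

lemma Y_per: "l > 0 \<Longrightarrow> Y l (Suc m) (t + P) = Y l (Suc m) t"
proof -
  have "H l m (t + P - q) = H l m (t - q)" for q using H_per[of l m "t - q"] by (simp add: algebra_simps)
  then show "l > 0 \<Longrightarrow> Y l (Suc m) (t + P) = Y l (Suc m) t" by (simp add: Y_Suc)
qed

lemma U_per: "U l n (t + P) = U l n t"
  using per_fun[OF per_u] by (simp add: U_def)

lemma Y_deriv:
  assumes "1 \<le> l * z"
  shows "(Y l (Suc m) has_real_derivative H l m t - l * Y l (Suc m) t) (at t)"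
proof -
  note l = l_pos[OF assms]
  have "Y l (Suc m) = (\<lambda>t. laplace l (\<lambda>q. H l m (t - q)))" using Y_Suc[OF l] by (rule ext)
  then show ?thesis using laplace_shift_derivative[OF H_continuous[OF l] H_bound[OF assms] l] by simp
qed

lemma Y_continuous: "1 \<le> l * z \<Longrightarrow> continuous_on A (Y l (Suc m))"
  by (rule DERIV_real_continuous_on[OF Y_deriv])

lemma W_continuous: "l > 0 \<Longrightarrow> finite A \<Longrightarrow> continuous_on UNIV (W l A n)"
  unfolding W_def[abs_def] by (rule rreg_laplace_continuous[OF reg_series])

lemma prim_continuous:
  assumes "1 \<le> l * z"
  shows "continuous_on UNIV (\<lambda>t. P * integral {0..1} (\<lambda>s. (1/2 - s) * Y l (Suc m) (t - P * s)))"
  by (rule DERIV_real_continuous_on,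
      rule sawtooth_average_derivative[OF Y_continuous[OF assms] Y_per[OF l_pos[OF assms]] pos(2)])

lemma integral_01_compose:
  "continuous_on UNIV h \<Longrightarrow> (\<lambda>s. h (P * s)) integrable_on {0..1}" for h :: "real \<Rightarrow> real"
  by (rule integrable_continuous_real) (auto intro!: continuous_intros continuous_on_compose2[of UNIV h])

text \<open>The solvability condition of each order. For \<open>m > 0\<close> the part of
  \<open>g\<close> of order \<open>m\<close> is \<open>c 1 * U l m\<close> plus the nonlinear part
  \<open>?W\<close>, and the constant \<open>K\<close> subtracted from \<open>?A\<close> in
  \<open>bstep\<close> is the mean of \<open>?A + ?W / c 1\<close>, so the two means cancel. For
  \<open>m = 0\<close> it is the assumption on \<open>Fr\<close>.\<close>

lemma H_mean:
  assumes "1 \<le> l * z"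
  shows "integral {0..1} (\<lambda>s. H l m (P * s)) = 0"
proof (cases m)
  case 0
  then show ?thesis using Fr_mean by (simp add: H_def)
next
  case (Suc m')
  note l = l_pos[OF assms]
  let ?A = "\<lambda>t. P * integral {0..1} (\<lambda>s. (1/2 - s) * Y l m (t - P * s))" and ?W = "W l {1..<m} m"
  have cA: "continuous_on UNIV ?A" and cW: "continuous_on UNIV ?W"
    using prim_continuous[OF assms, of m'] W_continuous[OF l] Suc by auto
  have mi: "integral {0..1} (\<lambda>x. ?A (P * x) + 1 / c 1 * ?W (P * x))
      = integral {0..1} (\<lambda>x. ?A (P * x)) + 1 / c 1 * integral {0..1} (\<lambda>x. ?W (P * x))"
    using integral_add[OF integral_01_compose[OF cA] integrable_on_cmult_left[OF integral_01_compose[OF cW], of "1 / c 1"]]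
    by (simp only: integral_mult_right of_real_eq_id id_apply)
  define K where "K = integral {0..1} (\<lambda>x. ?A (P * x) + 1 / c 1 * ?W (P * x))"
  have U: "U l m t = ?A t - K" for t unfolding K_def by (rule U_rec) (use Suc l in auto)
  have WU: "W l {..<m} m t = c 1 * U l m t + ?W t" for t
  proof -
    have "{..<m} = insert 0 {1..<m}" using Suc by auto
    then show ?thesis using W_eq[OF l, of "{..<m}"] W_eq[OF l, of "{1..<m}"] by (simp add: \<phi>_def)
  qed
  have "H l m t = c 1 * K - (c 1 * ?A t + ?W t)" for t
  proof -
    have gen: "- (a * (b - k) + w) = a * k - (a * b + w)" for a b k w :: real by (simp add: algebra_simps)
    have "H l m t = - W l {..<m} m t" using Suc by (simp add: H_def)
    then show ?thesis unfolding WU U gen .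
  qed
  then have "integral {0..1} (\<lambda>s. H l m (P * s)) = integral {0..1} (\<lambda>s. c 1 * K - (c 1 * ?A (P * s) + ?W (P * s)))"
    by simp
  also have "\<dots> = c 1 * K - (c 1 * integral {0..1} (\<lambda>s. ?A (P * s)) + integral {0..1} (\<lambda>s. ?W (P * s)))"
  proof -
    have i: "(\<lambda>s. c 1 * ?A (P * s)) integrable_on {0..1}"
      using integrable_on_cmult_left[OF integral_01_compose[OF cA], of "c 1"] by (simp only: of_real_eq_id id_apply)
    have k: "integral {0..1} (\<lambda>s::real. c 1 * K) = c 1 * K" by simp
    show ?thesis
      using integral_diff[OF integrable_const_ivl[of "c 1 * K" 0 1] integrable_add[OF i integral_01_compose[OF cW]]]
        integral_add[OF i integral_01_compose[OF cW]]
      unfolding k by (simp only: integral_mult_right)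
  qed
  also have "\<dots> = 0" unfolding K_def mi using c1 by (simp add: algebra_simps)
  finally show ?thesis .
qed

text \<open>The sawtooth average differentiates to \<open>Y\<close> minus its mean. This mean is
  zero because the force has mean zero and the delay preserves that.\<close>

lemma U_deriv:
  assumes "1 \<le> l * z"
  shows "(U l (Suc m) has_real_derivative Y l (Suc m) t) (at t)"
proof -
  note l = l_pos[OF assms]
  have mean: "integral {0..1} (\<lambda>s. Y l (Suc m) (P * s)) = 0"
    unfolding Y_Suc[OF l]
    by (rule laplace_shift_mean_zero[OF H_continuous[OF l] H_per H_bound[OF assms] l pos(2) H_mean[OF assms]])
  have "U l (Suc m) = (\<lambda>t. P * integral {0..1} (\<lambda>s. (1/2 - s) * Y l (Suc m) (t - P * s))
     - integral {0..1} (\<lambda>x. P * integral {0..1} (\<lambda>s. (1/2 - s) * Y l (Suc m) (P * x - P * s)) + 1 / c 1 * W l {1..<Suc m} (Suc m) (P * x)))"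
    using U_rec[of "Suc m" l] l by (intro ext) simp
  moreover have "(\<dots> has_real_derivative (Y l (Suc m) t - integral {0..1} (\<lambda>s. Y l (Suc m) (P * s))) - 0) (at t)"
    by (intro DERIV_diff DERIV_const sawtooth_average_derivative[OF Y_continuous[OF assms] Y_per[OF l] pos(2)])
  ultimately show ?thesis using mean by simp
qed

text \<open>One factor \<open>1 / (l * z)\<close> is kept out of the powers: it shows later that the
  solution stays within O(\<epsilon>) of \<open>c0\<close>.\<close>

lemma U_bound:
  assumes "1 \<le> l * z"
  shows "\<bar>U l n t\<bar> \<le> \<beta> n / (l * z)"
proof (cases "n = 0")
  case False
  have "\<bar>U l n t\<bar> \<le> bcoef B z n * (1 / l) ^ n"
    unfolding U_def by (rule rreg_laplace_bound[OF reg_u l_pos[OF assms]]) (use False in simp)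
  also have "\<dots> = \<beta> n * (1 / (l * z)) ^ n" by (rule bcoef_scaled[OF assms])
  also have "\<dots> \<le> \<beta> n * (1 / (l * z)) ^ 1"
    using assms False by (intro mult_left_mono power_decreasing \<beta>_nonneg) auto
  finally show ?thesis by simp
qed (use assms \<beta>_nonneg in auto)

lemma U_bound':
  assumes "1 \<le> l * z"
  shows "\<bar>U l n t\<bar> \<le> \<beta> n"
proof -
  have "\<beta> n / (l * z) \<le> \<beta> n / 1" using assms by (intro divide_left_mono \<beta>_nonneg) auto
  with U_bound[OF assms, of n t] show ?thesis by simp
qed

lemma Y_bound:
  assumes "1 \<le> l * z"
  shows "\<bar>Y l (Suc m) t\<bar> \<le> z * hb m"
proof -
  note l = l_pos[OF assms]
  have "1 / l \<le> z" using assms l by (simp add: field_simps)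
  have "\<bar>Y l (Suc m) t\<bar> \<le> (if Suc m = 1 then CF else \<Gamma> * bcoef B z (Suc m - 1)) * (1 / l) ^ Suc m"
    unfolding Y_def by (rule rreg_laplace_bound[OF reg_force l]) auto
  also have "\<dots> = (if m = 0 then CF else \<Gamma> * (bcoef B z m * (1 / l) ^ m)) * (1 / l)" by simp
  also have "\<dots> \<le> hb m * (1 / l)"
    using bcoef_scaled_le[OF assms, of m] l \<Gamma>_nonneg
    by (intro mult_right_mono) (auto simp: hb_def intro: mult_left_mono)
  also have "\<dots> \<le> hb m * z"
  proof (intro mult_left_mono \<open>1 / l \<le> z\<close>)
    show "0 \<le> hb m" using H_bound[OF assms, of m 0] by linarith
  qed
  finally show ?thesis by (simp add: mult.commute)
qed

definition sol :: "real \<Rightarrow> real \<Rightarrow> real" where "sol l t = (\<Sum>m. U l (Suc m) t)"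
definition vel :: "real \<Rightarrow> real \<Rightarrow> real" where "vel l t = (\<Sum>m. Y l (Suc m) t)"
definition frc :: "real \<Rightarrow> real \<Rightarrow> real" where "frc l t = (\<Sum>m. H l m t)"

lemma summable_U: "1 \<le> l * z \<Longrightarrow> summable (\<lambda>m. U l m t)"
  by (rule summable_comparison_test'[OF summable_\<beta>, of 0]) (use U_bound' in auto)

lemma summable_Y: "1 \<le> l * z \<Longrightarrow> summable (\<lambda>m. Y l (Suc m) t)"
  by (rule summable_comparison_test'[OF summable_mult[OF summable_hb, of z], of 0]) (use Y_bound in auto)

lemma summable_H: "1 \<le> l * z \<Longrightarrow> summable (\<lambda>m. H l m t)"
  by (rule summable_comparison_test'[OF summable_hb, of 0]) (use H_bound in auto)

lemma sol_deriv:
  assumes "1 \<le> l * z"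
  shows "(sol l has_real_derivative vel l t) (at t)"
  unfolding sol_def[abs_def] vel_def
proof (rule has_field_derivative_series'(2)[of UNIV _ _ 0])
  show "uniformly_convergent_on UNIV (\<lambda>n t. \<Sum>i<n. Y l (Suc i) t)"
    by (rule Weierstrass_m_test'[OF _ summable_mult[OF summable_hb, of z]]) (use Y_bound[OF assms] in auto)
  show "summable (\<lambda>m. U l (Suc m) 0)" using summable_U[OF assms, of 0] summable_Suc_iff[of "\<lambda>m. U l m 0"] by simp
qed (use U_deriv[OF assms] in auto)

lemma vel_deriv:
  assumes "1 \<le> l * z"
  shows "(vel l has_real_derivative frc l t - l * vel l t) (at t)"
proof -
  have "((\<lambda>t. \<Sum>m. Y l (Suc m) t) has_real_derivative (\<Sum>m. H l m t - l * Y l (Suc m) t)) (at t)"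
  proof (rule has_field_derivative_series'(2)[of UNIV _ _ 0])
    have "\<bar>H l m t - l * Y l (Suc m) t\<bar> \<le> hb m + l * (z * hb m)" for m t
    proof -
      have "\<bar>l * Y l (Suc m) t\<bar> \<le> l * (z * hb m)"
        unfolding abs_mult using l_pos[OF assms] Y_bound[OF assms, of m t] by (simp add: mult_left_mono)
      with H_bound[OF assms, of m t] show ?thesis by linarith
    qed
    then show "uniformly_convergent_on UNIV (\<lambda>n t. \<Sum>i<n. H l i t - l * Y l (Suc i) t)"
      by (intro Weierstrass_m_test'[where M = "\<lambda>m. hb m + l * (z * hb m)"])
         (auto intro!: summable_add summable_mult summable_hb)
  qed (use Y_deriv[OF assms] summable_Y[OF assms] in auto)
  moreover have "(\<Sum>m. H l m t - l * Y l (Suc m) t) = frc l t - l * vel l t"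
    unfolding frc_def vel_def
    using suminf_diff[OF summable_H[OF assms] summable_mult[OF summable_Y[OF assms]]] suminf_mult[OF summable_Y[OF assms]]
    by simp
  ultimately show ?thesis by (simp add: vel_def[abs_def])
qed

lemma sol_per: "sol l (t + P) = sol l t"
  by (simp add: sol_def U_per)

lemma sol_bound:
  assumes "1 \<le> l * z"
  shows "\<bar>sol l t\<bar> \<le> 2 * B / (l * z)"
proof -
  have sm: "summable (\<lambda>m. \<beta> (Suc m) / (l * z))" using summable_\<beta> by (intro summable_divide) (simp add: summable_Suc_iff)
  have sa: "summable (\<lambda>m. \<bar>U l (Suc m) t\<bar>)"
    by (rule summable_comparison_test'[OF sm, of 0]) (use U_bound[OF assms] in auto)
  have "\<bar>sol l t\<bar> \<le> (\<Sum>m. \<bar>U l (Suc m) t\<bar>)" unfolding sol_def by (rule summable_rabs[OF sa])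
  also have "\<dots> \<le> (\<Sum>m. \<beta> (Suc m) / (l * z))" by (rule suminf_le[OF U_bound[OF assms] sa sm])
  also have "\<dots> = (\<Sum>m. \<beta> (Suc m)) / (l * z)"
    using summable_\<beta> by (intro suminf_divide) (simp add: summable_Suc_iff)
  also have "(\<Sum>m. \<beta> (Suc m)) = (\<Sum>m. \<beta> m)"
  proof -
    have "\<beta> 0 = 0" by (simp add: \<beta>_def)
    with suminf_split_head[OF summable_\<beta>] show ?thesis by simp
  qed
  also have "(\<Sum>m. \<beta> m) / (l * z) \<le> 2 * B / (l * z)"
    using assms by (intro divide_right_mono suminf_\<beta>_le) auto
  finally show ?thesis .
qed

text \<open>By \<open>fps_composition_sums\<close> the graded pieces \<open>W l {..<n} n\<close> add
  up to the Taylor series of \<open>g\<close> evaluated at the summed solution.\<close>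

lemma frc_eq:
  assumes "1 \<le> l * z" and S: "(\<lambda>k. c (Suc k) * sol l t ^ Suc k) sums S"
  shows "frc l t = Fr t - S"
proof -
  note l = l_pos[OF assms(1)]
  have \<phi>0: "\<phi> l t $ 0 = 0" by (simp add: \<phi>_def)
  have sum\<phi>: "(\<Sum>n. \<phi> l t $ n) = sol l t"
    using suminf_split_head[OF summable_U[OF assms(1), of t]] by (simp add: \<phi>_def sol_def)
  have bd: "\<bar>(\<phi> l t ^ Suc k) $ n\<bar> \<le> (8 * B) ^ k * \<beta> n" for k n
  proof (cases "n = 0")
    case True
    then show ?thesis using \<phi>0 pos \<beta>_nonneg by simp
  next
    case False
    have "\<bar>laplace l (bpow u k n t)\<bar> \<le> (8 * B) ^ k * bcoef B z n * (1 / l) ^ n"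
      by (rule rreg_laplace_bound[OF reg_pow l]) (use False in simp)
    also have "\<dots> = (8 * B) ^ k * (bcoef B z n * (1 / l) ^ n)" by simp
    also have "\<dots> \<le> (8 * B) ^ k * \<beta> n" using pos by (intro mult_left_mono bcoef_scaled_le assms) auto
    finally show ?thesis by (simp add: laplace_bpow[OF l] del: power_Suc)
  qed
  have "(\<lambda>n. \<Sum>k<n. c (Suc k) * (\<phi> l t ^ Suc k) $ n) sums S"
    by (rule fps_composition_sums[OF \<phi>0 bd summable_\<beta> _ \<Gamma>']) (use S pos in \<open>auto simp: sum\<phi>\<close>)
  then have "(\<lambda>n. W l {..<n} n t) sums S" by (simp add: W_eq[OF l] del: power_Suc)
  from sums_diff[OF sums_single[of 0 "\<lambda>_. Fr t"] this]
  have "(\<lambda>n. (if n = 0 then Fr t else 0) - W l {..<n} n t) sums (Fr t - S)" .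
  \<comment> \<open>In order 0 the range of powers is empty, so \<open>Fr\<close> is the whole
    term.\<close>
  moreover have "(if n = 0 then Fr t else 0) - W l {..<n} n t = H l n t" for n
    using W_eq[OF l, of "{}" 0 t] by (auto simp: H_def)
  ultimately show ?thesis by (simp add: frc_def sums_iff)
qed

end

section \<open>The Borel transform of the solution\<close>

lemma rreg_abs: "rreg n C r \<Longrightarrow> rreg n C (\<lambda>t p. \<bar>r t p\<bar>)"
  unfolding rreg_def by (auto simp: case_prod_unfold intro!: continuous_intros)

lemma laplace_has_integral:
  assumes "integrable lborel (\<lambda>p. expker l p * h p)"
  shows "((\<lambda>p. exp (- l * p) * h p) has_integral laplace l h) {0..}"
proof -
  have e: "expker l p * h p = indicator {0..} p *\<^sub>R (exp (- l * p) * h p)" for p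
    by (auto simp: expker_def indicator_def)
  have i: "set_integrable lborel {0..} (\<lambda>p. exp (- l * p) * h p)"
    using assms unfolding e set_integrable_def .
  from set_borel_integral_eq_integral[OF this] show ?thesis
    unfolding laplace_def e set_lebesgue_integral_def[symmetric] by (metis has_integral_iff)
qed

context borel_recursion
begin

definition bor :: "complex \<Rightarrow> complex \<Rightarrow> complex" where "bor t p = (\<Sum>m. uc (Suc m) t p)"
definition borr :: "real \<Rightarrow> real \<Rightarrow> real" where "borr t p = (\<Sum>m. u (Suc m) t p)"

text \<open>Dropping the factor \<open>n^(-2)\<close> from \<open>bcoef\<close> leaves the terms of
  an exponential series, whence exponential type \<open>1 / z\<close> for the sum.\<close>

lemma uc_bound:
  assumes "(t, p) \<in> strip2 \<kappa>"
  shows "norm (uc (Suc m) t p) \<le> B / z * ((norm p / z) ^ m /\<^sub>R fact m)"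
proof -
  have "norm (uc (Suc m) t p) \<le> bcoef B z (Suc m) * (norm p ^ m / fact m)"
    using bndD[OF bnd_uc assms, of "Suc m"] by simp
  also have "bcoef B z (Suc m) \<le> B / z ^ Suc m * 1"
    unfolding bcoef_def using pos by (intro mult_left_mono) (auto simp: field_simps)
  then have "bcoef B z (Suc m) * (norm p ^ m / fact m) \<le> B / z ^ Suc m * 1 * (norm p ^ m / fact m)"
    by (intro mult_right_mono) auto
  also have "\<dots> = B / z * ((norm p / z) ^ m /\<^sub>R fact m)"
    by (simp add: divide_inverse power_mult_distrib power_inverse mult_ac)
  finally show ?thesis .
qed

lemma exp_series: "(\<lambda>m. B / z * ((x / z) ^ m /\<^sub>R fact m)) sums (B / z * exp (x / z))" for x :: real
  by (intro sums_mult exp_converges)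

lemma summable_uc: "(t, p) \<in> strip2 \<kappa> \<Longrightarrow> summable (\<lambda>m. norm (uc (Suc m) t p))"
  by (rule summable_comparison_test'[OF sums_summable[OF exp_series[of "norm p"]], of 0])
     (use uc_bound in \<open>simp only: real_norm_def abs_norm_cancel\<close>)

lemma bor_bound:
  assumes "(t, p) \<in> strip2 \<kappa>"
  shows "norm (bor t p) \<le> B / z * exp (norm p / z)"
proof -
  have "norm (bor t p) \<le> (\<Sum>m. norm (uc (Suc m) t p))"
    unfolding bor_def by (rule summable_norm[OF summable_uc[OF assms]])
  also have "\<dots> \<le> (\<Sum>m. B / z * ((norm p / z) ^ m /\<^sub>R fact m))"
    by (rule suminf_le[OF uc_bound[OF assms] summable_uc[OF assms] sums_summable[OF exp_series]])
  also have "\<dots> = B / z * exp (norm p / z)" using exp_series by (simp only: sums_iff)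
  finally show ?thesis .
qed

text \<open>On a disc \<open>cball x d\<close> the majorants are at most those at
  \<open>norm x + d\<close>, so the partial sums converge locally uniformly.\<close>

lemma bor_holomorphic: "bor (of_real t) holomorphic_on {p. \<bar>Im p\<bar> < \<kappa>}"
proof (rule holomorphic_uniform_sequence[OF open_horizontal_strip])
  have "(\<lambda>p. uc m (of_real t + 0 * p) (0 + 1 * p)) holomorphic_on {p. (of_real t + 0 * p, 0 + 1 * p) \<in> strip2 \<kappa>}" for m
    using bihol_uc[of m] unfolding bihol_def by blast
  then have "uc m (of_real t) holomorphic_on {p. \<bar>Im p\<bar> < \<kappa>}" for m by (simp add: mem_strip2)
  then show "(\<lambda>p. \<Sum>m<n. uc (Suc m) (of_real t) p) holomorphic_on {p. \<bar>Im p\<bar> < \<kappa>}" for n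
    by (intro holomorphic_intros)
  fix x assume "x \<in> {p. \<bar>Im p\<bar> < \<kappa>}"
  then obtain d where d: "d > 0" "cball x d \<subseteq> {p. \<bar>Im p\<bar> < \<kappa>}"
    using open_horizontal_strip open_contains_cball by blast
  have "uniform_limit (cball x d) (\<lambda>n p. \<Sum>m<n. uc (Suc m) (of_real t) p) (\<lambda>p. \<Sum>m. uc (Suc m) (of_real t) p) sequentially"
  proof (rule Weierstrass_m_test[OF _ sums_summable[OF exp_series[of "norm x + d"]]])
    fix m y assume y: "y \<in> cball x d"
    have "norm y \<le> norm x + d" using y norm_triangle_sub[of y x] by (simp add: dist_norm norm_minus_commute)
    then have "B / z * ((norm y / z) ^ m /\<^sub>R fact m) \<le> B / z * (((norm x + d) / z) ^ m /\<^sub>R fact m)"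
      using pos unfolding real_scaleR_def
      by (intro mult_left_mono power_mono divide_right_mono) auto
    moreover have "norm (uc (Suc m) (of_real t) y) \<le> B / z * ((norm y / z) ^ m /\<^sub>R fact m)"
      by (rule uc_bound) (use y d in \<open>auto simp: mem_strip2\<close>)
    ultimately show "norm (uc (Suc m) (of_real t) y) \<le> B / z * (((norm x + d) / z) ^ m /\<^sub>R fact m)" by simp
  qed
  then show "\<exists>d>0. cball x d \<subseteq> {p. \<bar>Im p\<bar> < \<kappa>} \<and>
      uniform_limit (cball x d) (\<lambda>n p. \<Sum>m<n. uc (Suc m) (of_real t) p) (bor (of_real t)) sequentially"
    using d unfolding bor_def[abs_def] by blast
qed

lemma real_mem_strip2: "(complex_of_real t, complex_of_real p) \<in> strip2 \<kappa>"
  using pos by (simp add: mem_strip2)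

lemma u_eq: "uc n (of_real t) (of_real p) = of_real (u n t p)"
  using restr_u by (simp add: real_restr_def)

lemma summable_u: "summable (\<lambda>m. \<bar>u (Suc m) t p\<bar>)"
  using summable_uc[OF real_mem_strip2[of t p]] by (simp add: u_eq)

lemma bor_real: "bor (of_real t) (of_real p) = of_real (borr t p)"
  unfolding bor_def borr_def u_eq
  using suminf_of_real[OF summable_rabs_cancel[OF summable_u], where ?'a = complex] by simp

lemma borr_bound: "\<bar>borr t p\<bar> \<le> B / z * exp (1 / z * \<bar>p\<bar>)"
  using bor_bound[OF real_mem_strip2[of t p]] by (simp add: bor_real)

text \<open>The integrals of the absolute values of the terms are bounded by \<beta>, so summation
  and integration may be exchanged.\<close>

lemma laplace_borr:
  assumes "1 < l * z"
  shows "laplace l (borr t) = sol l t" "integrable lborel (\<lambda>p. expker l p * borr t p)"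
proof -
  have l1: "1 \<le> l * z" using assms by simp
  note l = l_pos[OF l1]
  have [measurable]: "u n t \<in> borel_measurable borel" for n by (rule rreg_measurable[OF reg_u])
  have int: "integrable lborel (\<lambda>p. expker l p * u (Suc m) t p)" for m
    by (rule rreg_laplace_integrable[OF reg_u l])
  have ae: "AE p in lborel. summable (\<lambda>m. norm (expker l p * u (Suc m) t p))"
    using summable_u[of t] by (auto simp: abs_mult intro!: summable_mult)
  have sm: "summable (\<lambda>m. LINT p|lborel. norm (expker l p * u (Suc m) t p))"
  proof (rule summable_comparison_test')
    show "summable (\<lambda>m. \<beta> (Suc m))" using summable_\<beta> by (simp add: summable_Suc_iff)
    fix m
    have "(LINT p|lborel. norm (expker l p * u (Suc m) t p)) = laplace l (\<lambda>p. \<bar>u (Suc m) t p\<bar>)"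
      by (simp add: laplace_def abs_mult)
    moreover have "\<bar>laplace l (\<lambda>p. \<bar>u (Suc m) t p\<bar>)\<bar> \<le> bcoef B z (Suc m) * (1 / l) ^ Suc m"
      by (rule rreg_laplace_bound[OF rreg_abs[OF reg_u] l]) simp
    ultimately show "norm (LINT p|lborel. norm (expker l p * u (Suc m) t p)) \<le> \<beta> (Suc m)"
      using bcoef_scaled_le[OF l1, of "Suc m"] by (simp only: real_norm_def)
  qed
  have e: "(\<Sum>m. expker l p * u (Suc m) t p) = expker l p * borr t p" for p
    unfolding borr_def by (rule suminf_mult[OF summable_rabs_cancel[OF summable_u]])
  show "laplace l (borr t) = sol l t"
    using integral_suminf[OF int ae sm] unfolding e by (simp add: laplace_def sol_def U_def)
  show "integrable lborel (\<lambda>p. expker l p * borr t p)"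
    using integrable_suminf[OF int ae sm] unfolding e .
qed

end

section \<open>Watson's lemma\<close>

lemma Re_divide_fact: "Re (w / fact n) = Re w / fact n"
  using Re_divide_of_real[of w "fact n"] by simp

lemma Im_divide_fact: "Im (w / fact n) = Im w / fact n"
  using Im_divide_of_real[of w "fact n"] by simp

text \<open>The imaginary parts of the Taylor coefficients form a power series that is zero on a
  real interval, so all of them vanish.\<close>

lemma holomorphic_real_on_reals_coeff_real:
  assumes hol: "f holomorphic_on ball 0 r" and "r > 0" and real: "\<And>p. f (complex_of_real p) = of_real (h p)"
  shows "(deriv ^^ n) f 0 = of_real (Re ((deriv ^^ n) f 0))"
proof -
  let ?a = "\<lambda>n. Im ((deriv ^^ n) f 0 / fact n)"
  have "(\<lambda>n. ?a n * (y - 0) ^ n) sums (\<lambda>_. 0) y" if "y \<in> ball 0 r" for y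
  proof -
    have "complex_of_real y \<in> ball 0 r" using that by simp
    from holomorphic_power_series[OF hol this]
    have "(\<lambda>n. (deriv ^^ n) f 0 / fact n * of_real (y ^ n)) sums of_real (h y)" by (simp add: real)
    then have "(\<lambda>n. Im ((deriv ^^ n) f 0 / fact n * of_real (y ^ n))) sums Im (of_real (h y))"
      by (rule sums_Im)
    moreover have "Im (w * of_real x) = Im w * x" for w x by simp
    ultimately show ?thesis by (simp only: Im_complex_of_real diff_zero)
  qed
  from power_series_coeff_eq_deriv[OF \<open>r > 0\<close> this, of n]
  have "(deriv ^^ n) (\<lambda>_. 0::real) 0 / fact n = ?a n" by blast
  moreover have "(deriv ^^ n) (\<lambda>_. 0::real) = (\<lambda>_. 0)" by (induction n) auto
  ultimately have "Im ((deriv ^^ n) f 0) = 0"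
    by (simp add: Im_divide_fact)
  then show ?thesis by (simp add: complex_eq_iff)
qed

text \<open>Two regimes. For \<open>p \<le> r / 2\<close> Cauchy's estimates dominate the Taylor
  tail by a geometric series of ratio 1/2. For larger \<open>p\<close> the factor
  \<open>(2 / r * p) ^ N\<close> is at least 1 and absorbs both the exponential bound of
  \<open>h\<close> and each of the \<open>N\<close> Taylor terms. The constant \<open>N + 2\<close>
  covers both cases.\<close>

lemma watson_remainder:
  fixes h :: "real \<Rightarrow> real"
  assumes hol: "f holomorphic_on ball 0 R" and r: "0 < r" "r < R" and real: "\<And>p. f (complex_of_real p) = of_real (h p)"
    and M: "\<And>p. norm p \<le> r \<Longrightarrow> norm (f p) \<le> M" and bd: "\<And>p. p \<ge> 0 \<Longrightarrow> \<bar>h p\<bar> \<le> M * exp (k * p)"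
    and "k \<ge> 0" "p \<ge> 0"
  shows "\<bar>h p - (\<Sum>n<N. Re ((deriv ^^ n) f 0) * (p ^ n / fact n))\<bar>
    \<le> (real N + 2) * M * (2 / r) ^ N * p ^ N * exp (k * p)"
proof -
  define a where "a n = Re ((deriv ^^ n) f 0) / fact n" for n
  have "R > 0" using r by linarith
  have "M \<ge> 0" using M[of 0] r by (auto intro: order_trans[OF norm_ge_zero])
  have a_bd: "\<bar>a n\<bar> \<le> M / r ^ n" for n
  proof -
    have "norm ((deriv ^^ n) f 0) \<le> fact n * M / r ^ n"
    proof (rule Cauchy_inequality)
      show "f holomorphic_on ball 0 r" "continuous_on (cball 0 r) f"
        using hol r by (auto intro: holomorphic_on_subset intro!: holomorphic_on_imp_continuous_on)
    qed (use r M in auto)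
    then have "\<bar>Re ((deriv ^^ n) f 0)\<bar> \<le> fact n * M / r ^ n" by (rule order_trans[OF abs_Re_le_cmod])
    then show ?thesis by (simp add: a_def field_simps)
  qed
  have trm: "Re ((deriv ^^ n) f 0) * (p ^ n / fact n) = a n * p ^ n" for n by (simp add: a_def)
  have exp1: "1 \<le> exp (k * p)" using \<open>k \<ge> 0\<close> \<open>p \<ge> 0\<close> by simp
  have "\<bar>h p - (\<Sum>n<N. a n * p ^ n)\<bar> \<le> (real N + 2) * M * (2 / r * p) ^ N * exp (k * p)"
  proof (cases "p \<le> r / 2")
    case True
    then have "complex_of_real p \<in> ball 0 R" using r \<open>p \<ge> 0\<close> by simp
    from holomorphic_power_series[OF hol this]
    have "(\<lambda>n. (deriv ^^ n) f 0 / fact n * of_real (p ^ n)) sums of_real (h p)" by (simp add: real)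
    then have "(\<lambda>n. Re ((deriv ^^ n) f 0 / fact n * of_real (p ^ n))) sums Re (of_real (h p))"
      by (rule sums_Re)
    moreover have "Re (w * of_real x) = Re w * x" for w x by simp
    ultimately have "(\<lambda>n. a n * p ^ n) sums h p"
      by (simp only: a_def Re_divide_fact Re_complex_of_real)
    then have s: "(\<lambda>n. a (n + N) * p ^ (n + N)) sums (h p - (\<Sum>n<N. a n * p ^ n))"
      by (rule sums_split_initial_segment)
    have g: "(\<lambda>n. M * (p / r) ^ N * (1/2) ^ n) sums (M * (p / r) ^ N * (1 / (1 - 1/2)))"
      by (intro sums_mult geometric_sums) simp
    have le: "\<bar>a (n + N) * p ^ (n + N)\<bar> \<le> M * (p / r) ^ N * (1/2) ^ n" for n
    proof -
      have "\<bar>a (n + N) * p ^ (n + N)\<bar> \<le> M / r ^ (n + N) * p ^ (n + N)"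
        unfolding abs_mult using a_bd[of "n + N"] \<open>p \<ge> 0\<close> by (intro mult_mono) auto
      also have "\<dots> = M * (p / r) ^ N * (p / r) ^ n" by (simp add: power_divide power_add mult_ac)
      also have "\<dots> \<le> M * (p / r) ^ N * (1/2) ^ n"
        using True r \<open>p \<ge> 0\<close> \<open>M \<ge> 0\<close> by (intro mult_left_mono power_mono) (auto simp: field_simps)
      finally show ?thesis .
    qed
    have sa: "summable (\<lambda>n. \<bar>a (n + N) * p ^ (n + N)\<bar>)"
      by (rule summable_comparison_test'[OF sums_summable[OF g], of 0]) (use le in auto)
    have "\<bar>h p - (\<Sum>n<N. a n * p ^ n)\<bar> \<le> (\<Sum>n. \<bar>a (n + N) * p ^ (n + N)\<bar>)"
      using summable_rabs[OF sa] s by (simp only: sums_iff)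
    also have "\<dots> \<le> (\<Sum>n. M * (p / r) ^ N * (1/2) ^ n)" by (rule suminf_le[OF le sa sums_summable[OF g]])
    also have "\<dots> = 2 * (M * (p / r) ^ N)" using g by (simp add: sums_iff)
    also have "\<dots> \<le> (real N + 2) * (M * (2 / r * p) ^ N)"
      using r \<open>p \<ge> 0\<close> \<open>M \<ge> 0\<close> by (intro mult_mono mult_left_mono power_mono) (auto intro!: mult_nonneg_nonneg simp: field_simps)
    also have "\<dots> \<le> (real N + 2) * (M * (2 / r * p) ^ N) * exp (k * p)"
      using mult_left_mono[OF exp1, of "(real N + 2) * (M * (2 / r * p) ^ N)"] r \<open>p \<ge> 0\<close> \<open>M \<ge> 0\<close> by simp
    finally show ?thesis by (simp only: mult.assoc)
  next
    case False
    let ?q = "2 / r * p"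
    have q: "1 \<le> ?q" using False r by (simp add: field_simps)
    have "\<bar>h p\<bar> \<le> ?q ^ N * (M * exp (k * p))"
      using bd[OF \<open>p \<ge> 0\<close>] one_le_power[OF q, of N] mult_right_mono[of 1 "?q ^ N" "M * exp (k * p)"] \<open>M \<ge> 0\<close> by simp
    moreover have "\<bar>\<Sum>n<N. a n * p ^ n\<bar> \<le> real N * (M * ?q ^ N)"
    proof -
      have "\<bar>a n * p ^ n\<bar> \<le> M * ?q ^ N" if "n < N" for n
      proof -
        have "\<bar>a n * p ^ n\<bar> \<le> M / r ^ n * p ^ n"
          unfolding abs_mult using a_bd[of n] \<open>p \<ge> 0\<close> by (intro mult_mono) auto
        also have "\<dots> = M * (p / r) ^ n" by (simp add: power_divide)
        also have "\<dots> \<le> M * ?q ^ n"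
          using r \<open>p \<ge> 0\<close> \<open>M \<ge> 0\<close> by (intro mult_left_mono power_mono) (auto simp: field_simps)
        also have "\<dots> \<le> M * ?q ^ N"
          using that \<open>M \<ge> 0\<close> by (intro mult_left_mono power_increasing q) auto
        finally show ?thesis .
      qed
      then have "\<bar>\<Sum>n<N. a n * p ^ n\<bar> \<le> (\<Sum>n<N. M * ?q ^ N)"
        by (intro order_trans[OF sum_abs] sum_mono) auto
      then show ?thesis by simp
    qed
    moreover have "real N * (M * ?q ^ N) \<le> real N * (M * ?q ^ N) * exp (k * p)"
      using mult_left_mono[OF exp1, of "real N * (M * ?q ^ N)"] \<open>M \<ge> 0\<close> q by simp
    moreover have "0 \<le> M * ?q ^ N * exp (k * p)" using \<open>M \<ge> 0\<close> q by simp
    ultimately show ?thesis by (simp add: algebra_simps del: times_divide_eq_left)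
  qed
  then show ?thesis unfolding trm by (simp only: power_mult_distrib mult.assoc)
qed

text \<open>The remainder estimate is integrated against the kernel; \<open>2 * k < l\<close> makes
  the remaining rate \<open>l - k\<close> at least \<open>l / 2\<close>, which keeps the error a
  power of \<open>1 / l\<close>.\<close>

lemma watson:
  fixes h :: "real \<Rightarrow> real"
  assumes hol: "f holomorphic_on ball 0 R" and r: "0 < r" "r < R" and real: "\<And>p. f (complex_of_real p) = of_real (h p)"
    and M: "\<And>p. norm p \<le> r \<Longrightarrow> norm (f p) \<le> M" and bd: "\<And>p. p \<ge> 0 \<Longrightarrow> \<bar>h p\<bar> \<le> M * exp (k * p)"
    and "k \<ge> 0" "2 * k < l" and int: "integrable lborel (\<lambda>p. expker l p * h p)"
  shows "\<bar>laplace l h - (\<Sum>n<N. Re ((deriv ^^ n) f 0) * (1 / l) ^ Suc n)\<bar>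
    \<le> (real N + 2) * M * (2 / r) ^ N * fact N * (2 / l) ^ Suc N"
proof -
  have l: "l > 0" "l - k > 0" "l \<le> 2 * (l - k)" using \<open>k \<ge> 0\<close> \<open>2 * k < l\<close> by auto
  let ?S = "\<lambda>p. \<Sum>n<N. Re ((deriv ^^ n) f 0) * (p ^ n / fact n)"
  let ?C = "(real N + 2) * M * (2 / r) ^ N * fact N"
  have "M \<ge> 0" using M[of 0] r by (auto intro: order_trans[OF norm_ge_zero])
  have iterm: "integrable lborel (\<lambda>p. expker l p * (Re ((deriv ^^ n) f 0) * (p ^ n / fact n)))" for n
    using integrable_mult_right[OF laplace_power_over_fact(2)[OF l(1), of n], of "Re ((deriv ^^ n) f 0)"]
    by (simp add: mult_ac)
  have iS: "integrable lborel (\<lambda>p. expker l p * ?S p)"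
    unfolding sum_distrib_left by (intro Bochner_Integration.integrable_sum iterm)
  have "laplace l ?S = (\<Sum>n<N. laplace l (\<lambda>p. Re ((deriv ^^ n) f 0) * (p ^ n / fact n)))"
    by (rule laplace_sum) (rule iterm)
  also have "\<dots> = (\<Sum>n<N. Re ((deriv ^^ n) f 0) * (1 / l) ^ Suc n)"
    by (simp only: laplace_cmult laplace_power_over_fact(1)[OF l(1)])
  finally have diff: "laplace l h - (\<Sum>n<N. Re ((deriv ^^ n) f 0) * (1 / l) ^ Suc n) = laplace l (\<lambda>p. h p - ?S p)"
    using laplace_diff[OF int iS] by simp
  have "\<bar>laplace l (\<lambda>p. h p - ?S p)\<bar> \<le> laplace l (\<lambda>p. ?C * (p ^ N / fact N) * exp (k * p))"
  proof (rule laplace_mono)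
    show "integrable lborel (\<lambda>p. expker l p * (h p - ?S p))"
      using Bochner_Integration.integrable_diff[OF int iS] by (simp add: right_diff_distrib)
    have "expker l p * (?C * (p ^ N / fact N) * exp (k * p)) = ?C * (expker (l - k) p * (p ^ N / fact N))" for p
      by (simp add: expker_mult[symmetric] mult_ac)
    then show "integrable lborel (\<lambda>p. expker l p * (?C * (p ^ N / fact N) * exp (k * p)))"
      by (simp only:) (intro integrable_mult_right laplace_power_over_fact(2) l)
    show "\<bar>h p - ?S p\<bar> \<le> ?C * (p ^ N / fact N) * exp (k * p)" if "p \<ge> 0" for p
      using watson_remainder[OF hol r real M bd \<open>k \<ge> 0\<close> that, of N] by simp
  qed
  also have "\<dots> = ?C * laplace (l - k) (\<lambda>p. p ^ N / fact N)"
    unfolding laplace_cmult[symmetric] unfolding laplace_def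
    by (intro Bochner_Integration.integral_cong refl) (simp add: expker_mult[symmetric] mult_ac)
  also have "\<dots> = ?C * (1 / (l - k)) ^ Suc N" by (simp only: laplace_power_over_fact(1)[OF l(2)])
  also have "\<dots> \<le> ?C * (2 / l) ^ Suc N"
  proof (intro mult_left_mono power_mono)
    show "1 / (l - k) \<le> 2 / l" using l by (simp add: field_simps)
  qed (use \<open>M \<ge> 0\<close> r l in auto)
  finally show ?thesis unfolding diff .
qed

section \<open>Uniform asymptotic expansions\<close>

text \<open>Asymptotic expansion as \<epsilon> decreases to 0, uniform over \<open>S\<close>; the
  constant and the range of \<epsilon> may depend on \<open>N\<close>. The coefficients are packed
  in a formal power series so that algebraic operations on functions correspond to those on
  expansions.\<close>

definition asympt :: "'a set \<Rightarrow> (real \<Rightarrow> 'a \<Rightarrow> real) \<Rightarrow> ('a \<Rightarrow> real fps) \<Rightarrow> bool" where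
  "asympt S F \<phi> \<longleftrightarrow> (\<forall>N. \<exists>C. \<exists>e>0. \<forall>\<epsilon>. 0 < \<epsilon> \<and> \<epsilon> < e \<longrightarrow>
     (\<forall>t\<in>S. \<bar>F \<epsilon> t - (\<Sum>k<N. \<phi> t $ k * \<epsilon> ^ k)\<bar> \<le> C * \<epsilon> ^ N))"

lemma asymptE:
  assumes "asympt S F \<phi>"
  obtains C e where "C > 0" "0 < e" "e < 1"
    "\<And>\<epsilon> t. 0 < \<epsilon> \<Longrightarrow> \<epsilon> < e \<Longrightarrow> t \<in> S \<Longrightarrow> \<bar>F \<epsilon> t - (\<Sum>k<N. \<phi> t $ k * \<epsilon> ^ k)\<bar> \<le> C * \<epsilon> ^ N"
proof -
  obtain C e where C: "e > 0" "\<And>\<epsilon> t. 0 < \<epsilon> \<Longrightarrow> \<epsilon> < e \<Longrightarrow> t \<in> S \<Longrightarrow> \<bar>F \<epsilon> t - (\<Sum>k<N. \<phi> t $ k * \<epsilon> ^ k)\<bar> \<le> C * \<epsilon> ^ N"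
    using assms unfolding asympt_def by meson
  show ?thesis
  proof (rule that[of "\<bar>C\<bar> + 1" "min e (1/2)"])
    fix \<epsilon> t assume "0 < \<epsilon>" "\<epsilon> < min e (1/2)" "t \<in> S"
    then have "\<bar>F \<epsilon> t - (\<Sum>k<N. \<phi> t $ k * \<epsilon> ^ k)\<bar> \<le> C * \<epsilon> ^ N" by (intro C) auto
    also have "\<dots> \<le> (\<bar>C\<bar> + 1) * \<epsilon> ^ N" using \<open>0 < \<epsilon>\<close> by (intro mult_right_mono) auto
    finally show "\<bar>F \<epsilon> t - (\<Sum>k<N. \<phi> t $ k * \<epsilon> ^ k)\<bar> \<le> (\<bar>C\<bar> + 1) * \<epsilon> ^ N" .
  qed (use \<open>e > 0\<close> in auto)
qed

lemma asymptI:
  assumes "\<And>N. \<exists>C. \<exists>e>0. \<forall>\<epsilon>. 0 < \<epsilon> \<and> \<epsilon> < e \<longrightarrow>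
     (\<forall>t\<in>S. \<bar>F \<epsilon> t - (\<Sum>k<N. \<phi> t $ k * \<epsilon> ^ k)\<bar> \<le> C * \<epsilon> ^ N)"
  shows "asympt S F \<phi>"
  unfolding asympt_def by (rule allI) (rule assms)

lemma asympt_compose: "asympt S F \<phi> \<Longrightarrow> (\<And>x. x \<in> T \<Longrightarrow> h x \<in> S) \<Longrightarrow> asympt T (\<lambda>\<epsilon> x. F \<epsilon> (h x)) (\<lambda>x. \<phi> (h x))"
proof (rule asymptI)
  fix N assume F: "asympt S F \<phi>" and h: "\<And>x. x \<in> T \<Longrightarrow> h x \<in> S"
  obtain C e where C: "0 < e" "\<And>\<epsilon> t. 0 < \<epsilon> \<Longrightarrow> \<epsilon> < e \<Longrightarrow> t \<in> S \<Longrightarrow> \<bar>F \<epsilon> t - (\<Sum>k<N. \<phi> t $ k * \<epsilon> ^ k)\<bar> \<le> C * \<epsilon> ^ N"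
    by (rule asymptE[OF F, where N = "N"]) blast
  with h show "\<exists>C. \<exists>e>0. \<forall>\<epsilon>. 0 < \<epsilon> \<and> \<epsilon> < e \<longrightarrow> (\<forall>t\<in>T. \<bar>F \<epsilon> (h t) - (\<Sum>k<N. \<phi> (h t) $ k * \<epsilon> ^ k)\<bar> \<le> C * \<epsilon> ^ N)"
    by blast
qed

lemma asympt_subset: "asympt S F \<phi> \<Longrightarrow> T \<subseteq> S \<Longrightarrow> asympt T F \<phi>"
  using asympt_compose[of S F \<phi> T "\<lambda>x. x"] by auto

lemma asympt_cong:
  assumes "asympt S F \<phi>" and "e > 0" and "\<And>\<epsilon> t. 0 < \<epsilon> \<Longrightarrow> \<epsilon> < e \<Longrightarrow> t \<in> S \<Longrightarrow> G \<epsilon> t = F \<epsilon> t"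
  shows "asympt S G \<phi>"
proof (rule asymptI)
  fix N
  obtain C e' where C: "0 < e'" "\<And>\<epsilon> t. 0 < \<epsilon> \<Longrightarrow> \<epsilon> < e' \<Longrightarrow> t \<in> S \<Longrightarrow> \<bar>F \<epsilon> t - (\<Sum>k<N. \<phi> t $ k * \<epsilon> ^ k)\<bar> \<le> C * \<epsilon> ^ N"
    by (rule asymptE[OF assms(1), where N = "N"]) blast
  then show "\<exists>C. \<exists>e>0. \<forall>\<epsilon>. 0 < \<epsilon> \<and> \<epsilon> < e \<longrightarrow> (\<forall>t\<in>S. \<bar>G \<epsilon> t - (\<Sum>k<N. \<phi> t $ k * \<epsilon> ^ k)\<bar> \<le> C * \<epsilon> ^ N)"
    using assms(2,3) by (intro exI[of _ C] exI[of _ "min e e'"]) auto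
qed

text \<open>The estimates with \<open>n\<close> and with \<open>n + 1\<close> terms differ by the
  single term \<open>\<phi> t $ n * d ^ n\<close>; one fixed \<open>d\<close> is enough.\<close>

lemma asympt_coeff_bounded:
  assumes "asympt S F \<phi>"
  obtains K where "K > 0" "\<And>t. t \<in> S \<Longrightarrow> \<bar>\<phi> t $ n\<bar> \<le> K"
proof -
  obtain C e where C: "C > 0" "0 < e" "e < 1" "\<And>\<epsilon> t. 0 < \<epsilon> \<Longrightarrow> \<epsilon> < e \<Longrightarrow> t \<in> S \<Longrightarrow> \<bar>F \<epsilon> t - (\<Sum>k<n. \<phi> t $ k * \<epsilon> ^ k)\<bar> \<le> C * \<epsilon> ^ n"
    by (rule asymptE[OF assms, where N = "n"]) blast
  obtain C' e' where C': "C' > 0" "0 < e'" "e' < 1" "\<And>\<epsilon> t. 0 < \<epsilon> \<Longrightarrow> \<epsilon> < e' \<Longrightarrow> t \<in> S \<Longrightarrow> \<bar>F \<epsilon> t - (\<Sum>k<Suc n. \<phi> t $ k * \<epsilon> ^ k)\<bar> \<le> C' * \<epsilon> ^ Suc n"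
    by (rule asymptE[OF assms, where N = "Suc n"]) blast
  define d where "d = min e e' / 2"
  have d: "0 < d" "d < e" "d < e'" using C C' by (auto simp: d_def)
  have "\<bar>\<phi> t $ n\<bar> \<le> (C * d ^ n + C' * d ^ Suc n) / d ^ n" if t: "t \<in> S" for t
  proof -
    have "\<bar>\<phi> t $ n * d ^ n\<bar> \<le> C * d ^ n + C' * d ^ Suc n"
      using C(4)[OF d(1,2) t] C'(4)[OF d(1,3) t] by simp
    then show ?thesis using d by (simp add: abs_mult field_simps)
  qed
  moreover have "(C * d ^ n + C' * d ^ Suc n) / d ^ n > 0" using C C' d by (auto intro!: divide_pos_pos add_pos_pos)
  ultimately show ?thesis using that by blast
qed

text \<open>The factor \<open>c t\<close> may vary over \<open>S\<close>, which admits the factors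
  \<open>t - a\<close> of the integrated equation.\<close>

lemma asympt_linear:
  assumes F: "asympt S F \<phi>" and G: "asympt S G \<psi>" and c: "\<And>t. t \<in> S \<Longrightarrow> \<bar>c t\<bar> \<le> K"
  shows "asympt S (\<lambda>\<epsilon> t. F \<epsilon> t + c t * G \<epsilon> t) (\<lambda>t. \<phi> t + fps_const (c t) * \<psi> t)"
proof (rule asymptI)
  fix N
  obtain C e where C: "C > 0" "0 < e" "\<And>\<epsilon> t. 0 < \<epsilon> \<Longrightarrow> \<epsilon> < e \<Longrightarrow> t \<in> S \<Longrightarrow> \<bar>F \<epsilon> t - (\<Sum>k<N. \<phi> t $ k * \<epsilon> ^ k)\<bar> \<le> C * \<epsilon> ^ N"
    by (rule asymptE[OF F, where N = "N"]) blast
  obtain D e' where D: "D > 0" "0 < e'" "\<And>\<epsilon> t. 0 < \<epsilon> \<Longrightarrow> \<epsilon> < e' \<Longrightarrow> t \<in> S \<Longrightarrow> \<bar>G \<epsilon> t - (\<Sum>k<N. \<psi> t $ k * \<epsilon> ^ k)\<bar> \<le> D * \<epsilon> ^ N"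
    by (rule asymptE[OF G, where N = "N"]) blast
  have "\<bar>F \<epsilon> t + c t * G \<epsilon> t - (\<Sum>k<N. (\<phi> t + fps_const (c t) * \<psi> t) $ k * \<epsilon> ^ k)\<bar> \<le> (C + K * D) * \<epsilon> ^ N"
    if "0 < \<epsilon>" "\<epsilon> < min e e'" "t \<in> S" for \<epsilon> t
  proof -
    have "F \<epsilon> t + c t * G \<epsilon> t - (\<Sum>k<N. (\<phi> t + fps_const (c t) * \<psi> t) $ k * \<epsilon> ^ k)
      = (F \<epsilon> t - (\<Sum>k<N. \<phi> t $ k * \<epsilon> ^ k)) + c t * (G \<epsilon> t - (\<Sum>k<N. \<psi> t $ k * \<epsilon> ^ k))"
      by (simp add: sum.distrib sum_distrib_left algebra_simps)
    also have "\<bar>\<dots>\<bar> \<le> C * \<epsilon> ^ N + K * (D * \<epsilon> ^ N)"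
    proof (rule order_trans[OF abs_triangle_ineq add_mono])
      show "\<bar>F \<epsilon> t - (\<Sum>k<N. \<phi> t $ k * \<epsilon> ^ k)\<bar> \<le> C * \<epsilon> ^ N" using that by (intro C) auto
      have "\<bar>G \<epsilon> t - (\<Sum>k<N. \<psi> t $ k * \<epsilon> ^ k)\<bar> \<le> D * \<epsilon> ^ N" using that by (intro D) auto
      then show "\<bar>c t * (G \<epsilon> t - (\<Sum>k<N. \<psi> t $ k * \<epsilon> ^ k))\<bar> \<le> K * (D * \<epsilon> ^ N)"
        unfolding abs_mult using c[OF that(3)] by (intro mult_mono) auto
    qed
    finally show ?thesis by (simp add: algebra_simps)
  qed
  then show "\<exists>C. \<exists>e>0. \<forall>\<epsilon>. 0 < \<epsilon> \<and> \<epsilon> < e \<longrightarrow> (\<forall>t\<in>S. \<bar>F \<epsilon> t + c t * G \<epsilon> t - (\<Sum>k<N. (\<phi> t + fps_const (c t) * \<psi> t) $ k * \<epsilon> ^ k)\<bar> \<le> C * \<epsilon> ^ N)"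
    using C D by (intro exI[of _ "C + K * D"] exI[of _ "min e e'"]) auto
qed

lemma asympt_diff:
  assumes "asympt S F \<phi>" "asympt S G \<psi>"
  shows "asympt S (\<lambda>\<epsilon> t. F \<epsilon> t - G \<epsilon> t) (\<lambda>t. \<phi> t - \<psi> t)"
proof -
  have "asympt S (\<lambda>\<epsilon> t. F \<epsilon> t + - 1 * G \<epsilon> t) (\<lambda>t. \<phi> t + fps_const (- 1) * \<psi> t)"
    by (rule asympt_linear[OF assms, where K = 1]) simp
  moreover have "fps_const (- 1) * x = - x" for x :: "real fps" by (simp add: fps_eq_iff)
  ultimately show ?thesis by simp
qed

lemma asympt_shift:
  assumes F: "asympt S F \<phi>"
  shows "asympt S (\<lambda>\<epsilon> t. \<epsilon> * F \<epsilon> t) (\<lambda>t. fps_X * \<phi> t)"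
proof (rule asymptI)
  fix N
  show "\<exists>C. \<exists>e>0. \<forall>\<epsilon>. 0 < \<epsilon> \<and> \<epsilon> < e \<longrightarrow> (\<forall>t\<in>S. \<bar>\<epsilon> * F \<epsilon> t - (\<Sum>k<N. (fps_X * \<phi> t) $ k * \<epsilon> ^ k)\<bar> \<le> C * \<epsilon> ^ N)"
  proof (cases N)
    case 0
    obtain C e where C: "C > 0" "0 < e" "e < 1" "\<And>\<epsilon> t. 0 < \<epsilon> \<Longrightarrow> \<epsilon> < e \<Longrightarrow> t \<in> S \<Longrightarrow> \<bar>F \<epsilon> t - (\<Sum>k<0. \<phi> t $ k * \<epsilon> ^ k)\<bar> \<le> C * \<epsilon> ^ 0"
      by (rule asymptE[OF F, where N = "0"]) blast
    have "\<bar>\<epsilon> * F \<epsilon> t\<bar> \<le> C" if "0 < \<epsilon>" "\<epsilon> < e" "t \<in> S" for \<epsilon> t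
    proof -
      have "\<epsilon> * \<bar>F \<epsilon> t\<bar> \<le> 1 * C" using that C(1,3) C(4)[OF that] by (intro mult_mono) auto
      then show ?thesis using that by (simp add: abs_mult)
    qed
    then show ?thesis using 0 C by (intro exI[of _ C] exI[of _ e]) auto
  next
    case (Suc m)
    obtain C e where C: "C > 0" "0 < e" "e < 1" "\<And>\<epsilon> t. 0 < \<epsilon> \<Longrightarrow> \<epsilon> < e \<Longrightarrow> t \<in> S \<Longrightarrow> \<bar>F \<epsilon> t - (\<Sum>k<m. \<phi> t $ k * \<epsilon> ^ k)\<bar> \<le> C * \<epsilon> ^ m"
      by (rule asymptE[OF F, where N = "m"]) blast
    have "\<bar>\<epsilon> * F \<epsilon> t - (\<Sum>k<N. (fps_X * \<phi> t) $ k * \<epsilon> ^ k)\<bar> \<le> C * \<epsilon> ^ N" if "0 < \<epsilon>" "\<epsilon> < e" "t \<in> S" for \<epsilon> t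
    proof -
      have "(\<Sum>k<N. (fps_X * \<phi> t) $ k * \<epsilon> ^ k) = \<epsilon> * (\<Sum>k<m. \<phi> t $ k * \<epsilon> ^ k)"
        unfolding Suc by (subst sum.lessThan_Suc_shift) (simp add: sum_distrib_left mult_ac)
      then have "\<bar>\<epsilon> * F \<epsilon> t - (\<Sum>k<N. (fps_X * \<phi> t) $ k * \<epsilon> ^ k)\<bar> = \<epsilon> * \<bar>F \<epsilon> t - (\<Sum>k<m. \<phi> t $ k * \<epsilon> ^ k)\<bar>"
        using that by (simp add: right_diff_distrib[symmetric] abs_mult)
      also have "\<dots> \<le> \<epsilon> * (C * \<epsilon> ^ m)" using C(4)[OF that] that by (intro mult_left_mono) auto
      finally show ?thesis by (simp add: Suc mult_ac)
    qed
    then show ?thesis using C by blast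
  qed
qed

lemma asympt_mult:
  assumes F: "asympt S F \<phi>" and G: "asympt S G \<psi>"
  shows "asympt S (\<lambda>\<epsilon> t. F \<epsilon> t * G \<epsilon> t) (\<lambda>t. \<phi> t * \<psi> t)"
proof (rule asymptI)
  fix N
  obtain C e where C: "C > 0" "0 < e" "e < 1" "\<And>\<epsilon> t. 0 < \<epsilon> \<Longrightarrow> \<epsilon> < e \<Longrightarrow> t \<in> S \<Longrightarrow> \<bar>F \<epsilon> t - (\<Sum>k<N. \<phi> t $ k * \<epsilon> ^ k)\<bar> \<le> C * \<epsilon> ^ N"
    by (rule asymptE[OF F, where N = "N"]) blast
  obtain D e' where D: "D > 0" "0 < e'" "e' < 1" "\<And>\<epsilon> t. 0 < \<epsilon> \<Longrightarrow> \<epsilon> < e' \<Longrightarrow> t \<in> S \<Longrightarrow> \<bar>G \<epsilon> t - (\<Sum>k<N. \<psi> t $ k * \<epsilon> ^ k)\<bar> \<le> D * \<epsilon> ^ N"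
    by (rule asymptE[OF G, where N = "N"]) blast
  obtain C0 e0 where C0: "C0 > 0" "0 < e0" "e0 < 1" "\<And>\<epsilon> t. 0 < \<epsilon> \<Longrightarrow> \<epsilon> < e0 \<Longrightarrow> t \<in> S \<Longrightarrow> \<bar>F \<epsilon> t - (\<Sum>k<0. \<phi> t $ k * \<epsilon> ^ k)\<bar> \<le> C0 * \<epsilon> ^ 0"
    by (rule asymptE[OF F, where N = "0"]) blast
  obtain D0 e1 where D0: "D0 > 0" "0 < e1" "e1 < 1" "\<And>\<epsilon> t. 0 < \<epsilon> \<Longrightarrow> \<epsilon> < e1 \<Longrightarrow> t \<in> S \<Longrightarrow> \<bar>G \<epsilon> t - (\<Sum>k<0. \<psi> t $ k * \<epsilon> ^ k)\<bar> \<le> D0 * \<epsilon> ^ 0"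
    by (rule asymptE[OF G, where N = "0"]) blast
  obtain K where K: "\<And>n. K n > 0" "\<And>n t. t \<in> S \<Longrightarrow> \<bar>\<phi> t $ n\<bar> \<le> K n"
  proof -
    have "\<forall>n. \<exists>K>0. \<forall>t\<in>S. \<bar>\<phi> t $ n\<bar> \<le> K" by (meson asympt_coeff_bounded[OF F])
    then show ?thesis using that by metis
  qed
  obtain L where L: "\<And>n. L n > 0" "\<And>n t. t \<in> S \<Longrightarrow> \<bar>\<psi> t $ n\<bar> \<le> L n"
  proof -
    have "\<forall>n. \<exists>K>0. \<forall>t\<in>S. \<bar>\<psi> t $ n\<bar> \<le> K" by (meson asympt_coeff_bounded[OF G])
    then show ?thesis using that by metis
  qed
  define E where "E = (\<Sum>i<N. \<Sum>j<N. K i * L j)"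
  define d where "d = min (min e e') (min e0 e1)"
  have "\<bar>F \<epsilon> t * G \<epsilon> t - (\<Sum>k<N. (\<phi> t * \<psi> t) $ k * \<epsilon> ^ k)\<bar> \<le> (C0 * D + C * (D0 + D) + E) * \<epsilon> ^ N"
    if \<epsilon>: "0 < \<epsilon>" "\<epsilon> < d" and t: "t \<in> S" for \<epsilon> t
  proof -
    define P where "P = (\<Sum>k<N. \<phi> t $ k * \<epsilon> ^ k)"
    define Q where "Q = (\<Sum>k<N. \<psi> t $ k * \<epsilon> ^ k)"
    have 1: "\<bar>F \<epsilon> t - P\<bar> \<le> C * \<epsilon> ^ N" unfolding P_def by (rule C(4)) (use \<epsilon> t in \<open>auto simp: d_def\<close>)
    have 2: "\<bar>G \<epsilon> t - Q\<bar> \<le> D * \<epsilon> ^ N" unfolding Q_def by (rule D(4)) (use \<epsilon> t in \<open>auto simp: d_def\<close>)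
    have 3: "\<bar>F \<epsilon> t\<bar> \<le> C0" using C0(4)[of \<epsilon> t] \<epsilon> t by (simp add: d_def)
    have 4: "\<bar>G \<epsilon> t\<bar> \<le> D0" using D0(4)[of \<epsilon> t] \<epsilon> t by (simp add: d_def)
    have "\<epsilon> ^ N \<le> 1" using \<epsilon> C(3) by (intro power_le_one) (auto simp: d_def)
    then have "D * \<epsilon> ^ N \<le> D * 1" using D(1) by (intro mult_left_mono) auto
    then have 5: "\<bar>Q\<bar> \<le> D0 + D" using 2 4 by linarith
    \<comment> \<open>The product of the truncations differs from the truncated product only by
      terms with \<open>i + j \<ge> N\<close>, each of which is O(\<open>\<epsilon>^N\<close>)
      uniformly in \<open>t\<close>.\<close>
    have 6: "\<bar>P * Q - (\<Sum>k<N. (\<phi> t * \<psi> t) $ k * \<epsilon> ^ k)\<bar> \<le> E * \<epsilon> ^ N"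
    proof -
      let ?f = "\<lambda>i j. \<phi> t $ i * \<psi> t $ j * \<epsilon> ^ (i + j)"
      have PQ: "P * Q = (\<Sum>i<N. \<Sum>j<N. ?f i j)"
        unfolding P_def Q_def sum_product by (intro sum.cong refl) (simp add: power_add)
      have "(\<Sum>k<N. (\<phi> t * \<psi> t) $ k * \<epsilon> ^ k) = (\<Sum>k<N. \<Sum>i\<le>k. ?f i (k - i))"
        unfolding fps_mult_nth sum_distrib_right atLeast0AtMost by (intro sum.cong refl) simp
      also have "\<dots> = (\<Sum>(i, j)\<in>{(i, j). i + j < N}. ?f i j)"
        by (rule sum.triangle_reindex[symmetric])
      also have "\<dots> = (\<Sum>(i, j)\<in>{..<N} \<times> {..<N}. if i + j < N then ?f i j else 0)"
        by (rule sum.mono_neutral_cong_left) (auto split: if_splits)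
      also have "\<dots> = (\<Sum>i<N. \<Sum>j<N. if i + j < N then ?f i j else 0)"
        by (simp add: sum.cartesian_product)
      finally have "P * Q - (\<Sum>k<N. (\<phi> t * \<psi> t) $ k * \<epsilon> ^ k) = (\<Sum>i<N. \<Sum>j<N. ?f i j - (if i + j < N then ?f i j else 0))"
        by (simp only: PQ sum_subtractf)
      also have "\<bar>\<dots>\<bar> \<le> (\<Sum>i<N. \<Sum>j<N. K i * L j * \<epsilon> ^ N)"
      proof (intro order_trans[OF sum_abs] sum_mono)
        fix i j
        show "\<bar>?f i j - (if i + j < N then ?f i j else 0)\<bar> \<le> K i * L j * \<epsilon> ^ N"
        proof (cases "i + j < N")
          case True
          then show ?thesis using K(1)[of i] L(1)[of j] \<epsilon> by simp
        next
          case False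
          have "\<bar>?f i j\<bar> = \<bar>\<phi> t $ i\<bar> * \<bar>\<psi> t $ j\<bar> * \<epsilon> ^ (i + j)" using \<epsilon> by (simp add: abs_mult)
          also have "\<dots> \<le> K i * L j * \<epsilon> ^ N"
          proof (intro mult_mono K L t)
            show "\<epsilon> ^ (i + j) \<le> \<epsilon> ^ N" using False \<epsilon> C(3) by (intro power_decreasing) (auto simp: d_def)
          qed (use K(1)[of i] L(1)[of j] \<epsilon> in auto)
          finally show ?thesis using False by simp
        qed
      qed
      also have "\<dots> = E * \<epsilon> ^ N" by (simp add: E_def sum_distrib_right)
      finally show ?thesis .
    qed
    have "F \<epsilon> t * G \<epsilon> t - (\<Sum>k<N. (\<phi> t * \<psi> t) $ k * \<epsilon> ^ k)
       = F \<epsilon> t * (G \<epsilon> t - Q) + (F \<epsilon> t - P) * Q + (P * Q - (\<Sum>k<N. (\<phi> t * \<psi> t) $ k * \<epsilon> ^ k))"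
      by (simp add: algebra_simps)
    also have "\<bar>\<dots>\<bar> \<le> \<bar>F \<epsilon> t\<bar> * \<bar>G \<epsilon> t - Q\<bar> + \<bar>F \<epsilon> t - P\<bar> * \<bar>Q\<bar> + E * \<epsilon> ^ N"
      using 6 by (auto simp: abs_mult[symmetric] intro!: order_trans[OF abs_triangle_ineq] add_mono)
    also have "\<dots> \<le> C0 * (D * \<epsilon> ^ N) + (C * \<epsilon> ^ N) * (D0 + D) + E * \<epsilon> ^ N"
      using 1 2 3 5 C0(1) C(1) \<epsilon> by (intro add_mono mult_mono order_refl) auto
    finally show ?thesis by (simp add: algebra_simps)
  qed
  moreover have "d > 0" using C D C0 D0 by (simp add: d_def)
  ultimately show "\<exists>C. \<exists>e>0. \<forall>\<epsilon>. 0 < \<epsilon> \<and> \<epsilon> < e \<longrightarrow> (\<forall>t\<in>S. \<bar>F \<epsilon> t * G \<epsilon> t - (\<Sum>k<N. (\<phi> t * \<psi> t) $ k * \<epsilon> ^ k)\<bar> \<le> C * \<epsilon> ^ N)"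
    by blast
qed

lemma asympt_one: "asympt S (\<lambda>\<epsilon> t. 1) (\<lambda>t. 1)"
proof (rule asymptI)
  fix N
  have "\<bar>1 - (\<Sum>k<N. (1 :: real fps) $ k * \<epsilon> ^ k)\<bar> \<le> 1 * \<epsilon> ^ N" if "0 < \<epsilon>" for \<epsilon> :: real
  proof (cases N)
    case (Suc m)
    then have "(\<Sum>k<N. (1 :: real fps) $ k * \<epsilon> ^ k) = 1" by (subst Suc, subst sum.lessThan_Suc_shift) simp
    then show ?thesis using that by simp
  qed simp
  then show "\<exists>C. \<exists>e>0. \<forall>\<epsilon>. 0 < \<epsilon> \<and> \<epsilon> < e \<longrightarrow> (\<forall>t\<in>S. \<bar>1 - (\<Sum>k<N. (1 :: real fps) $ k * \<epsilon> ^ k)\<bar> \<le> C * \<epsilon> ^ N)"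
    by (intro exI[of _ 1]) auto
qed

lemma asympt_power: "asympt S F \<phi> \<Longrightarrow> asympt S (\<lambda>\<epsilon> t. F \<epsilon> t ^ n) (\<lambda>t. \<phi> t ^ n)"
  by (induction n) (auto intro: asympt_one asympt_mult)

lemma asympt_zero: "asympt S (\<lambda>\<epsilon> t. 0) (\<lambda>t. 0)"
  by (rule asymptI) (auto intro!: exI[of _ 0] exI[of _ "1::real"])

lemma asympt_bounded_fun:
  assumes "\<And>t. t \<in> S \<Longrightarrow> \<bar>f t\<bar> \<le> K"
  shows "asympt S (\<lambda>\<epsilon> t. f t) (\<lambda>t. fps_const (f t))"
  using asympt_linear[OF asympt_zero asympt_one, of S f K] assms by simp

lemma asympt_sum:
  "finite A \<Longrightarrow> (\<And>i. i \<in> A \<Longrightarrow> asympt S (F i) (\<phi> i)) \<Longrightarrow>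
   asympt S (\<lambda>\<epsilon> t. \<Sum>i\<in>A. c i * F i \<epsilon> t) (\<lambda>t. \<Sum>i\<in>A. fps_const (c i) * \<phi> i t)"
proof (induction A rule: finite_induct)
  case (insert x A)
  have "asympt S (\<lambda>\<epsilon> t. (\<Sum>i\<in>A. c i * F i \<epsilon> t) + c x * F x \<epsilon> t) (\<lambda>t. (\<Sum>i\<in>A. fps_const (c i) * \<phi> i t) + fps_const (c x) * \<phi> x t)"
    using insert by (intro asympt_linear[where K = "\<bar>c x\<bar>"]) auto
  then show ?case using insert by (simp add: add.commute)
qed (simp add: asympt_zero)

text \<open>By induction the lower coefficients agree; dividing the difference of the two estimates
  by \<open>\<epsilon> ^ n\<close> leaves O(\<epsilon>).\<close>

lemma asympt_unique:
  assumes "asympt S F \<phi>" "asympt S F \<psi>" "t \<in> S"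
  shows "\<phi> t = \<psi> t"
proof (rule fps_ext)
  fix n
  show "\<phi> t $ n = \<psi> t $ n"
  proof (induction n rule: less_induct)
    case (less n)
    obtain C e where C: "C > 0" "0 < e" "\<And>\<epsilon> t. 0 < \<epsilon> \<Longrightarrow> \<epsilon> < e \<Longrightarrow> t \<in> S \<Longrightarrow> \<bar>F \<epsilon> t - (\<Sum>k<Suc n. \<phi> t $ k * \<epsilon> ^ k)\<bar> \<le> C * \<epsilon> ^ Suc n"
      by (rule asymptE[OF assms(1), where N = "Suc n"]) blast
    obtain D e' where D: "D > 0" "0 < e'" "\<And>\<epsilon> t. 0 < \<epsilon> \<Longrightarrow> \<epsilon> < e' \<Longrightarrow> t \<in> S \<Longrightarrow> \<bar>F \<epsilon> t - (\<Sum>k<Suc n. \<psi> t $ k * \<epsilon> ^ k)\<bar> \<le> D * \<epsilon> ^ Suc n"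
      by (rule asymptE[OF assms(2), where N = "Suc n"]) blast
    have le: "\<bar>\<phi> t $ n - \<psi> t $ n\<bar> \<le> (C + D) * \<epsilon>" if "0 < \<epsilon>" "\<epsilon> < min e e'" for \<epsilon>
    proof -
      have s: "(\<Sum>k<n. \<phi> t $ k * \<epsilon> ^ k) = (\<Sum>k<n. \<psi> t $ k * \<epsilon> ^ k)" using less by (intro sum.cong) auto
      have "\<bar>F \<epsilon> t - (\<Sum>k<Suc n. \<phi> t $ k * \<epsilon> ^ k)\<bar> \<le> C * \<epsilon> ^ Suc n"
        "\<bar>F \<epsilon> t - (\<Sum>k<Suc n. \<psi> t $ k * \<epsilon> ^ k)\<bar> \<le> D * \<epsilon> ^ Suc n" using that C(3)[OF _ _ assms(3), of \<epsilon>] D(3)[OF _ _ assms(3), of \<epsilon>] by (simp_all only: min_less_iff_conj)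
      then have "\<bar>\<phi> t $ n * \<epsilon> ^ n - \<psi> t $ n * \<epsilon> ^ n\<bar> \<le> C * \<epsilon> ^ Suc n + D * \<epsilon> ^ Suc n"
        unfolding sum.lessThan_Suc s by linarith
      then have "\<bar>\<phi> t $ n - \<psi> t $ n\<bar> * \<epsilon> ^ n \<le> ((C + D) * \<epsilon>) * \<epsilon> ^ n"
        using that unfolding left_diff_distrib[symmetric] abs_mult by (simp add: algebra_simps)
      then show ?thesis using that by (simp add: mult_le_cancel_right)
    qed
    have "((\<lambda>\<epsilon>. (C + D) * \<epsilon>) \<longlongrightarrow> (C + D) * 0) (at_right 0)" by (intro tendsto_intros)
    moreover have "\<forall>\<^sub>F \<epsilon> in at_right 0. \<bar>\<phi> t $ n - \<psi> t $ n\<bar> \<le> (C + D) * \<epsilon>"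
      unfolding eventually_at_right_field using C D le by (intro exI[of _ "min e e'"]) auto
    ultimately have "\<bar>\<phi> t $ n - \<psi> t $ n\<bar> \<le> (C + D) * 0"
      by (intro tendsto_lowerbound[where f = "\<lambda>\<epsilon>. (C + D) * \<epsilon>" and F = "at_right 0"]) auto
    then show ?case by simp
  qed
qed

text \<open>The coefficient is the uniform limit, as \<epsilon> decreases to 0, of the rescaled
  remainders \<open>?G\<close>, which are continuous by induction.\<close>

lemma asympt_coeff_continuous:
  fixes F :: "real \<Rightarrow> 'a::metric_space \<Rightarrow> real"
  assumes F: "asympt S F \<phi>" and "d > 0" and cont: "\<And>\<epsilon>. 0 < \<epsilon> \<Longrightarrow> \<epsilon> < d \<Longrightarrow> continuous_on S (F \<epsilon>)"
  shows "continuous_on S (\<lambda>t. \<phi> t $ n)"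
proof (induction n rule: less_induct)
  case (less n)
  obtain C e where C: "C > 0" "0 < e" "\<And>\<epsilon> t. 0 < \<epsilon> \<Longrightarrow> \<epsilon> < e \<Longrightarrow> t \<in> S \<Longrightarrow> \<bar>F \<epsilon> t - (\<Sum>k<Suc n. \<phi> t $ k * \<epsilon> ^ k)\<bar> \<le> C * \<epsilon> ^ Suc n"
    by (rule asymptE[OF F, where N = "Suc n"]) blast
  let ?G = "\<lambda>\<epsilon> t. (F \<epsilon> t - (\<Sum>k<n. \<phi> t $ k * \<epsilon> ^ k)) / \<epsilon> ^ n"
  show ?case
  proof (rule uniform_limit_theorem[where F = "at_right 0" and f = ?G])
    show "\<forall>\<^sub>F \<epsilon> in at_right 0. continuous_on S (?G \<epsilon>)"
      unfolding eventually_at_right_field using \<open>d > 0\<close> cont less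
      by (intro exI[of _ d]) (auto intro!: continuous_intros)
    show "uniform_limit S ?G (\<lambda>t. \<phi> t $ n) (at_right 0)"
    proof (rule uniform_limitI)
      fix r :: real assume "r > 0"
      have "dist (?G \<epsilon> t) (\<phi> t $ n) < r" if "0 < \<epsilon>" "\<epsilon> < min e (r / C)" "t \<in> S" for \<epsilon> t
      proof -
        have "?G \<epsilon> t - \<phi> t $ n = (F \<epsilon> t - (\<Sum>k<Suc n. \<phi> t $ k * \<epsilon> ^ k)) / \<epsilon> ^ n"
          using that by (simp add: field_simps)
        then have "dist (?G \<epsilon> t) (\<phi> t $ n) = \<bar>F \<epsilon> t - (\<Sum>k<Suc n. \<phi> t $ k * \<epsilon> ^ k)\<bar> / \<epsilon> ^ n"
          using that by (simp only: dist_real_def abs_divide) simp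
        also have "\<dots> \<le> C * \<epsilon> ^ Suc n / \<epsilon> ^ n" using that by (intro divide_right_mono C) auto
        also have "\<dots> = C * \<epsilon>" using that by simp
        also have "\<dots> < r" using that C(1) by (simp add: field_simps)
        finally show ?thesis .
      qed
      then show "\<forall>\<^sub>F \<epsilon> in at_right 0. \<forall>t\<in>S. dist (?G \<epsilon> t) (\<phi> t $ n) < r"
        unfolding eventually_at_right_field using C \<open>r > 0\<close> by (intro exI[of _ "min e (r / C)"]) auto
    qed
  qed simp
qed

lemma asympt_integral:
  fixes F :: "real \<Rightarrow> real \<Rightarrow> real"
  assumes F: "asympt {a..b} F \<phi>" and "d > 0" and cont: "\<And>\<epsilon>. 0 < \<epsilon> \<Longrightarrow> \<epsilon> < d \<Longrightarrow> continuous_on {a..b} (F \<epsilon>)"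
  shows "asympt {a..b} (\<lambda>\<epsilon> t. integral {a..t} (F \<epsilon>)) (\<lambda>t. Abs_fps (\<lambda>n. integral {a..t} (\<lambda>s. \<phi> s $ n)))"
proof (rule asymptI)
  fix N
  have cc: "continuous_on {a..b} (\<lambda>t. \<phi> t $ n)" for n by (rule asympt_coeff_continuous[OF F \<open>d > 0\<close> cont])
  obtain C e where C: "C > 0" "0 < e" "\<And>\<epsilon> t. 0 < \<epsilon> \<Longrightarrow> \<epsilon> < e \<Longrightarrow> t \<in> {a..b} \<Longrightarrow> \<bar>F \<epsilon> t - (\<Sum>k<N. \<phi> t $ k * \<epsilon> ^ k)\<bar> \<le> C * \<epsilon> ^ N"
    by (rule asymptE[OF F, where N = "N"]) blast
  have "\<bar>integral {a..t} (F \<epsilon>) - (\<Sum>k<N. Abs_fps (\<lambda>n. integral {a..t} (\<lambda>s. \<phi> s $ n)) $ k * \<epsilon> ^ k)\<bar> \<le> C * (b - a) * \<epsilon> ^ N"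
    if \<epsilon>: "0 < \<epsilon>" "\<epsilon> < min d e" and t: "t \<in> {a..b}" for \<epsilon> t
  proof -
    have iF: "F \<epsilon> integrable_on {a..t}"
      by (rule integrable_continuous_real[OF continuous_on_subset[OF cont]]) (use \<epsilon> t in auto)
    have ic: "(\<lambda>s. \<phi> s $ k * \<epsilon> ^ k) integrable_on {a..t}" for k
      by (rule integrable_continuous_real) (use t in \<open>auto intro!: continuous_intros continuous_on_subset[OF cc]\<close>)
    have "(\<Sum>k<N. Abs_fps (\<lambda>n. integral {a..t} (\<lambda>s. \<phi> s $ n)) $ k * \<epsilon> ^ k) = (\<Sum>k<N. integral {a..t} (\<lambda>s. \<phi> s $ k * \<epsilon> ^ k))"
      by simp
    also have "\<dots> = integral {a..t} (\<lambda>s. \<Sum>k<N. \<phi> s $ k * \<epsilon> ^ k)"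
      by (rule integral_sum[symmetric]) (use ic in auto)
    finally have "integral {a..t} (F \<epsilon>) - (\<Sum>k<N. Abs_fps (\<lambda>n. integral {a..t} (\<lambda>s. \<phi> s $ n)) $ k * \<epsilon> ^ k)
        = integral {a..t} (\<lambda>s. F \<epsilon> s - (\<Sum>k<N. \<phi> s $ k * \<epsilon> ^ k))"
      using integral_diff[OF iF integrable_sum[of "{..<N}", OF _ ic]] by simp
    also have "norm \<dots> \<le> C * \<epsilon> ^ N * (t - a)"
    proof (rule integral_bound)
      show "continuous_on {a..t} (\<lambda>s. F \<epsilon> s - (\<Sum>k<N. \<phi> s $ k * \<epsilon> ^ k))"
        using \<epsilon> t by (intro continuous_intros continuous_on_subset[OF cont] continuous_on_subset[OF cc]) auto
      show "norm (F \<epsilon> s - (\<Sum>k<N. \<phi> s $ k * \<epsilon> ^ k)) \<le> C * \<epsilon> ^ N" if "s \<in> {a..t}" for s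
        using C(3)[of \<epsilon> s] \<epsilon> t that by simp
    qed (use t in auto)
    also have "\<dots> \<le> C * \<epsilon> ^ N * (b - a)" using t C(1) \<epsilon> by (intro mult_left_mono) auto
    finally show ?thesis by (simp add: mult_ac)
  qed
  then show "\<exists>C. \<exists>e>0. \<forall>\<epsilon>. 0 < \<epsilon> \<and> \<epsilon> < e \<longrightarrow> (\<forall>t\<in>{a..b}. \<bar>integral {a..t} (F \<epsilon>) - (\<Sum>k<N. Abs_fps (\<lambda>n. integral {a..t} (\<lambda>s. \<phi> s $ n)) $ k * \<epsilon> ^ k)\<bar> \<le> C * \<epsilon> ^ N)"
    using C \<open>d > 0\<close> by (intro exI[of _ "C * (b - a)"] exI[of _ "min d e"]) auto
qed

text \<open>As the constant coefficient vanishes, the inner function is O(\<epsilon>) and enters a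
  disc well inside that of convergence. The Taylor tail of \<open>G\<close> is then
  O(\<open>\<epsilon>^N\<close>), and the remaining polynomial is covered by sums and powers of
  expansions.\<close>

lemma asympt_analytic_compose:
  assumes F: "asympt S F \<phi>" and \<phi>0: "\<And>t. t \<in> S \<Longrightarrow> \<phi> t $ 0 = 0" and "r > 0"
    and G: "\<And>x. \<bar>x\<bar> < r \<Longrightarrow> (\<lambda>k. a k * x ^ k) sums G x"
  shows "asympt S (\<lambda>\<epsilon> t. G (F \<epsilon> t)) (\<lambda>t. fps_compose (Abs_fps a) (\<phi> t))"
proof (rule asymptI)
  fix N
  \<comment> \<open>Convergence at \<open>r / 2\<close> bounds the general term there by some
    \<open>K\<close>; for \<open>\<bar>x\<bar> \<le> r / 4\<close> this yields a geometric tail of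
    ratio 1/2.\<close>
  have "summable (\<lambda>k. a k * (r/2) ^ k)" using G[of "r/2"] \<open>r > 0\<close> by (auto simp: sums_iff)
  then have "(\<lambda>k. a k * (r/2) ^ k) \<longlonglongrightarrow> 0" by (rule summable_LIMSEQ_zero)
  then have "Bseq (\<lambda>k. a k * (r/2) ^ k)" by (intro convergent_imp_Bseq) (auto simp: convergent_def)
  then obtain K where K: "K > 0" "\<And>k. \<bar>a k * (r/2) ^ k\<bar> \<le> K" by (auto simp: Bseq_def)
  have tail: "\<bar>G x - (\<Sum>k<N. a k * x ^ k)\<bar> \<le> 2 * K * (2 / r) ^ N * \<bar>x\<bar> ^ N" if x: "\<bar>x\<bar> \<le> r / 4" for x
  proof -
    have s: "(\<lambda>k. a (k + N) * x ^ (k + N)) sums (G x - (\<Sum>k<N. a k * x ^ k))"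
      by (rule sums_split_initial_segment[OF G]) (use x \<open>r > 0\<close> in auto)
    have g: "(\<lambda>k. K * (\<bar>x\<bar> / (r/2)) ^ N * (1/2) ^ k) sums (K * (\<bar>x\<bar> / (r/2)) ^ N * (1 / (1 - 1/2)))"
      by (intro sums_mult geometric_sums) simp
    have le: "\<bar>a (k + N) * x ^ (k + N)\<bar> \<le> K * (\<bar>x\<bar> / (r/2)) ^ N * (1/2) ^ k" for k
    proof -
      have "\<bar>a (k + N) * x ^ (k + N)\<bar> = \<bar>a (k + N) * (r/2) ^ (k + N)\<bar> * (\<bar>x\<bar> / (r/2)) ^ (k + N)"
        using \<open>r > 0\<close> by (simp add: abs_mult power_abs power_divide power_mult_distrib)
      also have "\<dots> \<le> K * (\<bar>x\<bar> / (r/2)) ^ (k + N)" using \<open>r > 0\<close> by (intro mult_right_mono K) auto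
      also have "\<dots> = K * (\<bar>x\<bar> / (r/2)) ^ N * (\<bar>x\<bar> / (r/2)) ^ k" by (simp add: power_add)
      also have "\<dots> \<le> K * (\<bar>x\<bar> / (r/2)) ^ N * (1/2) ^ k"
        using x \<open>r > 0\<close> K(1) by (intro mult_left_mono power_mono) (auto simp: field_simps)
      finally show ?thesis .
    qed
    have sa: "summable (\<lambda>k. \<bar>a (k + N) * x ^ (k + N)\<bar>)"
      by (rule summable_comparison_test'[OF sums_summable[OF g], of 0]) (use le in auto)
    have "\<bar>G x - (\<Sum>k<N. a k * x ^ k)\<bar> \<le> (\<Sum>k. \<bar>a (k + N) * x ^ (k + N)\<bar>)"
      using summable_rabs[OF sa] s by (simp only: sums_iff)
    also have "\<dots> \<le> (\<Sum>k. K * (\<bar>x\<bar> / (r/2)) ^ N * (1/2) ^ k)" by (rule suminf_le[OF le sa sums_summable[OF g]])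
    also have "\<dots> = K * (\<bar>x\<bar> / (r/2)) ^ N * (1 / (1 - 1/2))" using g by (simp only: sums_iff)
    also have "\<dots> = 2 * K * (2 / r) ^ N * \<bar>x\<bar> ^ N" by (simp add: power_divide power_mult_distrib mult_ac)
    finally show ?thesis .
  qed
  obtain C e where C: "C > 0" "0 < e" "e < 1" "\<And>\<epsilon> t. 0 < \<epsilon> \<Longrightarrow> \<epsilon> < e \<Longrightarrow> t \<in> S \<Longrightarrow> \<bar>F \<epsilon> t - (\<Sum>k<1. \<phi> t $ k * \<epsilon> ^ k)\<bar> \<le> C * \<epsilon> ^ 1"
    by (rule asymptE[OF F, where N = 1]) blast
  have as: "asympt S (\<lambda>\<epsilon> t. \<Sum>i<N. a i * F \<epsilon> t ^ i) (\<lambda>t. \<Sum>i<N. fps_const (a i) * \<phi> t ^ i)"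
    by (rule asympt_sum) (auto intro: asympt_power F)
  obtain D e' where D: "D > 0" "0 < e'" "e' < 1" "\<And>\<epsilon> t. 0 < \<epsilon> \<Longrightarrow> \<epsilon> < e' \<Longrightarrow> t \<in> S \<Longrightarrow>
      \<bar>(\<Sum>i<N. a i * F \<epsilon> t ^ i) - (\<Sum>k<N. (\<Sum>i<N. fps_const (a i) * \<phi> t ^ i) $ k * \<epsilon> ^ k)\<bar> \<le> D * \<epsilon> ^ N"
    by (rule asymptE[OF as, where N = N]) blast
  \<comment> \<open>The bound \<open>r / (4 * C)\<close> forces
    \<open>C * \<epsilon> \<le> r / 4\<close>, which brings the values of \<open>F\<close> into the
    range of \<open>tail\<close>.\<close>
  define d where "d = min (min e e') (r / (4 * C))"
  have "\<bar>G (F \<epsilon> t) - (\<Sum>k<N. fps_compose (Abs_fps a) (\<phi> t) $ k * \<epsilon> ^ k)\<bar> \<le> (2 * K * (2 / r) ^ N * C ^ N + D) * \<epsilon> ^ N"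
    if \<epsilon>: "0 < \<epsilon>" "\<epsilon> < d" and t: "t \<in> S" for \<epsilon> t
  proof -
    have u: "\<bar>F \<epsilon> t\<bar> \<le> C * \<epsilon>" using C(4)[of \<epsilon> t] \<epsilon> t \<phi>0[OF t] by (simp add: d_def)
    have "\<epsilon> < r / (4 * C)" using \<epsilon> by (simp add: d_def)
    then have "C * \<epsilon> \<le> r / 4" using C(1) by (simp add: field_simps)
    with u have "\<bar>F \<epsilon> t\<bar> \<le> r / 4" by linarith
    from tail[OF this] have "\<bar>G (F \<epsilon> t) - (\<Sum>k<N. a k * F \<epsilon> t ^ k)\<bar> \<le> 2 * K * (2 / r) ^ N * \<bar>F \<epsilon> t\<bar> ^ N" .
    also have "\<dots> \<le> 2 * K * (2 / r) ^ N * (C * \<epsilon>) ^ N"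
      using u K(1) \<open>r > 0\<close> by (intro mult_left_mono power_mono) auto
    finally have 1: "\<bar>G (F \<epsilon> t) - (\<Sum>k<N. a k * F \<epsilon> t ^ k)\<bar> \<le> 2 * K * (2 / r) ^ N * C ^ N * \<epsilon> ^ N"
      by (simp add: power_mult_distrib mult_ac)
    have "fps_compose (Abs_fps a) (\<phi> t) $ k = (\<Sum>i<N. fps_const (a i) * \<phi> t ^ i) $ k" if "k < N" for k
    proof -
      have "fps_compose (Abs_fps a) (\<phi> t) $ k = (\<Sum>i\<in>{0..k}. a i * (\<phi> t ^ i) $ k)" by (simp add: fps_compose_nth)
      also have "\<dots> = (\<Sum>i<N. a i * (\<phi> t ^ i) $ k)"
      proof (rule sum.mono_neutral_left)
        show "\<forall>i\<in>{..<N} - {0..k}. a i * (\<phi> t ^ i) $ k = 0"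
          using startsby_zero_power_prefix[OF \<phi>0[OF t]] by auto
      qed (use that in auto)
      finally show ?thesis by (simp add: fps_sum_nth)
    qed
    then have "(\<Sum>k<N. fps_compose (Abs_fps a) (\<phi> t) $ k * \<epsilon> ^ k) = (\<Sum>k<N. (\<Sum>i<N. fps_const (a i) * \<phi> t ^ i) $ k * \<epsilon> ^ k)"
      by (intro sum.cong) auto
    with D(4)[of \<epsilon> t] \<epsilon> t have "\<bar>(\<Sum>i<N. a i * F \<epsilon> t ^ i) - (\<Sum>k<N. fps_compose (Abs_fps a) (\<phi> t) $ k * \<epsilon> ^ k)\<bar> \<le> D * \<epsilon> ^ N"
      by (simp add: d_def)
    with 1 show ?thesis unfolding distrib_right by linarith
  qed
  moreover have "d > 0" using C D \<open>r > 0\<close> by (simp add: d_def)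
  ultimately show "\<exists>C. \<exists>e>0. \<forall>\<epsilon>. 0 < \<epsilon> \<and> \<epsilon> < e \<longrightarrow> (\<forall>t\<in>S. \<bar>G (F \<epsilon> t) - (\<Sum>k<N. fps_compose (Abs_fps a) (\<phi> t) $ k * \<epsilon> ^ k)\<bar> \<le> C * \<epsilon> ^ N)"
    by blast
qed

section \<open>Singularly perturbed equations and asymptotic expansions\<close>

text \<open>The relation expresses \<open>p\<close> through primitives of continuous functions, so
  its differentiability comes out without being put in. In the application \<open>p\<close> and
  \<open>q\<close> are consecutive coefficients and \<open>K\<close> stems from the unknown initial
  velocity.\<close>

lemma integrated_relation_derivatives:
  fixes p q \<chi> :: "real \<Rightarrow> real"
  assumes q: "continuous_on UNIV q" and \<chi>: "continuous_on UNIV \<chi>" and "a < b"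
    and eq: "\<And>t. t \<in> {a..b} \<Longrightarrow>
      p t - p a + integral {a..t} q - (t - a) * q a - integral {a..t} (\<lambda>\<tau>. integral {a..\<tau>} \<chi>) = (t - a) * K"
    and t: "a < t" "t < b"
  shows "(p has_real_derivative deriv p t) (at t)"
    and "((\<lambda>s. deriv p s + q s) has_real_derivative \<chi> t) (at t)"
proof -
  have prim: "((\<lambda>s. integral {a..s} h) has_real_derivative h s) (at s)"
    if "continuous_on {a..b} h" "a < s" "s < b" for h :: "real \<Rightarrow> real" and s
  proof -
    have "((\<lambda>s. integral {a..s} h) has_real_derivative h s) (at s within {a..b})"
      by (rule integral_has_real_derivative) (use that in auto)
    then show ?thesis using that by (simp add: at_within_Icc_at)
  qed
  have q': "continuous_on {a..b} q" and \<chi>': "continuous_on {a..b} \<chi>"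
    using q \<chi> by (auto intro: continuous_on_subset)
  have I\<chi>: "continuous_on {a..b} (\<lambda>\<tau>. integral {a..\<tau>} \<chi>)"
    by (rule indefinite_integral_continuous_1) (rule integrable_continuous_real[OF \<chi>'])
  define L where "L = q a + K"
  have p': "(p has_real_derivative L + integral {a..s} \<chi> - q s) (at s)" if s: "a < s" "s < b" for s
  proof -
    have 1: "((\<lambda>t. p a - integral {a..t} q + (t - a) * L + integral {a..t} (\<lambda>\<tau>. integral {a..\<tau>} \<chi>))
        has_real_derivative L + integral {a..s} \<chi> - q s) (at s)"
      by (rule derivative_eq_intros prim[OF q' s] prim[OF I\<chi> s] refl)+ simp
    have 2: "p a - integral {a..t} q + (t - a) * L + integral {a..t} (\<lambda>\<tau>. integral {a..\<tau>} \<chi>) = p t"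
      if "t \<in> {a<..<b}" for t
    proof -
      have "(t - a) * L = (t - a) * q a + (t - a) * K" by (simp add: L_def distrib_left)
      then show ?thesis using eq[of t] that by simp
    qed
    show ?thesis
      by (rule has_field_derivative_transform_within_open[OF 1 open_greaterThanLessThan _ 2]) (use s in auto)
  qed
  have d: "deriv p s = L + integral {a..s} \<chi> - q s" if "a < s" "s < b" for s
    using p'[OF that] by (rule DERIV_imp_deriv)
  show "(p has_real_derivative deriv p t) (at t)" unfolding d[OF t] by (rule p'[OF t])
  have "((\<lambda>s. L + integral {a..s} \<chi>) has_real_derivative \<chi> t) (at t)"
    by (rule derivative_eq_intros prim[OF \<chi>' t] refl)+ simp
  then show "((\<lambda>s. deriv p s + q s) has_real_derivative \<chi> t) (at t)"
    by (rule has_field_derivative_transform_within_open[where S = "{a<..<b}"]) (use t d in auto)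
qed

text \<open>The first integration produces \<open>\<epsilon> * V + U\<close>; the second removes
  \<open>V\<close> except for its value at \<open>a\<close>.\<close>

lemma integrated_singular_ode:
  fixes U V A h :: "real \<Rightarrow> real"
  assumes U: "\<And>t. (U has_real_derivative V t) (at t)" and V: "\<And>t. (V has_real_derivative A t) (at t)"
    and eq: "\<And>t. \<epsilon> * A t + V t = \<epsilon> * h t" and h: "continuous_on UNIV h" and "a \<le> t"
  shows "\<epsilon> * (U t - U a) + integral {a..t} U - (t - a) * U a - \<epsilon> * integral {a..t} (\<lambda>\<tau>. integral {a..\<tau>} h)
    = (t - a) * (\<epsilon> * V a)"
proof -
  have 1: "\<epsilon> * (V \<tau> - V a) + U \<tau> - U a = \<epsilon> * integral {a..\<tau>} h" if "a \<le> \<tau>" for \<tau>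
  proof -
    have "((\<lambda>s. \<epsilon> * h s) has_integral (\<epsilon> * V \<tau> + U \<tau>) - (\<epsilon> * V a + U a)) {a..\<tau>}"
    proof (rule fundamental_theorem_of_calculus[OF that])
      fix s
      have "((\<lambda>s. \<epsilon> * V s + U s) has_real_derivative \<epsilon> * h s) (at s)"
        unfolding eq[symmetric] by (rule derivative_eq_intros U V refl)+ simp
      then show "((\<lambda>s. \<epsilon> * V s + U s) has_vector_derivative \<epsilon> * h s) (at s within {a..\<tau>})"
        by (simp add: has_real_derivative_iff_has_vector_derivative has_vector_derivative_at_within)
    qed
    moreover have "((\<lambda>s. \<epsilon> * h s) has_integral \<epsilon> * integral {a..\<tau>} h) {a..\<tau>}"
      using integrable_integral[OF integrable_continuous_real[OF continuous_on_subset[OF h, of "{a..\<tau>}"]]]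
      by (intro has_integral_mult_right) auto
    ultimately have "(\<epsilon> * V \<tau> + U \<tau>) - (\<epsilon> * V a + U a) = \<epsilon> * integral {a..\<tau>} h" by (rule has_integral_unique)
    then show ?thesis by (simp add: algebra_simps)
  qed
  have cU: "continuous_on {a..t} U" using U by (intro DERIV_continuous_on) (auto intro: has_field_derivative_at_within)
  have I: "continuous_on {a..t} (\<lambda>\<tau>. integral {a..\<tau>} h)"
    by (rule indefinite_integral_continuous_1)
      (use h in \<open>auto intro: integrable_continuous_real continuous_on_subset\<close>)
  have i1: "((\<lambda>\<tau>. \<epsilon> * V \<tau>) has_integral \<epsilon> * U t - \<epsilon> * U a) {a..t}"
  proof (rule fundamental_theorem_of_calculus[OF \<open>a \<le> t\<close>])
    fix s
    have "((\<lambda>s. \<epsilon> * U s) has_real_derivative \<epsilon> * V s) (at s)" by (rule DERIV_cmult[OF U])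
    then show "((\<lambda>s. \<epsilon> * U s) has_vector_derivative \<epsilon> * V s) (at s within {a..t})"
      by (simp add: has_real_derivative_iff_has_vector_derivative has_vector_derivative_at_within)
  qed
  have e: "(\<epsilon> * integral {a..\<tau>} h - U \<tau>) + (\<epsilon> * V a + U a) = \<epsilon> * V \<tau>" if "\<tau> \<in> {a..t}" for \<tau>
    using 1[of \<tau>] that unfolding right_diff_distrib atLeastAtMost_iff by linarith
  have "((\<lambda>\<tau>. (\<epsilon> * integral {a..\<tau>} h - U \<tau>) + (\<epsilon> * V a + U a)) has_integral
      (\<epsilon> * integral {a..t} (\<lambda>\<tau>. integral {a..\<tau>} h) - integral {a..t} U) + (t - a) * (\<epsilon> * V a + U a)) {a..t}"
    using has_integral_const_real[of "\<epsilon> * V a + U a" a t] \<open>a \<le> t\<close>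
    by (intro has_integral_add has_integral_diff has_integral_mult_right integrable_integral integrable_continuous_real I cU) simp_all
  then have "((\<lambda>\<tau>. \<epsilon> * V \<tau>) has_integral
      (\<epsilon> * integral {a..t} (\<lambda>\<tau>. integral {a..\<tau>} h) - integral {a..t} U) + (t - a) * (\<epsilon> * V a + U a)) {a..t}"
    by (rule has_integral_eq[rotated]) (rule e)
  with i1 have "\<epsilon> * U t - \<epsilon> * U a = (\<epsilon> * integral {a..t} (\<lambda>\<tau>. integral {a..\<tau>} h) - integral {a..t} U) + (t - a) * (\<epsilon> * V a + U a)"
    by (rule has_integral_unique)
  then show ?thesis by (simp add: algebra_simps)
qed

text \<open>Only \<open>U\<close> and \<open>H\<close> have known expansions, not \<open>V\<close>.
  In the twice integrated equation the velocity enters solely through the linear function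
  \<open>(t - a) * (\<epsilon> * V \<epsilon> a)\<close>, so uniqueness of expansions gives an
  integrated relation between consecutive coefficients, which is then differentiated.\<close>

lemma asympt_singular_ode:
  fixes U V A H :: "real \<Rightarrow> real \<Rightarrow> real"
  assumes U: "\<And>\<epsilon> t. 0 < \<epsilon> \<Longrightarrow> \<epsilon> < d \<Longrightarrow> (U \<epsilon> has_real_derivative V \<epsilon> t) (at t)"
    and V: "\<And>\<epsilon> t. 0 < \<epsilon> \<Longrightarrow> \<epsilon> < d \<Longrightarrow> (V \<epsilon> has_real_derivative A \<epsilon> t) (at t)"
    and eq: "\<And>\<epsilon> t. 0 < \<epsilon> \<Longrightarrow> \<epsilon> < d \<Longrightarrow> \<epsilon> * A \<epsilon> t + V \<epsilon> t = \<epsilon> * H \<epsilon> t"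
    and H: "\<And>\<epsilon>. 0 < \<epsilon> \<Longrightarrow> \<epsilon> < d \<Longrightarrow> continuous_on UNIV (H \<epsilon>)"
    and "d > 0" and asU: "asympt UNIV U \<phi>" and asH: "asympt UNIV H \<chi>"
  defines "p k t \<equiv> \<phi> t $ k"
  shows "(p k has_real_derivative deriv (p k) t) (at t)"
    and "((\<lambda>s. deriv (p k) s + p (Suc k) s) has_real_derivative \<chi> t $ k) (at t)"
proof -
  have contU: "continuous_on S (U \<epsilon>)" if "0 < \<epsilon>" "\<epsilon> < d" for \<epsilon> S
    using U[OF that] by (intro DERIV_continuous_on) (auto intro: has_field_derivative_at_within)
  have contH: "continuous_on S (H \<epsilon>)" if "0 < \<epsilon>" "\<epsilon> < d" for \<epsilon> S
    using H[OF that] by (rule continuous_on_subset) simp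
  have cp: "continuous_on UNIV (p n)" for n
    unfolding p_def by (rule asympt_coeff_continuous[OF asU \<open>d > 0\<close> contU])
  have c\<chi>: "continuous_on UNIV (\<lambda>t. \<chi> t $ n)" for n
    by (rule asympt_coeff_continuous[OF asH \<open>d > 0\<close> contH])
  define a b where "a = t - 1" and "b = t + 1"
  have ab: "a < b" "a < t" "t < b" "a + 1 \<in> {a..b}" by (auto simp: a_def b_def)
  have U': "asympt {a..b} U \<phi>" and H': "asympt {a..b} H \<chi>" using asU asH by (auto intro: asympt_subset)
  define R where "R \<epsilon> t = \<epsilon> * (U \<epsilon> t - U \<epsilon> a - integral {a..t} (\<lambda>\<tau>. integral {a..\<tau>} (H \<epsilon>)))
    + 1 * (integral {a..t} (U \<epsilon>) + (a - t) * U \<epsilon> a)" for \<epsilon> t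
  define I where "I \<psi> t = Abs_fps (\<lambda>n. integral {a..t} (\<lambda>s. (\<psi> s :: real fps) $ n))" for \<psi> t
  define r where "r t = fps_X * (\<phi> t - \<phi> a - I (I \<chi>) t) + fps_const 1 * (I \<phi> t + fps_const (a - t) * \<phi> a)" for t
  have Ua: "asympt {a..b} (\<lambda>\<epsilon> t. U \<epsilon> a) (\<lambda>t. \<phi> a)" by (rule asympt_compose[OF asU]) simp
  have cI: "continuous_on {a..b} (\<lambda>\<tau>. integral {a..\<tau>} (H \<epsilon>))" if "0 < \<epsilon>" "\<epsilon> < d" for \<epsilon>
    by (rule indefinite_integral_continuous_1) (rule integrable_continuous_real[OF contH[OF that]])
  have asR: "asympt {a..b} R r"
    unfolding R_def r_def I_def
    by (intro asympt_linear[where K = 1] asympt_linear[where K = "b - a"] asympt_shift asympt_diff U' Ua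
        asympt_integral[OF _ \<open>d > 0\<close>] H' contU contH cI) (auto simp: a_def b_def)
  \<comment> \<open>Evaluation at \<open>a + 1\<close> expresses
    \<open>\<epsilon> * V \<epsilon> a\<close> by \<open>R\<close> itself, whose expansion is known;
    this replaces an expansion of the velocity.\<close>
  have R_eq: "R \<epsilon> t = 0 + (t - a) * R \<epsilon> (a + 1)" if "0 < \<epsilon>" "\<epsilon> < d" "t \<in> {a..b}" for \<epsilon> t
  proof -
    have "R \<epsilon> s = (s - a) * (\<epsilon> * V \<epsilon> a)" if "a \<le> s" for s
      using integrated_singular_ode[of "U \<epsilon>" "V \<epsilon>" "A \<epsilon>" \<epsilon> "H \<epsilon>" a s] U V eq H \<open>0 < \<epsilon>\<close> \<open>\<epsilon> < d\<close> that
      by (simp add: R_def algebra_simps)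
    from this[of t] this[of "a + 1"] show ?thesis using that by simp
  qed
  have "asympt {a..b} (\<lambda>\<epsilon> t. 0 + (t - a) * R \<epsilon> (a + 1)) (\<lambda>t. 0 + fps_const (t - a) * r (a + 1))"
    by (rule asympt_linear[OF asympt_zero asympt_compose[OF asR], where K = "b - a"]) (use ab in auto)
  then have "asympt {a..b} R (\<lambda>t. 0 + fps_const (t - a) * r (a + 1))"
    by (rule asympt_cong[OF _ \<open>d > 0\<close>]) (rule R_eq)
  from asympt_unique[OF asR this] have r_eq: "r s = fps_const (s - a) * r (a + 1)" if "s \<in> {a..b}" for s
    using that by simp
  \<comment> \<open>The factor \<open>fps_X\<close> shifts the index: coefficient
    \<open>k + 1\<close> couples \<open>p k\<close> and order \<open>k\<close> of \<chi> with
    \<open>p (Suc k)\<close>.\<close>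
  have "r s $ Suc k = p k s - p k a + integral {a..s} (p (Suc k)) - (s - a) * p (Suc k) a
      - integral {a..s} (\<lambda>\<tau>. integral {a..\<tau>} (\<lambda>t. \<chi> t $ k))" for s
    by (simp add: r_def I_def p_def[abs_def] algebra_simps)
  with r_eq have *: "p k s - p k a + integral {a..s} (p (Suc k)) - (s - a) * p (Suc k) a
      - integral {a..s} (\<lambda>\<tau>. integral {a..\<tau>} (\<lambda>t. \<chi> t $ k)) = (s - a) * r (a + 1) $ Suc k" if "s \<in> {a..b}" for s
    using that by (metis fps_mult_left_const_nth)
  show "(p k has_real_derivative deriv (p k) t) (at t)"
    by (rule integrated_relation_derivatives(1)[OF cp c\<chi> ab(1) * ab(2,3)])
  show "((\<lambda>s. deriv (p k) s + p (Suc k) s) has_real_derivative \<chi> t $ k) (at t)"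
    by (rule integrated_relation_derivatives(2)[OF cp c\<chi> ab(1) * ab(2,3)])
qed

text \<open>\<open>asympt_singular_ode\<close> differentiates only the sum of
  \<open>deriv (p k)\<close> and \<open>p (Suc k)\<close>. Its first claim at index
  \<open>k + 1\<close> makes the second summand differentiable on its own, so it can be
  subtracted.\<close>

lemma asympt_singular_ode_C2:
  fixes U V A H :: "real \<Rightarrow> real \<Rightarrow> real"
  assumes U: "\<And>\<epsilon> t. 0 < \<epsilon> \<Longrightarrow> \<epsilon> < d \<Longrightarrow> (U \<epsilon> has_real_derivative V \<epsilon> t) (at t)"
    and V: "\<And>\<epsilon> t. 0 < \<epsilon> \<Longrightarrow> \<epsilon> < d \<Longrightarrow> (V \<epsilon> has_real_derivative A \<epsilon> t) (at t)"
    and eq: "\<And>\<epsilon> t. 0 < \<epsilon> \<Longrightarrow> \<epsilon> < d \<Longrightarrow> \<epsilon> * A \<epsilon> t + V \<epsilon> t = \<epsilon> * H \<epsilon> t"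
    and H: "\<And>\<epsilon>. 0 < \<epsilon> \<Longrightarrow> \<epsilon> < d \<Longrightarrow> continuous_on UNIV (H \<epsilon>)"
    and "d > 0" and asU: "asympt UNIV U \<phi>" and asH: "asympt UNIV H \<chi>"
  defines "p k t \<equiv> \<phi> t $ k"
  shows "(p k has_real_derivative deriv (p k) t) (at t)"
    and "(deriv (p k) has_real_derivative \<chi> t $ k - deriv (p (Suc k)) t) (at t)"
    and "continuous_on UNIV (\<lambda>t. \<chi> t $ k - deriv (p (Suc k)) t)"
proof -
  have contH: "continuous_on S (H \<epsilon>)" if "0 < \<epsilon>" "\<epsilon> < d" for \<epsilon> S
    using H[OF that] by (rule continuous_on_subset) simp
  have c\<chi>: "continuous_on UNIV (\<lambda>t. \<chi> t $ n)" for n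
    by (rule asympt_coeff_continuous[OF asH \<open>d > 0\<close> contH])
  have p: "(p n has_real_derivative deriv (p n) s) (at s)" for n s
    unfolding p_def by (rule asympt_singular_ode(1)[OF U V eq H \<open>d > 0\<close> asU asH])
  have p2: "((\<lambda>s. deriv (p n) s + p (Suc n) s) has_real_derivative \<chi> s $ n) (at s)" for n s
    unfolding p_def by (rule asympt_singular_ode(2)[OF U V eq H \<open>d > 0\<close> asU asH])
  have p': "(deriv (p n) has_real_derivative \<chi> s $ n - deriv (p (Suc n)) s) (at s)" for n s
    using DERIV_diff[OF p2[of n s] p[of "Suc n" s]] by simp
  show "(p k has_real_derivative deriv (p k) t) (at t)" "(deriv (p k) has_real_derivative \<chi> t $ k - deriv (p (Suc k)) t) (at t)"
    by (rule p p')+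
  show "continuous_on UNIV (\<lambda>t. \<chi> t $ k - deriv (p (Suc k)) t)"
    by (intro continuous_on_diff c\<chi> DERIV_continuous_on[OF p'])
qed

section \<open>The formal solution\<close>

context borel_recursion
begin

text \<open>The Borel transform of a series with coefficients \<open>a\<close> has Taylor
  coefficients \<open>a (n + 1) / n!\<close>, so \<open>a (n + 1)\<close> is its \<open>n\<close>-th
  derivative at 0. The real part only adjusts the type, as these derivatives are real by
  \<open>fser_Suc\<close>. The coefficient 0 is left empty and receives \<open>c0\<close> in
  \<open>xs\<close>.\<close>

definition fser :: "real \<Rightarrow> real fps" where
  "fser t = Abs_fps (\<lambda>k. case k of 0 \<Rightarrow> 0 | Suc n \<Rightarrow> Re ((deriv ^^ n) (bor (of_real t)) 0))"

lemma fser_0 [simp]: "fser t $ 0 = 0"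
  by (simp add: fser_def)

lemma ball_subset_strip: "ball 0 \<kappa> \<subseteq> {p. \<bar>Im p\<bar> < \<kappa>}"
  using le_less_trans[OF abs_Im_le_cmod] by auto

lemma bor_holomorphic_ball: "bor (of_real t) holomorphic_on ball 0 \<kappa>"
  by (rule holomorphic_on_subset[OF bor_holomorphic ball_subset_strip])

lemma fser_Suc: "complex_of_real (fser t $ Suc n) = (deriv ^^ n) (bor (of_real t)) 0"
  unfolding fser_def using holomorphic_real_on_reals_coeff_real[OF bor_holomorphic_ball pos(1) bor_real, where n = n] by simp

lemma borel_transform_continuation_bor:
  assumes "\<And>n. a (Suc n) = fser t $ Suc n"
  shows "borel_transform_continuation a (bor (of_real t))"
  unfolding borel_transform_continuation_def
proof (intro exI conjI ballI)
  show "\<kappa> > 0" by (rule pos)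
  show "open {p. \<bar>Im p\<bar> < \<kappa>}" "connected {p. \<bar>Im p\<bar> < \<kappa>}"
    by (rule open_horizontal_strip) (rule convex_connected[OF convex_horizontal_strip])
  show "ball 0 \<kappa> \<subseteq> {p. \<bar>Im p\<bar> < \<kappa>}" by (rule ball_subset_strip)
  show "complex_of_real ` {0..} \<subseteq> {p. \<bar>Im p\<bar> < \<kappa>}" using pos by auto
  show "bor (of_real t) holomorphic_on {p. \<bar>Im p\<bar> < \<kappa>}" by (rule bor_holomorphic)
  fix p :: complex assume "p \<in> ball 0 \<kappa>"
  from holomorphic_power_series[OF bor_holomorphic_ball this]
  show "(\<lambda>n. of_real (a (Suc n)) * p ^ n / fact n) sums bor (of_real t) p"
    by (simp add: assms fser_Suc)
qed

lemma has_borel_sum_sol: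
  assumes a: "\<And>n. a (Suc n) = fser t $ Suc n" and \<epsilon>: "0 < \<epsilon>" "\<epsilon> < z"
  shows "has_borel_sum a \<epsilon> (sol (1 / \<epsilon>) t)"
proof -
  have l: "1 < 1 / \<epsilon> * z" using \<epsilon> by (simp add: field_simps)
  have "((\<lambda>p. exp (- (1 / \<epsilon>) * p) * borr t p) has_integral sol (1 / \<epsilon>) t) {0..}"
    using laplace_has_integral[OF laplace_borr(2)[OF l]] unfolding laplace_borr(1)[OF l] .
  from has_integral_of_real[OF this, where ?'b = complex]
  have "((\<lambda>p. exp (- of_real (p / \<epsilon>)) * bor (of_real t) (of_real p)) has_integral complex_of_real (sol (1 / \<epsilon>) t)) {0..}"
    by (simp add: bor_real exp_of_real[symmetric])
  then show ?thesis
    unfolding has_borel_sum_def using borel_transform_continuation_bor[OF a] by blast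
qed

text \<open>Watson's lemma with radius \<open>\<kappa> / 2\<close> and exponential rate
  \<open>1 / z\<close>; all constants are independent of \<open>t\<close>. Since the constant
  coefficient is zero, \<open>m\<close> Taylor terms of the Borel transform account for
  \<open>m + 1\<close> terms of the expansion.\<close>

lemma asympt_sol: "asympt UNIV (\<lambda>\<epsilon>. sol (1 / \<epsilon>)) fser"
proof (rule asymptI)
  fix N
  let ?r = "\<kappa> / 2" and ?M = "B / z * exp (\<kappa> / 2 / z)"
  have M: "norm (bor (of_real t) p) \<le> ?M" if "norm p \<le> ?r" for t p
  proof -
    have "\<bar>Im p\<bar> < \<kappa>" using that pos abs_Im_le_cmod[of p] by linarith
    then have "norm (bor (of_real t) p) \<le> B / z * exp (norm p / z)"
      by (intro bor_bound) (use pos in \<open>simp add: mem_strip2\<close>)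
    also have "\<dots> \<le> ?M" using that pos by (intro mult_left_mono iffD2[OF exp_le_cancel_iff] divide_right_mono) auto
    finally show ?thesis .
  qed
  have bd: "\<bar>borr t p\<bar> \<le> ?M * exp (1 / z * p)" if "p \<ge> 0" for t p
  proof -
    have "\<bar>borr t p\<bar> \<le> B / z * 1 * exp (1 / z * p)" using borr_bound[of t p] that by simp
    also have "\<dots> \<le> ?M * exp (1 / z * p)" using pos by (intro mult_right_mono mult_left_mono) auto
    finally show ?thesis .
  qed
  have main: "\<bar>sol (1 / \<epsilon>) t - (\<Sum>n<N. fser t $ Suc n * \<epsilon> ^ Suc n)\<bar>
      \<le> (real N + 2) * ?M * (2 / ?r) ^ N * fact N * (2 * \<epsilon>) ^ Suc N"
    if \<epsilon>: "0 < \<epsilon>" "\<epsilon> < z / 2" for \<epsilon> t N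
  proof -
    have l: "1 < 1 / \<epsilon> * z" "2 * (1 / z) < 1 / \<epsilon>" using \<epsilon> by (simp_all add: field_simps)
    show ?thesis
      using watson[OF bor_holomorphic_ball, of ?r t "borr t" ?M "1 / z" "1 / \<epsilon>" N] pos \<epsilon> l M bd
        laplace_borr[OF l(1), of t] bor_real by (simp add: fser_def)
  qed
  show "\<exists>C. \<exists>e>0. \<forall>\<epsilon>. 0 < \<epsilon> \<and> \<epsilon> < e \<longrightarrow> (\<forall>t\<in>UNIV. \<bar>sol (1 / \<epsilon>) t - (\<Sum>k<N. fser t $ k * \<epsilon> ^ k)\<bar> \<le> C * \<epsilon> ^ N)"
  proof (cases N)
    case 0
    have "\<bar>sol (1 / \<epsilon>) t\<bar> \<le> 2 * ?M * z" if \<epsilon>: "0 < \<epsilon>" "\<epsilon> < z / 2" for \<epsilon> t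
    proof -
      have "\<bar>sol (1 / \<epsilon>) t\<bar> \<le> 2 * ?M * (2 * \<epsilon>)" using main[OF \<epsilon>, of t 0] by simp
      also have "\<dots> \<le> 2 * ?M * z" using \<epsilon> pos by (intro mult_left_mono) auto
      finally show ?thesis .
    qed
    then show ?thesis using 0 pos by (intro exI[of _ "2 * ?M * z"] exI[of _ "z / 2"]) auto
  next
    case (Suc m)
    have "(\<Sum>k<N. fser t $ k * \<epsilon> ^ k) = (\<Sum>n<m. fser t $ Suc n * \<epsilon> ^ Suc n)" for t \<epsilon>
      unfolding Suc sum.lessThan_Suc_shift by simp
    with main[of _ _ m] have "\<bar>sol (1 / \<epsilon>) t - (\<Sum>k<N. fser t $ k * \<epsilon> ^ k)\<bar> \<le> (real m + 2) * ?M * (2 / ?r) ^ m * fact m * 2 ^ N * \<epsilon> ^ N"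
      if "0 < \<epsilon>" "\<epsilon> < z / 2" for \<epsilon> t
      using that by (simp only: Suc power_mult_distrib mult.assoc)
    then show ?thesis using pos
      by (intro exI[of _ "(real m + 2) * ?M * (2 / ?r) ^ m * fact m * 2 ^ N"] exI[of _ "z / 2"]) auto
  qed
qed

text \<open>Inherited from the solutions by uniqueness of asymptotic expansions.\<close>

lemma fser_periodic: "fser (t + P) = fser t"
proof -
  have "asympt UNIV (\<lambda>\<epsilon>. sol (1 / \<epsilon>)) (\<lambda>t. fser (t + P))"
    by (rule asympt_cong[OF asympt_compose[OF asympt_sol, where h = "\<lambda>t. t + P"], where e = 1]) (simp_all add: sol_per)
  from asympt_unique[OF this asympt_sol, of t] show ?thesis by simp
qed

lemma sol_less: "1 \<le> l * z \<Longrightarrow> \<bar>sol l t\<bar> < \<rho>"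
proof -
  assume l: "1 \<le> l * z"
  have "2 * B / (l * z) \<le> 2 * B / 1" using l pos by (intro divide_left_mono) auto
  then show ?thesis using sol_bound[OF l, of t] B(1) pos by linarith
qed

lemma frc_eq_analytic:
  assumes G: "\<And>x. \<bar>x\<bar> < \<rho> \<Longrightarrow> (\<lambda>k. c k * x ^ k) sums G x" and l: "1 \<le> l * z"
  shows "frc l t = Fr t + c 0 - G (sol l t)"
proof -
  have "(\<lambda>k. c (Suc k) * sol l t ^ Suc k) sums (G (sol l t) - c 0)"
    using sums_Suc_iff[of "\<lambda>k. c k * sol l t ^ k" "G (sol l t) - c 0"] G[OF sol_less[OF l]] by simp
  from frc_eq[OF l this] show ?thesis by simp
qed

lemma sol_ode:
  assumes "0 < \<epsilon>" "\<epsilon> < z"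
  shows "(sol (1 / \<epsilon>) has_real_derivative vel (1 / \<epsilon>) t) (at t)"
    and "(vel (1 / \<epsilon>) has_real_derivative frc (1 / \<epsilon>) t - 1 / \<epsilon> * vel (1 / \<epsilon>) t) (at t)"
    and "\<epsilon> * (frc (1 / \<epsilon>) t - 1 / \<epsilon> * vel (1 / \<epsilon>) t) + vel (1 / \<epsilon>) t = \<epsilon> * frc (1 / \<epsilon>) t"
proof -
  have l: "1 \<le> 1 / \<epsilon> * z" using assms by (simp add: field_simps)
  show "(sol (1 / \<epsilon>) has_real_derivative vel (1 / \<epsilon>) t) (at t)"
    "(vel (1 / \<epsilon>) has_real_derivative frc (1 / \<epsilon>) t - 1 / \<epsilon> * vel (1 / \<epsilon>) t) (at t)"
    by (rule sol_deriv[OF l] vel_deriv[OF l])+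
  show "\<epsilon> * (frc (1 / \<epsilon>) t - 1 / \<epsilon> * vel (1 / \<epsilon>) t) + vel (1 / \<epsilon>) t = \<epsilon> * frc (1 / \<epsilon>) t"
    using assms by (simp add: field_simps)
qed

text \<open>\<chi> is the expansion of the force \<open>frc\<close>, obtained by composing the
  Taylor series of \<open>G\<close> with that of the solution. The solutions therefore fall under
  \<open>asympt_singular_ode_C2\<close>.\<close>

lemma fser_equation:
  assumes G: "\<And>x. \<bar>x\<bar> < \<rho> \<Longrightarrow> (\<lambda>k. c k * x ^ k) sums G x"
  defines "p k t \<equiv> fser t $ k"
    and "\<chi> t \<equiv> fps_const (Fr t + c 0) - fps_compose (Abs_fps c) (fser t)"
  shows "(p k has_real_derivative deriv (p k) t) (at t)"
    and "(deriv (p k) has_real_derivative \<chi> t $ k - deriv (p (Suc k)) t) (at t)"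
    and "continuous_on UNIV (\<lambda>t. \<chi> t $ k - deriv (p (Suc k)) t)"
proof -
  have l: "1 \<le> 1 / \<epsilon> * z" if "0 < \<epsilon>" "\<epsilon> < z" for \<epsilon> using that by (simp add: field_simps)
  have cont_sol: "continuous_on UNIV (sol (1 / \<epsilon>))" if "0 < \<epsilon>" "\<epsilon> < z" for \<epsilon>
    using sol_ode(1)[OF that] by (intro DERIV_continuous_on) auto
  have contG: "continuous_on {-\<rho><..<\<rho>} G"
  proof (rule continuous_at_imp_continuous_on, rule ballI)
    fix x assume "x \<in> {-\<rho><..<\<rho>}"
    then have "\<bar>x\<bar> < \<rho>" by auto
    then obtain s where s: "\<bar>x\<bar> < s" "s < \<rho>" using dense by blast
    have "isCont (\<lambda>x. \<Sum>k. c k * x ^ k) x"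
      by (rule isCont_powser[where K = s]) (use G[of s] s in \<open>auto simp: sums_iff\<close>)
    moreover have "\<forall>\<^sub>F y in nhds x. y \<in> {-\<rho><..<\<rho>}"
      using s by (intro eventually_nhds_in_open) auto
    then have "\<forall>\<^sub>F y in nhds x. (\<Sum>k. c k * y ^ k) = G y"
      by (rule eventually_mono) (use G in \<open>auto simp: sums_iff\<close>)
    ultimately show "isCont G x" by (rule iffD1[OF isCont_cong, rotated])
  qed
  have contH: "continuous_on UNIV (frc (1 / \<epsilon>))" if "0 < \<epsilon>" "\<epsilon> < z" for \<epsilon>
  proof -
    have "continuous_on UNIV (\<lambda>t. G (sol (1 / \<epsilon>) t))"
    proof (rule continuous_on_compose2[OF contG cont_sol[OF that]])
      show "sol (1 / \<epsilon>) ` UNIV \<subseteq> {-\<rho><..<\<rho>}" using sol_less[OF l[OF that]] by (auto simp: abs_less_iff minus_less_iff)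
    qed
    then have "continuous_on UNIV (\<lambda>t. Fr t + c 0 - G (sol (1 / \<epsilon>) t))"
      by (intro continuous_intros Fr_continuous)
    then show ?thesis by (rule continuous_on_eq) (simp add: frc_eq_analytic[OF G l[OF that]])
  qed
  have "asympt UNIV (\<lambda>\<epsilon> t. Fr t + c 0 - G (sol (1 / \<epsilon>) t)) \<chi>"
    unfolding \<chi>_def
  proof (rule asympt_diff[OF asympt_bounded_fun asympt_analytic_compose[OF asympt_sol _ pos(5) G]])
    show "\<bar>Fr t + c 0\<bar> \<le> CF + \<bar>c 0\<bar>" for t using Fr_bound[of t] by linarith
  qed auto
  then have asH: "asympt UNIV (\<lambda>\<epsilon>. frc (1 / \<epsilon>)) \<chi>"
    by (rule asympt_cong[OF _ pos(4)]) (rule frc_eq_analytic[OF G l])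
  note * = asympt_singular_ode_C2[OF sol_ode contH pos(4) asympt_sol asH]
  show "(p k has_real_derivative deriv (p k) t) (at t)" unfolding p_def by (rule *(1))
  show "(deriv (p k) has_real_derivative \<chi> t $ k - deriv (p (Suc k)) t) (at t)"
    unfolding p_def by (rule *(2))
  show "continuous_on UNIV (\<lambda>t. \<chi> t $ k - deriv (p (Suc k)) t)" unfolding p_def by (rule *(3))
qed

end

text \<open>The recursion runs with a positive period, whereas \<open>2 * pi / \<omega>\<close> may
  be negative; it is then the same shift taken backwards.\<close>

lemma periodic_abs_period:
  fixes h :: "real \<Rightarrow> 'a"
  assumes "\<And>t. h (t + 2 * pi / \<bar>\<omega>\<bar>) = h t"
  shows "h (t + 2 * pi / \<omega>) = h t"
  using assms[of t] assms[of "t + 2 * pi / \<omega>"] by (cases "\<omega> \<ge> 0") auto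

context borel_recursion
begin

context
  fixes \<omega> c0 :: real and g f :: "real \<Rightarrow> real"
  assumes \<omega>: "\<omega> \<noteq> 0" and P: "P = 2 * pi / \<bar>\<omega>\<bar>" and Fr: "\<And>t. Fr t = f (\<omega> * t) - g c0"
    and g: "\<And>x. \<bar>x\<bar> < \<rho> \<Longrightarrow> (\<lambda>k. c k * x ^ k) sums g (c0 + x)"
begin

lemma c0_eq: "c 0 = g c0"
  using g[of 0] pos by (simp add: powser_sums_zero_iff)

lemma ode_solution_sol:
  assumes "0 < \<epsilon>" "\<epsilon> < z"
  defines "x \<equiv> \<lambda>t. c0 + sol (1 / \<epsilon>) t"
  shows "ode_solution \<omega> g f \<epsilon> UNIV x (deriv x)" and "has_frequency \<omega> x"
proof -
  have l: "1 \<le> 1 / \<epsilon> * z" using assms(1,2) by (simp add: field_simps)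
  have x: "(x has_real_derivative vel (1 / \<epsilon>) t) (at t)" for t
    unfolding x_def by (rule derivative_eq_intros sol_ode(1)[OF assms(1,2)] refl)+ simp
  then have deriv: "deriv x = vel (1 / \<epsilon>)" by (intro ext DERIV_imp_deriv)
  have frc: "frc (1 / \<epsilon>) t = f (\<omega> * t) - g (x t)" for t
    using frc_eq_analytic[OF g l, of t] by (simp add: c0_eq Fr x_def)
  show "ode_solution \<omega> g f \<epsilon> UNIV x (deriv x)"
    unfolding ode_solution_def deriv
  proof (intro exI ballI conjI)
    fix t
    show "(x has_real_derivative vel (1 / \<epsilon>) t) (at t)" by (rule x)
    show "(vel (1 / \<epsilon>) has_real_derivative frc (1 / \<epsilon>) t - 1 / \<epsilon> * vel (1 / \<epsilon>) t) (at t)"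
      by (rule sol_ode(2)[OF assms(1,2)])
    show "\<epsilon> * (frc (1 / \<epsilon>) t - 1 / \<epsilon> * vel (1 / \<epsilon>) t) + vel (1 / \<epsilon>) t + \<epsilon> * g (x t) = \<epsilon> * f (\<omega> * t)"
      unfolding sol_ode(3)[OF assms(1,2)] by (simp add: frc right_diff_distrib)
  qed
  have per: "x (t + 2 * pi / \<omega>) = x t" for t
    by (rule periodic_abs_period) (simp add: x_def sol_per flip: P)
  show "has_frequency \<omega> x"
    unfolding has_frequency_def periodic_2pi_def
    using per \<omega> by (intro exI[of _ "\<lambda>s. x (s / \<omega>)"]) (simp add: add_divide_distrib)
qed

definition xs :: "nat \<Rightarrow> real \<Rightarrow> real" where
  "xs k t = (if k = 0 then c0 else 0) + fser t $ k"

lemma borel_summable_xs: "\<epsilon>0 \<le> z \<Longrightarrow> borel_summable_at_origin c0 xs \<epsilon>0 (\<lambda>\<epsilon> t. c0 + sol (1 / \<epsilon>) t)"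
proof -
  assume "\<epsilon>0 \<le> z"
  have *: "has_borel_sum (\<lambda>k. xs k t) \<epsilon> (sol (1 / \<epsilon>) t)" if "0 < \<epsilon>" "\<epsilon> < z" for \<epsilon> t
    by (rule has_borel_sum_sol) (use that in \<open>auto simp: xs_def\<close>)
  have "borel_summable (\<lambda>k. xs k t)" for t
    unfolding borel_summable_def using *[of "z / 2" t] pos by (intro exI[of _ "z / 2"]) auto
  with * \<open>\<epsilon>0 \<le> z\<close> show ?thesis by (simp add: borel_summable_at_origin_def)
qed

lemma formal_solution_xs: "formal_solution \<omega> g f c0 xs"
proof -
  define p where "p k t = fser t $ k" for k t
  define \<chi> where "\<chi> t = fps_const (Fr t + c 0) - fps_compose (Abs_fps c) (fser t)" for t
  note p = fser_equation[OF g, folded p_def \<chi>_def]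
  have x1: "(xs k has_real_derivative deriv (p k) t) (at t)" for k t
  proof -
    have "((\<lambda>t. (if k = 0 then c0 else 0) + p k t) has_real_derivative 0 + deriv (p k) t) (at t)"
      by (rule DERIV_add[OF DERIV_const p(1)])
    then show ?thesis by (simp add: xs_def[abs_def] p_def[abs_def])
  qed
  have d1: "deriv (xs k) = deriv (p k)" for k by (intro ext DERIV_imp_deriv x1)
  have d2: "deriv (deriv (p k)) t = \<chi> t $ k - deriv (p (Suc k)) t" for k t by (rule DERIV_imp_deriv[OF p(2)])
  have per: "xs k (t + 2 * pi / \<omega>) = xs k t" for k t
    by (rule periodic_abs_period) (simp add: xs_def fser_periodic flip: P)
  have taylor: "Abs_fps (\<lambda>n. (deriv ^^ n) g c0 / fact n) = Abs_fps c"
  proof -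
    have "(deriv ^^ n) g c0 / fact n = c n" for n
    proof (rule power_series_coeff_eq_deriv[OF pos(5)])
      show "(\<lambda>n. c n * (y - c0) ^ n) sums g y" if "y \<in> ball c0 \<rho>" for y
        using g[of "y - c0"] that by (simp add: dist_real_def abs_minus_commute)
    qed
    then show ?thesis by simp
  qed
  have arg: "Abs_fps (\<lambda>k. xs k t) - fps_const c0 = fser t" for t by (simp add: fps_eq_iff xs_def)
  have "p 0 = (\<lambda>t. 0)" by (simp add: p_def[abs_def])
  then have p0: "deriv (p 0) t = 0" for t by simp
  have "fps_X * Abs_fps (\<lambda>k. deriv (deriv (xs k)) t) + Abs_fps (\<lambda>k. deriv (xs k) t)
      + fps_X * fps_compose (Abs_fps c) (fser t) = fps_X * fps_const (f (\<omega> * t))" for t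
  proof (rule fps_ext)
    fix n
    show "(fps_X * Abs_fps (\<lambda>k. deriv (deriv (xs k)) t) + Abs_fps (\<lambda>k. deriv (xs k) t)
      + fps_X * fps_compose (Abs_fps c) (fser t)) $ n = (fps_X * fps_const (f (\<omega> * t))) $ n"
      \<comment> \<open>Order 0 says that \<open>xs 0\<close> is constant. In order
        \<open>n + 1\<close> the term \<open>deriv (p (Suc n))\<close> contained in the second
        derivative \<open>d2\<close> cancels against the first-order term, which leaves \<chi> plus
        the coefficient of \<open>g\<close>.\<close>
      by (cases n) (simp_all add: d1 d2 p0 \<chi>_def Fr c0_eq)
  qed
  moreover have "xs k differentiable_on UNIV" "deriv (xs k) differentiable_on UNIV" for k
    unfolding differentiable_on_def real_differentiable_def d1 using x1 p(2) by blast+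
  moreover have "\<exists>c. has_fourier_expansion \<omega> (xs k) c" for k
    by (rule has_fourier_expansion_C2[OF \<omega> x1 p(2) p(3) per])
  moreover have "xs 0 t = c0" for t by (simp add: xs_def)
  ultimately show ?thesis unfolding formal_solution_def taylor arg by blast
qed

lemma local_attractor_sol:
  assumes an: "real_analytic g" and f: "continuous_on UNIV f" and gpos: "deriv g c0 > 0"
  obtains e where "0 < e" "e \<le> z" "\<And>\<epsilon>. 0 < \<epsilon> \<Longrightarrow> \<epsilon> < e \<Longrightarrow> local_attractor \<omega> g f \<epsilon> (\<lambda>t. c0 + sol (1 / \<epsilon>) t)"
proof -
  let ?m = "deriv g c0"
  have cont: "continuous_on UNIV (deriv g)" by (rule real_analytic_continuous[OF real_analytic_deriv[OF an]])
  then obtain d where d: "d > 0" "\<And>u. dist u c0 < d \<Longrightarrow> dist (deriv g u) ?m < ?m / 2"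
    unfolding continuous_on_iff using gpos by (metis UNIV_I half_gt_zero)
  define r where "r = d / 2"
  have r: "r > 0" "\<And>u. \<bar>u - c0\<bar> \<le> r \<Longrightarrow> ?m / 2 \<le> deriv g u \<and> deriv g u \<le> 2 * ?m"
  proof -
    show "r > 0" using d by (simp add: r_def)
    fix u assume "\<bar>u - c0\<bar> \<le> r"
    then have "dist u c0 < d" using d(1) by (simp add: r_def dist_real_def)
    from d(2)[OF this] have "\<bar>deriv g u - ?m\<bar> < ?m / 2" by (simp add: dist_real_def)
    then show "?m / 2 \<le> deriv g u \<and> deriv g u \<le> 2 * ?m" using gpos unfolding abs_less_iff by linarith
  qed
  \<comment> \<open>The four entries keep \<epsilon> in the range of existence, keep it below 1,
    confine the solution to distance \<open>r / 2\<close> from \<open>c0\<close> through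
    \<open>sol_bound\<close>, and give \<open>2 * \<epsilon>\<^sup>2 * M \<le> 1\<close> for the
    slope bound \<open>M = 2 * ?m\<close>.\<close>
  define e where "e = Min {z, 1, r * z / (4 * B), 1 / (4 * ?m)}"
  have e: "0 < e" "e \<le> z" "e \<le> 1" "e \<le> r * z / (4 * B)" "e \<le> 1 / (4 * ?m)"
    using pos r(1) gpos by (simp_all add: e_def)
  have "local_attractor \<omega> g f \<epsilon> (\<lambda>t. c0 + sol (1 / \<epsilon>) t)" if \<epsilon>: "0 < \<epsilon>" "\<epsilon> < e" for \<epsilon>
  proof (rule local_attractor_of_increasing[OF ode_solution_sol(1) _ r(1) \<epsilon>(1) _ real_analytic_has_derivative[OF an] cont r(2) _ f])
    show "0 < \<epsilon>" "\<epsilon> < z" using \<epsilon> e by auto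
    show "0 < ?m / 2" using gpos by simp
    fix t
    have l: "1 \<le> 1 / \<epsilon> * z" using \<epsilon> e(2) by (simp add: field_simps)
    have "\<bar>sol (1 / \<epsilon>) t\<bar> \<le> 2 * B / (1 / \<epsilon> * z)" by (rule sol_bound[OF l])
    also have "\<dots> = 2 * B / z * \<epsilon>" by simp
    also have "\<dots> \<le> 2 * B / z * (r * z / (4 * B))" using pos \<epsilon> e(4) by (intro mult_left_mono) auto
    also have "\<dots> = r / 2" using pos by (simp add: field_simps)
    finally show "\<bar>c0 + sol (1 / \<epsilon>) t - c0\<bar> \<le> r / 2" by simp
    have "2 * \<epsilon>\<^sup>2 * (2 * ?m) = \<epsilon> * (4 * ?m * \<epsilon>)" by (simp add: power2_eq_square)
    also have "\<dots> \<le> 1 * 1"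
    proof (rule mult_mono)
      have "\<epsilon> \<le> 1 / (4 * ?m)" using \<epsilon> e(5) by simp
      then show "4 * ?m * \<epsilon> \<le> 1" using gpos by (simp add: field_simps)
    qed (use \<epsilon> e gpos in auto)
    finally show "2 * \<epsilon>\<^sup>2 * (2 * ?m) \<le> 1" by simp
  qed
  then show ?thesis using that e by blast
qed

end

end

section \<open>Choice of the constants and conclusion\<close>

lemma borel_recursion_exists:
  assumes "\<omega> \<noteq> 0" and f: "real_analytic f" "periodic_2pi f" and hat: "has_fourier_expansion 1 f f_hat"
    and gf: "complex_of_real (b) = f_hat 0" and "r > 0" and sm: "summable (\<lambda>k. a k * r ^ k)" and "a 1 \<noteq> 0"
  obtains \<kappa> B CF \<rho> \<Gamma> z F where "\<rho> < r" "borel_recursion \<kappa> (2 * pi / \<bar>\<omega>\<bar>) CF B z \<rho> \<Gamma> a F (\<lambda>t. f (\<omega> * t) - b)"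
proof -
  obtain \<kappa>0 H M where H: "\<kappa>0 > 0" "H holomorphic_on {z. \<bar>Im z\<bar> < \<kappa>0}"
      "\<And>x. H (complex_of_real x) = complex_of_real (f x)"
      "\<And>z. \<bar>Im z\<bar> < \<kappa>0 \<Longrightarrow> norm (H z) \<le> M"
    using real_analytic_periodic_extension[OF f] by metis
  have contf: "continuous_on A f" for A by (rule real_analytic_continuous[OF f(1)])
  have "complex_of_real (integral {0..2 * pi} f / (2 * pi)) = of_real (b)"
    using fourier_expansion_mean[OF hat contf] gf by simp
  then have "integral {0..2 * pi} f / (2 * pi) = b" by (simp only: of_real_eq_iff)
  then have mean: "integral {0..2 * pi} f = 2 * pi * b" by (simp add: field_simps)
  define P where "P = 2 * pi / \<bar>\<omega>\<bar>"
  \<comment> \<open>Halving the radius makes the coefficient series that defines \<Gamma> converge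
    absolutely.\<close>
  define \<rho> where "\<rho> = r / 2"
  define \<Gamma> where "\<Gamma> = (\<Sum>k. \<bar>a (Suc k)\<bar> * \<rho> ^ k)"
  define CF where "CF = M + \<bar>b\<bar>"
  \<comment> \<open>\<open>B\<close> depends only on the coefficients \<open>a\<close> and is fixed
    first; \<open>z\<close> is then chosen in terms of \<open>B\<close>. Adding 1 to \<Gamma> and to
    \<open>CF\<close> avoids zero denominators.\<close>
  define B where "B = min (\<rho> / 8) (\<rho> * \<bar>a 1\<bar> / (16 * (\<Gamma> + 1)))"
  define z where "z = min (B / (P * (CF + 1))) (1 / (8 * P * (\<Gamma> + 1)))"
  define F where "F = (\<lambda>x. H (of_real \<omega> * x) - of_real (b))"
  have P: "P > 0" and \<rho>: "0 < \<rho>" "\<rho> < r" using assms by (auto simp: P_def \<rho>_def)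
  have "summable (\<lambda>k. norm (a k * \<rho> ^ k))" by (rule powser_insidea[OF sm]) (use \<rho> in auto)
  then have "summable (\<lambda>k. norm (a (Suc k) * \<rho> ^ Suc k) / \<rho>)"
    by (intro summable_divide) (rule summable_Suc_iff[THEN iffD2, of "\<lambda>k. norm (a k * \<rho> ^ k)"])
  moreover have "norm (a (Suc k) * \<rho> ^ Suc k) / \<rho> = \<bar>a (Suc k)\<bar> * \<rho> ^ k" for k using \<rho> by (simp add: abs_mult)
  ultimately have s\<Gamma>: "summable (\<lambda>k. \<bar>a (Suc k)\<bar> * \<rho> ^ k)" by (simp only:)
  have \<Gamma>: "(\<Sum>k<N. \<bar>a (Suc k)\<bar> * \<rho> ^ k) \<le> \<Gamma>" for N
    unfolding \<Gamma>_def by (rule sum_le_suminf[OF s\<Gamma>]) (use \<rho> in auto)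
  have "\<Gamma> \<ge> 0" using \<Gamma>[of 0] by simp
  have "CF \<ge> 0" using H(4)[of 0] H(1) norm_ge_zero[of "H 0"] by (simp add: CF_def del: norm_ge_zero)
  have B: "B > 0" using \<rho> \<open>a 1 \<noteq> 0\<close> \<open>\<Gamma> \<ge> 0\<close> by (simp add: B_def)
  have z: "z > 0" using B P \<open>\<Gamma> \<ge> 0\<close> \<open>CF \<ge> 0\<close> by (simp add: z_def)
  have "borel_recursion (\<kappa>0 / \<bar>\<omega>\<bar>) P CF B z \<rho> \<Gamma> a F (\<lambda>t. f (\<omega> * t) - b)"
  proof
    show "0 < \<kappa>0 / \<bar>\<omega>\<bar>" "0 < P" "0 < B" "0 < z" "0 < \<rho>" using H(1) \<open>\<omega> \<noteq> 0\<close> P B z \<rho> by auto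
    have strip: "\<bar>Im (of_real \<omega> * x)\<bar> < \<kappa>0" if "\<bar>Im x\<bar> < \<kappa>0 / \<bar>\<omega>\<bar>" for x
      using that \<open>\<omega> \<noteq> 0\<close> by (simp add: abs_mult field_simps)
    have "(H \<circ> (\<lambda>x. of_real \<omega> * x)) holomorphic_on {x. \<bar>Im x\<bar> < \<kappa>0 / \<bar>\<omega>\<bar>}"
      by (rule holomorphic_on_compose_gen[OF _ H(2)]) (use strip in \<open>auto intro!: holomorphic_intros\<close>)
    then show "F holomorphic_on {x. \<bar>Im x\<bar> < \<kappa>0 / \<bar>\<omega>\<bar>}"
      unfolding F_def o_def by (intro holomorphic_intros)
    show "norm (F x) \<le> CF" if "\<bar>Im x\<bar> < \<kappa>0 / \<bar>\<omega>\<bar>" for x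
      using norm_triangle_ineq4[of "H (of_real \<omega> * x)" "of_real (b)"] H(4)[OF strip[OF that]]
      by (simp add: F_def CF_def)
    show "F (complex_of_real x) = complex_of_real (f (\<omega> * x) - b)" for x
      using H(3)[of "\<omega> * x"] by (simp add: F_def)
    have per: "f (x + 2 * pi) = f x" "f (x - 2 * pi) = f x" for x
      using f(2)[unfolded periodic_2pi_def, rule_format, of x] f(2)[unfolded periodic_2pi_def, rule_format, of "x - 2 * pi"]
      by simp_all
    have "\<omega> * (x + P) = \<omega> * x + 2 * pi \<or> \<omega> * (x + P) = \<omega> * x - 2 * pi" for x
      using \<open>\<omega> \<noteq> 0\<close> by (cases "\<omega> > 0") (auto simp: P_def field_simps)
    then show "f (\<omega> * (x + P)) - b = f (\<omega> * x) - b" for x using per by metis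
    define h where "h s = f (2 * pi * s)" for s
    have conth: "continuous_on A h" for A
      unfolding h_def by (rule continuous_on_compose2[OF contf[of UNIV]]) (auto intro!: continuous_intros)
    have "((\<lambda>s. f (2 * pi * s)) has_integral (1 / \<bar>2 * pi\<bar>) *\<^sub>R integral {0..2 * pi} f) ((\<lambda>x. x / (2 * pi)) ` {0..2 * pi})"
      by (rule has_integral_stretch_real) (auto intro!: integrable_integral integrable_continuous_real contf)
    moreover have "(\<lambda>x. x / (2 * pi)) ` {0..2 * pi} = {0..1}" by simp
    ultimately have "(h has_integral b) {0..1}" by (simp add: mean h_def[abs_def])
    then have h1: "integral {0..1} h = b" by (rule integral_unique)
    \<comment> \<open>For negative \<omega> the rescaled time runs backwards over a period; the mean
      is the same.\<close>
    have h2: "integral {0..1} (\<lambda>s. h (- s)) = b"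
    proof -
      have "integral {0..1} (\<lambda>s. h (- s)) = integral {-1..0} h"
        using Henstock_Kurzweil_Integration.integral_reflect_real[of 0 "-1" h] by simp
      also have "\<dots> = integral {0..1} h"
        using integral_periodic_shift[of h 1 "-1"] conth per by (simp add: h_def distrib_left)
      finally show ?thesis using h1 by simp
    qed
    have "integral {0..1} (\<lambda>s. f (\<omega> * (P * s))) = b"
    proof (cases "\<omega> > 0")
      case True
      then have "f (\<omega> * (P * s)) = h s" for s by (simp add: h_def P_def)
      then show ?thesis using h1 by simp
    next
      case False
      then have "f (\<omega> * (P * s)) = h (- s)" for s using \<open>\<omega> \<noteq> 0\<close> by (simp add: h_def P_def)
      then show ?thesis using h2 by simp
    qed
    moreover have "(\<lambda>s. f (\<omega> * (P * s))) integrable_on {0..1}"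
      by (intro integrable_continuous_real continuous_on_compose2[OF contf[of UNIV]]) (auto intro!: continuous_intros)
    ultimately show "integral {0..1} (\<lambda>s. f (\<omega> * (P * s)) - b) = 0"
      using Henstock_Kurzweil_Integration.integral_diff[of "\<lambda>s. f (\<omega> * (P * s))" "{0..1}" "\<lambda>_. b"] by (simp add: integrable_const_ivl)
    show "(\<Sum>k<N. \<bar>a (Suc k)\<bar> * \<rho> ^ k) \<le> \<Gamma>" for N by (rule \<Gamma>)
    show "8 * B \<le> \<rho>" by (simp add: B_def)
    have le: "x * \<Gamma> / (\<Gamma> + 1) \<le> x" if "x \<ge> 0" for x
      using that \<open>\<Gamma> \<ge> 0\<close> by (simp add: field_simps)
    have "8 * B * \<Gamma> \<le> 8 * (\<rho> * \<bar>a 1\<bar> / (16 * (\<Gamma> + 1))) * \<Gamma>"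
      using \<open>\<Gamma> \<ge> 0\<close> by (intro mult_right_mono mult_left_mono) (auto simp: B_def)
    also have "\<dots> = \<rho> * \<bar>a 1\<bar> / 2 * \<Gamma> / (\<Gamma> + 1)" using \<open>\<Gamma> \<ge> 0\<close> by (simp add: field_simps)
    also have "\<dots> \<le> \<rho> * \<bar>a 1\<bar> / 2" using \<rho> by (intro le) auto
    finally show "8 * B * \<Gamma> \<le> \<rho> * \<bar>a 1\<bar> / 2" .
    show "a 1 \<noteq> 0" by fact
    have "z * P * CF \<le> B / (P * (CF + 1)) * P * CF"
      using P \<open>CF \<ge> 0\<close> by (intro mult_right_mono) (auto simp: z_def)
    also have "\<dots> = B * (CF / (CF + 1))" using P by simp
    also have "\<dots> \<le> B * 1" using B \<open>CF \<ge> 0\<close> by (intro mult_left_mono) auto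
    finally show "z * P * CF \<le> B" by simp
    have quot: "4 * P * x * (1 / (8 * P * y)) = 1 / 2 * x / y" for x y :: real using P by simp
    have "4 * P * \<Gamma> * z \<le> 4 * P * \<Gamma> * (1 / (8 * P * (\<Gamma> + 1)))"
      using P \<open>\<Gamma> \<ge> 0\<close> by (intro mult_left_mono) (auto simp: z_def)
    also have "\<dots> = 1 / 2 * \<Gamma> / (\<Gamma> + 1)" by (rule quot)
    also have "\<dots> \<le> 1 / 2" by (intro le) auto
    finally show "4 * P * \<Gamma> * z \<le> 1 / 2" .
  qed
  then show ?thesis using that \<rho>(2) unfolding P_def by blast
qed

theorem theorem1:
  fixes \<omega> c0 :: real
    and g f :: "real \<Rightarrow> real"
    and f_hat :: "int \<Rightarrow> complex"
  assumes "\<omega> \<noteq> 0"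
    and "real_analytic g"
    and "real_analytic f"
    and "periodic_2pi f"
    and "has_fourier_expansion 1 f f_hat"
    and "complex_of_real (g c0) = f_hat 0"
    and "deriv g c0 \<noteq> 0"
  shows "\<exists>xs. formal_solution \<omega> g f c0 xs \<and>
    (\<exists>\<epsilon>0>0. \<exists>x :: real \<Rightarrow> real \<Rightarrow> real.
       (\<forall>\<epsilon>. 0 < \<epsilon> \<and> \<epsilon> < \<epsilon>0 \<longrightarrow>
          ode_solution \<omega> g f \<epsilon> UNIV (x \<epsilon>) (deriv (x \<epsilon>)) \<and> has_frequency \<omega> (x \<epsilon>)) \<and>
       borel_summable_at_origin c0 xs \<epsilon>0 x \<and>
       (deriv g c0 > 0 \<longrightarrow>
          (\<forall>\<epsilon>. 0 < \<epsilon> \<and> \<epsilon> < \<epsilon>0 \<longrightarrow> local_attractor \<omega> g f \<epsilon> (x \<epsilon>))))"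
proof -
  obtain r a where r: "r > 0" and a: "\<And>y. y \<in> ball c0 r \<Longrightarrow> (\<lambda>n. a n * (y - c0) ^ n) sums g y"
    using \<open>real_analytic g\<close> unfolding real_analytic_def by meson
  have a': "(\<lambda>n. a n * x ^ n) sums g (c0 + x)" if "\<bar>x\<bar> < r" for x
    using a[of "c0 + x"] that by (simp add: dist_real_def)
  have "a 1 = deriv g c0" using power_series_coeff_eq_deriv[OF r a, where n = 1] by simp
  then have a1: "a 1 \<noteq> 0" using assms by simp
  \<comment> \<open>Convergence is known only inside the disc, so the point \<open>r / 2\<close>
    serves in place of \<open>r\<close>.\<close>
  have sm: "summable (\<lambda>k. a k * (r / 2) ^ k)" using a'[of "r / 2"] r by (auto simp: sums_iff)
  obtain \<kappa> B CF \<rho> \<Gamma> z F where \<rho>: "\<rho> < r / 2"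
      and br: "borel_recursion \<kappa> (2 * pi / \<bar>\<omega>\<bar>) CF B z \<rho> \<Gamma> a F (\<lambda>t. f (\<omega> * t) - g c0)"
    by (rule borel_recursion_exists[where r = "r / 2" and a = a and \<omega> = \<omega> and f = f and b = "g c0" and f_hat = f_hat])
      (use assms r sm a1 that in auto)
  interpret borel_recursion \<kappa> "2 * pi / \<bar>\<omega>\<bar>" CF B z \<rho> \<Gamma> a F "\<lambda>t. f (\<omega> * t) - g c0" by (rule br)
  have g: "(\<lambda>k. a k * x ^ k) sums g (c0 + x)" if "\<bar>x\<bar> < \<rho>" for x using a' that \<rho> r by simp
  let ?x = "\<lambda>\<epsilon> t. c0 + sol (1 / \<epsilon>) t"
  \<comment> \<open>The range of \<epsilon> is shrunk below \<open>z\<close> only in the attracting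
    case; otherwise \<open>e = z\<close>.\<close>
  obtain e where e: "0 < e" "e \<le> z" "deriv g c0 > 0 \<longrightarrow> (\<forall>\<epsilon>. 0 < \<epsilon> \<and> \<epsilon> < e \<longrightarrow> local_attractor \<omega> g f \<epsilon> (?x \<epsilon>))"
  proof (cases "deriv g c0 > 0")
    case True
    show ?thesis
      by (rule local_attractor_sol[OF assms(1) refl refl g assms(2) real_analytic_continuous[OF assms(3)] True])
        (assumption, rule that, assumption, assumption, blast)
  qed (use that[of z] pos in auto)
  show ?thesis
  proof (intro exI conjI)
    show "formal_solution \<omega> g f c0 (xs c0)" by (rule formal_solution_xs[OF assms(1) refl refl g])
    show "e > 0" by (rule e)
    show "\<forall>\<epsilon>. 0 < \<epsilon> \<and> \<epsilon> < e \<longrightarrow> ode_solution \<omega> g f \<epsilon> UNIV (?x \<epsilon>) (deriv (?x \<epsilon>)) \<and> has_frequency \<omega> (?x \<epsilon>)"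
      using ode_solution_sol[OF assms(1) refl refl g] e(2) by fastforce
    show "borel_summable_at_origin c0 (xs c0) e ?x"
      by (rule borel_summable_xs[OF assms(1) refl refl g e(2)])
  qed (rule e(3))
qed

end
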